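(* Let $T$ be a Calderón–Zygmund operator on $\mathbb R^d$ whose modulus of continuity $\omega$ satisfies the Dini condition $\int_0^1\omega(t)\,\frac{dt}{t}<\infty$. Then there is a constant $C$, independent of $f$, such that for any compactly supported function $f\in L^1(\mathbb R^d)$ we have $$\lvert Tf\rvert\le C\,\mathsf S\lvert f\rvert ,$$ where $\mathsf S=\mathsf S(f,T)$ is a sum of at most $3^d$ operators, each of which is sparse relative to a choice of dyadic grid on $\mathbb R^d$. The same conclusion holds for the maximal truncations $T_\sharp$ in place of $T$, i.e. $T_\sharp f\le C\,\mathsf S\lvert f\rvert$ for some such $\mathsf S=\mathsf S(f,T)$, where $$T_\sharp f(x):=\sup_{\delta>0}\Bigl\lvert\int_{\lvert x-y\rvert>\delta}K(x,y)f(y)\,dy\Bigr\rvert$$ and $K$ is the kernel of $T$.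
   Context: Calderón–Zygmund operator. $T$ is a bounded linear operator on $L^2(\mathbb R^d)$ of norm $1$ with kernel $K(x,y)$, meaning that for all $f,g\in C_0(\mathbb R^d)$ whose closed supports do not intersect, $$\langle Tf,g\rangle=\iint K(x,y)f(y)g(x)\,dx\,dy .$$ Let $\omega:[0,\infty)\to[0,1)$ be a modulus of continuity, that is, a monotone increasing and subadditive function. $T$ is a Calderón–Zygmund operator (with modulus of continuity $\omega$) if $$\lvert K(x,y)-K(x',y)\rvert\le\omega\Bigl(\frac{\lvert x-x'\rvert}{\lvert x-y\rvert}\Bigr)\frac1{\lvert x-y\rvert^d}\qquad\text{whenever } x\ne y,\ 2\lvert x-x'\rvert\le\lvert x-y\rvert,$$ and the dual condition, with the roles of $x$ and $y$ reversed, holds. For $f\in L^1(\mathbb R^d)$, $Tf$ is defined through the usual weak-type $(1,1)$ extension of $T$. Dyadic grid. A collection $\mathcal D$ of cubes $Q\subset\mathbb R^d$ such that for each $k\in\mathbb Z$ the cubes $\mathcal D_k:=\{Q\in\mathcal D:\lvert Q\rvert=2^{-kd}\}$ partition $\mathbb R^d$, and these collections form an increasing filtration on $\mathbb R^d$. Sparse operator relative to a dyadic grid $\mathcal D$. An operator $\mathsf S f=\sum_{P\in\mathcal S}\langle f\rangle_P\mathbf 1_P$, where $\langle f\rangle_P:=\lvert P\rvert^{-1}\int_P f$ and $\mathcal S\subset\mathcal D$ satisfies, for each $P\in\mathcal S$, $$\sum_{Q\in\mathrm{ch}_{\mathcal S}(P)}\lvert Q\rvert\le\tfrac12\lvert P\rvert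 ,$$ where $\mathrm{ch}_{\mathcal S}(P)$ is the set of maximal elements of $\mathcal S$ strictly contained in $P$, and $\lvert\cdot\rvert$ is Lebesgue measure. Inequalities between functions are understood almost everywhere. *)

theory Defs
  imports "HOL-Analysis.Analysis"
begin

text \<open>
  The space \<open>\<real>\<^sup>d\<close> is an arbitrary type \<open>'a\<close> of class \<open>euclidean_space\<close>, with \<open>d = DIM('a)\<close>.
  Elements of \<open>L\<^sup>1\<close> and \<open>L\<^sup>2\<close> are represented by Lebesgue measurable complex functions, and
  an operator by a map on such representatives whose values matter only almost everywhere.
\<close>

definition L2_fun :: "('a::euclidean_space \<Rightarrow> complex) set" where
  "L2_fun = {f \<in> borel_measurable lebesgue. integrable lebesgue (\<lambda>x. (norm (f x))\<^sup>2)}"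

definition L2_norm :: "('a::euclidean_space \<Rightarrow> complex) \<Rightarrow> real" where
  "L2_norm f = sqrt (\<integral>x. (norm (f x))\<^sup>2 \<partial>lebesgue)"

definition ae_linear_on ::
    "('a::euclidean_space \<Rightarrow> complex) set \<Rightarrow> (('a \<Rightarrow> complex) \<Rightarrow> 'a \<Rightarrow> complex) \<Rightarrow> bool" where
  "ae_linear_on V T \<longleftrightarrow>
     (\<forall>f\<in>V. \<forall>g\<in>V. AE x in lebesgue. T (\<lambda>y. f y + g y) x = T f x + T g x) \<and>
     (\<forall>c. \<forall>f\<in>V. AE x in lebesgue. T (\<lambda>y. c * f y) x = c * T f x)"

text \<open>
  Linearity and boundedness force \<open>T f = T g\<close> almost everywhere whenever \<open>f = g\<close> almost
  everywhere, so \<open>T\<close> does induce an operator on the classes.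
\<close>

definition bounded_linear_L2 ::
    "(('a::euclidean_space \<Rightarrow> complex) \<Rightarrow> 'a \<Rightarrow> complex) \<Rightarrow> bool" where
  "bounded_linear_L2 T \<longleftrightarrow>
     (\<forall>f\<in>L2_fun. T f \<in> L2_fun) \<and> ae_linear_on L2_fun T \<and>
     (\<exists>B. \<forall>f\<in>L2_fun. L2_norm (T f) \<le> B * L2_norm f)"

definition L2_opnorm :: "(('a::euclidean_space \<Rightarrow> complex) \<Rightarrow> 'a \<Rightarrow> complex) \<Rightarrow> real" where
  "L2_opnorm T = (SUP f\<in>{f \<in> L2_fun. L2_norm f \<le> 1}. L2_norm (T f))"

definition closed_support :: "('a::euclidean_space \<Rightarrow> complex) \<Rightarrow> 'a set" where
  "closed_support f = closure {x. f x \<noteq> 0}"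

definition C0_fun :: "('a::euclidean_space \<Rightarrow> complex) set" where
  "C0_fun = {f. continuous_on UNIV f \<and> compact (closed_support f)}"

text \<open>
  The pairing is bilinear (no conjugation), and \<open>has_bochner_integral\<close> includes the absolute
  convergence of the double integral. The values \<open>K x x\<close> play no role.
\<close>

definition has_kernel ::
    "(('a::euclidean_space \<Rightarrow> complex) \<Rightarrow> 'a \<Rightarrow> complex) \<Rightarrow> ('a \<Rightarrow> 'a \<Rightarrow> complex) \<Rightarrow> bool" where
  "has_kernel T K \<longleftrightarrow>
     (\<forall>f\<in>C0_fun. \<forall>g\<in>C0_fun. closed_support f \<inter> closed_support g = {} \<longrightarrow>
        has_bochner_integral lebesgue (\<lambda>(x, y). K x y * f y * g x)
          (\<integral>x. T f x * g x \<partial>lebesgue))"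

definition modulus_of_continuity :: "(real \<Rightarrow> real) \<Rightarrow> bool" where
  "modulus_of_continuity \<omega> \<longleftrightarrow>
     (\<forall>t\<ge>0. 0 \<le> \<omega> t \<and> \<omega> t < 1) \<and> mono_on {0..} \<omega> \<and>
     (\<forall>s\<ge>0. \<forall>t\<ge>0. \<omega> (s + t) \<le> \<omega> s + \<omega> t)"

definition dini :: "(real \<Rightarrow> real) \<Rightarrow> bool" where
  "dini \<omega> \<longleftrightarrow> (\<integral>\<^sup>+t\<in>{0<..1}. ennreal (\<omega> t / t) \<partial>lborel) < \<infinity>"

definition kernel_regularity ::
    "(real \<Rightarrow> real) \<Rightarrow> ('a::euclidean_space \<Rightarrow> 'a \<Rightarrow> complex) \<Rightarrow> bool" where
  "kernel_regularity \<omega> K \<longleftrightarrow>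
     (\<forall>x x' y. x \<noteq> y \<and> 2 * dist x x' \<le> dist x y \<longrightarrow>
        norm (K x y - K x' y) \<le> \<omega> (dist x x' / dist x y) * (1 / dist x y ^ DIM('a)))"

definition calderon_zygmund ::
    "(real \<Rightarrow> real) \<Rightarrow> (('a::euclidean_space \<Rightarrow> complex) \<Rightarrow> 'a \<Rightarrow> complex) \<Rightarrow>
       ('a \<Rightarrow> 'a \<Rightarrow> complex) \<Rightarrow> bool" where
  "calderon_zygmund \<omega> T K \<longleftrightarrow>
     modulus_of_continuity \<omega> \<and> bounded_linear_L2 T \<and> L2_opnorm T = 1 \<and> has_kernel T K \<and>
     kernel_regularity \<omega> K \<and> kernel_regularity \<omega> (\<lambda>x y. K y x)"

definition weak_type_1_1 ::
    "(('a::euclidean_space \<Rightarrow> complex) \<Rightarrow> 'a \<Rightarrow> complex) \<Rightarrow> bool" where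
  "weak_type_1_1 U \<longleftrightarrow>
     (\<forall>f. integrable lebesgue f \<longrightarrow> U f \<in> borel_measurable lebesgue) \<and>
     (\<exists>A. \<forall>f. integrable lebesgue f \<longrightarrow>
        (\<forall>t>0. emeasure lebesgue {x. t < norm (U f x)}
                 \<le> ennreal (A * (\<integral>x. norm (f x) \<partial>lebesgue) / t)))"

text \<open>
  By density of \<open>L\<^sup>1 \<inter> L\<^sup>2\<close> in \<open>L\<^sup>1\<close>, the operator chosen here is unique up to null sets as soon
  as one exists; its existence is not assumed, but is a theorem about Calderon-Zygmund operators.
\<close>

definition weak_L1_extension ::
    "(('a::euclidean_space \<Rightarrow> complex) \<Rightarrow> 'a \<Rightarrow> complex) \<Rightarrow> ('a \<Rightarrow> complex) \<Rightarrow> 'a \<Rightarrow> complex" where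
  "weak_L1_extension T = (SOME U. weak_type_1_1 U \<and> ae_linear_on {f. integrable lebesgue f} U \<and>
     (\<forall>f\<in>L2_fun. integrable lebesgue f \<longrightarrow> (AE x in lebesgue. U f x = T f x)))"

text \<open>Extended values, since the supremum may be infinite on a null set.\<close>

definition max_truncation ::
    "('a::euclidean_space \<Rightarrow> 'a \<Rightarrow> complex) \<Rightarrow> ('a \<Rightarrow> complex) \<Rightarrow> 'a \<Rightarrow> ennreal" where
  "max_truncation K f x =
     (SUP \<delta>\<in>{0<..}. ennreal (norm (LINT y:{y. \<delta> < dist x y}|lebesgue. K x y * f y)))"

text \<open>Compact support of an \<open>L\<^sup>1\<close> class: \<open>f\<close> vanishes almost everywhere off a compact set.\<close>

definition compactly_supported :: "('a::euclidean_space \<Rightarrow> complex) \<Rightarrow> bool" where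
  "compactly_supported f \<longleftrightarrow> (\<exists>C. compact C \<and> (AE x in lebesgue. x \<notin> C \<longrightarrow> f x = 0))"

text \<open>Half-open cubes, so that translates can partition the space exactly.\<close>

definition cube :: "'a::euclidean_space set \<Rightarrow> bool" where
  "cube Q \<longleftrightarrow> (\<exists>a l. 0 < l \<and> Q = {x. \<forall>b\<in>Basis. a \<bullet> b \<le> x \<bullet> b \<and> x \<bullet> b < a \<bullet> b + l})"

definition cubes_at :: "'a::euclidean_space set set \<Rightarrow> int \<Rightarrow> 'a set set" where
  "cubes_at D k = {Q \<in> D. measure lebesgue Q = 2 powi (- k * int DIM('a))}"

definition dyadic_grid :: "'a::euclidean_space set set \<Rightarrow> bool" where
  "dyadic_grid D \<longleftrightarrow>
     (\<forall>Q\<in>D. cube Q) \<and> D = (\<Union>k. cubes_at D k) \<and>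
     (\<forall>k. partition_on UNIV (cubes_at D k)) \<and>
     (\<forall>k. refines UNIV (cubes_at D (k + 1)) (cubes_at D k))"

definition children :: "'a set set \<Rightarrow> 'a set \<Rightarrow> 'a set set" where
  "children S P = {Q \<in> S. Q \<subset> P \<and> (\<forall>R\<in>S. R \<subset> P \<longrightarrow> \<not> Q \<subset> R)}"

definition sparse_family :: "'a::euclidean_space set set \<Rightarrow> 'a set set \<Rightarrow> bool" where
  "sparse_family D S \<longleftrightarrow>
     S \<subseteq> D \<and>
     (\<forall>P\<in>S. (\<Sum>\<^sub>\<infinity>Q\<in>children S P. emeasure lebesgue Q) \<le> emeasure lebesgue P / 2)"

text \<open>
  Averages and sparse operators are defined on nonnegative functions with values in \<open>[0, \<infinity>]\<close>,
  where the possibly infinite sum always makes sense.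
\<close>

definition avg :: "('a::euclidean_space \<Rightarrow> ennreal) \<Rightarrow> 'a set \<Rightarrow> ennreal" where
  "avg h P = (\<integral>\<^sup>+y\<in>P. h y \<partial>lebesgue) / emeasure lebesgue P"

definition sparse_operator ::
    "'a::euclidean_space set set \<Rightarrow> (('a \<Rightarrow> ennreal) \<Rightarrow> 'a \<Rightarrow> ennreal) \<Rightarrow> bool" where
  "sparse_operator D A \<longleftrightarrow>
     (\<exists>S. sparse_family D S \<and> A = (\<lambda>h x. \<Sum>\<^sub>\<infinity>P\<in>S. avg h P * indicator P x))"

definition sum_of_sparse_operators ::
    "nat \<Rightarrow> (('a::euclidean_space \<Rightarrow> ennreal) \<Rightarrow> 'a \<Rightarrow> ennreal) \<Rightarrow> bool" where
  "sum_of_sparse_operators n S \<longleftrightarrow>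
     (\<exists>D A. (\<forall>i<n. dyadic_grid (D i) \<and> sparse_operator (D i) (A i)) \<and>
            S = (\<lambda>h x. \<Sum>i<n. A i h x))"

end

theory Submission
  imports Defs
begin

text \<open>
  A single stopping time argument handles \<open>T\<close> and its maximal truncations together. On a cube
  \<open>Q\<close>, the maximum of the truncations of \<open>f\<close> restricted to a dilate of \<open>Q\<close> and of the
  Hardy-Littlewood maximal function is, by the weak type (1,1) inequality, bounded by a multiple of the
  average of \<open>|f|\<close> over the dilate outside a set of small proportion in \<open>Q\<close>. Iterating inside
  the maximal cubes of that exceptional set bounds the truncations by a Carleson sum of averages over
  dilates; the Dini condition makes the cost of localising from a cube to a stopping cube a constant
  times the same average. By the one-third trick each dilate lies in a cube of comparable size of one
  of \<open>2\<^sup>d\<close> shifted dyadic grids, a chain of cubes around the origin takes care of the points far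
  from the support, and a Carleson family is replaced by a sparse one, so that \<open>2\<^sup>d + 1 \<le> 3\<^sup>d\<close>
  sparse operators suffice.

  The inputs are classical: the kernel bound \<open>|K(x, y)| \<le> A / |x - y|\<^sup>d\<close> comes from testing the
  \<open>L\<^sup>2\<close> bound on bumps, the weak type of \<open>T\<close> from the Calderon-Zygmund decomposition, that of
  the maximal truncations from Cotlar's inequality, and \<open>|T f|\<close> is dominated almost everywhere by
  the maximal truncations and the maximal function through a density point argument.
\<close>

text \<open>Weak type bounds say nothing about a given point, whereas the truncations have to be
  controlled at each point of a cube and at all scales. The remedy is to call a cube good as soon as
  one of its points has a small joint maximal function: regularity of the kernel transfers the value
  at that point to every other point of the cube, at all scales not below its side. The transfer
  costs the maximal function at the good point, which is why that function is carried along with the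
  truncations. A cube that is not good lies wholly in the exceptional set, so the bad cubes inside Q
  fill at most half of Q. The parent of a maximal bad cube is good, which leaves only scales below
  twice the side of the bad cube, where f may be restricted to the smaller dilate.

  The constant is fixed before f, although the families of cubes depend on f. Exceptional sets and
  unions of cubes stand in for level sets of maximal functions. The bound of T f by the joint
  maximal function, and that of f off the selected cubes, rest on one density criterion: a set that
  fills at most a fixed proportion below 1 of every dyadic cube it meets is null.\<close>

text \<open>As simplification rules these replace \<open>lebesgue\<close> by main parts of sets in \<open>lborel\<close>.\<close>

declare emeasure_completion [simp del] measure_completion [simp del]

subsection \<open>Countable families of sets\<close>

text \<open>Continuity from below along an enumeration reduces the bound to finite subfamilies, so
  that later estimates on unions of cubes can work with finite sums.\<close>

lemma emeasure_countable_Union_le: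
  assumes "countable G" "G \<subseteq> sets M"
    and "\<And>F. finite F \<Longrightarrow> F \<subseteq> G \<Longrightarrow> emeasure M (\<Union>F) \<le> c"
  shows "emeasure M (\<Union>G) \<le> c"
proof (cases "G = {}")
  case True then show ?thesis by simp
next
  case False
  define A where "A n = \<Union>(from_nat_into G ` {..n})" for n :: nat
  have sub: "from_nat_into G ` {..n} \<subseteq> G" for n
    using False by (auto intro: from_nat_into)
  have r: "range (from_nat_into G) = G"
    using False \<open>countable G\<close> by (rule range_from_nat_into)
  have UA: "\<Union>G = (\<Union>n. A n)"
  proof -
    have "\<Union>G = (\<Union>n. from_nat_into G n)" by (simp add: r)
    also have "\<dots> = (\<Union>n. A n)" unfolding A_def by blast
    finally show ?thesis .
  qed
  have "range A \<subseteq> sets M"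
    unfolding A_def using sub assms(2) by (auto intro!: sets.finite_UN)
  moreover have "incseq A"
    unfolding A_def by (intro monoI UN_mono) auto
  ultimately have "emeasure M (\<Union>G) = (SUP n. emeasure M (A n))"
    unfolding UA by (rule SUP_emeasure_incseq[symmetric])
  also have "\<dots> \<le> c"
    using assms(3) sub by (auto intro!: SUP_least simp: A_def)
  finally show ?thesis .
qed

lemma infsum_ennreal_SUP:
  fixes f :: "'b \<Rightarrow> ennreal"
  shows "infsum f A = (SUP F\<in>{F. finite F \<and> F \<subseteq> A}. sum f F)"
  by (rule nonneg_infsum_complete) simp

lemma infsum_ennreal_le:
  fixes f :: "'b \<Rightarrow> ennreal"
  assumes "\<And>F. finite F \<Longrightarrow> F \<subseteq> A \<Longrightarrow> sum f F \<le> c"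
  shows "infsum f A \<le> c"
  unfolding infsum_ennreal_SUP using assms by (auto intro: SUP_least)

lemma sum_le_infsum_ennreal:
  fixes f :: "'b \<Rightarrow> ennreal"
  assumes "finite F" "F \<subseteq> A"
  shows "sum f F \<le> infsum f A"
  unfolding infsum_ennreal_SUP using assms by (auto intro: SUP_upper)

lemma sum_nn_integral_disjoint_le:
  fixes h :: "'b \<Rightarrow> ennreal"
  assumes "finite F" "\<And>Q. Q \<in> F \<Longrightarrow> X Q \<in> sets M" "disjoint_family_on X F" "\<And>Q. Q \<in> F \<Longrightarrow> X Q \<subseteq> B"
    and "h \<in> borel_measurable M"
  shows "(\<Sum>Q\<in>F. \<integral>\<^sup>+y\<in>X Q. h y \<partial>M) \<le> (\<integral>\<^sup>+y\<in>B. h y \<partial>M)"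
proof -
  have "(\<Sum>Q\<in>F. \<integral>\<^sup>+y\<in>X Q. h y \<partial>M) = (\<integral>\<^sup>+y. (\<Sum>Q\<in>F. h y * indicator (X Q) y) \<partial>M)"
    using assms by (intro nn_integral_sum[symmetric]) auto
  also have "\<dots> \<le> (\<integral>\<^sup>+y\<in>B. h y \<partial>M)"
  proof (rule nn_integral_mono)
    fix y
    have "(\<Sum>Q\<in>F. indicator (X Q) y :: ennreal) = indicator (\<Union>Q\<in>F. X Q) y"
      using assms by (subst indicator_UN_disjoint) auto
    then have "(\<Sum>Q\<in>F. h y * indicator (X Q) y) = h y * indicator (\<Union>Q\<in>F. X Q) y"
      by (simp add: sum_distrib_left[symmetric])
    also have "\<dots> \<le> h y * indicator B y"
      using assms(4) by (intro mult_left_mono) (auto simp: indicator_def)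
    finally show "(\<Sum>Q\<in>F. h y * indicator (X Q) y) \<le> h y * indicator B y" .
  qed
  finally show ?thesis .
qed

lemma sum_emeasure_disjoint_le:
  assumes "finite F" "\<And>Q. Q \<in> F \<Longrightarrow> X Q \<in> sets M" "disjoint_family_on X F" "\<And>Q. Q \<in> F \<Longrightarrow> X Q \<subseteq> B" "B \<in> sets M"
  shows "(\<Sum>Q\<in>F. emeasure M (X Q)) \<le> emeasure M B"
proof -
  have "(\<Sum>Q\<in>F. emeasure M (X Q)) = emeasure M (\<Union>Q\<in>F. X Q)"
    using assms by (intro sum_emeasure) auto
  also have "\<dots> \<le> emeasure M B" using assms by (intro emeasure_mono) auto
  finally show ?thesis .
qed

subsection \<open>Dyadic grids\<close>

text \<open>The level is minus the binary logarithm of the side length: higher levels are finer, and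
  the order of levels is opposite to the order of sides.\<close>

definition side :: "int \<Rightarrow> real" where "side k = 2 powi (- k)"

lemma side_pos [simp]: "0 < side k" by (simp add: side_def)
lemma side_nonneg [simp]: "0 \<le> side k" by (simp add: less_imp_le)
lemma side_neq0 [simp]: "side k \<noteq> 0" using side_pos[of k] by linarith
lemma side_Suc: "side (k + 1) = side k / 2"
  by (simp add: side_def power_int_diff power_int_minus)
lemma side_less_iff [simp]: "side k < side j \<longleftrightarrow> j < k"
proof -
  have "2 powi m < (2 powi n :: real)" if "m < n" for m n :: int
    using that by (intro power_int_strict_increasing) auto
  from this[of "-k" "-j"] this[of "-j" "-k"] show ?thesis
    unfolding side_def by (cases j k rule: linorder_cases) auto
qed
lemma side_le_iff [simp]: "side k \<le> side j \<longleftrightarrow> j \<le> k"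
  using side_less_iff[of j k] by linarith
lemma side_eq_iff [simp]: "side k = side j \<longleftrightarrow> k = j"
  using side_le_iff[of j k] side_le_iff[of k j] by (metis order_antisym order_refl)
lemma side_diff: "side (k - int m) = 2 ^ m * side k"
  by (simp add: side_def power_int_diff power_int_minus power_int_add divide_simps)

lemma side_nat: "side (int k) = (1/2) ^ k"
proof (induction k)
  case 0 show ?case by (simp add: side_def)
next
  case (Suc k)
  have "side (int (Suc k)) = side (int k + 1)" by (simp add: add.commute)
  with Suc show ?case by (simp only: side_Suc) simp
qed

lemma ex_side:
  assumes "0 < (\<delta>::real)"
  obtains j where "side j \<le> \<delta>" "\<delta> < 2 * side j"
proof -
  define j where "j = - \<lfloor>log 2 \<delta>\<rfloor>"
  have e: "side j = 2 powr (\<lfloor>log 2 \<delta>\<rfloor>)"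
    by (simp add: side_def j_def powr_real_of_int')
  have "2 powr (\<lfloor>log 2 \<delta>\<rfloor>) \<le> 2 powr (log 2 \<delta>)" by (intro powr_mono) auto
  then have "side j \<le> \<delta>" using assms e by simp
  moreover have "2 powr (log 2 \<delta>) < 2 powr (\<lfloor>log 2 \<delta>\<rfloor> + 1)"
    by (intro powr_less_mono) linarith+
  then have "\<delta> < 2 * side j" using assms e by (simp add: powr_add)
  ultimately show ?thesis by (rule that)
qed

locale grid =
  fixes D :: "'a::euclidean_space set set"
  assumes grid: "dyadic_grid D"
begin

definition cell :: "int \<Rightarrow> 'a \<Rightarrow> 'a set" where
  "cell k x = (THE Q. Q \<in> cubes_at D k \<and> x \<in> Q)"

lemma cubes_at_partition: "partition_on UNIV (cubes_at D k)"
  using grid by (simp add: dyadic_grid_def)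

lemma cubes_at_unique: "Q \<in> cubes_at D k \<Longrightarrow> R \<in> cubes_at D k \<Longrightarrow> x \<in> Q \<Longrightarrow> x \<in> R \<Longrightarrow> Q = R"
  using cubes_at_partition[of k] by (auto simp: partition_on_def disjoint_def)

lemma cell_ex1: "\<exists>!Q. Q \<in> cubes_at D k \<and> x \<in> Q"
proof -
  have "x \<in> \<Union>(cubes_at D k)" using cubes_at_partition[of k] by (auto simp: partition_on_def)
  then show ?thesis using cubes_at_unique by blast
qed

lemma cell_mem [simp, intro]: "cell k x \<in> cubes_at D k" "x \<in> cell k x"
  using theI'[OF cell_ex1[of k x]] by (auto simp: cell_def)

lemma cell_eq: "Q \<in> cubes_at D k \<Longrightarrow> x \<in> Q \<Longrightarrow> Q = cell k x"
  using cubes_at_unique cell_mem by blast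

lemma cubes_at_nonempty: "Q \<in> cubes_at D k \<Longrightarrow> Q \<noteq> {}"
  using cubes_at_partition[of k] by (auto simp: partition_on_def)

lemma cubes_at_cell: "Q \<in> cubes_at D k \<Longrightarrow> \<exists>x. Q = cell k x"
  using cubes_at_nonempty cell_eq by blast

lemma cell_D [simp, intro]: "cell k x \<in> D"
  using cell_mem(1)[of k x] by (simp add: cubes_at_def)

lemma D_cell: "Q \<in> D \<Longrightarrow> x \<in> Q \<Longrightarrow> \<exists>k. Q = cell k x"
  using grid cell_eq unfolding dyadic_grid_def by blast

lemma D_cubes_at: "Q \<in> D \<Longrightarrow> \<exists>k. Q \<in> cubes_at D k"
  using grid unfolding dyadic_grid_def by blast

lemma cubes_at_D: "Q \<in> cubes_at D k \<Longrightarrow> Q \<in> D"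
  by (simp add: cubes_at_def)

lemma D_nonempty: "Q \<in> D \<Longrightarrow> Q \<noteq> {}"
  using D_cubes_at cubes_at_nonempty by blast

lemma measure_cell: "measure lebesgue (cell k x) = side k ^ DIM('a)"
proof -
  have "measure lebesgue (cell k x) = 2 powi (- k * int DIM('a))"
    using cell_mem(1)[of k x] unfolding cubes_at_def by blast
  also have "\<dots> = (2 powi (- k)) powi int DIM('a)" by (rule power_int_mult)
  finally show ?thesis by (simp only: power_int_of_nat side_def)
qed

lemma cell_mono: "j \<le> k \<Longrightarrow> cell k x \<subseteq> cell j x"
proof (induction k rule: int_ge_induct)
  case (step k)
  have "refines UNIV (cubes_at D (k + 1)) (cubes_at D k)" using grid by (simp add: dyadic_grid_def)
  then obtain Y where "Y \<in> cubes_at D k" "cell (k+1) x \<subseteq> Y"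
    unfolding refines_def using cell_mem(1) by meson
  moreover from this have "Y = cell k x" using cell_eq cell_mem(2) by blast
  ultimately show ?case using step by blast
qed auto

lemma cell_cong: "y \<in> cell k x \<Longrightarrow> cell k y = cell k x"
  using cell_eq cell_mem by metis

lemma cell_inj: "cell k x = cell j y \<Longrightarrow> k = j"
  using measure_cell[of k x] measure_cell[of j y]
  by (metis DIM_positive power_eq_iff_eq_base side_eq_iff side_nonneg)

lemma cell_subset_iff: "cell k x \<subseteq> cell j x \<longleftrightarrow> j \<le> k"
  by (metis cell_inj cell_mono linorder_linear order_antisym_conv)

lemma cell_psubset_iff: "cell k x \<subset> cell j x \<longleftrightarrow> j < k"
  using cell_subset_iff[of k x j] cell_subset_iff[of j x k] by auto

lemma nested:
  assumes "P \<in> D" "Q \<in> D" "x \<in> P" "x \<in> Q"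
  shows "P \<subseteq> Q \<or> Q \<subseteq> P"
  using D_cell[OF assms(1,3)] D_cell[OF assms(2,4)] cell_mono[of _ _ x] by (metis linorder_linear)

text \<open>A grid prescribes only the volume of its cubes. Squeezing the half-open cube between an
  open and a closed box of side l gives it the volume l^d, hence l = \<open>side k\<close>. The open
  box is recorded for \<open>countable_D\<close>.\<close>

lemma cell_cube:
  obtains a where "cell k x = {y. \<forall>b\<in>Basis. a \<bullet> b \<le> y \<bullet> b \<and> y \<bullet> b < a \<bullet> b + side k}"
    "box a (a + side k *\<^sub>R One) \<subseteq> cell k x"
proof -
  have "cube (cell k x)" using grid by (simp add: dyadic_grid_def)
  then obtain a l where l: "0 < l" and c: "cell k x = {y. \<forall>b\<in>Basis. a \<bullet> b \<le> y \<bullet> b \<and> y \<bullet> b < a \<bullet> b + l}"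
    unfolding cube_def by auto
  have 1: "box a (a + l *\<^sub>R One) \<subseteq> cell k x" "cell k x \<subseteq> cbox a (a + l *\<^sub>R One)"
    unfolding c by (auto simp: box_def cbox_def inner_simps intro: less_imp_le)
  have m: "cell k x \<in> sets lebesgue"
  proof -
    have "cell k x = (\<Inter>b\<in>Basis. {y. a \<bullet> b \<le> y \<bullet> b} \<inter> {y. y \<bullet> b < a \<bullet> b + l})"
      unfolding c by auto
    also have "\<dots> \<in> sets borel"
      by (intro sets.finite_INT finite_Basis) (auto simp: nonempty_Basis)
    finally show ?thesis by auto
  qed
  have "measure lebesgue (cell k x) \<le> measure lebesgue (cbox a (a + l *\<^sub>R One))"
    using 1 m by (intro measure_mono_fmeasurable) auto
  moreover have "measure lebesgue (box a (a + l *\<^sub>R One)) \<le> measure lebesgue (cell k x)"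
    using 1 m by (intro measure_mono_fmeasurable) (auto intro: fmeasurableI2[OF lmeasurable_cbox])
  moreover have "measure lebesgue (cbox a (a + l *\<^sub>R One)) = l ^ DIM('a)"
    using l by (subst measure_completion) (auto simp: content_cbox_plus)
  moreover have "measure lebesgue (box a (a + l *\<^sub>R One)) = l ^ DIM('a)"
    using l by (subst measure_completion) (auto simp: measure_lborel_box_eq inner_simps)
  ultimately have "side k ^ DIM('a) = l ^ DIM('a)" unfolding measure_cell by simp
  then have "l = side k" using l DIM_positive by (metis power_eq_iff_eq_base side_nonneg less_imp_le)
  with c 1 show ?thesis by (intro that) auto
qed

lemma cell_sets [simp, intro]: "cell k x \<in> sets lebesgue"
proof -
  obtain a where c: "cell k x = {y. \<forall>b\<in>Basis. a \<bullet> b \<le> y \<bullet> b \<and> y \<bullet> b < a \<bullet> b + side k}"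
    by (rule cell_cube)
  have "cell k x = (\<Inter>b\<in>Basis. {y. a \<bullet> b \<le> y \<bullet> b} \<inter> {y. y \<bullet> b < a \<bullet> b + side k})"
    unfolding c by auto
  also have "\<dots> \<in> sets borel"
    by (intro sets.finite_INT finite_Basis) (auto simp: nonempty_Basis)
  finally show ?thesis by auto
qed

lemma D_sets: "Q \<in> D \<Longrightarrow> Q \<in> sets lebesgue"
  using D_cubes_at cubes_at_cell by (metis cell_sets)

lemma emeasure_cell: "emeasure lebesgue (cell k x) = ennreal (side k ^ DIM('a))"
proof -
  obtain a where c: "cell k x = {y. \<forall>b\<in>Basis. a \<bullet> b \<le> y \<bullet> b \<and> y \<bullet> b < a \<bullet> b + side k}"
    by (rule cell_cube)
  have "cell k x \<subseteq> cbox a (a + side k *\<^sub>R One)"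
    unfolding c by (auto simp: cbox_def inner_simps intro: less_imp_le)
  then have "cell k x \<in> lmeasurable"
    by (intro fmeasurableI2[OF lmeasurable_cbox]) auto
  then show ?thesis by (simp add: emeasure_eq_measure2 measure_cell)
qed

lemma emeasure_D: "Q \<in> D \<Longrightarrow> 0 < emeasure lebesgue Q \<and> emeasure lebesgue Q < \<infinity>"
  using D_cubes_at cubes_at_cell by (metis emeasure_cell ennreal_less_top ennreal_less_zero_iff infinity_ennreal_def side_pos zero_less_power)

lemma emeasure_D_neq: "Q \<in> D \<Longrightarrow> emeasure lebesgue Q \<noteq> 0" "Q \<in> D \<Longrightarrow> emeasure lebesgue Q \<noteq> \<infinity>"
  using emeasure_D by fastforce+

text \<open>Estimating the Euclidean norm by the sum of the coordinates yields d times the side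
  instead of sqrt d times it; this cruder diameter is the source of the factors
  \<open>real DIM('a)\<close> in the constants below.\<close>

lemma dist_cell:
  assumes "y \<in> cell k x" "z \<in> cell k x"
  shows "dist y z \<le> real DIM('a) * side k"
proof -
  obtain a where c: "cell k x = {y. \<forall>b\<in>Basis. a \<bullet> b \<le> y \<bullet> b \<and> y \<bullet> b < a \<bullet> b + side k}"
    by (rule cell_cube)
  have "dist y z \<le> (\<Sum>b\<in>Basis. \<bar>(y - z) \<bullet> b\<bar>)"
    unfolding dist_norm by (rule norm_le_l1)
  also have "\<dots> \<le> (\<Sum>b\<in>(Basis::'a set). side k)"
  proof (rule sum_mono)
    fix b :: 'a assume "b \<in> Basis"
    then have "a \<bullet> b \<le> y \<bullet> b" "y \<bullet> b < a \<bullet> b + side k" "a \<bullet> b \<le> z \<bullet> b" "z \<bullet> b < a \<bullet> b + side k"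
      using assms unfolding c by auto
    then show "\<bar>(y - z) \<bullet> b\<bar> \<le> side k" by (auto simp: inner_diff_left)
  qed
  finally show ?thesis by simp
qed

text \<open>Every cube contains an open box, hence a point of a fixed countable dense set; that
  point and the level determine the cube.\<close>

lemma countable_D: "countable D"
proof -
  obtain X :: "'a set" where X: "countable X" "\<And>U. open U \<Longrightarrow> U \<noteq> {} \<Longrightarrow> \<exists>x\<in>X. x \<in> U"
    using countable_dense_setE by blast
  have "D \<subseteq> (\<lambda>(k, x). cell k x) ` (UNIV \<times> X)"
  proof
    fix Q assume "Q \<in> D"
    then obtain k x where Q: "Q = cell k x" using D_cubes_at cubes_at_cell by metis
    obtain a where b: "box a (a + side k *\<^sub>R One) \<subseteq> cell k x" by (rule cell_cube)
    have "box a (a + side k *\<^sub>R One) \<noteq> {}" by (simp add: box_ne_empty inner_simps)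
    then obtain q where "q \<in> X" "q \<in> box a (a + side k *\<^sub>R One)" using X(2) by blast
    with b Q have "Q = cell k q" using cell_cong by blast
    with \<open>q \<in> X\<close> show "Q \<in> (\<lambda>(k, x). cell k x) ` (UNIV \<times> X)" by auto
  qed
  then show ?thesis using X(1) by (meson countable_SIGMA countable_image countable_subset countableI_type)
qed

definition lev :: "'a set \<Rightarrow> int" where
  "lev Q = (THE k. Q \<in> cubes_at D k)"

lemma lev_cell [simp]: "lev (cell k x) = k"
  unfolding lev_def
proof (rule the_equality)
  fix j assume "cell k x \<in> cubes_at D j"
  then obtain y where "cell k x = cell j y" using cubes_at_cell by blast
  then show "j = k" using cell_inj by metis
qed simp

lemma lev_cubes_at: "Q \<in> cubes_at D k \<Longrightarrow> lev Q = k"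
  using cubes_at_cell lev_cell by blast

lemma cell_lev: "Q \<in> D \<Longrightarrow> x \<in> Q \<Longrightarrow> cell (lev Q) x = Q"
  using D_cell lev_cell by metis

lemma D_cell_lev: "Q \<in> D \<Longrightarrow> Q \<in> cubes_at D (lev Q)"
  using D_cubes_at lev_cubes_at by blast

lemma emeasure_lev: "Q \<in> D \<Longrightarrow> emeasure lebesgue Q = ennreal (side (lev Q) ^ DIM('a))"
  using D_cell_lev cubes_at_cell emeasure_cell by metis

lemma lev_mono: "P \<in> D \<Longrightarrow> Q \<in> D \<Longrightarrow> P \<subseteq> Q \<Longrightarrow> lev Q \<le> lev P"
proof -
  assume *: "P \<in> D" "Q \<in> D" "P \<subseteq> Q"
  then obtain x where "x \<in> P" "x \<in> Q" using D_nonempty by blast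
  with * show ?thesis using cell_lev[of P x] cell_lev[of Q x] cell_subset_iff[of "lev P" x "lev Q"] by simp
qed

lemma lev_less: "P \<in> D \<Longrightarrow> Q \<in> D \<Longrightarrow> P \<subset> Q \<Longrightarrow> lev Q < lev P"
proof -
  assume *: "P \<in> D" "Q \<in> D" "P \<subset> Q"
  then obtain x where "x \<in> P" "x \<in> Q" using D_nonempty by blast
  with * show ?thesis using cell_lev[of P x] cell_lev[of Q x] cell_psubset_iff[of "lev P" x "lev Q"] by simp
qed

section \<open>Maximal cubes, the dyadic weak type bound and a density criterion\<close>

definition maxi :: "'a set set \<Rightarrow> 'a set set" where
  "maxi G = {Q \<in> G. \<forall>R\<in>G. \<not> Q \<subset> R}"

lemma maxi_subset: "maxi G \<subseteq> G" by (auto simp: maxi_def)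

lemma maxi_disjoint: "G \<subseteq> D \<Longrightarrow> disjoint (maxi G)"
  using nested unfolding disjoint_def maxi_def by (auto 0 0) (metis in_mono psubsetI)+

text \<open>A member above Q of least level is maximal, as a strictly larger cube has a smaller
  level. The lower bound \<open>k0\<close> turns levels into natural numbers, among which a least
  one exists.\<close>

lemma ex_maxi:
  assumes "G \<subseteq> D" "\<And>Q. Q \<in> G \<Longrightarrow> k0 \<le> lev Q" "Q \<in> G"
  shows "\<exists>R\<in>maxi G. Q \<subseteq> R"
proof -
  obtain R where R: "R \<in> G" "Q \<subseteq> R" and min: "\<And>P. P \<in> G \<Longrightarrow> Q \<subseteq> P \<Longrightarrow> nat (lev R - k0) \<le> nat (lev P - k0)"
    using ex_has_least_nat[of "\<lambda>R. R \<in> G \<and> Q \<subseteq> R" Q "\<lambda>R. nat (lev R - k0)"] assms(3) by auto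
  have "\<not> R \<subset> P" if "P \<in> G" for P
  proof
    assume "R \<subset> P"
    then have "lev P < lev R" using that R assms(1) lev_less by blast
    moreover have "lev R \<le> lev P" using min[OF that] order_trans[OF R(2) psubset_imp_subset[OF \<open>R \<subset> P\<close>]] assms(2)[OF that] assms(2)[OF R(1)] by linarith
    ultimately show False by simp
  qed
  then show ?thesis using R unfolding maxi_def by auto
qed

lemma Union_maxi:
  assumes "G \<subseteq> D" "\<And>Q. Q \<in> G \<Longrightarrow> k0 \<le> lev Q"
  shows "\<Union>(maxi G) = \<Union>G"
  using ex_maxi[OF assms] maxi_subset by blast

text \<open>The weak type (1,1) inequality of the dyadic maximal function: the maximal cubes of G
  are disjoint, have the same union as G, and their integrals add up to at most the integral over
  B.\<close>

lemma dyadic_maximal: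
  fixes h :: "'a \<Rightarrow> ennreal"
  assumes c: "0 < (c::real)" and G: "G \<subseteq> D" and h: "h \<in> borel_measurable lebesgue"
    and big: "\<And>Q. Q \<in> G \<Longrightarrow> ennreal c * emeasure lebesgue Q \<le> (\<integral>\<^sup>+y\<in>Q. h y \<partial>lebesgue)"
    and sub: "\<And>Q. Q \<in> G \<Longrightarrow> Q \<subseteq> B" and bd: "\<And>Q. Q \<in> G \<Longrightarrow> k0 \<le> lev Q"
  shows "ennreal c * emeasure lebesgue (\<Union>G) \<le> (\<integral>\<^sup>+y\<in>B. h y \<partial>lebesgue)"
proof -
  define H where "H = maxi G"
  have H: "H \<subseteq> D" "H \<subseteq> G" "disjoint H" using G maxi_subset maxi_disjoint[OF G] by (auto simp: H_def)
  have cH: "countable H" using H countable_D countable_subset by blast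
  have disj: "disjoint_family_on (\<lambda>Q. Q) H"
    using H(3) by (auto simp: disjoint_family_on_def disjoint_def)
  have fin: "ennreal c * emeasure lebesgue (\<Union>F) \<le> (\<integral>\<^sup>+y\<in>B. h y \<partial>lebesgue)" if F: "finite F" "F \<subseteq> H" for F
  proof -
    have d: "disjoint_family_on (\<lambda>Q. Q) F" by (rule disjoint_family_on_mono[OF F(2) disj])
    have s: "\<And>Q. Q \<in> F \<Longrightarrow> Q \<in> sets lebesgue" using F H D_sets by blast
    have "ennreal c * emeasure lebesgue (\<Union>F) \<le> c * (\<Sum>Q\<in>F. emeasure lebesgue Q)"
      using emeasure_subadditive_finite[of F "\<lambda>Q. Q" lebesgue] F s by (intro mult_left_mono) auto
    also have "\<dots> = (\<Sum>Q\<in>F. ennreal c * emeasure lebesgue Q)" by (simp add: sum_distrib_left)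
    also have "\<dots> \<le> (\<Sum>Q\<in>F. \<integral>\<^sup>+y\<in>Q. h y \<partial>lebesgue)" using F H big by (intro sum_mono) auto
    also have "\<dots> \<le> (\<integral>\<^sup>+y\<in>B. h y \<partial>lebesgue)"
      using F H(2) sub by (intro sum_nn_integral_disjoint_le d s h) blast+
    finally show ?thesis .
  qed
  have cc: "ennreal c \<noteq> 0" "ennreal c \<noteq> top" using c by auto
  have "emeasure lebesgue (\<Union>H) \<le> (\<integral>\<^sup>+y\<in>B. h y \<partial>lebesgue) / ennreal c"
  proof (rule emeasure_countable_Union_le[OF cH])
    fix F assume "finite F" "F \<subseteq> H"
    from divide_right_mono_ennreal[OF fin[OF this], of "ennreal c"]
    show "emeasure lebesgue (\<Union>F) \<le> (\<integral>\<^sup>+y\<in>B. h y \<partial>lebesgue) / ennreal c"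
      using cc by (simp add: mult.commute[of "ennreal c"] ennreal_mult_divide_eq)
  qed (use H D_sets in auto)
  then have "ennreal c * emeasure lebesgue (\<Union>H) \<le> ennreal c * ((\<integral>\<^sup>+y\<in>B. h y \<partial>lebesgue) / ennreal c)"
    by (rule mult_left_mono) simp
  also have "\<dots> = (\<integral>\<^sup>+y\<in>B. h y \<partial>lebesgue)"
    using cc by (simp add: ennreal_times_divide mult.commute[of "ennreal c"] ennreal_mult_divide_eq)
  finally show ?thesis using Union_maxi[OF G bd] by (simp add: H_def)
qed

text \<open>Cover a bounded part of E by an open set of almost the same measure. Each dyadic cube
  inside that open set contains at most the proportion \<theta> of E, so the measure of that part is
  at most \<theta> times itself, up to an arbitrarily small error.\<close>

lemma null_by_density:
  assumes E: "E \<in> sets lebesgue" and th: "0 \<le> \<theta>" "\<theta> < 1"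
    and den: "\<And>Q. Q \<in> D \<Longrightarrow> Q \<inter> E \<noteq> {} \<Longrightarrow> emeasure lebesgue (E \<inter> Q) \<le> ennreal \<theta> * emeasure lebesgue Q"
  shows "E \<in> null_sets lebesgue"
proof -
  \<comment> \<open>Intersecting with one cube makes the measure m finite, which is needed to
    conclude m = 0 from m \<le> \<theta> * m.\<close>
  have null: "E \<inter> B \<in> null_sets lebesgue" if B: "B \<in> D" for B
  proof -
    define E0 where "E0 = E \<inter> B"
    have E0: "E0 \<in> sets lebesgue" using E B D_sets by (auto simp: E0_def)
    have fin: "emeasure lebesgue E0 < \<infinity>"
      using emeasure_mono[of E0 B lebesgue] B D_sets emeasure_D[OF B] by (auto simp: E0_def)
    have main: "emeasure lebesgue E0 \<le> ennreal \<theta> * (emeasure lebesgue E0 + ennreal e)" if e: "e > 0" for e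
    proof -
      obtain O' where O: "open O'" "E0 \<subseteq> O'" "O' - E0 \<in> lmeasurable" "emeasure lebesgue (O' - E0) < ennreal e"
        using sets_lebesgue_outer_open[OF E0 e] by blast
      have Os: "O' \<in> sets lebesgue" using O by auto
      have Oe: "emeasure lebesgue O' \<le> emeasure lebesgue E0 + ennreal e"
      proof -
        have "emeasure lebesgue O' = emeasure lebesgue (E0 \<union> (O' - E0))" using O by (simp add: Un_absorb1)
        also have "\<dots> \<le> emeasure lebesgue E0 + emeasure lebesgue (O' - E0)"
          using E0 Os by (intro emeasure_subadditive) auto
        also have "\<dots> \<le> emeasure lebesgue E0 + ennreal e" using O by (intro add_left_mono) auto
        finally show ?thesis .
      qed
      \<comment> \<open>The cubes of generation k inside \<open>O'\<close> are disjoint, so their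
        volumes add up to at most that of \<open>O'\<close>; as k grows they exhaust
        \<open>E0\<close>, because the cubes around a point shrink to it.\<close>
      define G where "G k = {Q \<in> cubes_at D (int k). Q \<subseteq> O'}" for k :: nat
      have G: "G k \<subseteq> D" for k using cubes_at_D by (auto simp: G_def)
      have cG: "countable (G k)" for k using G countable_D countable_subset by blast
      have one: "emeasure lebesgue (E0 \<inter> \<Union>(G k)) \<le> ennreal \<theta> * emeasure lebesgue O'" for k
      proof -
        have eq: "E0 \<inter> \<Union>(G k) = \<Union>((\<inter>) E0 ` G k)" by auto
        show ?thesis unfolding eq
        proof (rule emeasure_countable_Union_le)
          fix F assume F: "finite F" "F \<subseteq> (\<inter>) E0 ` G k"
          then obtain F' where F': "finite F'" "F' \<subseteq> G k" "F = (\<inter>) E0 ` F'"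
            by (meson finite_subset_image)
          have s: "\<And>Q. Q \<in> F' \<Longrightarrow> Q \<in> sets lebesgue" using F' G D_sets by blast
          have "emeasure lebesgue (\<Union>F) \<le> (\<Sum>Q\<in>F'. emeasure lebesgue (E0 \<inter> Q))"
            using emeasure_subadditive_finite[of F' "\<lambda>Q. E0 \<inter> Q" lebesgue] F' s E0 by auto
          also have "\<dots> \<le> (\<Sum>Q\<in>F'. ennreal \<theta> * emeasure lebesgue Q)"
          proof (rule sum_mono)
            fix Q assume Q: "Q \<in> F'"
            then have QD: "Q \<in> D" using F' G by blast
            show "emeasure lebesgue (E0 \<inter> Q) \<le> ennreal \<theta> * emeasure lebesgue Q"
            proof (cases "E \<inter> Q = {}")
              case True then have "E0 \<inter> Q = {}" by (auto simp: E0_def)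
              then show ?thesis by (metis emeasure_empty zero_le)
            next
              case False
              have "emeasure lebesgue (E0 \<inter> Q) \<le> emeasure lebesgue (E \<inter> Q)"
                using E D_sets[OF QD] by (intro emeasure_mono) (auto simp: E0_def)
              also have "\<dots> \<le> ennreal \<theta> * emeasure lebesgue Q"
                using den[OF QD] False by auto
              finally show ?thesis .
            qed
          qed
          also have "\<dots> = ennreal \<theta> * (\<Sum>Q\<in>F'. emeasure lebesgue Q)" by (simp add: sum_distrib_left)
          also have "\<dots> \<le> ennreal \<theta> * emeasure lebesgue O'"
          proof (intro mult_left_mono sum_emeasure_disjoint_le)
            show "disjoint_family_on (\<lambda>Q. Q) F'"
              using F' cubes_at_unique unfolding disjoint_family_on_def G_def by blast
          qed (use F' s Os in \<open>auto simp: G_def\<close>)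
          finally show "emeasure lebesgue (\<Union>F) \<le> ennreal \<theta> * emeasure lebesgue O'" .
        next
          show "(\<inter>) E0 ` G k \<subseteq> sets lebesgue" using G[of k] D_sets E0 by blast
        qed (use cG in auto)
      qed
      have inc: "incseq (\<lambda>k. E0 \<inter> \<Union>(G k))"
      proof (rule incseq_SucI, rule Int_mono[OF order_refl], rule subsetI)
        fix k x assume "x \<in> \<Union>(G k)"
        then have "cell (int k) x \<subseteq> O'" using cell_eq by (auto simp: G_def)
        then have "cell (int (Suc k)) x \<subseteq> O'" using cell_mono[of "int k" "int (Suc k)" x] by auto
        then show "x \<in> \<Union>(G (Suc k))" unfolding G_def using cell_mem by blast
      qed
      have UN: "(\<Union>k. E0 \<inter> \<Union>(G k)) = E0"
      proof (intro equalityI subsetI)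
        fix x assume x: "x \<in> E0"
        then obtain r where r: "r > 0" "ball x r \<subseteq> O'" using O open_contains_ball by (metis subsetD)
        obtain k :: nat where k: "(1/2)^k < r / real DIM('a)"
          using real_arch_pow_inv[of "r / real DIM('a)" "1/2"] r by auto
        have "side (int k) = (1/2)^k" by (rule side_nat)
        then have "real DIM('a) * side (int k) < r" using k by (simp add: pos_less_divide_eq mult.commute)
        then have "cell (int k) x \<subseteq> ball x r"
          using dist_cell[of x "int k" x] by (meson cell_mem(2) le_less_trans mem_ball subsetI)
        then have "cell (int k) x \<in> G k" using r by (auto simp: G_def)
        then show "x \<in> (\<Union>k. E0 \<inter> \<Union>(G k))" using x cell_mem(2) by blast
      qed auto
      have sG: "\<Union>(G k) \<in> sets lebesgue" for k
        using cG G D_sets by (intro sets.countable_Union) auto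
      have "(SUP k. emeasure lebesgue (E0 \<inter> \<Union>(G k))) = emeasure lebesgue (\<Union>k. E0 \<inter> \<Union>(G k))"
        by (rule SUP_emeasure_incseq[OF _ inc]) (use sG E0 in blast)
      then have "emeasure lebesgue E0 = (SUP k. emeasure lebesgue (E0 \<inter> \<Union>(G k)))"
        unfolding UN by (rule sym)
      also have "\<dots> \<le> ennreal \<theta> * emeasure lebesgue O'" using one by (rule SUP_least)
      also have "\<dots> \<le> ennreal \<theta> * (emeasure lebesgue E0 + ennreal e)"
        using Oe by (intro mult_left_mono) auto
      finally show ?thesis .
    qed
    obtain m where m: "emeasure lebesgue E0 = ennreal m" "0 \<le> m"
      using fin by (cases "emeasure lebesgue E0") auto
    have "m \<le> \<theta> * (m + e)" if "e > 0" for e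
      using main[OF that] th m that by (simp add: ennreal_mult[symmetric] ennreal_plus[symmetric] del: ennreal_plus)
    then have "m \<le> \<theta> * m + e" if "e > 0" for e
    proof -
      have "m \<le> \<theta> * (m + e)" using \<open>\<And>e. e > 0 \<Longrightarrow> m \<le> \<theta> * (m + e)\<close> that .
      also have "\<dots> \<le> \<theta> * m + e" using th that by (simp add: algebra_simps)
      finally show ?thesis .
    qed
    then have "m \<le> \<theta> * m" by (rule field_le_epsilon)
    then have "(1 - \<theta>) * m \<le> 0" by (simp add: algebra_simps)
    then have "m = 0" using th m by (simp add: mult_le_0_iff)
    then show ?thesis using m E0 by (simp add: E0_def null_sets_def)
  qed
  have "E = (\<Union>B\<in>D. E \<inter> B)" using cell_mem(2) cell_D by blast
  also have "\<dots> \<in> null_sets lebesgue" using countable_D null by (intro null_sets_UN') auto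
  finally show ?thesis .
qed

end

subsection \<open>Principal cubes\<close>

primrec gens :: "('a set \<Rightarrow> 'a set set) \<Rightarrow> 'a set set \<Rightarrow> nat \<Rightarrow> 'a set set" where
  "gens st B 0 = B"
| "gens st B (Suc n) = (\<Union>Q\<in>gens st B n. st Q)"

lemma ennreal_le_half: "2 * (e::ennreal) \<le> q \<Longrightarrow> e \<le> q / 2"
proof -
  assume "2 * e \<le> q"
  then have "2 * e / 2 \<le> q / 2" by (rule divide_right_mono_ennreal)
  then show ?thesis by (simp add: mult.commute[of 2] ennreal_mult_divide_eq)
qed

text \<open>Smallness of the stopping cubes of Q is expressed by a measurable superset of their
  union, because such sets E arise as exceptional sets of weak type inequalities.\<close>

locale stopping = grid D for D :: "'a::euclidean_space set set" +
  fixes st :: "'a set \<Rightarrow> 'a set set" and k0 :: int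
  assumes st_D: "Q \<in> D \<Longrightarrow> st Q \<subseteq> D"
    and st_less: "Q \<in> D \<Longrightarrow> P \<in> st Q \<Longrightarrow> P \<subset> Q"
    and st_disj: "Q \<in> D \<Longrightarrow> disjoint (st Q)"
    and st_small: "Q \<in> D \<Longrightarrow> \<exists>E\<in>sets lebesgue. \<Union>(st Q) \<subseteq> E \<and> 2 * emeasure lebesgue E \<le> emeasure lebesgue Q"
begin

abbreviation "gen \<equiv> gens st (cubes_at D k0)"
definition "fam = (\<Union>n. gen n)"

lemma gen_D: "gen n \<subseteq> D"
proof (induction n)
  case 0 then show ?case using cubes_at_D by auto
next
  case (Suc n) then show ?case using st_D by auto
qed

lemma fam_D: "fam \<subseteq> D" using gen_D by (auto simp: fam_def)

text \<open>Two cubes of one generation through x have parents through x, which coincide by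
  induction, and the stopping cubes of a single parent are disjoint.\<close>

lemma gen_unique: "P \<in> gen n \<Longrightarrow> Q \<in> gen n \<Longrightarrow> x \<in> P \<Longrightarrow> x \<in> Q \<Longrightarrow> P = Q"
proof (induction n arbitrary: P Q)
  case 0 then show ?case using cubes_at_unique by auto
next
  case (Suc n)
  from Suc.prems obtain P' where P': "P' \<in> gen n" "P \<in> st P'" by auto
  from Suc.prems obtain Q' where Q': "Q' \<in> gen n" "Q \<in> st Q'" by auto
  have D: "P' \<in> D" "Q' \<in> D" using P' Q' gen_D by auto
  have "x \<in> P'" "x \<in> Q'" using st_less D P' Q' Suc.prems by blast+
  then have "P' = Q'" using Suc.IH P' Q' by blast
  then show ?case using st_disj[OF D(1)] P' Q' Suc.prems unfolding disjoint_def by blast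
qed

lemma gen_ancestor: "R \<in> gen (n + j) \<Longrightarrow> \<exists>Q\<in>gen n. R \<subseteq> Q"
proof (induction j arbitrary: R)
  case 0 then show ?case by auto
next
  case (Suc j)
  then obtain Q where Q: "Q \<in> gen (n + j)" "R \<in> st Q" by auto
  have "Q \<in> D" using Q gen_D by auto
  then have "R \<subseteq> Q" using Q st_less by auto
  with Suc.IH[OF Q(1)] show ?case by (meson order_trans)
qed

text \<open>A member strictly inside Q belongs to a later generation, so it lies in a cube of the
  generation right after that of Q, and this cube is a stopping cube of Q. Maximality makes the two
  equal, and sparseness of \<open>fam\<close> can be read off from \<open>st_small\<close>.\<close>

lemma children_subset:
  assumes Q: "Q \<in> fam"
  shows "children fam Q \<subseteq> st Q"
proof
  fix R assume R: "R \<in> children fam Q"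
  then have RF: "R \<in> fam" "R \<subset> Q" and Rmax: "\<And>P. P \<in> fam \<Longrightarrow> P \<subset> Q \<Longrightarrow> \<not> R \<subset> P"
    by (auto simp: children_def)
  obtain n m where n: "Q \<in> gen n" and m: "R \<in> gen m" using Q RF by (auto simp: fam_def)
  have QD: "Q \<in> D" using Q fam_D by auto
  obtain x where x: "x \<in> R" using RF fam_D D_nonempty by blast
  then have xQ: "x \<in> Q" using RF by auto
  have "\<not> m \<le> n"
  proof
    assume "m \<le> n"
    then obtain Q' where "Q' \<in> gen m" "Q \<subseteq> Q'" using gen_ancestor[of Q m "n - m"] n by auto
    then have "Q' = R" using gen_unique[OF _ m, of Q' x] x xQ by auto
    then show False using \<open>Q \<subseteq> Q'\<close> RF by auto
  qed
  then obtain P where P: "P \<in> gen (Suc n)" "R \<subseteq> P" using gen_ancestor[of R "Suc n" "m - Suc n"] m by auto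
  then obtain Q' where Q': "Q' \<in> gen n" "P \<in> st Q'" by auto
  have "Q' \<in> D" using Q' gen_D by auto
  then have "x \<in> Q'" using Q' P x st_less by blast
  then have "Q' = Q" using gen_unique[OF Q'(1) n] xQ by auto
  then have "P \<in> st Q" "P \<in> fam" "P \<subset> Q" using Q' P st_less QD unfolding fam_def by blast+
  then have "\<not> R \<subset> P" using Rmax by auto
  then show "R \<in> st Q" using P \<open>P \<in> st Q\<close> by auto
qed

lemma sparse: "sparse_family D fam"
  unfolding sparse_family_def
proof (intro conjI fam_D ballI)
  fix Q assume Q: "Q \<in> fam"
  then have QD: "Q \<in> D" using fam_D by auto
  obtain E where E: "E \<in> sets lebesgue" "\<Union>(st Q) \<subseteq> E" "2 * emeasure lebesgue E \<le> emeasure lebesgue Q"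
    using st_small[OF QD] by auto
  have "(\<Sum>\<^sub>\<infinity>P\<in>children fam Q. emeasure lebesgue P) \<le> emeasure lebesgue E"
  proof (rule infsum_ennreal_le)
    fix F assume F: "finite F" "F \<subseteq> children fam Q"
    then have FS: "F \<subseteq> st Q" using children_subset[OF Q] by auto
    show "sum (emeasure lebesgue) F \<le> emeasure lebesgue E"
    proof (rule sum_emeasure_disjoint_le[OF F(1), of "\<lambda>P. P"])
      show "disjoint_family_on (\<lambda>P. P) F"
        using st_disj[OF QD] FS unfolding disjoint_family_on_def disjoint_def by blast
      show "P \<in> sets lebesgue" if "P \<in> F" for P using that FS st_D[OF QD] D_sets by auto
    qed (use FS E in auto)
  qed
  also have "\<dots> \<le> emeasure lebesgue Q / 2" using E by (intro ennreal_le_half)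
  finally show "(\<Sum>\<^sub>\<infinity>P\<in>children fam Q. emeasure lebesgue P) \<le> emeasure lebesgue Q / 2" .
qed

text \<open>Passing to the next generation at least halves the measure. A finite subfamily has
  finitely many parents, these are disjoint, and the stopping cubes of each are covered by a set of
  at most half its measure.\<close>

lemma gen_small:
  assumes B: "B \<in> cubes_at D k0"
  shows "emeasure lebesgue (\<Union>{Q\<in>gen n. Q \<subseteq> B}) \<le> emeasure lebesgue B / 2 ^ n"
proof (induction n)
  case 0
  have "\<Union>{Q\<in>gen 0. Q \<subseteq> B} \<subseteq> B" by auto
  then have "emeasure lebesgue (\<Union>{Q\<in>gen 0. Q \<subseteq> B}) \<le> emeasure lebesgue B"
    using B cubes_at_D D_sets by (intro emeasure_mono) auto
  then show ?case by (simp add: divide_ennreal_def)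
next
  case (Suc n)
  define g where "g n = {Q\<in>gen n. Q \<subseteq> B}" for n
  have gD: "g n \<subseteq> D" for n using gen_D by (auto simp: g_def)
  have cg: "countable (g n)" for n using gD countable_D countable_subset by blast
  have sg: "\<Union>(g n) \<in> sets lebesgue" for n
    using cg gD D_sets by (intro sets.countable_Union) auto
  have "emeasure lebesgue (\<Union>(g (Suc n))) \<le> emeasure lebesgue (\<Union>(g n)) / 2"
  proof (rule emeasure_countable_Union_le[OF cg])
    show "g (Suc n) \<subseteq> sets lebesgue" using gD D_sets by blast
    fix F assume F: "finite F" "F \<subseteq> g (Suc n)"
    have "\<exists>Q. Q \<in> g n \<and> P \<in> st Q" if "P \<in> F" for P
    proof -
      have P: "P \<in> gen (Suc n)" "P \<subseteq> B" using that F by (auto simp: g_def)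
      then obtain Q where Q: "Q \<in> gen n" "P \<in> st Q" by auto
      then have QD: "Q \<in> D" using gen_D by auto
      have "P \<in> D" using gD[of "Suc n"] F(2) that by auto
      then obtain x where x: "x \<in> P" using D_nonempty by auto
      then have xQ: "x \<in> Q" using st_less[OF QD Q(2)] by auto
      obtain B' where B': "B' \<in> gen 0" "Q \<subseteq> B'" using gen_ancestor[of Q 0 n] Q by auto
      then have "B' = B" using cubes_at_unique[of B' k0 B x] B x xQ P by auto
      then show ?thesis using Q B' by (auto simp: g_def)
    qed
    then obtain f where f: "\<And>P. P \<in> F \<Longrightarrow> f P \<in> g n \<and> P \<in> st (f P)" by metis
    have "\<exists>E. Q \<in> D \<longrightarrow> E \<in> sets lebesgue \<and> \<Union>(st Q) \<subseteq> E \<and> emeasure lebesgue E \<le> emeasure lebesgue Q / 2" for Q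
      using st_small[of Q] ennreal_le_half by blast
    then obtain E where E: "\<And>Q. Q \<in> D \<Longrightarrow> E Q \<in> sets lebesgue \<and> \<Union>(st Q) \<subseteq> E Q \<and> emeasure lebesgue (E Q) \<le> emeasure lebesgue Q / 2"
      by metis
    have fD: "f P \<in> D" if "P \<in> F" for P using f[OF that] gD by blast
    have "\<Union>F \<subseteq> (\<Union>Q\<in>f ` F. E Q)"
    proof
      fix x assume "x \<in> \<Union>F"
      then obtain P where P: "P \<in> F" "x \<in> P" by auto
      then have "x \<in> E (f P)" using f[OF P(1)] E[OF fD[OF P(1)]] by auto
      then show "x \<in> (\<Union>Q\<in>f ` F. E Q)" using P by auto
    qed
    then have "emeasure lebesgue (\<Union>F) \<le> emeasure lebesgue (\<Union>Q\<in>f ` F. E Q)"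
      using F E fD by (intro emeasure_mono sets.finite_UN) auto
    also have "\<dots> \<le> (\<Sum>Q\<in>f ` F. emeasure lebesgue (E Q))"
      using F E fD by (intro emeasure_subadditive_finite) auto
    also have "\<dots> \<le> (\<Sum>Q\<in>f ` F. emeasure lebesgue Q / 2)"
      using E fD by (intro sum_mono) auto
    also have "\<dots> = (\<Sum>Q\<in>f ` F. emeasure lebesgue Q) / 2"
      by (simp add: divide_ennreal_def sum_distrib_right)
    also have "\<dots> \<le> emeasure lebesgue (\<Union>(g n)) / 2"
    proof (intro divide_right_mono_ennreal sum_emeasure_disjoint_le)
      show "disjoint_family_on (\<lambda>Q. Q) (f ` F)"
        unfolding disjoint_family_on_def
      proof (intro ballI impI)
        fix P Q assume *: "P \<in> f ` F" "Q \<in> f ` F" "P \<noteq> Q"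
        then have "P \<in> gen n" "Q \<in> gen n" using f by (auto simp: g_def)
        then show "P \<inter> Q = {}" using gen_unique[of P n Q] * by auto
      qed
      show "Q \<in> sets lebesgue" if "Q \<in> f ` F" for Q using that fD D_sets by auto
      show "Q \<subseteq> \<Union>(g n)" if "Q \<in> f ` F" for Q using that f by auto
    qed (use F sg in auto)
    finally show "emeasure lebesgue (\<Union>F) \<le> emeasure lebesgue (\<Union>(g n)) / 2" .
  qed
  also have "\<dots> \<le> emeasure lebesgue B / 2 ^ n / 2"
    using Suc by (intro divide_right_mono_ennreal) (simp add: g_def)
  also have "\<dots> = emeasure lebesgue B / 2 ^ Suc n"
  proof -
    have "inverse (2 ^ n) * inverse 2 = (inverse (2 ^ n * 2) :: ennreal)"
      by (rule ennreal_inverse_mult[symmetric]) (auto simp: power_less_top_ennreal)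
    then show ?thesis by (simp add: divide_ennreal_def mult.assoc mult.commute[of 2])
  qed
  finally show ?case by (simp add: g_def)
qed

text \<open>Inside each of the countably many cubes of level \<open>k0\<close> the n-th generation
  has at most 2^-n times the measure of the cube, so the points that lie in all generations form a
  null set.\<close>

lemma AE_not_gen: "AE x in lebesgue. \<exists>n. x \<notin> \<Union>(gen n)"
proof -
  define Z where "Z B = (\<Inter>n. \<Union>{Q\<in>gen n. Q \<subseteq> B})" for B
  have s: "\<Union>{Q\<in>gen n. Q \<subseteq> B} \<in> sets lebesgue" for n B
  proof (rule sets.countable_Union)
    show "countable {Q\<in>gen n. Q \<subseteq> B}"
      using gen_D by (intro countable_subset[OF _ countable_D]) auto
    show "{Q\<in>gen n. Q \<subseteq> B} \<subseteq> sets lebesgue" using gen_D D_sets by blast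
  qed
  have sZ: "Z B \<in> sets lebesgue" for B unfolding Z_def using s by (intro sets.countable_INT) auto
  have "Z B \<in> null_sets lebesgue" if B: "B \<in> cubes_at D k0" for B
  proof -
    obtain b where b: "emeasure lebesgue B = ennreal b" "0 \<le> b"
      using emeasure_D[OF cubes_at_D[OF B]] by (cases "emeasure lebesgue B") auto
    have le: "emeasure lebesgue (Z B) \<le> ennreal (b / 2 ^ n)" for n
    proof -
      have "emeasure lebesgue (Z B) \<le> emeasure lebesgue (\<Union>{Q\<in>gen n. Q \<subseteq> B})"
        using s by (intro emeasure_mono) (auto simp: Z_def)
      also have "\<dots> \<le> emeasure lebesgue B / 2 ^ n" by (rule gen_small[OF B])
      also have "\<dots> = ennreal (b / 2 ^ n)"
      proof -
        have "(2::ennreal) ^ n = ennreal (2 ^ n)" by (simp add: ennreal_power[symmetric])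
        then show ?thesis using b by (simp add: divide_ennreal)
      qed
      finally show ?thesis .
    qed
    have "(\<lambda>n. ennreal (b / 2 ^ n)) \<longlonglongrightarrow> ennreal 0"
    proof (rule tendsto_ennrealI)
      show "(\<lambda>n. b / 2 ^ n) \<longlonglongrightarrow> 0"
        using LIMSEQ_divide_realpow_zero[of 2 b] by simp
    qed
    then have "emeasure lebesgue (Z B) \<le> ennreal 0"
      by (rule LIMSEQ_le_const) (use le in auto)
    then show ?thesis using sZ by (simp add: null_sets_def)
  qed
  moreover have "countable (cubes_at D k0)"
    using cubes_at_D by (intro countable_subset[OF _ countable_D]) auto
  ultimately have N: "(\<Union>B\<in>cubes_at D k0. Z B) \<in> null_sets lebesgue" by (intro null_sets_UN') auto
  show ?thesis
  proof (rule AE_I'[OF N], safe)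
    fix x assume "\<nexists>n. x \<notin> \<Union>(gen n)"
    then have all: "\<And>n. x \<in> \<Union>(gen n)" by auto
    have "x \<in> Z (cell k0 x)" unfolding Z_def
    proof
      fix n
      obtain Q where Q: "Q \<in> gen n" "x \<in> Q" using all[of n] by auto
      obtain B where B: "B \<in> gen 0" "Q \<subseteq> B" using gen_ancestor[of Q 0 n] Q by auto
      then have "B = cell k0 x" using Q cell_eq by auto
      then show "x \<in> \<Union>{Q\<in>gen n. Q \<subseteq> cell k0 x}" using Q B by auto
    qed
    then show "x \<in> (\<Union>B\<in>cubes_at D k0. Z B)" by blast
  qed
qed

text \<open>Stopping at Q costs \<open>a Q\<close>, and so does passing from Q to a stopping cube.
  For almost every x the descent ends after finitely many steps, and the costs add up to part of the
  sum over \<open>fam\<close>.\<close>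

lemma domination:
  fixes N :: "'a set \<Rightarrow> 'a \<Rightarrow> ennreal"
  assumes N1: "\<And>Q x. Q \<in> D \<Longrightarrow> x \<in> Q \<Longrightarrow> x \<notin> \<Union>(st Q) \<Longrightarrow> N Q x \<le> a Q"
    and N2: "\<And>Q P x. Q \<in> D \<Longrightarrow> P \<in> st Q \<Longrightarrow> x \<in> P \<Longrightarrow> N Q x \<le> a Q + N P x"
  shows "AE x in lebesgue. N (cell k0 x) x \<le> (\<Sum>\<^sub>\<infinity>P\<in>fam. a P * indicator P x)"
proof -
  \<comment> \<open>Induction on the number m of generations after which x has dropped out. The
    cubes collected below P are proper subsets of Q, so Q is new and contributes its own
    term.\<close>
  have main: "\<exists>G. finite G \<and> G \<subseteq> fam \<and> (\<forall>P\<in>G. P \<subseteq> Q \<and> x \<in> P) \<and> N Q x \<le> sum a G"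
    if "Q \<in> gen j" "x \<in> Q" "x \<notin> \<Union>(gen (j + m))" for Q j m x
    using that
  proof (induction m arbitrary: Q j)
    case 0 then show ?case by auto
  next
    case (Suc m)
    have QD: "Q \<in> D" using Suc.prems gen_D by auto
    have Qf: "Q \<in> fam" using Suc.prems by (auto simp: fam_def)
    show ?case
    proof (cases "x \<in> \<Union>(st Q)")
      case False
      then show ?thesis using N1[OF QD Suc.prems(2)] Qf Suc.prems(2) by (intro exI[of _ "{Q}"]) auto
    next
      case True
      then obtain P where P: "P \<in> st Q" "x \<in> P" by auto
      have "P \<in> gen (Suc j)" using P Suc.prems by auto
      from Suc.IH[OF this P(2)] Suc.prems(3)
      obtain G where G: "finite G" "G \<subseteq> fam" "\<forall>R\<in>G. R \<subseteq> P \<and> x \<in> R" "N P x \<le> sum a G" by auto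
      have PQ: "P \<subset> Q" using st_less[OF QD P(1)] .
      have "Q \<notin> G" using G PQ by auto
      have "N Q x \<le> a Q + N P x" by (rule N2[OF QD P])
      also have "\<dots> \<le> a Q + sum a G" using G by (intro add_left_mono) auto
      also have "\<dots> = sum a (insert Q G)" using G \<open>Q \<notin> G\<close> by simp
      finally show ?thesis using G PQ Qf Suc.prems(2) by (intro exI[of _ "insert Q G"]) auto
    qed
  qed
  show ?thesis
    using AE_not_gen
  proof eventually_elim
    case (elim x)
    then obtain n where n: "x \<notin> \<Union>(gen n)" by auto
    obtain G where G: "finite G" "G \<subseteq> fam" "\<forall>P\<in>G. P \<subseteq> cell k0 x \<and> x \<in> P" "N (cell k0 x) x \<le> sum a G"
      using main[of "cell k0 x" 0 x n] n by auto
    note G(4)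
    also have "sum a G = (\<Sum>P\<in>G. a P * indicator P x)" using G by (intro sum.cong) auto
    also have "\<dots> \<le> (\<Sum>\<^sub>\<infinity>P\<in>fam. a P * indicator P x)" by (rule sum_le_infsum_ennreal[OF G(1,2)])
    finally show ?case .
  qed
qed

end

context grid begin

lemma fam_level: "Q \<in> gens st (cubes_at D k0) n \<Longrightarrow> stopping D st \<Longrightarrow> k0 \<le> lev Q"
proof -
  assume Q: "Q \<in> gens st (cubes_at D k0) n" and "stopping D st"
  then interpret stopping D st k0 by simp
  obtain B where B: "B \<in> gen 0" "Q \<subseteq> B" using gen_ancestor[of Q 0 n] Q by auto
  then have "B \<in> cubes_at D k0" by simp
  then have "lev B \<le> lev Q" using lev_mono[of Q B] gen_D Q B cubes_at_D by blast
  then show ?thesis using lev_cubes_at[OF \<open>B \<in> cubes_at D k0\<close>] by simp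
qed

text \<open>The relation \<open>bad\<close> is arbitrary, and the stopping cubes of Q are the
  maximal P with \<open>bad Q P\<close>. The last premise of \<open>N2\<close> records this
  maximality: no cube strictly above P and inside Q, Q itself included, is bad. The lemma is applied
  to sums of averages over a Carleson family and to the joint maximal function.\<close>

lemma principal:
  fixes N :: "'a set \<Rightarrow> 'a \<Rightarrow> ennreal"
  assumes E: "\<And>Q. Q \<in> D \<Longrightarrow> \<exists>E\<in>sets lebesgue. (\<forall>P\<in>D. P \<subseteq> Q \<and> bad Q P \<longrightarrow> P \<subseteq> E) \<and> 2 * emeasure lebesgue E \<le> emeasure lebesgue Q"
    and N1: "\<And>Q x. Q \<in> D \<Longrightarrow> x \<in> Q \<Longrightarrow> (\<And>P. P \<in> D \<Longrightarrow> P \<subseteq> Q \<Longrightarrow> x \<in> P \<Longrightarrow> \<not> bad Q P) \<Longrightarrow> N Q x \<le> a Q"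
    and N2: "\<And>Q P x. Q \<in> D \<Longrightarrow> P \<in> D \<Longrightarrow> P \<subset> Q \<Longrightarrow> bad Q P \<Longrightarrow> x \<in> P \<Longrightarrow>
        (\<And>R. R \<in> D \<Longrightarrow> P \<subset> R \<Longrightarrow> R \<subseteq> Q \<Longrightarrow> \<not> bad Q R) \<Longrightarrow> N Q x \<le> a Q + N P x"
  obtains F where "sparse_family D F" "\<And>Q. Q \<in> F \<Longrightarrow> k0 \<le> lev Q"
    "AE x in lebesgue. N (cell k0 x) x \<le> (\<Sum>\<^sub>\<infinity>P\<in>F. a P * indicator P x)"
proof -
  define b where "b Q = {P \<in> D. P \<subseteq> Q \<and> bad Q P}" for Q
  define st where "st Q = maxi (b Q)" for Q
  have bD: "b Q \<subseteq> D" for Q by (auto simp: b_def)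
  have lvl: "lev Q \<le> lev P" if "Q \<in> D" "P \<in> b Q" for P Q
    using that lev_mono[of P Q] by (auto simp: b_def)
  \<comment> \<open>A bad Q would lie in a set of at most half its own measure. Hence stopping cubes
    are strictly smaller than Q.\<close>
  have not_self: "\<not> bad Q Q" if Q: "Q \<in> D" for Q
  proof
    assume "bad Q Q"
    then obtain E where "E \<in> sets lebesgue" "Q \<subseteq> E" "2 * emeasure lebesgue E \<le> emeasure lebesgue Q"
      using E[OF Q] Q by auto
    moreover from this have "emeasure lebesgue Q \<le> emeasure lebesgue E" by (intro emeasure_mono)
    ultimately have "2 * emeasure lebesgue Q \<le> emeasure lebesgue Q"
      by (meson mult_left_mono order_trans zero_le)
    moreover obtain q where "emeasure lebesgue Q = ennreal q" "q > 0"
      using emeasure_D[OF Q] by (cases "emeasure lebesgue Q") auto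
    ultimately show False
      by (simp add: ennreal_numeral[symmetric] ennreal_mult[symmetric] del: ennreal_numeral)
  qed
  have mem_st: "P \<in> st Q \<longleftrightarrow> P \<in> D \<and> P \<subseteq> Q \<and> bad Q P \<and> (\<forall>R\<in>D. R \<subseteq> Q \<and> bad Q R \<longrightarrow> \<not> P \<subset> R)" for P Q
    by (auto simp: st_def maxi_def b_def)
  have stop: "stopping D st"
  proof unfold_locales
    fix Q assume Q: "Q \<in> D"
    show "st Q \<subseteq> D" by (auto simp: mem_st)
    show "disjoint (st Q)" unfolding st_def by (rule maxi_disjoint[OF bD])
    show "P \<subset> Q" if "P \<in> st Q" for P using that not_self[OF Q] by (auto simp: mem_st)
    show "\<exists>E\<in>sets lebesgue. \<Union>(st Q) \<subseteq> E \<and> 2 * emeasure lebesgue E \<le> emeasure lebesgue Q"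
    proof -
      obtain E where "E \<in> sets lebesgue" "\<forall>P\<in>D. P \<subseteq> Q \<and> bad Q P \<longrightarrow> P \<subseteq> E" "2 * emeasure lebesgue E \<le> emeasure lebesgue Q"
        using E[OF Q] by auto
      moreover from this have "\<Union>(st Q) \<subseteq> E"
        by (intro Union_least) (simp add: mem_st)
      ultimately show ?thesis by auto
    qed
  qed
  interpret stopping D st k0 by (rule stop)
  have "AE x in lebesgue. N (cell k0 x) x \<le> (\<Sum>\<^sub>\<infinity>P\<in>fam. a P * indicator P x)"
  proof (rule domination)
    fix Q x assume Q: "Q \<in> D" "x \<in> Q" "x \<notin> \<Union>(st Q)"
    show "N Q x \<le> a Q"
    proof (rule N1[OF Q(1,2)])
      fix P assume P: "P \<in> D" "P \<subseteq> Q" "x \<in> P"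
      show "\<not> bad Q P"
      proof
        assume "bad Q P"
        then have "P \<in> b Q" using P by (auto simp: b_def)
        then obtain R where "R \<in> maxi (b Q)" "P \<subseteq> R" using ex_maxi[OF bD lvl[OF Q(1)]] by blast
        then show False using Q(3) P(3) by (auto simp: st_def)
      qed
    qed
  next
    fix Q P x assume Q: "Q \<in> D" and P: "P \<in> st Q" "x \<in> P"
    show "N Q x \<le> a Q + N P x"
    proof (rule N2[OF Q])
      show "P \<subset> Q" by (rule st_less[OF Q P(1)])
      show "P \<in> D" "bad Q P" using P by (auto simp: mem_st)
      fix R assume "R \<in> D" "P \<subset> R" "R \<subseteq> Q" then show "\<not> bad Q R" using P(1) by (auto simp: mem_st)
    qed (rule P(2))
  qed
  moreover have "k0 \<le> lev Q" if Q: "Q \<in> fam" for Q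
  proof -
    obtain n where "Q \<in> gens st (cubes_at D k0) n" using Q unfolding fam_def by auto
    then show ?thesis using fam_level stop by blast
  qed
  ultimately show ?thesis using sparse by (intro that)
qed

end

subsection \<open>From Carleson families to sparse families\<close>

context grid begin

text \<open>Cubes of the grid through a common point are ordered by their levels, so the one of
  highest level lies in all others.\<close>

lemma chain_least:
  assumes "finite F" "F \<noteq> {}" "F \<subseteq> D" "\<And>R. R \<in> F \<Longrightarrow> x \<in> R"
  obtains P where "P \<in> F" "\<And>R. R \<in> F \<Longrightarrow> P \<subseteq> R"
proof -
  have "Max (lev ` F) \<in> lev ` F" using assms by (intro Max_in) auto
  then obtain P where P: "P \<in> F" "lev P = Max (lev ` F)" by auto
  have "P \<subseteq> R" if R: "R \<in> F" for R
  proof -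
    have "lev R \<le> lev P" unfolding P(2) using R assms(1) by (intro Max_ge) auto
    moreover have "P \<in> D" "x \<in> P" "R \<in> D" "x \<in> R" using P(1) R assms(3,4) by auto
    ultimately show ?thesis using cell_lev[of P x] cell_lev[of R x] cell_subset_iff[of "lev P" x "lev R"] by simp
  qed
  with P show ?thesis by (intro that)
qed

text \<open>Around a point of P there is one cube for each level between those of Q and P.\<close>

lemma finite_between:
  assumes "P \<in> D" "Q \<in> D"
  shows "finite {R\<in>D. P \<subseteq> R \<and> R \<subseteq> Q}"
proof -
  obtain x where x: "x \<in> P" using D_nonempty[OF assms(1)] by auto
  have "{R\<in>D. P \<subseteq> R \<and> R \<subseteq> Q} \<subseteq> (\<lambda>k. cell k x) ` {lev Q..lev P}"
  proof
    fix R assume R: "R \<in> {R\<in>D. P \<subseteq> R \<and> R \<subseteq> Q}"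
    then have "R = cell (lev R) x" using cell_lev x by auto
    moreover have "lev R \<in> {lev Q..lev P}" using R assms lev_mono by auto
    ultimately show "R \<in> (\<lambda>k. cell k x) ` {lev Q..lev P}" by auto
  qed
  then show ?thesis by (rule finite_subset) auto
qed

lemma finite_between_subset:
  assumes "S \<subseteq> D" "P \<in> D" "Q \<in> D"
  shows "finite {R\<in>S. P \<subseteq> R \<and> R \<subseteq> Q}"
  by (rule finite_subset[OF _ finite_between[OF assms(2,3)]]) (use assms(1) in auto)

lemma avg_emeasure: "Q \<in> D \<Longrightarrow> avg h Q * emeasure lebesgue Q = (\<integral>\<^sup>+y\<in>Q. h y \<partial>lebesgue)"
  using emeasure_D_neq[of Q] unfolding avg_def
  by (metis ennreal_divide_times ennreal_divide_self infinity_ennreal_def less_top mult.right_neutral zero_less_iff_neq_zero)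

text \<open>Markov's inequality for the number of members of S between a small cube and Q: by the
  Carleson condition the integral of that number is at most \<Lambda> times the volume of Q.\<close>

lemma carleson_count:
  assumes S: "S \<subseteq> D" and L: "0 < (\<Lambda>::real)" and Q: "Q \<in> D"
    and carl: "\<And>F. finite F \<Longrightarrow> F \<subseteq> S \<Longrightarrow> (\<And>P. P \<in> F \<Longrightarrow> P \<subseteq> Q) \<Longrightarrow>
       (\<Sum>P\<in>F. emeasure lebesgue P) \<le> ennreal \<Lambda> * emeasure lebesgue Q"
  shows "8 * emeasure lebesgue (\<Union>{P\<in>D. P \<subseteq> Q \<and> 8 * \<Lambda> < card {R\<in>S. P \<subseteq> R \<and> R \<subseteq> Q}}) \<le> emeasure lebesgue Q"
proof -
  define H where "H = {P\<in>D. P \<subseteq> Q \<and> 8 * \<Lambda> < card {R\<in>S. P \<subseteq> R \<and> R \<subseteq> Q}}"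
  have HD: "H \<subseteq> D" by (auto simp: H_def)
  have "emeasure lebesgue (\<Union>H) \<le> emeasure lebesgue Q / 8"
  proof (rule emeasure_countable_Union_le)
    show "countable H" using HD countable_D countable_subset by blast
    show "H \<subseteq> sets lebesgue" using HD D_sets by blast
    fix F assume F: "finite F" "F \<subseteq> H"
    \<comment> \<open>The members of S that are counted for the finitely many cubes of F. This
      family is finite, so the Carleson bound applies to it.\<close>
    define S' where "S' = (\<Union>P\<in>F. {R\<in>S. P \<subseteq> R \<and> R \<subseteq> Q})"
    have fin1: "finite {R\<in>S. P \<subseteq> R \<and> R \<subseteq> Q}" if "P \<in> F" for P
      using that F HD Q by (intro finite_between_subset[OF S]) auto
    then have fS: "finite S'" using F by (auto simp: S'_def)
    have sF: "\<Union>F \<in> sets lebesgue" using F HD D_sets by (intro sets.finite_Union) auto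
    have "ennreal (8 * \<Lambda>) * emeasure lebesgue (\<Union>F) = (\<integral>\<^sup>+x. ennreal (8 * \<Lambda>) * indicator (\<Union>F) x \<partial>lebesgue)"
      using sF by (simp add: nn_integral_cmult_indicator)
    also have "\<dots> \<le> (\<integral>\<^sup>+x. (\<Sum>R\<in>S'. indicator R x) \<partial>lebesgue)"
    proof (rule nn_integral_mono)
      fix x
      show "ennreal (8 * \<Lambda>) * indicator (\<Union>F) x \<le> (\<Sum>R\<in>S'. indicator R x)"
      proof (cases "x \<in> \<Union>F")
        case True
        then obtain P where P: "P \<in> F" "x \<in> P" by auto
        define C where "C = {R\<in>S. P \<subseteq> R \<and> R \<subseteq> Q}"
        have "ennreal (8 * \<Lambda>) \<le> ennreal (card C)"
          using P F by (intro ennreal_leI) (auto simp: H_def C_def)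
        also have "\<dots> = (\<Sum>R\<in>C. indicator R x)"
        proof -
          have "(\<Sum>R\<in>C. indicator R x :: ennreal) = (\<Sum>R\<in>C. 1)"
            using P by (intro sum.cong) (auto simp: C_def)
          then show ?thesis by (simp add: ennreal_of_nat_eq_real_of_nat)
        qed
        also have "\<dots> \<le> (\<Sum>R\<in>S'. indicator R x)"
          using fS P by (intro sum_mono2) (auto simp: C_def S'_def)
        finally show ?thesis using True by simp
      qed simp
    qed
    also have "\<dots> = (\<Sum>R\<in>S'. emeasure lebesgue R)"
      using S D_sets by (subst nn_integral_sum) (auto simp: S'_def subset_iff)
    also have "\<dots> \<le> ennreal \<Lambda> * emeasure lebesgue Q"
      by (rule carl[OF fS]) (auto simp: S'_def)
    finally have *: "ennreal (8 * \<Lambda>) * emeasure lebesgue (\<Union>F) \<le> ennreal \<Lambda> * emeasure lebesgue Q" .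
    have "ennreal \<Lambda> * (8 * emeasure lebesgue (\<Union>F)) \<le> ennreal \<Lambda> * emeasure lebesgue Q"
      using * L by (simp add: ennreal_mult' mult.assoc mult.left_commute)
    then have "8 * emeasure lebesgue (\<Union>F) \<le> emeasure lebesgue Q"
      using L by (subst (asm) ennreal_mult_le_mult_iff) auto
    then have "8 * emeasure lebesgue (\<Union>F) / 8 \<le> emeasure lebesgue Q / 8"
      by (rule divide_right_mono_ennreal)
    then show "emeasure lebesgue (\<Union>F) \<le> emeasure lebesgue Q / 8"
      by (simp add: mult.commute[of 8] ennreal_mult_divide_eq)
  qed
  then have "8 * emeasure lebesgue (\<Union>H) \<le> 8 * (emeasure lebesgue Q / 8)"
    by (rule mult_left_mono) simp
  also have "\<dots> = emeasure lebesgue Q"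
    by (simp add: ennreal_times_divide mult.commute[of 8] ennreal_mult_divide_eq)
  finally show ?thesis by (simp add: H_def)
qed

text \<open>Stop when the averages accumulated on the way down from Q exceed 64 * \<Lambda> times
  the average over Q. If all averages on the way are at most 8 times that of Q and at most 8 *
  \<Lambda> cubes are met, the accumulated sum stays within 8 * 8 * \<Lambda> times it; each of the
  two conditions fails on at most an eighth of Q. The family obtained depends on h.\<close>

lemma carleson_sparse:
  fixes h :: "'a \<Rightarrow> ennreal"
  assumes S: "S \<subseteq> D" and lev: "\<And>Q. Q \<in> S \<Longrightarrow> k0 \<le> lev Q" and L: "1 \<le> (\<Lambda>::real)"
    and h: "h \<in> borel_measurable lebesgue" "(\<integral>\<^sup>+y. h y \<partial>lebesgue) < \<infinity>"
    and carl: "\<And>F Q. finite F \<Longrightarrow> F \<subseteq> S \<Longrightarrow> Q \<in> D \<Longrightarrow> (\<And>P. P \<in> F \<Longrightarrow> P \<subseteq> Q) \<Longrightarrow>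
       (\<Sum>P\<in>F. emeasure lebesgue P) \<le> ennreal \<Lambda> * emeasure lebesgue Q"
  obtains F where "sparse_family D F"
    "AE x in lebesgue. (\<Sum>\<^sub>\<infinity>P\<in>S. avg h P * indicator P x) \<le> ennreal (64 * \<Lambda>) * (\<Sum>\<^sub>\<infinity>P\<in>F. avg h P * indicator P x)"
proof -
  define C where "C = ennreal (64 * \<Lambda>)"
  define N where "N Q x = (\<Sum>\<^sub>\<infinity>P\<in>{P\<in>S. P \<subseteq> Q}. avg h P * indicator P x)" for Q x
  define bad where "bad Q P \<longleftrightarrow> C * avg h Q < (\<Sum>R\<in>{R\<in>S. P \<subseteq> R \<and> R \<subseteq> Q}. avg h R)" for Q P
  have fin: "finite {R\<in>S. P \<subseteq> R \<and> R \<subseteq> Q}" if "P \<in> D" "Q \<in> D" for P Q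
    by (rule finite_between_subset[OF S that])
  have Es: "\<exists>E\<in>sets lebesgue. (\<forall>P\<in>D. P \<subseteq> Q \<and> bad Q P \<longrightarrow> P \<subseteq> E) \<and> 2 * emeasure lebesgue E \<le> emeasure lebesgue Q"
    if Q: "Q \<in> D" for Q
  proof -
    have intQ: "(\<integral>\<^sup>+y\<in>Q. h y \<partial>lebesgue) < \<infinity>"
    proof (rule le_less_trans[OF _ h(2)])
      show "(\<integral>\<^sup>+y\<in>Q. h y \<partial>lebesgue) \<le> (\<integral>\<^sup>+y. h y \<partial>lebesgue)"
        by (rule nn_integral_mono) (auto simp: indicator_def)
    qed
    have "avg h Q \<noteq> \<infinity>"
      using intQ emeasure_D_neq[OF Q] by (auto simp: avg_def ennreal_divide_eq_top_iff)
    then obtain q where q: "avg h Q = ennreal q" "0 \<le> q" by (cases "avg h Q") auto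
    show ?thesis
    proof (cases "q = 0")
      \<comment> \<open>With zero average there is no positive level for the weak type bound, but
        then all averages inside Q vanish and no cube is bad.\<close>
      case True
      have z: "avg h R = 0" if R: "R \<in> D" "R \<subseteq> Q" for R
      proof -
        have "(\<integral>\<^sup>+y\<in>R. h y \<partial>lebesgue) \<le> (\<integral>\<^sup>+y\<in>Q. h y \<partial>lebesgue)"
          by (rule nn_integral_mono) (use R in \<open>auto simp: indicator_def\<close>)
        also have "\<dots> = 0" using avg_emeasure[OF Q, of h] q True by simp
        finally show ?thesis by (simp add: avg_def)
      qed
      have "\<not> bad Q P" if "P \<in> D" for P
      proof -
        have "(\<Sum>R\<in>{R\<in>S. P \<subseteq> R \<and> R \<subseteq> Q}. avg h R) = 0"
          using z S by (intro sum.neutral) auto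
        then show ?thesis by (simp add: bad_def)
      qed
      then show ?thesis by (intro bexI[of _ "{}"]) auto
    next
      case False
      then have q0: "q > 0" using q by auto
      define G where "G = {R\<in>D. R \<subseteq> Q \<and> ennreal (8 * q) < avg h R}"
      define H where "H = {P\<in>D. P \<subseteq> Q \<and> 8 * \<Lambda> < card {R\<in>S. P \<subseteq> R \<and> R \<subseteq> Q}}"
      have GD: "G \<subseteq> D" "H \<subseteq> D" by (auto simp: G_def H_def)
      have sG: "\<Union>G \<in> sets lebesgue" "\<Union>H \<in> sets lebesgue"
        using GD countable_D D_sets by (auto intro!: sets.countable_Union intro: countable_subset)
      have "ennreal (8 * q) * emeasure lebesgue (\<Union>G) \<le> (\<integral>\<^sup>+y\<in>Q. h y \<partial>lebesgue)"
      proof (rule dyadic_maximal[OF _ GD(1) h(1), of _ Q "lev Q"])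
        fix R assume R: "R \<in> G"
        then have RD: "R \<in> D" using GD by auto
        have "ennreal (8 * q) * emeasure lebesgue R \<le> avg h R * emeasure lebesgue R"
          using R by (intro mult_right_mono) (auto simp: G_def)
        then show "ennreal (8 * q) * emeasure lebesgue R \<le> (\<integral>\<^sup>+y\<in>R. h y \<partial>lebesgue)"
          using avg_emeasure[OF RD] by simp
        show "lev Q \<le> lev R" using R Q lev_mono by (auto simp: G_def)
        show "R \<subseteq> Q" using R by (auto simp: G_def)
      qed (use q0 in auto)
      also have "\<dots> = ennreal q * emeasure lebesgue Q" using avg_emeasure[OF Q, of h] q by simp
      finally have "ennreal q * (8 * emeasure lebesgue (\<Union>G)) \<le> ennreal q * emeasure lebesgue Q"
        using q0 by (simp add: ennreal_mult' mult.assoc mult.left_commute)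
      then have g8: "8 * emeasure lebesgue (\<Union>G) \<le> emeasure lebesgue Q"
        using q0 by (subst (asm) ennreal_mult_le_mult_iff) auto
      have h8: "8 * emeasure lebesgue (\<Union>H) \<le> emeasure lebesgue Q"
        unfolding H_def using carl[OF _ _ Q] L by (intro carleson_count[OF S _ Q]) auto
      show ?thesis
      proof (intro bexI[of _ "\<Union>G \<union> \<Union>H"] conjI ballI impI)
        show "\<Union>G \<union> \<Union>H \<in> sets lebesgue" using sG by auto
        have "emeasure lebesgue (\<Union>G \<union> \<Union>H) \<le> emeasure lebesgue (\<Union>G) + emeasure lebesgue (\<Union>H)"
          using sG by (rule emeasure_subadditive)
        then have "8 * emeasure lebesgue (\<Union>G \<union> \<Union>H) \<le> 8 * (emeasure lebesgue (\<Union>G) + emeasure lebesgue (\<Union>H))"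
          by (rule mult_left_mono) simp
        also have "\<dots> \<le> emeasure lebesgue Q + emeasure lebesgue Q"
          unfolding distrib_left by (rule add_mono[OF g8 h8])
        finally have 8: "8 * emeasure lebesgue (\<Union>G \<union> \<Union>H) \<le> 2 * emeasure lebesgue Q" by (simp add: mult_2)
        have "2 * (2 * emeasure lebesgue (\<Union>G \<union> \<Union>H)) \<le> 8 * emeasure lebesgue (\<Union>G \<union> \<Union>H)"
          unfolding mult.assoc[symmetric] by (rule mult_right_mono) auto
        then have "2 * (2 * emeasure lebesgue (\<Union>G \<union> \<Union>H)) \<le> 2 * emeasure lebesgue Q"
          using 8 by (rule order_trans)
        then have "ennreal 2 * (2 * emeasure lebesgue (\<Union>G \<union> \<Union>H)) \<le> ennreal 2 * emeasure lebesgue Q" by simp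
        then show "2 * emeasure lebesgue (\<Union>G \<union> \<Union>H) \<le> emeasure lebesgue Q"
          by (subst (asm) ennreal_mult_le_mult_iff) auto
        fix P assume P: "P \<in> D" "P \<subseteq> Q \<and> bad Q P"
        show "P \<subseteq> \<Union>G \<union> \<Union>H"
        proof (rule ccontr)
          assume no: "\<not> P \<subseteq> \<Union>G \<union> \<Union>H"
          define A where "A = {R\<in>S. P \<subseteq> R \<and> R \<subseteq> Q}"
          have "P \<notin> H" using no by auto
          then have card: "real (card A) \<le> 8 * \<Lambda>" using P by (auto simp: H_def A_def)
          have "avg h R \<le> ennreal (8 * q)" if "R \<in> A" for R
          proof (rule ccontr)
            assume "\<not> avg h R \<le> ennreal (8 * q)"
            then have "R \<in> G" using that S by (auto simp: G_def A_def)
            then show False using that no by (auto simp: A_def)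
          qed
          then have "(\<Sum>R\<in>A. avg h R) \<le> (\<Sum>R\<in>A. ennreal (8 * q))" by (rule sum_mono)
          also have "\<dots> = ennreal (card A * (8 * q))"
            using q0 by (simp add: ennreal_of_nat_eq_real_of_nat ennreal_mult)
          also have "\<dots> \<le> ennreal ((8 * \<Lambda>) * (8 * q))"
            using card q0 by (intro ennreal_leI mult_right_mono) auto
          also have "\<dots> = ennreal (64 * \<Lambda> * q)" by (simp add: mult.assoc mult.left_commute)
          also have "\<dots> = C * avg h Q" using q L by (simp add: C_def ennreal_mult)
          finally have "\<not> bad Q P" by (simp add: bad_def A_def not_less)
          then show False using P by auto
        qed
      qed
    qed
  qed
  \<comment> \<open>The cubes of F through x form a chain. With P its least member, the sum is part
    of the one that is tested in \<open>bad Q P\<close>.\<close>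
  have upto: "(\<Sum>P\<in>F. avg h P * indicator P x) \<le> C * avg h Q"
    if F: "finite F" "F \<subseteq> S" "\<And>P. P \<in> F \<Longrightarrow> P \<subseteq> Q" and Q: "Q \<in> D" "x \<in> Q"
      and nb: "\<And>P. P \<in> F \<Longrightarrow> x \<in> P \<Longrightarrow> \<not> bad Q P" for F Q x
  proof -
    define F' where "F' = {P\<in>F. x \<in> P}"
    have "(\<Sum>P\<in>F. avg h P * indicator P x) = (\<Sum>P\<in>F'. avg h P)"
      unfolding F'_def using F(1) by (intro sum.mono_neutral_cong_right) auto
    also have "\<dots> \<le> C * avg h Q"
    proof (cases "F' = {}")
      case False
      have sub: "finite F'" "F' \<subseteq> D" "\<And>R. R \<in> F' \<Longrightarrow> x \<in> R" using F S by (auto simp: F'_def)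
      obtain P where P: "P \<in> F'" "\<And>R. R \<in> F' \<Longrightarrow> P \<subseteq> R"
        using chain_least[OF sub(1) False sub(2,3)] by metis
      have PD: "P \<in> D" using P F S by (auto simp: F'_def)
      have "(\<Sum>P\<in>F'. avg h P) \<le> (\<Sum>R\<in>{R\<in>S. P \<subseteq> R \<and> R \<subseteq> Q}. avg h R)"
        using P F by (intro sum_mono2 fin PD Q) (auto simp: F'_def)
      also have "\<dots> \<le> C * avg h Q" using nb[of P] P by (auto simp: bad_def F'_def not_less)
      finally show ?thesis .
    qed simp
    finally show ?thesis .
  qed
  obtain F where F: "sparse_family D F"
    "AE x in lebesgue. N (cell k0 x) x \<le> (\<Sum>\<^sub>\<infinity>P\<in>F. (C * avg h P) * indicator P x)"
  proof (rule principal[of bad N "\<lambda>Q. C * avg h Q" k0])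
    show "\<exists>E\<in>sets lebesgue. (\<forall>P\<in>D. P \<subseteq> Q \<and> bad Q P \<longrightarrow> P \<subseteq> E) \<and> 2 * emeasure lebesgue E \<le> emeasure lebesgue Q"
      if "Q \<in> D" for Q by (rule Es[OF that])
    show "N Q x \<le> C * avg h Q"
      if Q: "Q \<in> D" "x \<in> Q" and nb: "\<And>P. P \<in> D \<Longrightarrow> P \<subseteq> Q \<Longrightarrow> x \<in> P \<Longrightarrow> \<not> bad Q P" for Q x
      unfolding N_def
    proof (rule infsum_ennreal_le)
      fix F assume F: "finite F" "F \<subseteq> {P\<in>S. P \<subseteq> Q}"
      show "(\<Sum>P\<in>F. avg h P * indicator P x) \<le> C * avg h Q"
      proof (rule upto)
        fix P assume P: "P \<in> F" "x \<in> P"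
        then have "P \<in> D" "P \<subseteq> Q" using F S by auto
        then show "\<not> bad Q P" using nb P(2) by auto
      qed (use F Q in auto)
    qed
    show "N Q x \<le> C * avg h Q + N P x"
      if Q: "Q \<in> D" and P: "P \<in> D" "P \<subset> Q" "bad Q P" "x \<in> P"
        and nb: "\<And>R. R \<in> D \<Longrightarrow> P \<subset> R \<Longrightarrow> R \<subseteq> Q \<Longrightarrow> \<not> bad Q R" for Q P x
      unfolding N_def[of Q]
    proof (rule infsum_ennreal_le)
      fix F assume F: "finite F" "F \<subseteq> {P\<in>S. P \<subseteq> Q}"
      \<comment> \<open>The members inside P are accounted for by \<open>N P\<close>. A member
        through x that is not inside P strictly contains P, so it is not bad, and
        \<open>upto\<close> bounds the remaining sum by a single term.\<close>
      define F1 where "F1 = {R\<in>F. R \<subseteq> P}"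
      have "(\<Sum>P\<in>F. avg h P * indicator P x) = (\<Sum>P\<in>F - F1. avg h P * indicator P x) + (\<Sum>P\<in>F1. avg h P * indicator P x)"
        by (rule sum.subset_diff) (use F in \<open>auto simp: F1_def\<close>)
      also have "\<dots> \<le> C * avg h Q + N P x"
      proof (rule add_mono)
        show "(\<Sum>P\<in>F - F1. avg h P * indicator P x) \<le> C * avg h Q"
        proof (rule upto)
          fix R assume R: "R \<in> F - F1" "x \<in> R"
          then have RD: "R \<in> D" using F S by auto
          have "P \<subset> R" using nested[OF P(1) RD P(4) R(2)] R by (auto simp: F1_def)
          then show "\<not> bad Q R" using nb RD R F by auto
        qed (use F Q P in auto)
        show "(\<Sum>P\<in>F1. avg h P * indicator P x) \<le> N P x"
          unfolding N_def by (rule sum_le_infsum_ennreal) (use F in \<open>auto simp: F1_def\<close>)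
      qed
      finally show "(\<Sum>P\<in>F. avg h P * indicator P x) \<le> C * avg h Q + N P x" .
    qed
  qed
  show ?thesis
  proof (rule that[OF F(1)])
    show "AE x in lebesgue. (\<Sum>\<^sub>\<infinity>P\<in>S. avg h P * indicator P x) \<le> ennreal (64 * \<Lambda>) * (\<Sum>\<^sub>\<infinity>P\<in>F. avg h P * indicator P x)"
      using F(2)
    proof eventually_elim
      case (elim x)
      have "(\<Sum>\<^sub>\<infinity>P\<in>S. avg h P * indicator P x) \<le> N (cell k0 x) x"
      proof (rule infsum_ennreal_le)
        fix G assume G: "finite G" "G \<subseteq> S"
        have "(\<Sum>P\<in>G. avg h P * indicator P x) = (\<Sum>P\<in>{P\<in>G. x \<in> P}. avg h P * indicator P x)"
          using G(1) by (intro sum.mono_neutral_cong_right) auto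
        also have "\<dots> \<le> N (cell k0 x) x"
          unfolding N_def
        proof (rule sum_le_infsum_ennreal)
          \<comment> \<open>Members of S have level at least \<open>k0\<close>, so those through x
            lie in the cube of level \<open>k0\<close> at x, where the stopping process
            starts.\<close>
          show "{P\<in>G. x \<in> P} \<subseteq> {P\<in>S. P \<subseteq> cell k0 x}"
          proof safe
            fix P y assume P: "P \<in> G" "x \<in> P" and y: "y \<in> P"
            then have "P = cell (lev P) x" using cell_lev G S by auto
            moreover have "k0 \<le> lev P" using lev P G by auto
            ultimately show "y \<in> cell k0 x" using cell_mono[of k0 "lev P" x] y by auto
          qed (use G in auto)
        qed (use G in auto)
        finally show "(\<Sum>P\<in>G. avg h P * indicator P x) \<le> N (cell k0 x) x" .
      qed
      also note elim
      also have "(\<Sum>\<^sub>\<infinity>P\<in>F. (C * avg h P) * indicator P x) \<le> C * (\<Sum>\<^sub>\<infinity>P\<in>F. avg h P * indicator P x)"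
      proof (rule infsum_ennreal_le)
        fix G assume G: "finite G" "G \<subseteq> F"
        have "(\<Sum>P\<in>G. (C * avg h P) * indicator P x) = C * (\<Sum>P\<in>G. avg h P * indicator P x)"
          by (simp add: sum_distrib_left mult.assoc)
        also have "\<dots> \<le> C * (\<Sum>\<^sub>\<infinity>P\<in>F. avg h P * indicator P x)"
          by (intro mult_left_mono sum_le_infsum_ennreal G) auto
        finally show "(\<Sum>P\<in>G. (C * avg h P) * indicator P x) \<le> C * (\<Sum>\<^sub>\<infinity>P\<in>F. avg h P * indicator P x)" .
      qed
      finally show ?case by (simp add: C_def)
    qed
  qed
qed

end

subsection \<open>Disjoint major subsets of a sparse family\<close>

context grid begin

text \<open>Q minus its children keeps at least half of Q. Disjointness uses the lower bound on the
  levels: above any member strictly inside Q there is a maximal such member, which is a child of Q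
  and has been removed.\<close>

lemma sparse_disjoint_parts:
  assumes sp: "sparse_family D F" and lev: "\<And>Q. Q \<in> F \<Longrightarrow> k0 \<le> lev Q"
  obtains E where "\<And>Q. Q \<in> F \<Longrightarrow> E Q \<in> sets lebesgue" "\<And>Q. Q \<in> F \<Longrightarrow> E Q \<subseteq> Q"
    "\<And>Q. Q \<in> F \<Longrightarrow> emeasure lebesgue Q \<le> 2 * emeasure lebesgue (E Q)" "disjoint_family_on E F"
proof -
  define E where "E Q = Q - \<Union>(children F Q)" for Q
  have FD: "F \<subseteq> D" using sp by (simp add: sparse_family_def)
  have cc: "countable (children F Q)" "children F Q \<subseteq> sets lebesgue" for Q
  proof -
    have "children F Q \<subseteq> D" using FD by (auto simp: children_def)
    then show "countable (children F Q)" "children F Q \<subseteq> sets lebesgue"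
      using countable_D countable_subset D_sets by blast+
  qed
  have sU: "\<Union>(children F Q) \<in> sets lebesgue" for Q using cc by (rule sets.countable_Union)
  show ?thesis
  proof (rule that[of E])
    show "E Q \<in> sets lebesgue" if "Q \<in> F" for Q
      unfolding E_def using sU that FD D_sets by (intro sets.Diff) auto
    show "E Q \<subseteq> Q" for Q by (auto simp: E_def)
    show "emeasure lebesgue Q \<le> 2 * emeasure lebesgue (E Q)" if Q: "Q \<in> F" for Q
    proof -
      have QD: "Q \<in> D" using Q FD by auto
      obtain q where q: "emeasure lebesgue Q = ennreal q" "0 \<le> q"
        using emeasure_D[OF QD] by (cases "emeasure lebesgue Q") auto
      have "emeasure lebesgue (\<Union>(children F Q)) \<le> (\<Sum>\<^sub>\<infinity>P\<in>children F Q. emeasure lebesgue P)"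
      proof (rule emeasure_countable_Union_le[OF cc])
        fix G assume G: "finite G" "G \<subseteq> children F Q"
        have "emeasure lebesgue (\<Union>G) \<le> (\<Sum>P\<in>G. emeasure lebesgue P)"
          using emeasure_subadditive_finite[of G "\<lambda>P. P" lebesgue] G cc[of Q] by auto
        also have "\<dots> \<le> (\<Sum>\<^sub>\<infinity>P\<in>children F Q. emeasure lebesgue P)" by (rule sum_le_infsum_ennreal[OF G])
        finally show "emeasure lebesgue (\<Union>G) \<le> (\<Sum>\<^sub>\<infinity>P\<in>children F Q. emeasure lebesgue P)" .
      qed
      also have "\<dots> \<le> emeasure lebesgue Q / 2" using sp Q by (simp add: sparse_family_def)
      also have "\<dots> = ennreal (q / 2)" using q by (metis divide_ennreal ennreal_numeral zero_less_numeral)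
      finally have c: "emeasure lebesgue (\<Union>(children F Q)) \<le> ennreal (q / 2)" .
      have "emeasure lebesgue Q \<le> emeasure lebesgue (E Q \<union> \<Union>(children F Q))"
        using sU FD Q D_sets by (intro emeasure_mono sets.Un) (auto simp: E_def)
      also have "\<dots> \<le> emeasure lebesgue (E Q) + emeasure lebesgue (\<Union>(children F Q))"
        using sU FD Q D_sets by (intro emeasure_subadditive) (auto simp: E_def)
      also have "\<dots> \<le> emeasure lebesgue (E Q) + ennreal (q / 2)" using c by (rule add_left_mono)
      finally have m: "ennreal q \<le> emeasure lebesgue (E Q) + ennreal (q / 2)" using q by simp
      show ?thesis
      proof (cases "emeasure lebesgue (E Q)")
        case (real e)
        then have "q \<le> e + q / 2" using m q by (simp add: ennreal_plus[symmetric] del: ennreal_plus)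
        then have "q \<le> 2 * e" by simp
        then have "ennreal q \<le> ennreal (2 * e)" by (rule ennreal_leI)
        then show ?thesis using q real by (simp add: ennreal_mult)
      qed (simp add: ennreal_mult_top)
    qed
    show "disjoint_family_on E F"
      unfolding disjoint_family_on_def
    proof (intro ballI impI)
      have aux: "E P \<inter> Q = {}" if P: "P \<in> F" and Q: "Q \<in> F" and "Q \<subset> P" for P Q
      proof -
        define b where "b = {R\<in>F. R \<subset> P}"
        have bD: "b \<subseteq> D" using FD by (auto simp: b_def)
        have "\<exists>R\<in>maxi b. Q \<subseteq> R"
          by (rule ex_maxi[OF bD, of k0]) (use lev that in \<open>auto simp: b_def\<close>)
        then obtain R where R: "R \<in> maxi b" "Q \<subseteq> R" by auto
        then have "R \<in> children F P" by (auto simp: maxi_def b_def children_def)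
        then show ?thesis using R by (auto simp: E_def)
      qed
      fix P Q assume PQ: "P \<in> F" "Q \<in> F" "P \<noteq> Q"
      show "E P \<inter> E Q = {}"
      proof (rule ccontr)
        assume "E P \<inter> E Q \<noteq> {}"
        then obtain x where x: "x \<in> E P" "x \<in> E Q" by auto
        then have xx: "x \<in> P" "x \<in> Q" by (auto simp: E_def)
        then have "P \<subset> Q \<or> Q \<subset> P" using nested[of P Q x] PQ FD by auto
        then show False using aux[of P Q] aux[of Q P] PQ x xx by auto
      qed
    qed
  qed
qed

end

subsection \<open>The one-third trick\<close>

text \<open>The shift alternates in sign with the scale, because the shift of the finer scale has to be
  congruent to twice the shift of the coarser one modulo the integers.\<close>

definition shift :: "'a set \<Rightarrow> int \<Rightarrow> 'a \<Rightarrow> real" where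
  "shift A k b = (if b \<in> A then (if even k then 1/3 else - 1/3) else 0)"

text \<open>In the coordinates of A the lattice of side \<open>side k\<close> is translated by a
  third of its side, and \<open>idx\<close> numbers its intervals. Thus the subsets of the basis
  index the 2^d shifted grids.\<close>

definition idx :: "'a::euclidean_space set \<Rightarrow> int \<Rightarrow> 'a \<Rightarrow> 'a \<Rightarrow> int" where
  "idx A k x b = \<lfloor>(x \<bullet> b) / side k - shift A k b\<rfloor>"

definition scell :: "'a::euclidean_space set \<Rightarrow> int \<Rightarrow> 'a \<Rightarrow> 'a set" where
  "scell A k x = {y. \<forall>b\<in>Basis. idx A k y b = idx A k x b}"

definition sgrid :: "'a::euclidean_space set \<Rightarrow> 'a set set" where
  "sgrid A = {scell A k x | k x. True}"

lemma scell_cube: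
  fixes x :: "'a::euclidean_space" and A :: "'a set" and k :: int
  defines "a \<equiv> (\<Sum>b\<in>Basis. (side k * (of_int (idx A k x b) + shift A k b)) *\<^sub>R b)"
  shows "scell A k x = {y. \<forall>b\<in>Basis. a \<bullet> b \<le> y \<bullet> b \<and> y \<bullet> b < a \<bullet> b + side k}"
proof -
  have a: "a \<bullet> b = side k * (of_int (idx A k x b) + shift A k b)" if "b \<in> Basis" for b
    using that by (simp add: a_def inner_sum_left_Basis)
  have "idx A k y b = idx A k x b \<longleftrightarrow> a \<bullet> b \<le> y \<bullet> b \<and> y \<bullet> b < a \<bullet> b + side k" if b: "b \<in> Basis" for y b
  proof -
    have "idx A k y b = idx A k x b \<longleftrightarrow>
        of_int (idx A k x b) \<le> (y \<bullet> b) / side k - shift A k b \<and> (y \<bullet> b) / side k - shift A k b < of_int (idx A k x b) + 1"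
      unfolding idx_def[of A k y b] by (rule floor_eq_iff)
    also have "of_int (idx A k x b) \<le> (y \<bullet> b) / side k - shift A k b \<longleftrightarrow> a \<bullet> b \<le> y \<bullet> b"
      unfolding a[OF b] le_diff_eq pos_le_divide_eq[OF side_pos] by (simp add: mult.commute)
    also have "(y \<bullet> b) / side k - shift A k b < of_int (idx A k x b) + 1 \<longleftrightarrow> y \<bullet> b < a \<bullet> b + side k"
      unfolding a[OF b] diff_less_eq pos_divide_less_eq[OF side_pos] by (simp add: algebra_simps)
    finally show ?thesis .
  qed
  then show ?thesis by (auto simp: scell_def)
qed

lemma measure_scell:
  fixes x :: "'a::euclidean_space"
  shows "measure lebesgue (scell A k x) = side k ^ DIM('a)"
proof -
  define a where "a = (\<Sum>b\<in>Basis. (side k * (of_int (idx A k x b) + shift A k b)) *\<^sub>R b)"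
  have c: "scell A k x = {y. \<forall>b\<in>Basis. a \<bullet> b \<le> y \<bullet> b \<and> y \<bullet> b < a \<bullet> b + side k}"
    unfolding a_def by (rule scell_cube)
  have 1: "box a (a + side k *\<^sub>R One) \<subseteq> scell A k x" "scell A k x \<subseteq> cbox a (a + side k *\<^sub>R One)"
    unfolding c by (auto simp: box_def cbox_def inner_simps intro: less_imp_le)
  have m: "scell A k x \<in> sets lebesgue"
  proof -
    have "scell A k x = (\<Inter>b\<in>Basis. {y. a \<bullet> b \<le> y \<bullet> b} \<inter> {y. y \<bullet> b < a \<bullet> b + side k})"
      unfolding c by auto
    also have "\<dots> \<in> sets borel"
      by (intro sets.finite_INT finite_Basis) (auto simp: nonempty_Basis)
    finally show ?thesis by auto
  qed
  have "measure lebesgue (scell A k x) \<le> measure lebesgue (cbox a (a + side k *\<^sub>R One))"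
    using 1 m by (intro measure_mono_fmeasurable) auto
  moreover have "measure lebesgue (box a (a + side k *\<^sub>R One)) \<le> measure lebesgue (scell A k x)"
    using 1 m by (intro measure_mono_fmeasurable) (auto intro: fmeasurableI2[OF lmeasurable_cbox])
  moreover have "measure lebesgue (cbox a (a + side k *\<^sub>R One)) = side k ^ DIM('a)"
    by (subst measure_completion) (auto simp: content_cbox_plus)
  moreover have "measure lebesgue (box a (a + side k *\<^sub>R One)) = side k ^ DIM('a)"
    by (subst measure_completion) (auto simp: measure_lborel_box_eq inner_simps)
  ultimately show ?thesis by linarith
qed

text \<open>\<open>cubes_at\<close> selects cubes by volume, and the volume of a shifted cube
  determines its level.\<close>

lemma cubes_at_sgrid:
  fixes A :: "'a::euclidean_space set"
  shows "cubes_at (sgrid A) k = range (scell A k)"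
proof -
  have pw: "2 powi (- j * int DIM('a)) = side j ^ DIM('a)" for j
  proof -
    have "2 powi (- j * int DIM('a)) = (2 powi (- j) :: real) powi int DIM('a)" by (rule power_int_mult)
    then show ?thesis by (simp only: power_int_of_nat side_def)
  qed
  have "side j ^ DIM('a) = side k ^ DIM('a) \<longleftrightarrow> j = k" for j
    by (metis DIM_positive power_eq_iff_eq_base side_eq_iff side_nonneg)
  then show ?thesis
    unfolding cubes_at_def sgrid_def pw by (auto simp: measure_scell)
qed

text \<open>Three times the shift is an integer c. The finer index minus c, halved and rounded down,
  is the coarser index, which the finer one therefore determines.\<close>

lemma idx_coarser:
  fixes x y :: "'a::euclidean_space"
  assumes "idx A (k + 1) y b = idx A (k + 1) x b"
  shows "idx A k y b = idx A k x b"
proof -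
  define c :: int where "c = (if b \<in> A then (if even k then 1 else -1) else 0)"
  have c: "3 * shift A k b = of_int c" "shift A (k + 1) b = - shift A k b"
    by (auto simp: shift_def c_def)
  have half: "\<lfloor>u\<rfloor> = \<lfloor>2 * u\<rfloor> div 2" for u :: real
  proof -
    have "\<lfloor>2 * u / of_int 2\<rfloor> = \<lfloor>2 * u\<rfloor> div 2" by (rule floor_divide_real_eq_div) simp
    then show ?thesis by simp
  qed
  have "idx A k z b = (idx A (k + 1) z b - c) div 2" for z
  proof -
    have "(z \<bullet> b) / side (k + 1) - shift A (k + 1) b = 2 * ((z \<bullet> b) / side k - shift A k b) + of_int c"
      using c by (simp add: side_Suc)
    then have "idx A (k + 1) z b = \<lfloor>2 * ((z \<bullet> b) / side k - shift A k b)\<rfloor> + c"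
      unfolding idx_def by simp
    then show ?thesis unfolding idx_def[of A k] by (subst half) simp
  qed
  with assms show ?thesis by simp
qed

lemma dyadic_sgrid: "dyadic_grid (sgrid (A :: 'a::euclidean_space set))"
  unfolding dyadic_grid_def
proof (intro conjI ballI allI)
  have part: "partition_on UNIV (range (scell A k))" for k
    unfolding partition_on_def disjoint_def by (auto simp: scell_def)
  show "partition_on UNIV (cubes_at (sgrid A) k)" for k
    unfolding cubes_at_sgrid by (rule part)
  show "refines UNIV (cubes_at (sgrid A) (k + 1)) (cubes_at (sgrid A) k)" for k
    unfolding cubes_at_sgrid refines_def
  proof (intro conjI part ballI)
    fix X assume "X \<in> range (scell A (k + 1))"
    then obtain x where X: "X = scell A (k + 1) x" by auto
    have "X \<subseteq> scell A k x" unfolding X scell_def using idx_coarser by blast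
    then show "\<exists>Y\<in>range (scell A k). X \<subseteq> Y" by auto
  qed
  show "sgrid A = (\<Union>k. cubes_at (sgrid A) k)"
    unfolding cubes_at_sgrid by (auto simp: sgrid_def)
  show "cube Q" if "Q \<in> sgrid A" for Q
  proof -
    obtain k x where "Q = scell A k x" using \<open>Q \<in> sgrid A\<close> by (auto simp: sgrid_def)
    then show ?thesis unfolding cube_def using scell_cube[of A k x] side_pos[of k] by blast
  qed
qed

lemma sgrid_cell: "grid.cell (sgrid A) k x = scell A k x" for A :: "'a::euclidean_space set"
proof -
  interpret grid "sgrid A" by unfold_locales (rule dyadic_sgrid)
  show ?thesis by (rule cell_eq[symmetric]) (auto simp: cubes_at_sgrid scell_def)
qed

lemma floor_third:
  fixes w :: real
  shows "\<bar>w - of_int n\<bar> < 1/3 \<Longrightarrow> \<lfloor>w - 1/3\<rfloor> = n - 1"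
    and "\<bar>w - of_int n\<bar> < 1/3 \<Longrightarrow> \<lfloor>w - - 1/3\<rfloor> = n"
    and "\<bar>w\<bar> < 1/3 \<Longrightarrow> \<lfloor>w - 1/3\<rfloor> = -1"
    and "\<bar>w\<bar> < 1/3 \<Longrightarrow> \<lfloor>w - - 1/3\<rfloor> = 0"
  by linarith+

text \<open>Origin of the factor 6: in a coordinate where the lattice cuts the ball, x is within a
  sixth of the side of a lattice hyperplane, hence all points of the ball are within a third of the
  side of it. After a shift by a third, in either direction, no hyperplane of the lattice separates
  them.\<close>

lemma ball_in_scell:
  fixes x :: "'a::euclidean_space"
  assumes r: "6 * r \<le> side k"
  shows "\<exists>A. A \<subseteq> Basis \<and> ball x r \<subseteq> scell A k x"
proof -
  \<comment> \<open>Shift exactly the coordinates in which the unshifted lattice cuts the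
    ball.\<close>
  define A where "A = {b\<in>Basis. \<exists>y\<in>ball x r. \<lfloor>(y \<bullet> b) / side k\<rfloor> \<noteq> \<lfloor>(x \<bullet> b) / side k\<rfloor>}"
  have small: "\<bar>(x \<bullet> b) / side k - (y \<bullet> b) / side k\<bar> < r / side k" if "y \<in> ball x r" "b \<in> Basis" for y b
  proof -
    have "\<bar>(x - y) \<bullet> b\<bar> \<le> norm (x - y)" using that(2) by (rule Basis_le_norm)
    also have "\<dots> < r" using that(1) by (simp add: dist_norm)
    finally have "\<bar>(x - y) \<bullet> b\<bar> / side k < r / side k" by (simp add: divide_strict_right_mono)
    moreover have "(x \<bullet> b) / side k - (y \<bullet> b) / side k = ((x - y) \<bullet> b) / side k"
      by (simp add: inner_diff_left diff_divide_distrib)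
    ultimately show ?thesis by simp
  qed
  have rs: "r / side k \<le> 1/6" using r by (simp add: pos_divide_le_eq)
  have "ball x r \<subseteq> scell A k x"
    unfolding scell_def
  proof safe
    fix y b assume y: "y \<in> ball x r" and b: "b \<in> (Basis :: 'a set)"
    show "idx A k y b = idx A k x b"
    proof (cases "b \<in> A")
      case False
      then show ?thesis using y b by (auto simp: A_def idx_def shift_def)
    next
      case True
      then obtain z where z: "z \<in> ball x r" "\<lfloor>(z \<bullet> b) / side k\<rfloor> \<noteq> \<lfloor>(x \<bullet> b) / side k\<rfloor>" by (auto simp: A_def)
      obtain n :: int where n: "\<bar>(x \<bullet> b) / side k - of_int n\<bar> < r / side k"
      proof (cases "\<lfloor>(z \<bullet> b) / side k\<rfloor> < \<lfloor>(x \<bullet> b) / side k\<rfloor>")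
        case True
        then have "(z \<bullet> b) / side k < of_int \<lfloor>(x \<bullet> b) / side k\<rfloor>" by linarith
        then show ?thesis using small[OF z(1) b] by (intro that[of "\<lfloor>(x \<bullet> b) / side k\<rfloor>"]) linarith
      next
        case False
        then have "\<lfloor>(x \<bullet> b) / side k\<rfloor> < \<lfloor>(z \<bullet> b) / side k\<rfloor>" using z(2) by linarith
        then have "(x \<bullet> b) / side k < of_int \<lfloor>(z \<bullet> b) / side k\<rfloor>" by linarith
        then show ?thesis using small[OF z(1) b] by (intro that[of "\<lfloor>(z \<bullet> b) / side k\<rfloor>"]) linarith
      qed
      show ?thesis
      proof (cases "even k")
        case True
        then have s: "shift A k b = 1/3" using \<open>b \<in> A\<close> by (simp add: shift_def)
        have "idx A k x b = n - 1" unfolding idx_def s using n rs by (intro floor_third) linarith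
        moreover have "idx A k y b = n - 1" unfolding idx_def s using n rs small[OF y b] by (intro floor_third) linarith
        ultimately show ?thesis by simp
      next
        case False
        then have s: "shift A k b = - 1/3" using \<open>b \<in> A\<close> by (simp add: shift_def)
        have "idx A k x b = n" unfolding idx_def s using n rs by (intro floor_third) linarith
        moreover have "idx A k y b = n" unfolding idx_def s using n rs small[OF y b] by (intro floor_third) linarith
        ultimately show ?thesis by simp
      qed
    qed
  qed
  moreover have "A \<subseteq> Basis" by (auto simp: A_def)
  ultimately show ?thesis by blast
qed

text \<open>In the unshifted grid the origin is a corner at every scale. With all coordinates
  shifted it stays at least a third of a side away from every face, so the cubes around the origin
  exhaust the space.\<close>

lemma ball_in_chain:
  fixes r :: real
  assumes r: "3 * r \<le> side k"
  shows "ball (0::'a::euclidean_space) r \<subseteq> scell Basis k 0"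
  unfolding scell_def
proof safe
  fix y b :: 'a assume y: "y \<in> ball 0 r" and b: "b \<in> Basis"
  have "\<bar>y \<bullet> b\<bar> \<le> norm y" using b by (rule Basis_le_norm)
  also have "\<dots> < r" using y by (simp add: dist_norm)
  finally have "\<bar>y \<bullet> b\<bar> / side k < r / side k" by (simp add: divide_strict_right_mono)
  moreover have "r / side k \<le> 1/3" using r by (simp add: pos_divide_le_eq)
  ultimately have "\<bar>y \<bullet> b\<bar> / side k < 1/3" by (rule less_le_trans)
  then have s: "\<bar>(y \<bullet> b) / side k\<bar> < 1/3" by (simp add: abs_divide)
  show "idx Basis k y b = idx Basis k 0 b"
  proof (cases "even k")
    case True
    then have sh: "shift Basis k b = 1/3" using b by (simp add: shift_def)
    have "idx Basis k y b = -1" unfolding idx_def sh using s by (intro floor_third) simp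
    moreover have "idx Basis k 0 b = -1" unfolding idx_def sh by (intro floor_third) simp
    ultimately show ?thesis by simp
  next
    case False
    then have sh: "shift Basis k b = - 1/3" using b by (simp add: shift_def)
    have "idx Basis k y b = 0" unfolding idx_def sh using s by (intro floor_third) simp
    moreover have "idx Basis k 0 b = 0" unfolding idx_def sh by (intro floor_third) simp
    ultimately show ?thesis by simp
  qed
qed

subsection \<open>Pointwise bounds for the maximal function and the maximal truncations\<close>

definition mass :: "('a::euclidean_space \<Rightarrow> complex) \<Rightarrow> 'a set \<Rightarrow> ennreal" where
  "mass f A = (\<integral>\<^sup>+y\<in>A. ennreal (norm (f y)) \<partial>lebesgue)"

text \<open>The centred Hardy-Littlewood maximal function at x is at most t, normalised by r^d in
  place of the volume of the ball.\<close>

definition max_le :: "('a::euclidean_space \<Rightarrow> complex) \<Rightarrow> 'a \<Rightarrow> real \<Rightarrow> bool" where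
  "max_le f x t \<longleftrightarrow> (\<forall>r>0. mass f (ball x r) \<le> ennreal (t * r ^ DIM('a)))"

definition trunc :: "('a::euclidean_space \<Rightarrow> 'a \<Rightarrow> complex) \<Rightarrow> real \<Rightarrow> ('a \<Rightarrow> complex) \<Rightarrow> 'a \<Rightarrow> complex" where
  "trunc K \<delta> f x = (LINT y:{y. \<delta> < dist x y}|lebesgue. K x y * f y)"

definition trunc_le :: "('a::euclidean_space \<Rightarrow> 'a \<Rightarrow> complex) \<Rightarrow> ('a \<Rightarrow> complex) \<Rightarrow> 'a \<Rightarrow> real \<Rightarrow> bool" where
  "trunc_le K f x t \<longleftrightarrow> (\<forall>\<delta>>0. norm (trunc K \<delta> f x) \<le> t)"

definition res :: "'a set \<Rightarrow> ('a \<Rightarrow> complex) \<Rightarrow> 'a \<Rightarrow> complex" where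
  "res A f = (\<lambda>y. if y \<in> A then f y else 0)"

lemma res_apply: "res A f y = indicator A y *\<^sub>R f y"
  by (simp add: res_def)

lemma res_measurable [measurable (raw)]:
  "f \<in> borel_measurable M \<Longrightarrow> A \<in> sets M \<Longrightarrow> res A f \<in> borel_measurable M"
  unfolding res_apply[abs_def] by (rule borel_measurable_scaleR) auto

lemma res_integrable: "integrable lebesgue f \<Longrightarrow> A \<in> sets lebesgue \<Longrightarrow> integrable lebesgue (res A f)"
  unfolding res_apply[abs_def] by (rule integrable_mult_indicator)

lemma mass_mono: "A \<subseteq> B \<Longrightarrow> mass f A \<le> mass f B"
  unfolding mass_def by (rule nn_integral_mono) (auto simp: indicator_def)

lemma mass_res: "mass (res A f) B = mass f (A \<inter> B)"
  unfolding mass_def by (rule nn_integral_cong) (auto simp: indicator_def res_def)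

lemma mass_UNIV: "mass f UNIV = (\<integral>\<^sup>+y. ennreal (norm (f y)) \<partial>lebesgue)"
  by (simp add: mass_def)

lemma mass_integrable: "integrable lebesgue f \<Longrightarrow> mass f UNIV = ennreal (\<integral>y. norm (f y) \<partial>lebesgue)"
  unfolding mass_UNIV by (rule nn_integral_eq_integral) auto

lemma mass_finite: "integrable lebesgue f \<Longrightarrow> mass f A < \<infinity>"
  using mass_mono[of A UNIV f] mass_integrable[of f] by (simp add: le_less_trans)

lemma mass_real: "integrable lebesgue f \<Longrightarrow> mass f A = ennreal (enn2real (mass f A))"
  using mass_finite[of f A] by simp

lemma lebesgue_ball [simp, intro]: "ball x r \<in> sets lebesgue" for x :: "'a::euclidean_space"
  by auto

lemma emeasure_lebesgue_ball:
  fixes x :: "'a::euclidean_space"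
  assumes "0 \<le> r"
  shows "emeasure lebesgue (ball x r) = ennreal (unit_ball_vol (real DIM('a)) * r ^ DIM('a))"
  using emeasure_ball[OF assms, of x] by (simp add: emeasure_completion)

lemma max_le_one: "max_le (\<lambda>_. 1) (x::'a::euclidean_space) (unit_ball_vol (real DIM('a)))"
  unfolding max_le_def mass_def by (auto simp: emeasure_lebesgue_ball)

lemma mass_bounded_ball:
  fixes x :: "'a::euclidean_space"
  assumes "max_le f x t" "0 < r" "A \<subseteq> ball x r"
  shows "mass f A \<le> ennreal (t * r ^ DIM('a))"
  using mass_mono[OF assms(3)] assms(1,2) unfolding max_le_def by (meson order_trans)

text \<open>Cubes on which an integrable function has a large average have bounded volume; this
  turns the volume bound into the lower bound on levels that maximal cubes require.\<close>

lemma ex_level_bound: "\<exists>k0. \<forall>k. side k ^ DIM('a::euclidean_space) \<le> R \<longrightarrow> k0 \<le> k"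
proof -
  obtain j where j: "side j \<le> max 1 R" "max 1 R < 2 * side j" by (rule ex_side[of "max 1 R"]) auto
  have "j - 1 \<le> k" if "side k ^ DIM('a) \<le> R" for k
  proof -
    have "side k \<le> max 1 R"
    proof (cases "side k \<le> 1")
      case False
      then have "side k ^ 1 \<le> side k ^ DIM('a)" by (intro power_increasing) (auto simp: DIM_positive Suc_leI)
      then show ?thesis using that by simp
    qed simp
    then have "side k < 2 * side j" using j(2) by (rule le_less_trans)
    then have "side k < 2 ^ 1 * side j" by simp
    then have "side k < side (j - int 1)" by (simp only: side_diff)
    then show ?thesis by simp
  qed
  then show ?thesis by blast
qed

text \<open>A ball of radius r lies in a cube of side between 6 r and 12 r of one of the 2^d shifted
  grids, so too much mass on the ball forces that cube to have density above t / 12^d. The dyadic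
  weak type bounds of the grids add up to the factor 2^d * 12^d = 24^d.\<close>

lemma weak_max:
  fixes f :: "'a::euclidean_space \<Rightarrow> complex"
  assumes f: "f \<in> borel_measurable lebesgue" and n: "mass f UNIV \<le> ennreal n" "0 \<le> n" and t: "0 < t"
  shows "\<exists>E\<in>sets lebesgue. emeasure lebesgue E \<le> ennreal (24 ^ DIM('a) * n / t) \<and> (\<forall>x. x \<notin> E \<longrightarrow> max_le f x t)"
proof -
  define c where "c = t / 12 ^ DIM('a)"
  have c: "c > 0" using t by (simp add: c_def)
  define G where "G A = {Q \<in> sgrid A. ennreal c * emeasure lebesgue Q \<le> mass f Q}" for A :: "'a set"
  define E where "E = (\<Union>A\<in>Pow Basis. \<Union>(G A))"
  have one: "\<Union>(G A) \<in> sets lebesgue \<and> emeasure lebesgue (\<Union>(G A)) \<le> ennreal (12 ^ DIM('a) * n / t)" for A :: "'a set"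
  proof -
    interpret grid "sgrid A" by unfold_locales (rule dyadic_sgrid)
    have GD: "G A \<subseteq> sgrid A" by (auto simp: G_def)
    have s: "\<Union>(G A) \<in> sets lebesgue"
      using GD countable_subset[OF GD countable_D] D_sets by (intro sets.countable_Union) auto
    obtain k0 where k0: "\<And>k. side k ^ DIM('a) \<le> n / c \<Longrightarrow> k0 \<le> k" using ex_level_bound by blast
    have "ennreal c * emeasure lebesgue (\<Union>(G A)) \<le> (\<integral>\<^sup>+y\<in>UNIV. ennreal (norm (f y)) \<partial>lebesgue)"
    proof (rule dyadic_maximal[OF c GD, where ?k0.0 = k0])
      fix Q assume Q: "Q \<in> G A"
      then have QD: "Q \<in> sgrid A" using GD by auto
      show "ennreal c * emeasure lebesgue Q \<le> (\<integral>\<^sup>+y\<in>Q. ennreal (norm (f y)) \<partial>lebesgue)"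
        using Q by (simp add: G_def mass_def)
      have "ennreal (c * side (lev Q) ^ DIM('a)) = ennreal c * emeasure lebesgue Q"
        using c by (simp add: emeasure_lev[OF QD] ennreal_mult)
      also have "\<dots> \<le> mass f Q" using Q by (simp add: G_def)
      also have "\<dots> \<le> ennreal n" using mass_mono[of Q UNIV f] n by simp
      finally have "c * side (lev Q) ^ DIM('a) \<le> n" using n by simp
      then show "k0 \<le> lev Q" using c by (intro k0) (simp add: pos_le_divide_eq mult.commute)
    qed (use f in auto)
    also have "\<dots> \<le> ennreal n" using n by (simp add: mass_UNIV)
    finally have *: "ennreal c * emeasure lebesgue (\<Union>(G A)) \<le> ennreal n" .
    have "emeasure lebesgue (\<Union>(G A)) = (ennreal c * emeasure lebesgue (\<Union>(G A))) / ennreal c"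
      using c by (simp add: mult.commute[of "ennreal c"] ennreal_mult_divide_eq)
    also have "\<dots> \<le> ennreal n / ennreal c" using * by (rule divide_right_mono_ennreal)
    also have "\<dots> = ennreal (12 ^ DIM('a) * n / t)" using c n by (simp add: divide_ennreal c_def mult.commute)
    finally show ?thesis using s by simp
  qed
  show ?thesis
  proof (intro bexI[of _ E] conjI allI impI)
    show "E \<in> sets lebesgue" unfolding E_def using one by (intro sets.finite_UN) auto
    have "emeasure lebesgue E \<le> (\<Sum>A\<in>Pow (Basis :: 'a set). emeasure lebesgue (\<Union>(G A)))"
      unfolding E_def using one by (intro emeasure_subadditive_finite) auto
    also have "\<dots> \<le> (\<Sum>A\<in>Pow (Basis :: 'a set). ennreal (12 ^ DIM('a) * n / t))"
      using one by (intro sum_mono) auto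
    also have "\<dots> = of_nat (2 ^ DIM('a)) * ennreal (12 ^ DIM('a) * n / t)"
      by (simp add: card_Pow)
    also have "\<dots> = ennreal (2 ^ DIM('a) * (12 ^ DIM('a) * n / t))"
      using n t by (subst ennreal_mult) (auto simp: ennreal_of_nat_eq_real_of_nat)
    also have "2 ^ DIM('a) * (12 ^ DIM('a) * n / t) = 24 ^ DIM('a) * n / t"
      by (simp add: power_mult_distrib[symmetric] mult.assoc[symmetric])
    finally show "emeasure lebesgue E \<le> ennreal (24 ^ DIM('a) * n / t)" .
    fix x assume x: "x \<notin> E"
    show "max_le f x t" unfolding max_le_def
    proof (intro allI impI)
      fix r :: real assume r: "r > 0"
      obtain j where j: "side j \<le> 6 * r" "6 * r < 2 * side j" by (rule ex_side[of "6 * r"]) (use r in auto)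
      define k where "k = j - 1"
      have k: "6 * r \<le> side k" "side k \<le> 12 * r" using j side_Suc[of k] by (auto simp: k_def)
      obtain A :: "'a set" where A: "A \<subseteq> Basis" "ball x r \<subseteq> scell A k x" using ball_in_scell[OF k(1)] by blast
      interpret grid "sgrid A" by unfold_locales (rule dyadic_sgrid)
      have sc: "scell A k x = cell k x" by (simp add: sgrid_cell)
      have "cell k x \<notin> G A" using x A(1) cell_mem(2)[of x k] by (auto simp: E_def)
      then have less: "mass f (cell k x) \<le> ennreal c * emeasure lebesgue (cell k x)"
        by (auto simp: G_def not_le)
      have "mass f (ball x r) \<le> mass f (cell k x)" using A(2) by (intro mass_mono) (simp add: sc)
      also note less
      also have "ennreal c * emeasure lebesgue (cell k x) = ennreal (c * side k ^ DIM('a))"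
        using c by (simp add: emeasure_cell ennreal_mult)
      also have "\<dots> \<le> ennreal (c * (12 * r) ^ DIM('a))"
        using k c by (intro ennreal_leI mult_left_mono power_mono) auto
      also have "c * (12 * r) ^ DIM('a) = t * r ^ DIM('a)"
        by (simp add: c_def power_mult_distrib)
      finally show "mass f (ball x r) \<le> ennreal (t * r ^ DIM('a))" .
    qed
  qed
qed

subsection \<open>Regular kernels\<close>

text \<open>On the interval from 2^-(k+1) to 2^-k the integrand is at least \<omega>(2^-(k+1)) /
  2^-k by monotonicity, and the length 2^-(k+1) leaves half of \<omega>(2^-(k+1)).\<close>

lemma dini_summable:
  assumes om: "modulus_of_continuity \<omega>" and dini: "dini \<omega>"
  shows "summable (\<lambda>k. \<omega> ((1/2) ^ k))"
proof -
  have nn: "\<And>t. 0 \<le> t \<Longrightarrow> 0 \<le> \<omega> t" and mono: "\<And>s t. 0 \<le> s \<Longrightarrow> s \<le> t \<Longrightarrow> \<omega> s \<le> \<omega> t"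
    using om by (auto simp: modulus_of_continuity_def mono_on_def)
  define c where "c k = \<omega> ((1/2) ^ Suc k) / (1/2) ^ k" for k
  have c0: "0 \<le> c k" for k using nn by (simp add: c_def)
  have "(\<Sum>k. ennreal (\<omega> ((1/2) ^ Suc k) / 2)) = (\<Sum>k. \<integral>\<^sup>+(t::real). ennreal (c k) * indicator {(1/2)^Suc k<..(1/2)^k} t \<partial>lborel)"
  proof (rule suminf_cong)
    fix k
    have "(1/2::real) ^ Suc k \<le> (1/2) ^ k" by simp
    then have "emeasure lborel {(1/2::real)^Suc k<..(1/2)^k} = ennreal ((1/2)^k - (1/2) ^ Suc k)"
      by (rule emeasure_lborel_Ioc)
    then have "(\<integral>\<^sup>+(t::real). ennreal (c k) * indicator {(1/2)^Suc k<..(1/2)^k} t \<partial>lborel) = ennreal (c k) * ennreal ((1/2)^k - (1/2) ^ Suc k)"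
      by (simp add: nn_integral_cmult_indicator)
    also have "\<dots> = ennreal (c k * ((1/2)^k - (1/2) ^ Suc k))" by (rule ennreal_mult'[symmetric]) (rule c0)
    also have "c k * ((1/2)^k - (1/2) ^ Suc k) = \<omega> ((1/2) ^ Suc k) / 2" by (simp add: c_def)
    finally show "ennreal (\<omega> ((1/2) ^ Suc k) / 2) = (\<integral>\<^sup>+(t::real). ennreal (c k) * indicator {(1/2)^Suc k<..(1/2)^k} t \<partial>lborel)" by simp
  qed
  also have "\<dots> = (\<integral>\<^sup>+(t::real). (\<Sum>k. ennreal (c k) * indicator {(1/2)^Suc k<..(1/2)^k} t) \<partial>lborel)"
    by (rule nn_integral_suminf[symmetric]) auto
  also have "\<dots> \<le> (\<integral>\<^sup>+t\<in>{0<..1}. ennreal (\<omega> t / t) \<partial>lborel)"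
  proof (rule nn_integral_mono)
    fix t :: real
    show "(\<Sum>k. ennreal (c k) * indicator {(1/2)^Suc k<..(1/2)^k} t) \<le> ennreal (\<omega> t / t) * indicator {0<..1} t"
    proof (cases "\<exists>k. t \<in> {(1/2)^Suc k<..(1/2)^k}")
      case False
      then have "(\<Sum>k. ennreal (c k) * indicator {(1/2)^Suc k<..(1/2)^k} t) = (\<Sum>k. 0)"
        by (intro suminf_cong) auto
      then show ?thesis by simp
    next
      case True
      then obtain k where k: "(1/2)^Suc k < t" "t \<le> (1/2)^k" by auto
      have t: "0 < t" "t \<le> 1"
      proof -
        have "0 < (1/2::real)^Suc k" by simp
        then show "0 < t" using k(1) by linarith
        have "(1/2::real)^k \<le> 1" by (simp add: power_le_one)
        then show "t \<le> 1" using k(2) by linarith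
      qed
      have uniq: "t \<notin> {(1/2)^Suc j<..(1/2)^j}" if "j \<noteq> k" for j
      proof (cases "j < k")
        case True
        then have "(1/2::real)^k \<le> (1/2)^Suc j" by (intro power_decreasing) auto
        then show ?thesis using k by auto
      next
        case False
        then have "(1/2::real)^j \<le> (1/2)^Suc k" using that by (intro power_decreasing) auto
        then show ?thesis using k by auto
      qed
      define g where "g = (\<lambda>j. ennreal (c j) * indicator {(1/2)^Suc j<..(1/2)^j} t)"
      have "suminf g = sum g {k}"
        by (rule suminf_finite) (use uniq in \<open>auto simp: g_def\<close>)
      also have "\<dots> = g k" by simp
      also have "\<dots> \<le> ennreal (c k)" unfolding g_def by (simp add: indicator_def)
      also have "\<dots> \<le> ennreal (\<omega> t / t)"
        unfolding c_def using k t nn[of t] by (intro ennreal_leI frac_le mono) auto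
      finally show ?thesis using t by (simp add: g_def)
    qed
  qed
  also have "\<dots> < \<infinity>" using dini by (simp add: dini_def)
  finally have "(\<Sum>k. ennreal (\<omega> ((1/2) ^ Suc k) / 2)) \<noteq> top" by simp
  then have "summable (\<lambda>k. \<omega> ((1/2) ^ Suc k) / 2)"
    by (intro summable_suminf_not_top) (use nn in auto)
  then have "summable (\<lambda>k. \<omega> ((1/2) ^ Suc k))" using summable_mult[of "\<lambda>k. \<omega> ((1/2) ^ Suc k) / 2" 2] by simp
  then show ?thesis by (subst summable_Suc_iff[symmetric])
qed

text \<open>Split the far region into annuli of radii 2^j \<rho>. There the kernel difference is at
  most \<omega>(2^-j) / (2^j \<rho>)^d and f has mass at most t (2^(j+1) \<rho>)^d, so the Dini sum
  remains. Regularity is assumed in one variable only, so that the transposed kernel can be treated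
  with f = 1.\<close>

lemma kernel_tail:
  fixes K :: "'a::euclidean_space \<Rightarrow> 'a \<Rightarrow> complex"
  assumes om: "modulus_of_continuity \<omega>" and sum: "summable (\<lambda>k. \<omega> ((1/2) ^ k))"
    and reg: "kernel_regularity \<omega> K" and f: "f \<in> borel_measurable lebesgue"
    and xz: "dist z x \<le> \<rho>" "0 < \<rho>" and M: "max_le f z t" "0 \<le> t"
  shows "(\<integral>\<^sup>+y\<in>{y. 2 * \<rho> \<le> dist z y}. ennreal (norm (K z y - K x y)) * ennreal (norm (f y)) \<partial>lebesgue)
    \<le> ennreal (2 ^ DIM('a) * (\<Sum>k. \<omega> ((1/2) ^ k)) * t)"
proof -
  have nn: "\<And>t. 0 \<le> t \<Longrightarrow> 0 \<le> \<omega> t" and mono: "\<And>s t. 0 \<le> s \<Longrightarrow> s \<le> t \<Longrightarrow> \<omega> s \<le> \<omega> t"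
    using om by (auto simp: modulus_of_continuity_def mono_on_def)
  define c where "c k = \<omega> ((1/2) ^ k) / (2 ^ k * \<rho>) ^ DIM('a)" for k
  have c0: "0 \<le> c k" for k using nn xz by (simp add: c_def)
  have "(\<integral>\<^sup>+y\<in>{y. 2 * \<rho> \<le> dist z y}. ennreal (norm (K z y - K x y)) * ennreal (norm (f y)) \<partial>lebesgue)
      \<le> (\<integral>\<^sup>+y. (\<Sum>k. ennreal (c k) * (ennreal (norm (f y)) * indicator (ball z (2 ^ Suc k * \<rho>)) y)) \<partial>lebesgue)"
  proof (rule nn_integral_mono)
    fix y
    show "ennreal (norm (K z y - K x y)) * ennreal (norm (f y)) * indicator {y. 2 * \<rho> \<le> dist z y} y
      \<le> (\<Sum>k. ennreal (c k) * (ennreal (norm (f y)) * indicator (ball z (2 ^ Suc k * \<rho>)) y))"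
    proof (cases "2 * \<rho> \<le> dist z y")
      case True
      define D where "D = dist z y"
      have D: "2 * \<rho> \<le> D" "0 < D" using True xz by (auto simp: D_def)
      \<comment> \<open>The least k with D < 2^k \<rho> is positive, and its predecessor j is the
        index of the annulus that contains y.\<close>
      have "\<exists>k::nat. D < 2 ^ k * \<rho>"
        using real_arch_pow[of 2 "D / \<rho>"] xz by (auto simp: pos_divide_less_eq)
      then obtain k where k: "D < 2 ^ k * \<rho>" and kmin: "\<And>j. j < k \<Longrightarrow> \<not> D < 2 ^ j * \<rho>"
        using exists_least_iff[of "\<lambda>k. D < 2 ^ k * \<rho>"] by blast
      have "k \<noteq> 0"
      proof
        assume "k = 0"
        then have "D < \<rho>" using k by simp
        then show False using D xz by simp
      qed
      then obtain j where j: "k = Suc j" by (cases k) auto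
      then have lo: "2 ^ j * \<rho> \<le> D" using kmin[of j] by simp
      have "norm (K z y - K x y) \<le> \<omega> (dist z x / D) * (1 / D ^ DIM('a))"
        using reg D xz unfolding kernel_regularity_def D_def by auto
      also have "\<dots> \<le> c j"
      proof -
        have "dist z x / D \<le> \<rho> / (2 ^ j * \<rho>)"
          using lo xz D by (intro frac_le) auto
        also have "\<dots> = (1/2) ^ j" using xz by (simp add: power_one_over)
        finally have w: "\<omega> (dist z x / D) \<le> \<omega> ((1/2) ^ j)" using D by (intro mono) auto
        have "(2 ^ j * \<rho>) ^ DIM('a) \<le> D ^ DIM('a)" using lo xz by (intro power_mono) auto
        then have "1 / D ^ DIM('a) \<le> 1 / (2 ^ j * \<rho>) ^ DIM('a)" using xz D by (intro divide_left_mono) auto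
        then have "\<omega> (dist z x / D) * (1 / D ^ DIM('a)) \<le> \<omega> ((1/2) ^ j) * (1 / (2 ^ j * \<rho>) ^ DIM('a))"
          using w nn D by (intro mult_mono) auto
        then show ?thesis by (simp add: c_def)
      qed
      finally have "ennreal (norm (K z y - K x y)) \<le> ennreal (c j)" by (rule ennreal_leI)
      then have "ennreal (norm (K z y - K x y)) * ennreal (norm (f y)) * indicator {y. 2 * \<rho> \<le> dist z y} y
        \<le> ennreal (c j) * (ennreal (norm (f y)) * indicator (ball z (2 ^ Suc j * \<rho>)) y)"
        using k j True by (auto simp: D_def intro: mult_right_mono)
      also have "\<dots> = (\<Sum>k\<in>{j}. ennreal (c k) * (ennreal (norm (f y)) * indicator (ball z (2 ^ Suc k * \<rho>)) y))" by simp
      also have "\<dots> \<le> (\<Sum>k. ennreal (c k) * (ennreal (norm (f y)) * indicator (ball z (2 ^ Suc k * \<rho>)) y))"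
        by (rule sum_le_suminf) auto
      finally show ?thesis .
    qed simp
  qed
  also have "\<dots> = (\<Sum>k. \<integral>\<^sup>+y. ennreal (c k) * (ennreal (norm (f y)) * indicator (ball z (2 ^ Suc k * \<rho>)) y) \<partial>lebesgue)"
  proof (rule nn_integral_suminf)
    fix k
    have [measurable]: "f \<in> borel_measurable lebesgue" "ball z (2 ^ Suc k * \<rho>) \<in> sets lebesgue" using f by auto
    show "(\<lambda>y. ennreal (c k) * (ennreal (norm (f y)) * indicator (ball z (2 ^ Suc k * \<rho>)) y)) \<in> borel_measurable lebesgue"
      by measurable
  qed
  also have "\<dots> = (\<Sum>k. ennreal (c k) * mass f (ball z (2 ^ Suc k * \<rho>)))"
    unfolding mass_def
  proof (intro suminf_cong nn_integral_cmult)
    fix k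
    have [measurable]: "f \<in> borel_measurable lebesgue" "ball z (2 ^ Suc k * \<rho>) \<in> sets lebesgue" using f by auto
    show "(\<lambda>y. ennreal (norm (f y)) * indicator (ball z (2 ^ Suc k * \<rho>)) y) \<in> borel_measurable lebesgue"
      by measurable
  qed
  also have "\<dots> \<le> (\<Sum>k. ennreal (2 ^ DIM('a) * t * \<omega> ((1/2) ^ k)))"
  proof (rule suminf_le)
    fix k
    have "ennreal (c k) * mass f (ball z (2 ^ Suc k * \<rho>)) \<le> ennreal (c k) * ennreal (t * (2 ^ Suc k * \<rho>) ^ DIM('a))"
      using M xz unfolding max_le_def by (intro mult_left_mono) auto
    also have "\<dots> = ennreal (c k * (t * (2 ^ Suc k * \<rho>) ^ DIM('a)))"
      by (rule ennreal_mult'[symmetric]) (rule c0)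
    also have "c k * (t * (2 ^ Suc k * \<rho>) ^ DIM('a)) = 2 ^ DIM('a) * t * \<omega> ((1/2) ^ k)"
    proof -
      have "(2 ^ Suc k * \<rho>) ^ DIM('a) = 2 ^ DIM('a) * (2 ^ k * \<rho>) ^ DIM('a)"
        unfolding power_Suc mult.assoc power_mult_distrib[of 2] by (rule refl)
      then show ?thesis using xz by (simp add: c_def)
    qed
    finally show "ennreal (c k) * mass f (ball z (2 ^ Suc k * \<rho>)) \<le> ennreal (2 ^ DIM('a) * t * \<omega> ((1/2) ^ k))" .
  qed auto
  also have "\<dots> = ennreal (\<Sum>k. 2 ^ DIM('a) * t * \<omega> ((1/2) ^ k))"
    using nn M sum by (intro suminf_ennreal2 summable_mult) auto
  also have "(\<Sum>k. 2 ^ DIM('a) * t * \<omega> ((1/2) ^ k)) = 2 ^ DIM('a) * (\<Sum>k. \<omega> ((1/2) ^ k)) * t"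
    using sum by (subst suminf_mult) auto
  finally show ?thesis .
qed

lemma dominated_Ints_norm_bound:
  fixes g :: "'b \<Rightarrow> complex"
  assumes "integrable M g" "(\<integral>\<^sup>+x. ennreal (norm (g x)) \<partial>M) \<le> ennreal c" "0 \<le> c"
  shows "norm (integral\<^sup>L M g) \<le> c"
proof -
  have "ennreal (norm (integral\<^sup>L M g)) \<le> ennreal c"
    using integral_norm_bound_ennreal[OF assms(1)] assms(2) by (rule order_trans)
  then show ?thesis using assms(3) by simp
qed

text \<open>No bound on the size of the kernel is included here: \<open>kernel_size\<close> derives
  one from the operator, in an extension of this locale.\<close>

locale cz_regular =
  fixes \<omega> :: "real \<Rightarrow> real" and K :: "'a::euclidean_space \<Rightarrow> 'a \<Rightarrow> complex"
  assumes om: "modulus_of_continuity \<omega>"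
    and sumW: "summable (\<lambda>k. \<omega> ((1/2) ^ k))"
    and reg: "kernel_regularity \<omega> K"
    and regT: "kernel_regularity \<omega> (\<lambda>x y. K y x)"
begin

definition W where "W = 2 ^ DIM('a) * (\<Sum>k. \<omega> ((1/2) ^ k))"

lemma om_nonneg: "0 \<le> t \<Longrightarrow> 0 \<le> \<omega> t" and om_mono: "0 \<le> s \<Longrightarrow> s \<le> t \<Longrightarrow> \<omega> s \<le> \<omega> t"
  and om_less: "0 \<le> t \<Longrightarrow> \<omega> t < 1"
  using om by (auto simp: modulus_of_continuity_def mono_on_def)

lemma W_nonneg: "0 \<le> W"
  unfolding W_def using om_nonneg sumW by (intro mult_nonneg_nonneg suminf_nonneg) auto

lemma om_small:
  assumes "0 < e"
  shows "\<exists>\<delta>>0. \<forall>t. 0 \<le> t \<and> t \<le> \<delta> \<longrightarrow> \<omega> t < e"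
proof -
  have "(\<lambda>k. \<omega> ((1/2) ^ k)) \<longlonglongrightarrow> 0" using sumW by (rule summable_LIMSEQ_zero)
  then have "\<forall>\<^sub>F k in sequentially. \<omega> ((1/2) ^ k) < e" using assms by (rule order_tendstoD)
  then obtain k where k: "\<omega> ((1/2) ^ k) < e" by (auto simp: eventually_sequentially)
  have "\<omega> t < e" if "0 \<le> t" "t \<le> (1/2) ^ k" for t
    using om_mono[OF that] k by simp
  then show ?thesis by (intro exI[of _ "(1/2)^k"]) auto
qed

lemma regD: "x \<noteq> y \<Longrightarrow> 2 * dist x x' \<le> dist x y \<Longrightarrow>
    norm (K x y - K x' y) \<le> \<omega> (dist x x' / dist x y) / dist x y ^ DIM('a)"
  using reg by (auto simp: kernel_regularity_def)

lemma regTD: "x \<noteq> y \<Longrightarrow> 2 * dist y y' \<le> dist y x \<Longrightarrow>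
    norm (K x y - K x y') \<le> \<omega> (dist y y' / dist y x) / dist y x ^ DIM('a)"
  using regT by (auto simp: kernel_regularity_def)

text \<open>Regularity in both variables gives joint continuity off the diagonal, since \<omega>
  tends to 0 at 0 by summability. This continuity is the source of the measurability of the
  kernel.\<close>

lemma K_continuous: "continuous_on {p. fst p \<noteq> snd p} (\<lambda>(x, y). K x y)"
  unfolding continuous_on_eq_continuous_at[OF open_Collect_neq[OF continuous_on_fst[OF continuous_on_id] continuous_on_snd[OF continuous_on_id]]]
proof
  fix p :: "'a \<times> 'a" assume "p \<in> {p. fst p \<noteq> snd p}"
  then obtain x y where p: "p = (x, y)" "x \<noteq> y" by (cases p) auto
  define D where "D = dist x y"
  have D: "D > 0" using p by (simp add: D_def)
  show "isCont (\<lambda>(x, y). K x y) p"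
    unfolding continuous_at_eps_delta
  proof (intro allI impI)
    fix e :: real assume e: "e > 0"
    \<comment> \<open>The relevant distances stay above D / 2, so each of the two kernel differences
      is below e' / (D / 2)^d = e / 2.\<close>
    define e' where "e' = e * (D / 2) ^ DIM('a) / 2"
    have e': "e' > 0" using e D by (simp add: e'_def)
    obtain \<delta> where \<delta>: "\<delta> > 0" "\<And>t. 0 \<le> t \<Longrightarrow> t \<le> \<delta> \<Longrightarrow> \<omega> t < e'" using om_small[OF e'] by blast
    define \<eta> where "\<eta> = min (D / 4) (\<delta> * D / 2)"
    have \<eta>: "\<eta> > 0" "\<eta> \<le> D / 4" "\<eta> \<le> \<delta> * D / 2" using D \<delta> by (auto simp: \<eta>_def)
    have "dist ((\<lambda>(x, y). K x y) q) ((\<lambda>(x, y). K x y) p) < e" if q: "dist q p < \<eta>" for q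
    proof -
      obtain x' y' where q': "q = (x', y')" by (cases q)
      have dx: "dist x' x < \<eta>" "dist y' y < \<eta>"
        using q dist_fst_le[of q p] dist_snd_le[of q p] by (auto simp: q' p)
      have xy': "D / 2 \<le> dist x y'" "x \<noteq> y'"
      proof -
        have "D \<le> dist x y' + dist y' y" unfolding D_def by (rule dist_triangle)
        then show "D / 2 \<le> dist x y'" using dx \<eta> D by linarith
        then show "x \<noteq> y'" using D by auto
      qed
      have small: "\<omega> (s / r) / r ^ DIM('a) < e / 2" if "0 \<le> s" "s \<le> \<eta>" "D / 2 \<le> r" for s r
      proof -
        have "s / r \<le> (\<delta> * D / 2) / (D / 2)" using that \<eta> D \<delta> by (intro frac_le) auto
        then have "s / r \<le> \<delta>" using D by simp
        then have "\<omega> (s / r) < e'" using that D by (intro \<delta>) auto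
        moreover have "0 \<le> \<omega> (s / r)" using that D by (intro om_nonneg) auto
        moreover have "(D / 2) ^ DIM('a) \<le> r ^ DIM('a)" using that D by (intro power_mono) auto
        ultimately have "\<omega> (s / r) / r ^ DIM('a) < e' / (D / 2) ^ DIM('a)"
          using D by (intro frac_less) auto
        then show ?thesis using D by (simp add: e'_def)
      qed
      have "norm (K x y' - K x' y') \<le> \<omega> (dist x x' / dist x y') / dist x y' ^ DIM('a)"
        using xy' dx \<eta> by (intro regD) (auto simp: dist_commute)
      also have "\<dots> < e / 2" using dx xy' by (intro small) (auto simp: dist_commute)
      finally have 1: "norm (K x y' - K x' y') < e / 2" .
      have "norm (K x y - K x y') \<le> \<omega> (dist y y' / dist y x) / dist y x ^ DIM('a)"
        using p(2) dx \<eta> D by (intro regTD) (auto simp: dist_commute D_def)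
      also have "\<dots> < e / 2" using dx D by (intro small) (auto simp: dist_commute D_def)
      finally have 2: "norm (K x y - K x y') < e / 2" .
      have "norm (K x' y' - K x y) \<le> norm (K x' y' - K x y') + norm (K x y' - K x y)"
        by (metis dist_norm dist_triangle)
      also have "\<dots> < e" using 1 2 by (simp add: norm_minus_commute)
      finally show ?thesis by (simp add: q' p dist_norm)
    qed
    then show "\<exists>d>0. \<forall>x'. dist x' p < d \<longrightarrow> dist ((\<lambda>(x, y). K x y) x') ((\<lambda>(x, y). K x y) p) < e"
      using \<eta>(1) by blast
  qed
qed

lemma K_off_diagonal_borel: "(\<lambda>(x, y). if x = y then 0 else K x y) \<in> borel_measurable borel"
proof -
  have "open {p :: 'a \<times> 'a. fst p \<noteq> snd p}"
    by (intro open_Collect_neq continuous_intros)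
  then have "(\<lambda>p. indicator {p. fst p \<noteq> snd p} p *\<^sub>R (case p of (x, y) \<Rightarrow> K x y)) \<in> borel_measurable borel"
    by (intro borel_measurable_continuous_on_indicator K_continuous) auto
  also have "(\<lambda>p. indicator {p. fst p \<noteq> snd p} p *\<^sub>R (case p of (x, y) \<Rightarrow> K x y)) = (\<lambda>(x, y). if x = y then 0 else K x y)"
    by (auto simp: fun_eq_iff)
  finally show ?thesis .
qed

lemma K_off_pair [measurable]: "(\<lambda>(x, y). if x = y then 0 else K x y) \<in> borel_measurable (borel \<Otimes>\<^sub>M borel)"
  using K_off_diagonal_borel by (simp add: borel_prod)

lemma K_off_1 [measurable]: "(\<lambda>x. if x = y then 0 else K x y) \<in> borel_measurable lebesgue"
proof -
  have "(\<lambda>x. (\<lambda>(x, y). if x = y then 0 else K x y) (x, y)) \<in> borel_measurable borel" by measurable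
  then have "(\<lambda>x. if x = y then 0 else K x y) \<in> borel_measurable lborel" by simp
  then show ?thesis by (rule measurable_completion)
qed

lemma K_off_2 [measurable]: "(\<lambda>y. if x = y then 0 else K x y) \<in> borel_measurable lebesgue"
proof -
  have "(\<lambda>y. (\<lambda>(x, y). if x = y then 0 else K x y) (x, y)) \<in> borel_measurable borel" by measurable
  then have "(\<lambda>y. if x = y then 0 else K x y) \<in> borel_measurable lborel" by simp
  then show ?thesis by (rule measurable_completion)
qed

lemma tail:
  assumes "f \<in> borel_measurable lebesgue" "dist z x \<le> \<rho>" "0 < \<rho>" "max_le f z t" "0 \<le> t"
  shows "(\<integral>\<^sup>+y\<in>{y. 2 * \<rho> \<le> dist z y}. ennreal (norm (K z y - K x y)) * ennreal (norm (f y)) \<partial>lebesgue) \<le> ennreal (W * t)"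
  unfolding W_def by (rule kernel_tail[OF om sumW reg assms])

text \<open>Hormander's condition: the tail estimate for the transposed kernel and the constant
  function 1, whose maximal bound is the volume of the unit ball.\<close>

lemma tail_dual:
  assumes "dist z y \<le> \<rho>" "0 < \<rho>"
  shows "(\<integral>\<^sup>+x\<in>{x. 2 * \<rho> \<le> dist z x}. ennreal (norm (K x z - K x y)) \<partial>lebesgue)
     \<le> ennreal (W * unit_ball_vol (real DIM('a)))"
proof -
  have "(\<integral>\<^sup>+x\<in>{x. 2 * \<rho> \<le> dist z x}. ennreal (norm (K x z - K x y)) * ennreal (norm (1::complex)) \<partial>lebesgue)
     \<le> ennreal (W * unit_ball_vol (real DIM('a)))"
    unfolding W_def by (rule kernel_tail[OF om sumW regT _ assms max_le_one]) (auto intro: less_imp_le)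
  then show ?thesis by simp
qed

text \<open>Measurability is known for the kernel set to 0 on the diagonal, and on G the two kernels
  agree because x lies outside G.\<close>

lemma K_integrand_measurable:
  assumes f: "f \<in> borel_measurable lebesgue" and G: "G \<in> sets lebesgue" and x: "x \<notin> G"
  shows "(\<lambda>y. indicator G y *\<^sub>R (K x y * f y)) \<in> borel_measurable lebesgue"
proof -
  have "(\<lambda>y. indicator G y *\<^sub>R ((if x = y then 0 else K x y) * f y)) \<in> borel_measurable lebesgue"
    using f G by measurable
  also have "(\<lambda>y. indicator G y *\<^sub>R ((if x = y then 0 else K x y) * f y)) = (\<lambda>y. indicator G y *\<^sub>R (K x y * f y))"
    using x by (auto simp: fun_eq_iff indicator_def)
  finally show ?thesis .
qed

end

locale cz_kernel = cz_regular \<omega> K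
  for \<omega> :: "real \<Rightarrow> real" and K :: "'a::euclidean_space \<Rightarrow> 'a \<Rightarrow> complex" +
  fixes A :: real
  assumes size: "x \<noteq> y \<Longrightarrow> norm (K x y) \<le> A / dist x y ^ DIM('a)" and A: "0 \<le> A"
begin

lemma integral_nn_bound:
  assumes f: "f \<in> borel_measurable lebesgue" and G: "G \<in> sets lebesgue"
    and "0 < \<eta>" "\<And>y. y \<in> G \<Longrightarrow> \<eta> \<le> dist x y"
  shows "(\<integral>\<^sup>+y. ennreal (norm (indicator G y *\<^sub>R (K x y * f y))) \<partial>lebesgue) \<le> ennreal (A / \<eta> ^ DIM('a)) * mass f G"
proof -
  have c0: "0 \<le> A / \<eta> ^ DIM('a)" using A assms by simp
  have "(\<integral>\<^sup>+y. ennreal (norm (indicator G y *\<^sub>R (K x y * f y))) \<partial>lebesgue) \<le> (\<integral>\<^sup>+y. ennreal (A / \<eta> ^ DIM('a)) * (ennreal (norm (f y)) * indicator G y) \<partial>lebesgue)"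
  proof (rule nn_integral_mono)
    fix y
    show "ennreal (norm (indicator G y *\<^sub>R (K x y * f y))) \<le> ennreal (A / \<eta> ^ DIM('a)) * (ennreal (norm (f y)) * indicator G y)"
    proof (cases "y \<in> G")
      case True
      then have d: "\<eta> \<le> dist x y" using assms by auto
      then have "x \<noteq> y" using assms by auto
      then have "norm (K x y) \<le> A / dist x y ^ DIM('a)" by (rule size)
      also have "\<dots> \<le> A / \<eta> ^ DIM('a)" using A assms d by (intro divide_left_mono power_mono mult_pos_pos zero_less_power) auto
      finally have "norm (K x y) * norm (f y) \<le> A / \<eta> ^ DIM('a) * norm (f y)" by (rule mult_right_mono) simp
      then have "ennreal (norm (K x y) * norm (f y)) \<le> ennreal (A / \<eta> ^ DIM('a) * norm (f y))" by (rule ennreal_leI)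
      also have "\<dots> = ennreal (A / \<eta> ^ DIM('a)) * ennreal (norm (f y))" by (rule ennreal_mult'[OF c0])
      finally show ?thesis using True by (simp add: norm_mult)
    qed simp
  qed
  also have "\<dots> = ennreal (A / \<eta> ^ DIM('a)) * mass f G"
  proof -
    have [measurable]: "f \<in> borel_measurable lebesgue" "G \<in> sets lebesgue" using f G by auto
    show ?thesis unfolding mass_def by (rule nn_integral_cmult) measurable
  qed
  finally show ?thesis .
qed

lemma integrable_off:
  assumes f: "integrable lebesgue f" and G: "G \<in> sets lebesgue"
    and \<eta>: "0 < \<eta>" "\<And>y. y \<in> G \<Longrightarrow> \<eta> \<le> dist x y"
  shows "integrable lebesgue (\<lambda>y. indicator G y *\<^sub>R (K x y * f y))"
proof (rule integrableI_bounded)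
  have x: "x \<notin> G" using \<eta> by force
  have fm: "f \<in> borel_measurable lebesgue" using f by auto
  show "(\<lambda>y. indicator G y *\<^sub>R (K x y * f y)) \<in> borel_measurable lebesgue"
    by (rule K_integrand_measurable[OF fm G x])
  have "(\<integral>\<^sup>+y. ennreal (norm (indicator G y *\<^sub>R (K x y * f y))) \<partial>lebesgue) \<le> ennreal (A / \<eta> ^ DIM('a)) * mass f G"
    by (rule integral_nn_bound[OF fm G \<eta>])
  also have "\<dots> < \<infinity>" using mass_finite[OF f, of G] by (simp add: ennreal_mult_less_top)
  finally show "(\<integral>\<^sup>+y. ennreal (norm (indicator G y *\<^sub>R (K x y * f y))) \<partial>lebesgue) < \<infinity>" .
qed

lemma norm_off:
  assumes f: "integrable lebesgue f" and G: "G \<in> sets lebesgue"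
    and \<eta>: "0 < \<eta>" "\<And>y. y \<in> G \<Longrightarrow> \<eta> \<le> dist x y" and m: "mass f G \<le> ennreal m" "0 \<le> m"
  shows "norm (LINT y:G|lebesgue. K x y * f y) \<le> A / \<eta> ^ DIM('a) * m"
  unfolding set_lebesgue_integral_def
proof (rule dominated_Ints_norm_bound[OF integrable_off[OF f G \<eta>]])
  have fm: "f \<in> borel_measurable lebesgue" using f by auto
  have c0: "0 \<le> A / \<eta> ^ DIM('a)" using A \<eta> by simp
  have "(\<integral>\<^sup>+y. ennreal (norm (indicator G y *\<^sub>R (K x y * f y))) \<partial>lebesgue) \<le> ennreal (A / \<eta> ^ DIM('a)) * mass f G"
    by (rule integral_nn_bound[OF fm G \<eta>])
  also have "\<dots> \<le> ennreal (A / \<eta> ^ DIM('a)) * ennreal m" using m by (intro mult_left_mono) auto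
  also have "\<dots> = ennreal (A / \<eta> ^ DIM('a) * m)" by (rule ennreal_mult'[OF c0, symmetric])
  finally show "(\<integral>\<^sup>+y. ennreal (norm (indicator G y *\<^sub>R (K x y * f y))) \<partial>lebesgue) \<le> ennreal (A / \<eta> ^ DIM('a) * m)" .
  show "0 \<le> A / \<eta> ^ DIM('a) * m" using c0 m by (intro mult_nonneg_nonneg)
qed

text \<open>G stays away from x and contains everything farther than C \<rho> from z. On this outer
  part the kernel is moved from x to z at the cost W t. The rest of G lies in the ball about z of
  radius 2 C \<rho>, where the size bound A / (\<eta> \<rho>)^d meets the mass t (2 C \<rho>)^d. A
  general region G covers truncations as well as complements of dilates and of balls.\<close>

lemma compare:
  assumes f: "integrable lebesgue f" and G: "G \<in> sets lebesgue"
    and xz: "dist z x \<le> \<rho>" "0 < \<rho>" and \<eta>: "0 < \<eta>" "\<And>y. y \<in> G \<Longrightarrow> \<eta> * \<rho> \<le> dist x y"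
    and C: "2 \<le> C" "\<And>y. C * \<rho> < dist z y \<Longrightarrow> y \<in> G"
    and M: "max_le f z t" "0 \<le> t"
  shows "norm (LINT y:G|lebesgue. K x y * f y)
     \<le> norm (trunc K (C * \<rho>) f z) + (A * (2 * C / \<eta>) ^ DIM('a) + W) * t"
proof -
  have fm: "f \<in> borel_measurable lebesgue" using f by auto
  define H where "H = {y. C * \<rho> < dist z y}"
  define G1 where "G1 = G - H"
  have Hs: "H \<in> sets lebesgue" unfolding H_def
    by (intro sets_completionI_sets) (simp add: borel_open open_Collect_less continuous_intros)
  have G1s: "G1 \<in> sets lebesgue" using G Hs by (simp add: G1_def sets.Diff)
  have HG: "H \<subseteq> G" using C by (auto simp: H_def)
  have eta0: "0 < \<eta> * \<rho>" using \<eta> xz by simp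
  have Hz: "C * \<rho> \<le> dist z y" if "y \<in> H" for y using that by (simp add: H_def)
  have C0: "0 < C * \<rho>" using C xz by simp
  have "norm (LINT y:G1|lebesgue. K x y * f y) \<le> A / (\<eta> * \<rho>) ^ DIM('a) * (t * (2 * C * \<rho>) ^ DIM('a))"
  proof (rule norm_off[OF f G1s eta0])
    show "\<eta> * \<rho> \<le> dist x y" if "y \<in> G1" for y using that \<eta> by (auto simp: G1_def)
    \<comment> \<open>The radius is doubled because G1 lies in the closed ball of radius C \<rho>,
      while \<open>max_le\<close> speaks of open balls.\<close>
    have "G1 \<subseteq> ball z (2 * C * \<rho>)" using C0 by (auto simp: G1_def H_def)
    then show "mass f G1 \<le> ennreal (t * (2 * C * \<rho>) ^ DIM('a))"
      using C0 by (intro mass_bounded_ball[OF M(1)]) auto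
    show "0 \<le> t * (2 * C * \<rho>) ^ DIM('a)" using C0 M by auto
  qed
  also have "\<dots> = A * (2 * C / \<eta>) ^ DIM('a) * t"
    using \<eta> xz by (simp add: power_mult_distrib power_divide)
  finally have 1: "norm (LINT y:G1|lebesgue. K x y * f y) \<le> A * (2 * C / \<eta>) ^ DIM('a) * t" .
  have ix: "integrable lebesgue (\<lambda>y. indicator H y *\<^sub>R (K x y * f y))"
    by (rule integrable_off[OF f Hs eta0]) (use \<eta> HG in auto)
  have iz: "integrable lebesgue (\<lambda>y. indicator H y *\<^sub>R (K z y * f y))"
    by (rule integrable_off[OF f Hs C0]) (use Hz in auto)
  have i1: "integrable lebesgue (\<lambda>y. indicator G1 y *\<^sub>R (K x y * f y))"
    by (rule integrable_off[OF f G1s eta0]) (use \<eta> in \<open>auto simp: G1_def\<close>)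
  have "norm (integral\<^sup>L lebesgue (\<lambda>y. indicator H y *\<^sub>R (K z y * f y) - indicator H y *\<^sub>R (K x y * f y))) \<le> W * t"
  proof (rule dominated_Ints_norm_bound)
    show "integrable lebesgue (\<lambda>y. indicator H y *\<^sub>R (K z y * f y) - indicator H y *\<^sub>R (K x y * f y))"
      using ix iz by (rule Bochner_Integration.integrable_diff[rotated])
    have "(\<integral>\<^sup>+y. ennreal (norm (indicator H y *\<^sub>R (K z y * f y) - indicator H y *\<^sub>R (K x y * f y))) \<partial>lebesgue)
      \<le> (\<integral>\<^sup>+y\<in>{y. 2 * \<rho> \<le> dist z y}. ennreal (norm (K z y - K x y)) * ennreal (norm (f y)) \<partial>lebesgue)"
    proof (rule nn_integral_mono)
      fix y
      show "ennreal (norm (indicator H y *\<^sub>R (K z y * f y) - indicator H y *\<^sub>R (K x y * f y)))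
        \<le> ennreal (norm (K z y - K x y)) * ennreal (norm (f y)) * indicator {y. 2 * \<rho> \<le> dist z y} y"
      proof (cases "y \<in> H")
        case True
        then have "C * \<rho> < dist z y" by (simp add: H_def)
        moreover have "2 * \<rho> \<le> C * \<rho>" using C xz by (intro mult_right_mono) auto
        ultimately have "2 * \<rho> \<le> dist z y" by linarith
        moreover have "K z y * f y - K x y * f y = (K z y - K x y) * f y" by (simp add: algebra_simps)
        ultimately show ?thesis using True by (simp add: norm_mult ennreal_mult)
      qed simp
    qed
    also have "\<dots> \<le> ennreal (W * t)" by (rule tail[OF fm xz M])
    finally show "(\<integral>\<^sup>+y. ennreal (norm (indicator H y *\<^sub>R (K z y * f y) - indicator H y *\<^sub>R (K x y * f y))) \<partial>lebesgue) \<le> ennreal (W * t)" .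
    show "0 \<le> W * t" using W_nonneg M by simp
  qed
  then have 2: "norm ((LINT y:H|lebesgue. K z y * f y) - (LINT y:H|lebesgue. K x y * f y)) \<le> W * t"
    unfolding set_lebesgue_integral_def using ix iz by simp
  have "(LINT y:G|lebesgue. K x y * f y) = (LINT y:G1|lebesgue. K x y * f y) + (LINT y:H|lebesgue. K x y * f y)"
  proof -
    have "(\<lambda>y. indicator G y *\<^sub>R (K x y * f y)) = (\<lambda>y. indicator G1 y *\<^sub>R (K x y * f y) + indicator H y *\<^sub>R (K x y * f y))"
      using HG by (auto simp: fun_eq_iff G1_def indicator_def)
    then show ?thesis unfolding set_lebesgue_integral_def using i1 ix by simp
  qed
  moreover have "(LINT y:H|lebesgue. K z y * f y) = trunc K (C * \<rho>) f z"
    by (simp add: trunc_def H_def)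
  ultimately have "(LINT y:G|lebesgue. K x y * f y) = trunc K (C * \<rho>) f z + (LINT y:G1|lebesgue. K x y * f y)
       - ((LINT y:H|lebesgue. K z y * f y) - (LINT y:H|lebesgue. K x y * f y))" by simp
  then have "norm (LINT y:G|lebesgue. K x y * f y) \<le> norm (trunc K (C * \<rho>) f z) + norm (LINT y:G1|lebesgue. K x y * f y)
       + norm ((LINT y:H|lebesgue. K z y * f y) - (LINT y:H|lebesgue. K x y * f y))"
    by (metis (no_types, lifting) add_mono_thms_linordered_semiring(3) norm_triangle_ineq norm_triangle_le_diff order_trans order_refl)
  then show ?thesis using 1 2 by (simp add: algebra_simps)
qed

end

subsection \<open>Principal cubes for the maximal truncations\<close>

definition hl_max :: "('a::euclidean_space \<Rightarrow> complex) \<Rightarrow> 'a \<Rightarrow> ennreal" where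
  "hl_max f x = (SUP r\<in>{0<..}. mass f (ball x r) / ennreal (r ^ DIM('a)))"

definition joint_max :: "('a::euclidean_space \<Rightarrow> 'a \<Rightarrow> complex) \<Rightarrow> ('a \<Rightarrow> complex) \<Rightarrow> 'a \<Rightarrow> ennreal" where
  "joint_max K f x = max (max_truncation K f x) (hl_max f x)"

lemma ennreal_divide_le_iff:
  assumes "0 < (c::real)" "0 \<le> t"
  shows "X / ennreal c \<le> ennreal t \<longleftrightarrow> X \<le> ennreal (t * c)"
proof
  have tc: "ennreal (t * c) = ennreal c * ennreal t" using assms by (simp add: ennreal_mult mult.commute)
  show "X / ennreal c \<le> ennreal t" if "X \<le> ennreal (t * c)"
    using that assms unfolding tc by (intro divide_le_posI_ennreal) auto
  assume "X / ennreal c \<le> ennreal t"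
  then have "X / ennreal c * ennreal c \<le> ennreal t * ennreal c" by (rule mult_right_mono) simp
  moreover have "X / ennreal c * ennreal c = X"
    using assms by (simp add: ennreal_divide_times)
  ultimately show "X \<le> ennreal (t * c)" unfolding tc by (simp add: mult.commute)
qed

lemma joint_max_le_iff:
  assumes "0 \<le> t"
  shows "joint_max K f x \<le> ennreal t \<longleftrightarrow> trunc_le K f x t \<and> max_le f x t"
proof -
  have "max_truncation K f x \<le> ennreal t \<longleftrightarrow> trunc_le K f x t"
    using assms unfolding max_truncation_def trunc_le_def trunc_def by (auto simp: SUP_le_iff)
  moreover have "hl_max f x \<le> ennreal t \<longleftrightarrow> max_le f x t"
    using assms unfolding hl_max_def max_le_def by (auto simp: SUP_le_iff ennreal_divide_le_iff)
  ultimately show ?thesis by (simp add: joint_max_def)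
qed

lemma trunc_region_sets [simp, intro]: "{y. \<delta> < dist x y} \<in> sets lebesgue" for x :: "'a::euclidean_space"
  by (intro sets_completionI_sets) (simp add: borel_open open_Collect_less continuous_intros)

text \<open>Weak type is stated through a measurable exceptional set, which leaves open whether
  \<open>joint_max\<close> itself is measurable. A value of B is supplied by
  \<open>weak_joint\<close>.\<close>

locale cz_weak = cz_kernel \<omega> K A for \<omega> and K :: "'a::euclidean_space \<Rightarrow> 'a \<Rightarrow> complex" and A +
  fixes B :: real
  assumes B: "0 < B"
    and weak: "integrable lebesgue f \<Longrightarrow> mass f UNIV \<le> ennreal n \<Longrightarrow> 0 \<le> n \<Longrightarrow> 0 < t \<Longrightarrow>
      \<exists>E\<in>sets lebesgue. emeasure lebesgue E \<le> ennreal (B * n / t) \<and>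
        (\<forall>x. x \<notin> E \<longrightarrow> trunc_le K f x t \<and> max_le f x t)"

locale cz_principal = grid D + cz_weak \<omega> K A B
  for D :: "'a::euclidean_space set set" and \<omega> and K :: "'a \<Rightarrow> 'a \<Rightarrow> complex" and A B +
  fixes f :: "'a \<Rightarrow> complex"
  assumes f: "integrable lebesgue f"
begin

lemma d1: "1 \<le> real DIM('a)" using DIM_positive[where 'a='a] by linarith

text \<open>The centre is an arbitrary point of Q. A radius of 4 times the diameter bound keeps the
  points of Q three such diameters away from the complement and makes the dilates of nested cubes
  nested.\<close>

definition star :: "'a set \<Rightarrow> 'a set" where
  "star Q = ball (SOME x. x \<in> Q) (4 * real DIM('a) * side (lev Q))"

text \<open>Normalised by the volume of Q, not of the dilate; \<open>adjacent_families\<close>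
  compares it with averages over genuine cubes.\<close>

definition av :: "'a set \<Rightarrow> real" where
  "av Q = enn2real (mass f (star Q)) / side (lev Q) ^ DIM('a)"

definition loc :: "'a set \<Rightarrow> 'a \<Rightarrow> complex" where "loc Q = res (star Q) f"

text \<open>The sum of the costs met below: A for truncations at scales above the side of Q, 1 for
  large balls, and the terms with 2 * B, from the threshold \<open>2 * B * av Q\<close>, for moving
  to a good point.\<close>

definition sparse_const :: real where
  "sparse_const = A + 1 + 2 * B * (1 + A * (4 * real DIM('a)) ^ DIM('a) + W + A * 6 ^ DIM('a) + (1 + real DIM('a)) ^ DIM('a))"

lemma star_sets [simp]: "star Q \<in> sets lebesgue" by (simp add: star_def)

lemma star_compl [simp]: "- star Q \<in> sets lebesgue"
  by (subst Compl_in_sets_lebesgue) simp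

lemma av_nonneg: "0 \<le> av Q" by (simp add: av_def)

lemma mass_star: "mass f (star Q) = ennreal (av Q * side (lev Q) ^ DIM('a))"
  using mass_real[OF f, of "star Q"] by (simp add: av_def)

lemma loc_integrable: "integrable lebesgue (loc Q)"
  unfolding loc_def by (rule res_integrable[OF f]) simp

lemma mass_loc: "mass (loc Q) G \<le> ennreal (av Q * side (lev Q) ^ DIM('a))"
  unfolding loc_def mass_res mass_star[symmetric] by (rule mass_mono) auto

lemma some_mem: "Q \<in> D \<Longrightarrow> (SOME x. x \<in> Q) \<in> Q"
  using D_nonempty by (simp add: some_in_eq)

lemma dist_in: "Q \<in> D \<Longrightarrow> x \<in> Q \<Longrightarrow> y \<in> Q \<Longrightarrow> dist x y \<le> real DIM('a) * side (lev Q)"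
  using dist_cell[of x "lev Q" x y] cell_lev[of Q x] by simp

lemma far_from_star:
  assumes "Q \<in> D" "x \<in> Q" "y \<notin> star Q"
  shows "3 * real DIM('a) * side (lev Q) \<le> dist x y"
proof -
  have "4 * real DIM('a) * side (lev Q) \<le> dist (SOME x. x \<in> Q) y" using assms(3) by (simp add: star_def)
  also have "\<dots> \<le> dist (SOME x. x \<in> Q) x + dist x y" by (rule dist_triangle)
  also have "dist (SOME x. x \<in> Q) x \<le> real DIM('a) * side (lev Q)" using assms some_mem dist_in by blast
  finally show ?thesis by simp
qed

lemma const_pos: "0 < sparse_const" and const_size: "A \<le> sparse_const" "1 \<le> sparse_const"
  and const_good: "2 * B * (1 + A * (4 * real DIM('a)) ^ DIM('a) + W) \<le> sparse_const"
    "2 * B * (1 + real DIM('a)) ^ DIM('a) \<le> sparse_const" "2 * B * (1 + A * 6 ^ DIM('a) + W) \<le> sparse_const"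
proof -
  have nn: "0 \<le> A * (4 * real DIM('a)) ^ DIM('a)" "0 \<le> W" "0 \<le> A * 6 ^ DIM('a)" "0 \<le> (1 + real DIM('a)) ^ DIM('a)"
    using A W_nonneg by auto
  have BB: "0 \<le> 2 * B" using B by simp
  have mono: "2 * B * u \<le> 2 * B * v" if "u \<le> v" for u v using that BB by (rule mult_left_mono)
  have "0 \<le> 2 * B * (1 + A * (4 * real DIM('a)) ^ DIM('a) + W + A * 6 ^ DIM('a) + (1 + real DIM('a)) ^ DIM('a))"
    using nn BB by (intro mult_nonneg_nonneg) auto
  then show "0 < sparse_const" "A \<le> sparse_const" "1 \<le> sparse_const" using A by (auto simp: sparse_const_def)
  have a: "0 \<le> A" by (rule A)
  have "2 * B * (1 + A * (4 * real DIM('a)) ^ DIM('a) + W) \<le> 2 * B * (1 + A * (4 * real DIM('a)) ^ DIM('a) + W + A * 6 ^ DIM('a) + (1 + real DIM('a)) ^ DIM('a))"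
    using nn by (intro mono) linarith
  then show "2 * B * (1 + A * (4 * real DIM('a)) ^ DIM('a) + W) \<le> sparse_const" using a unfolding sparse_const_def by linarith
  have "2 * B * (1 + real DIM('a)) ^ DIM('a) \<le> 2 * B * (1 + A * (4 * real DIM('a)) ^ DIM('a) + W + A * 6 ^ DIM('a) + (1 + real DIM('a)) ^ DIM('a))"
    using nn by (intro mono) linarith
  then show "2 * B * (1 + real DIM('a)) ^ DIM('a) \<le> sparse_const" using a unfolding sparse_const_def by linarith
  have "2 * B * (1 + A * 6 ^ DIM('a) + W) \<le> 2 * B * (1 + A * (4 * real DIM('a)) ^ DIM('a) + W + A * 6 ^ DIM('a) + (1 + real DIM('a)) ^ DIM('a))"
    using nn by (intro mono) linarith
  then show "2 * B * (1 + A * 6 ^ DIM('a) + W) \<le> sparse_const" using a unfolding sparse_const_def by linarith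
qed

text \<open>Beyond the side s of Q the kernel is at most A / s^d, and \<open>loc Q\<close> has mass
  at most \<open>av Q\<close> times s^d.\<close>

lemma trunc_large:
  assumes "side (lev Q) \<le> \<delta>"
  shows "norm (trunc K \<delta> (loc Q) x) \<le> sparse_const * av Q"
proof -
  have "norm (trunc K \<delta> (loc Q) x) \<le> A / side (lev Q) ^ DIM('a) * (av Q * side (lev Q) ^ DIM('a))"
    unfolding trunc_def
    by (rule norm_off[OF loc_integrable]) (use assms mass_loc av_nonneg in auto)
  also have "\<dots> = A * av Q" by simp
  also have "\<dots> \<le> sparse_const * av Q" by (intro mult_right_mono const_size av_nonneg)
  finally show ?thesis .
qed

lemma max_large:
  assumes "side (lev Q) \<le> r"
  shows "mass (loc Q) (ball x r) \<le> ennreal (sparse_const * av Q * r ^ DIM('a))"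
proof -
  have "mass (loc Q) (ball x r) \<le> ennreal (av Q * side (lev Q) ^ DIM('a))" by (rule mass_loc)
  also have "\<dots> \<le> ennreal (sparse_const * av Q * r ^ DIM('a))"
  proof (intro ennreal_leI mult_mono power_mono)
    show "av Q \<le> sparse_const * av Q" using const_size(2) av_nonneg[of Q] mult_right_mono[of 1 sparse_const "av Q"] by simp
  qed (use assms av_nonneg const_pos in auto)
  finally show ?thesis .
qed

text \<open>The threshold makes the weak type bound of the exceptional set, B * (av Q * s) / (2 * B
  * av Q), exactly half the volume s of Q.\<close>

definition good :: "'a set \<Rightarrow> 'a set \<Rightarrow> bool" where
  "good Q R \<longleftrightarrow> (\<exists>z\<in>R. joint_max K (loc Q) z \<le> ennreal (2 * B * av Q))"

lemma goodD:
  assumes "good Q R"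
  obtains z where "z \<in> R" "trunc_le K (loc Q) z (2 * B * av Q)" "max_le (loc Q) z (2 * B * av Q)"
proof -
  have "0 \<le> 2 * B * av Q" using B av_nonneg by simp
  then show ?thesis using assms joint_max_le_iff[of "2 * B * av Q" K "loc Q"] that unfolding good_def by blast
qed

text \<open>The good point z of R is within d \<delta> of x, and \<open>compare\<close> with \<rho>
  = d \<delta>, \<eta> = 1 / d and C = 2 produces the factor A (4 d)^d. The ball of radius \<delta>
  about x lies in the ball of radius (1 + d) \<delta> about z.\<close>

lemma transfer:
  assumes R: "R \<in> D" "x \<in> R" "good Q R" and \<delta>: "side (lev R) \<le> \<delta>"
  shows "norm (trunc K \<delta> (loc Q) x) \<le> sparse_const * av Q"
    and "mass (loc Q) (ball x \<delta>) \<le> ennreal (sparse_const * av Q * \<delta> ^ DIM('a))"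
proof -
  define \<tau> where "\<tau> = 2 * B * av Q"
  have \<tau>: "0 \<le> \<tau>" using B av_nonneg by (simp add: \<tau>_def)
  obtain z where z: "z \<in> R" "trunc_le K (loc Q) z \<tau>" "max_le (loc Q) z \<tau>"
    using goodD[OF R(3)] unfolding \<tau>_def by metis
  have \<delta>0: "0 < \<delta>" using \<delta> side_pos[of "lev R"] by linarith
  have dd: "0 < real DIM('a) * \<delta>" using \<delta>0 d1 by auto
  have dzx: "dist z x \<le> real DIM('a) * \<delta>"
    using dist_in[OF R(1) z(1) R(2)] mult_left_mono[OF \<delta>, of "real DIM('a)"] d1 by linarith
  have "norm (LINT y:{y. \<delta> < dist x y}|lebesgue. K x y * loc Q y)
     \<le> norm (trunc K (2 * (real DIM('a) * \<delta>)) (loc Q) z) + (A * (2 * 2 / (1 / real DIM('a))) ^ DIM('a) + W) * \<tau>"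
  proof (rule compare[OF loc_integrable trunc_region_sets dzx dd])
    show "1 / real DIM('a) * (real DIM('a) * \<delta>) \<le> dist x y" if "y \<in> {y. \<delta> < dist x y}" for y using that d1 by simp
    fix y assume y: "2 * (real DIM('a) * \<delta>) < dist z y"
    have "dist z y \<le> dist z x + dist x y" by (rule dist_triangle)
    then have "real DIM('a) * \<delta> < dist x y" using y dzx by linarith
    moreover have "\<delta> \<le> real DIM('a) * \<delta>" using d1 \<delta>0 by simp
    ultimately show "y \<in> {y. \<delta> < dist x y}" by simp
  qed (use z \<tau> d1 in auto)
  also have "norm (trunc K (2 * (real DIM('a) * \<delta>)) (loc Q) z) \<le> \<tau>"
    using z(2) dd unfolding trunc_le_def by auto
  finally have "norm (trunc K \<delta> (loc Q) x) \<le> (1 + A * (4 * real DIM('a)) ^ DIM('a) + W) * \<tau>"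
    by (simp add: trunc_def algebra_simps)
  also have "\<dots> = 2 * B * (1 + A * (4 * real DIM('a)) ^ DIM('a) + W) * av Q" by (simp add: \<tau>_def)
  also have "\<dots> \<le> sparse_const * av Q" by (intro mult_right_mono const_good av_nonneg)
  finally show "norm (trunc K \<delta> (loc Q) x) \<le> sparse_const * av Q" .
  have "ball x \<delta> \<subseteq> ball z ((1 + real DIM('a)) * \<delta>)"
  proof
    fix y assume "y \<in> ball x \<delta>"
    then have "dist x y < \<delta>" by simp
    moreover have "dist z y \<le> dist z x + dist x y" by (rule dist_triangle)
    ultimately show "y \<in> ball z ((1 + real DIM('a)) * \<delta>)" using dzx by (simp add: algebra_simps)
  qed
  then have "mass (loc Q) (ball x \<delta>) \<le> ennreal (\<tau> * ((1 + real DIM('a)) * \<delta>) ^ DIM('a))"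
    using \<delta>0 d1 by (intro mass_bounded_ball[OF z(3)]) auto
  also have "\<dots> \<le> ennreal (sparse_const * av Q * \<delta> ^ DIM('a))"
  proof (rule ennreal_leI)
    have "\<tau> * ((1 + real DIM('a)) * \<delta>) ^ DIM('a) = (2 * B * (1 + real DIM('a)) ^ DIM('a)) * (av Q * \<delta> ^ DIM('a))"
      by (simp add: \<tau>_def power_mult_distrib)
    also have "\<dots> \<le> sparse_const * (av Q * \<delta> ^ DIM('a))"
      using \<delta>0 av_nonneg[of Q] by (intro mult_right_mono const_good) auto
    finally show "\<tau> * ((1 + real DIM('a)) * \<delta>) ^ DIM('a) \<le> sparse_const * av Q * \<delta> ^ DIM('a)" by (simp add: mult.assoc)
  qed
  finally show "mass (loc Q) (ball x \<delta>) \<le> ennreal (sparse_const * av Q * \<delta> ^ DIM('a))" .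
qed

lemma exceptional:
  assumes Q: "Q \<in> D"
  shows "\<exists>E\<in>sets lebesgue. (\<forall>P\<in>D. P \<subseteq> Q \<and> \<not> good Q P \<longrightarrow> P \<subseteq> E) \<and> 2 * emeasure lebesgue E \<le> emeasure lebesgue Q"
proof (cases "av Q = 0")
  \<comment> \<open>No positive level is available for the weak type bound, but \<open>loc Q\<close>
    has no mass, so all its truncations vanish and every cube is good.\<close>
  case True
  have m0: "mass (loc Q) G \<le> ennreal 0" for G using mass_loc[of Q G] True by simp
  have "trunc_le K (loc Q) z 0" for z
    unfolding trunc_le_def trunc_def
  proof (intro allI impI)
    fix \<delta> :: real assume "\<delta> > 0"
    then have "norm (LINT y:{y. \<delta> < dist z y}|lebesgue. K z y * loc Q y) \<le> A / \<delta> ^ DIM('a) * 0"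
      by (intro norm_off[OF loc_integrable]) (use m0 in auto)
    then show "norm (LINT y:{y. \<delta> < dist z y}|lebesgue. K z y * loc Q y) \<le> 0" by simp
  qed
  moreover have "max_le (loc Q) z 0" for z using m0 by (auto simp: max_le_def)
  ultimately have "joint_max K (loc Q) z \<le> ennreal (2 * B * av Q)" for z
    using joint_max_le_iff[of 0 K "loc Q" z] True by simp
  then have "good Q P" if "P \<in> D" for P using D_nonempty[OF that] by (auto simp: good_def)
  then show ?thesis by (intro bexI[of _ "{}"]) auto
next
  case False
  then have a: "0 < av Q" using av_nonneg[of Q] by linarith
  define s where "s = side (lev Q) ^ DIM('a)"
  have s: "0 < s" by (simp add: s_def)
  obtain E where E: "E \<in> sets lebesgue" "emeasure lebesgue E \<le> ennreal (B * (av Q * s) / (2 * B * av Q))"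
    "\<And>x. x \<notin> E \<Longrightarrow> trunc_le K (loc Q) x (2 * B * av Q) \<and> max_le (loc Q) x (2 * B * av Q)"
    using weak[OF loc_integrable[of Q], of "av Q * s" "2 * B * av Q"] mass_loc[of Q UNIV] a s B
    unfolding s_def by auto
  have eq: "B * (av Q * s) / (2 * B * av Q) = s / 2" using a B by simp
  have "2 * emeasure lebesgue E \<le> 2 * ennreal (s / 2)"
    using E(2) unfolding eq by (rule mult_left_mono) simp
  also have "\<dots> = ennreal 2 * ennreal (s / 2)" by simp
  also have "\<dots> = ennreal s" using s by (simp only: ennreal_mult'[symmetric]) simp
  also have "\<dots> = emeasure lebesgue Q" by (simp add: emeasure_lev[OF Q] s_def)
  finally have le: "2 * emeasure lebesgue E \<le> emeasure lebesgue Q" .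
  have "z \<in> E" if "P \<in> D" "\<not> good Q P" "z \<in> P" for P z
  proof (rule ccontr)
    assume "z \<notin> E"
    then have "joint_max K (loc Q) z \<le> ennreal (2 * B * av Q)"
      using E(3)[of z] joint_max_le_iff[of "2 * B * av Q"] a B by auto
    then show False using that by (auto simp: good_def)
  qed
  then show ?thesis using E(1) le by (intro bexI[of _ E]) blast+
qed

text \<open>Every scale below the side of Q is at least the side of some cube around x inside Q, and
  all of these are good. Larger scales are covered by \<open>trunc_large\<close> and
  \<open>max_large\<close>.\<close>

lemma step_stop:
  assumes Q: "Q \<in> D" "x \<in> Q" and gd: "\<And>P. P \<in> D \<Longrightarrow> P \<subseteq> Q \<Longrightarrow> x \<in> P \<Longrightarrow> good Q P"
  shows "joint_max K (loc Q) x \<le> ennreal (sparse_const * av Q)"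
proof -
  have small: "\<exists>R\<in>D. x \<in> R \<and> good Q R \<and> side (lev R) \<le> \<delta>" if dl: "0 < \<delta>" "\<delta> < side (lev Q)" for \<delta>
  proof -
    obtain j where j: "side j \<le> \<delta>" "\<delta> < 2 * side j" by (rule ex_side[OF dl(1)])
    have "side j < side (lev Q)" using j dl by linarith
    then have "lev Q < j" by simp
    then have "cell j x \<subseteq> Q" using cell_mono[of "lev Q" j x] cell_lev[OF Q] by simp
    then show ?thesis using gd[of "cell j x"] j by (intro bexI[of _ "cell j x"]) auto
  qed
  have "trunc_le K (loc Q) x (sparse_const * av Q)"
    unfolding trunc_le_def
  proof (intro allI impI)
    fix \<delta> :: real assume "\<delta> > 0"
    then show "norm (trunc K \<delta> (loc Q) x) \<le> sparse_const * av Q"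
      using small[of \<delta>] trunc_large[of Q \<delta> x] transfer(1)[of _ x Q \<delta>] by (cases "side (lev Q) \<le> \<delta>") auto
  qed
  moreover have "max_le (loc Q) x (sparse_const * av Q)"
    unfolding max_le_def
  proof (intro allI impI)
    fix \<delta> :: real assume "\<delta> > 0"
    then show "mass (loc Q) (ball x \<delta>) \<le> ennreal (sparse_const * av Q * \<delta> ^ DIM('a))"
      using small[of \<delta>] max_large[of Q \<delta> x] transfer(2)[of _ x Q \<delta>] by (cases "side (lev Q) \<le> \<delta>") auto
  qed
  moreover have "0 \<le> sparse_const * av Q" using const_pos av_nonneg[of Q] by simp
  ultimately show ?thesis using joint_max_le_iff by blast
qed

text \<open>The centre moves by at most d times the side of Q, and the smaller radius is at most 2 d
  times that side, as P has at most half the side of Q. Together this is 3 d, which is below 4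
  d.\<close>

lemma star_mono:
  assumes "P \<in> D" "Q \<in> D" "P \<subset> Q"
  shows "star P \<subseteq> star Q"
proof
  fix y assume y: "y \<in> star P"
  define p q where "p = (SOME x. x \<in> P)" and "q = (SOME x. x \<in> Q)"
  have m: "p \<in> Q" "q \<in> Q" using some_mem assms by (auto simp: p_def q_def)
  have "2 * side (lev P) \<le> side (lev Q)"
  proof -
    have "lev Q \<le> lev P - 1" using lev_less[OF assms] by simp
    then have "side (lev P - int 1) \<le> side (lev Q)" by simp
    then show ?thesis unfolding side_diff by simp
  qed
  then have le: "4 * real DIM('a) * side (lev P) \<le> 2 * real DIM('a) * side (lev Q)" using d1 by simp
  have "dist q y \<le> dist q p + dist p y" by (rule dist_triangle)
  moreover have "dist q p \<le> real DIM('a) * side (lev Q)" using dist_in[OF assms(2) m(2,1)] .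
  moreover have "dist p y < 4 * real DIM('a) * side (lev P)" using y by (simp add: star_def p_def)
  ultimately have "dist q y < 3 * real DIM('a) * side (lev Q)" using le by linarith
  also have "\<dots> \<le> 4 * real DIM('a) * side (lev Q)" using d1 by simp
  finally show "y \<in> star Q" by (simp add: star_def q_def)
qed

text \<open>Scales at least the side of Q, or of a good cube above P, are handled without P. At
  scales below twice the side of P the truncation of \<open>loc Q\<close> is that of
  \<open>loc P\<close> plus an integral over the complement of \<open>star P\<close>, which does not
  depend on the scale.\<close>

lemma step_descend:
  assumes Q: "Q \<in> D" and P: "P \<in> D" "P \<subset> Q" "x \<in> P"
    and gd: "\<And>R. R \<in> D \<Longrightarrow> P \<subset> R \<Longrightarrow> R \<subseteq> Q \<Longrightarrow> good Q R"
  shows "joint_max K (loc Q) x \<le> ennreal (sparse_const * av Q) + joint_max K (loc P) x"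
proof (cases "joint_max K (loc P) x")
  case (real v)
  have v: "trunc_le K (loc P) x v" "max_le (loc P) x v"
    using joint_max_le_iff[of v K "loc P" x] real by auto
  have xQ: "x \<in> Q" using P by auto
  define p where "p = side (lev P)"
  have p: "0 < p" by (simp add: p_def)
  have lPQ: "lev Q < lev P" by (rule lev_less[OF P(1) Q P(2)])
  have c0: "0 \<le> sparse_const * av Q" using const_pos av_nonneg[of Q] by simp
  \<comment> \<open>The third case reaches up to 2 p rather than p, because the smallest cube known
    to be good is the parent of P, of side 2 p.\<close>
  have cases: "side (lev Q) \<le> \<delta> \<or> (\<exists>R\<in>D. x \<in> R \<and> good Q R \<and> side (lev R) \<le> \<delta>) \<or> \<delta> < 2 * p" if dl: "0 < \<delta>" for \<delta>
  proof -
    obtain j where j: "side j \<le> \<delta>" "\<delta> < 2 * side j" by (rule ex_side[OF dl(1)])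
    show ?thesis
    proof (cases "side (lev Q) \<le> \<delta> \<or> lev P \<le> j")
      case True
      then show ?thesis
      proof
        assume "lev P \<le> j"
        then have "side j \<le> p" by (simp add: p_def)
        then show ?thesis using j by auto
      qed auto
    next
      case False
      then have "side j < side (lev Q)" using j by linarith
      then have "lev Q < j" by simp
      then have "cell j x \<subseteq> Q" using cell_mono[of "lev Q" j x] cell_lev[OF Q xQ] by simp
      moreover have "P \<subset> cell j x" using False cell_psubset_iff[of "lev P" x j] cell_lev[OF P(1,3)] by simp
      ultimately show ?thesis using gd[of "cell j x"] j by (intro disjI2 disjI1 bexI[of _ "cell j x"]) auto
    qed
  qed
  have far: "3 * real DIM('a) * p \<le> dist x y" if "y \<notin> star P" for y
    using far_from_star[OF P(1,3) that] by (simp add: p_def)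
  have tail_bound: "norm (LINT y:- star P|lebesgue. K x y * loc Q y) \<le> sparse_const * av Q"
  proof -
    define \<tau> where "\<tau> = 2 * B * av Q"
    have \<tau>: "0 \<le> \<tau>" using B av_nonneg by (simp add: \<tau>_def)
    \<comment> \<open>The parent of P is good by \<open>gd\<close>, and its good point z is the
      point of comparison for the integral over the complement of \<open>star P\<close>.\<close>
    define R where "R = cell (lev P - 1) x"
    have "P \<subset> R" using cell_psubset_iff[of "lev P" x "lev P - 1"] cell_lev[OF P(1,3)] by (simp add: R_def)
    moreover have "R \<subseteq> Q" using cell_mono[of "lev Q" "lev P - 1" x] cell_lev[OF Q xQ] lPQ by (simp add: R_def)
    ultimately have "good Q R" by (intro gd) (auto simp: R_def)
    then obtain z where z: "z \<in> R" "trunc_le K (loc Q) z \<tau>" "max_le (loc Q) z \<tau>"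
      using goodD unfolding \<tau>_def by metis
    have lR: "side (lev R) = 2 * p" using side_diff[of "lev P" 1] by (simp add: R_def p_def)
    have RD: "R \<in> D" by (simp add: R_def)
    have xR: "x \<in> R" by (simp add: R_def)
    \<comment> \<open>This bounds the diameter of the parent. With C = 3, a point farther than 3
      \<rho> from z is farther than 2 \<rho> = 4 d p from the centre of P, hence outside
      \<open>star P\<close>.\<close>
    define \<rho> where "\<rho> = 2 * real DIM('a) * p"
    have \<rho>: "0 < \<rho>" using p d1 by (simp add: \<rho>_def)
    have dzx: "dist z x \<le> \<rho>" using dist_in[OF RD z(1) xR] by (simp add: lR \<rho>_def)
    have "norm (LINT y:- star P|lebesgue. K x y * loc Q y)
      \<le> norm (trunc K (3 * \<rho>) (loc Q) z) + (A * (2 * 3 / 1) ^ DIM('a) + W) * \<tau>"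
    proof (rule compare[OF loc_integrable _ dzx \<rho>])
      show "1 * \<rho> \<le> dist x y" if "y \<in> - star P" for y
      proof -
        have "2 * real DIM('a) * p \<le> 3 * real DIM('a) * p" using p d1 by simp
        moreover have "3 * real DIM('a) * p \<le> dist x y" using far[of y] that by simp
        ultimately show ?thesis unfolding \<rho>_def by linarith
      qed
      show "y \<in> - star P" if y: "3 * \<rho> < dist z y" for y
      proof -
        define c where "c = (SOME x. x \<in> P)"
        have "c \<in> R" using some_mem[OF P(1)] \<open>P \<subset> R\<close> by (auto simp: c_def)
        then have "dist z c \<le> \<rho>" using dist_in[OF RD z(1)] by (simp add: lR \<rho>_def mult.left_commute mult.commute)
        moreover have "dist z y \<le> dist z c + dist c y" by (rule dist_triangle)
        ultimately have "2 * \<rho> < dist c y" using y by linarith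
        then show ?thesis by (simp add: star_def c_def[symmetric] \<rho>_def p_def)
      qed
    qed (use z \<tau> in auto)
    also have "norm (trunc K (3 * \<rho>) (loc Q) z) \<le> \<tau>" using z(2) \<rho> unfolding trunc_le_def by auto
    finally have "norm (LINT y:- star P|lebesgue. K x y * loc Q y) \<le> (1 + A * 6 ^ DIM('a) + W) * \<tau>"
      by (simp add: algebra_simps)
    also have "\<dots> = 2 * B * (1 + A * 6 ^ DIM('a) + W) * av Q" by (simp add: \<tau>_def)
    also have "\<dots> \<le> sparse_const * av Q" by (intro mult_right_mono const_good av_nonneg)
    finally show ?thesis .
  qed
  have "trunc_le K (loc Q) x (sparse_const * av Q + v)"
    unfolding trunc_le_def
  proof (intro allI impI)
    fix \<delta> :: real assume \<delta>: "\<delta> > 0"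
    from cases[OF \<delta>] consider "side (lev Q) \<le> \<delta>" | R where "R \<in> D" "x \<in> R" "good Q R" "side (lev R) \<le> \<delta>" | "\<delta> < 2 * p" by blast
    then show "norm (trunc K \<delta> (loc Q) x) \<le> sparse_const * av Q + v"
    proof cases
      case 1 then show ?thesis using trunc_large[of Q \<delta> x] real by simp
    next
      case 2 then show ?thesis using transfer(1)[of R x Q \<delta>] real by simp
    next
      case 3
      have p3: "2 * p \<le> 3 * real DIM('a) * p"
      proof -
        have "2 * p \<le> 3 * p" using p by simp
        also have "\<dots> \<le> 3 * real DIM('a) * p" using p d1 by simp
        finally show ?thesis .
      qed
      have i1: "integrable lebesgue (\<lambda>y. indicator {y. \<delta> < dist x y} y *\<^sub>R (K x y * loc P y))"
        by (rule integrable_off[OF loc_integrable _ \<delta>]) auto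
      have p0: "0 < 2 * p" using p by simp
      have i2: "integrable lebesgue (\<lambda>y. indicator (- star P) y *\<^sub>R (K x y * loc Q y))"
        by (rule integrable_off[OF loc_integrable _ p0]) (use far p3 in force)+
      have "(\<lambda>y. indicator {y. \<delta> < dist x y} y *\<^sub>R (K x y * loc Q y)) =
        (\<lambda>y. indicator {y. \<delta> < dist x y} y *\<^sub>R (K x y * loc P y) + indicator (- star P) y *\<^sub>R (K x y * loc Q y))"
      proof
        fix y
        show "indicator {y. \<delta> < dist x y} y *\<^sub>R (K x y * loc Q y) =
          indicator {y. \<delta> < dist x y} y *\<^sub>R (K x y * loc P y) + indicator (- star P) y *\<^sub>R (K x y * loc Q y)"
        proof (cases "y \<in> star P")
          case True
          then have "y \<in> star Q" using star_mono[OF P(1) Q P(2)] by auto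
          then show ?thesis using True by (simp add: loc_def res_def)
        next
          case False
          then have "\<delta> < dist x y" using far[of y] p3 3 by linarith
          then show ?thesis using False by (simp add: loc_def res_def)
        qed
      qed
      then have "trunc K \<delta> (loc Q) x = trunc K \<delta> (loc P) x + (LINT y:- star P|lebesgue. K x y * loc Q y)"
        unfolding trunc_def set_lebesgue_integral_def using i1 i2 by simp
      then have "norm (trunc K \<delta> (loc Q) x) \<le> norm (trunc K \<delta> (loc P) x) + norm (LINT y:- star P|lebesgue. K x y * loc Q y)"
        by (simp add: norm_triangle_ineq)
      also have "\<dots> \<le> v + sparse_const * av Q" using v(1) \<delta> tail_bound unfolding trunc_le_def by (intro add_mono) auto
      finally show ?thesis by simp
    qed
  qed
  moreover have "max_le (loc Q) x (sparse_const * av Q + v)"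
    unfolding max_le_def
  proof (intro allI impI)
    fix \<delta> :: real assume \<delta>: "\<delta> > 0"
    have up: "ennreal (sparse_const * av Q * \<delta> ^ DIM('a)) \<le> ennreal ((sparse_const * av Q + v) * \<delta> ^ DIM('a))"
      "ennreal (v * \<delta> ^ DIM('a)) \<le> ennreal ((sparse_const * av Q + v) * \<delta> ^ DIM('a))"
      using real c0 \<delta> by (auto intro!: ennreal_leI mult_right_mono)
    from cases[OF \<delta>] consider "side (lev Q) \<le> \<delta>" | R where "R \<in> D" "x \<in> R" "good Q R" "side (lev R) \<le> \<delta>" | "\<delta> < 2 * p" by blast
    then show "mass (loc Q) (ball x \<delta>) \<le> ennreal ((sparse_const * av Q + v) * \<delta> ^ DIM('a))"
    proof cases
      case 1 then show ?thesis using max_large[of Q \<delta> x] up(1) by (meson order_trans)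
    next
      case 2 then show ?thesis using transfer(2)[of R x Q \<delta>] up(1) by (meson order_trans)
    next
      case 3
      have "2 * p \<le> 3 * real DIM('a) * p"
      proof -
        have "2 * p \<le> 3 * p" using p by simp
        also have "\<dots> \<le> 3 * real DIM('a) * p" using p d1 by simp
        finally show ?thesis .
      qed
      then have "ball x \<delta> \<subseteq> star P" using far 3 by fastforce
      then have "star Q \<inter> ball x \<delta> = star P \<inter> ball x \<delta>" using star_mono[OF P(1) Q P(2)] by auto
      then have "mass (loc Q) (ball x \<delta>) = mass (loc P) (ball x \<delta>)" by (simp add: loc_def mass_res)
      also have "\<dots> \<le> ennreal (v * \<delta> ^ DIM('a))" using v(2) \<delta> unfolding max_le_def by auto
      finally show ?thesis using up(2) by (rule order_trans)
    qed
  qed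
  moreover have "0 \<le> sparse_const * av Q + v" using c0 real by simp
  ultimately have "joint_max K (loc Q) x \<le> ennreal (sparse_const * av Q + v)" using joint_max_le_iff by blast
  then show ?thesis using real c0 by (simp add: ennreal_plus)
qed simp

lemma local_domination:
  obtains F where "sparse_family D F" "\<And>Q. Q \<in> F \<Longrightarrow> k0 \<le> lev Q"
    "AE x in lebesgue. joint_max K (loc (cell k0 x)) x \<le> (\<Sum>\<^sub>\<infinity>P\<in>F. ennreal (sparse_const * av P) * indicator P x)"
proof (rule principal[of "\<lambda>Q P. \<not> good Q P" "\<lambda>Q. joint_max K (loc Q)" "\<lambda>Q. ennreal (sparse_const * av Q)" k0])
  show "\<exists>E\<in>sets lebesgue. (\<forall>P\<in>D. P \<subseteq> Q \<and> \<not> good Q P \<longrightarrow> P \<subseteq> E) \<and> 2 * emeasure lebesgue E \<le> emeasure lebesgue Q"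
    if "Q \<in> D" for Q by (rule exceptional[OF that])
  show "joint_max K (loc Q) x \<le> ennreal (sparse_const * av Q)"
    if "Q \<in> D" "x \<in> Q" "\<And>P. P \<in> D \<Longrightarrow> P \<subseteq> Q \<Longrightarrow> x \<in> P \<Longrightarrow> \<not> \<not> good Q P" for Q x
    using step_stop[OF that(1,2)] that(3) by blast
  show "joint_max K (loc Q) x \<le> ennreal (sparse_const * av Q) + joint_max K (loc P) x"
    if "Q \<in> D" "P \<in> D" "P \<subset> Q" "\<not> good Q P" "x \<in> P"
      "\<And>R. R \<in> D \<Longrightarrow> P \<subset> R \<Longrightarrow> R \<subseteq> Q \<Longrightarrow> \<not> \<not> good Q R" for Q P x
    using step_descend[OF that(1,2,3,5)] that(6) by blast
qed (rule that)

end

section \<open>Passage to the shifted grids, and the points far from the support\<close>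

lemma grid_sgrid: "grid (sgrid A)" for A :: "'a::euclidean_space set"
  by unfold_locales (rule dyadic_sgrid)

lemma sgrid_lev [simp]: "grid.lev (sgrid A) (scell A k x) = k" for A :: "'a::euclidean_space set"
  using grid.lev_cell[OF grid_sgrid[of A], of k x] by (simp add: sgrid_cell)

lemma scell_in_sgrid [simp]: "scell A k x \<in> sgrid A" for A :: "'a::euclidean_space set"
  by (auto simp: sgrid_def)

lemma emeasure_scell: "emeasure lebesgue (scell A k x) = ennreal (side k ^ DIM('a))" for A :: "'a::euclidean_space set"
  using grid.emeasure_cell[OF grid_sgrid[of A], of k x] by (simp add: sgrid_cell)

lemma avg_scell: "avg (\<lambda>y. ennreal (norm (f y))) (scell A k x) = mass f (scell A k x) / ennreal (side k ^ DIM('a))"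
  for A :: "'a::euclidean_space set"
  by (simp add: avg_def mass_def emeasure_scell)

context cz_principal begin

text \<open>Off the dilate of the starting cube, the support keeps distance at least (|x| + l) / 2
  from x, where l = \<open>side k0\<close>. The remaining part of f therefore adds at most A,
  respectively 1, times m / ((|x| + l) / 2)^d to the truncations and to the maximal function; A + 1
  covers both.\<close>

lemma far_part:
  assumes supp: "mass f (- ball 0 (side k0)) = 0" and Q: "Q \<in> cubes_at D k0" "x \<in> Q"
    and m: "mass f UNIV \<le> ennreal m" "0 \<le> m"
  shows "joint_max K f x \<le> joint_max K (loc Q) x + ennreal ((A + 1) * 2 ^ DIM('a) * m / (norm x + side k0) ^ DIM('a))"
proof (cases "joint_max K (loc Q) x")
  case (real v)
  have QD: "Q \<in> D" using Q(1) by (rule cubes_at_D)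
  have lev: "lev Q = k0" using Q(1) by (rule lev_cubes_at)
  have v: "trunc_le K (loc Q) x v" "max_le (loc Q) x v"
    using joint_max_le_iff[of v K "loc Q" x] real by auto
  define l where "l = side k0"
  define \<eta> where "\<eta> = (norm x + l) / 2"
  have l: "0 < l" by (simp add: l_def)
  have \<eta>: "0 < \<eta>" using l by (simp add: \<eta>_def add_nonneg_pos)
  have fm: "f \<in> borel_measurable lebesgue" using f by auto
  have sB: "- ball 0 l \<in> sets lebesgue" for l by (subst Compl_in_sets_lebesgue) simp
  \<comment> \<open>The distance is at least 3 l and at least |x| - l, hence |x| + l \<le> dist + 2
    l \<le> 2 dist.\<close>
  have away: "\<eta> \<le> dist x y" if "y \<in> ball 0 l" "y \<notin> star Q" for y
  proof -
    have "3 * real DIM('a) * l \<le> dist x y"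
      using far_from_star[OF QD Q(2) that(2)] by (simp add: lev l_def)
    moreover have "3 * l \<le> 3 * real DIM('a) * l" using d1 l by simp
    moreover have "norm x \<le> dist x y + norm y"
      by (metis dist_0_norm dist_commute dist_triangle add.commute)
    moreover have "norm y < l" using that(1) by simp
    ultimately have "norm x + l \<le> 2 * dist x y" using l by linarith
    then show ?thesis by (simp add: \<eta>_def)
  qed
  have zero: "AE y in lebesgue. y \<notin> ball 0 l \<longrightarrow> f y = 0"
  proof -
    have [measurable]: "f \<in> borel_measurable lebesgue" by (rule fm)
    have [measurable]: "- ball 0 l \<in> sets lebesgue" by (rule sB)
    have "(\<lambda>y. ennreal (norm (f y)) * indicator (- ball 0 l) y) \<in> borel_measurable lebesgue" by measurable
    then have "AE y in lebesgue. ennreal (norm (f y)) * indicator (- ball 0 l) y = 0"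
      using supp unfolding mass_def l_def[symmetric] by (simp only: nn_integral_0_iff_AE)
    then show ?thesis by eventually_elim (auto simp: indicator_def split: if_splits)
  qed
  have c: "(A + 1) * 2 ^ DIM('a) * m / (norm x + side k0) ^ DIM('a) = (A + 1) * m / \<eta> ^ DIM('a)"
    by (simp add: \<eta>_def l_def power_divide)
  have Am: "A * m / \<eta> ^ DIM('a) \<le> (A + 1) * m / \<eta> ^ DIM('a)" "m / \<eta> ^ DIM('a) \<le> (A + 1) * m / \<eta> ^ DIM('a)"
    using \<eta> m A by (auto intro!: divide_right_mono mult_right_mono simp: algebra_simps)
  have "trunc_le K f x (v + (A + 1) * m / \<eta> ^ DIM('a))"
    unfolding trunc_le_def
  proof (intro allI impI)
    fix \<delta> :: real assume \<delta>: "\<delta> > 0"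
    define G where "G = {y. \<delta> < dist x y} \<inter> (- star Q) \<inter> ball 0 l"
    have Gs: "G \<in> sets lebesgue" unfolding G_def by (intro sets.Int) auto
    have i0: "integrable lebesgue (\<lambda>y. indicator {y. \<delta> < dist x y} y *\<^sub>R (K x y * f y))"
      by (rule integrable_off[OF f _ \<delta>]) auto
    have i1: "integrable lebesgue (\<lambda>y. indicator {y. \<delta> < dist x y} y *\<^sub>R (K x y * loc Q y))"
      by (rule integrable_off[OF loc_integrable _ \<delta>]) auto
    have i2: "integrable lebesgue (\<lambda>y. indicator G y *\<^sub>R (K x y * f y))"
      by (rule integrable_off[OF f Gs \<eta>]) (use away in \<open>auto simp: G_def\<close>)
    have "trunc K \<delta> f x = integral\<^sup>L lebesgue (\<lambda>y. indicator {y. \<delta> < dist x y} y *\<^sub>R (K x y * loc Q y) + indicator G y *\<^sub>R (K x y * f y))"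
      unfolding trunc_def set_lebesgue_integral_def
    proof (rule integral_cong_AE)
      show "(\<lambda>y. indicator {y. \<delta> < dist x y} y *\<^sub>R (K x y * f y)) \<in> borel_measurable lebesgue" using i0 by auto
      show "(\<lambda>y. indicator {y. \<delta> < dist x y} y *\<^sub>R (K x y * loc Q y) + indicator G y *\<^sub>R (K x y * f y)) \<in> borel_measurable lebesgue"
        using i1 i2 by auto
      show "AE y in lebesgue. indicator {y. \<delta> < dist x y} y *\<^sub>R (K x y * f y) =
          indicator {y. \<delta> < dist x y} y *\<^sub>R (K x y * loc Q y) + indicator G y *\<^sub>R (K x y * f y)"
        using zero
      proof eventually_elim
        case (elim y)
        then show ?case
          by (cases "y \<in> star Q"; cases "y \<in> ball 0 l") (auto simp: G_def loc_def res_def indicator_def)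
      qed
    qed
    also have "\<dots> = trunc K \<delta> (loc Q) x + (LINT y:G|lebesgue. K x y * f y)"
      unfolding trunc_def set_lebesgue_integral_def using i1 i2 by simp
    finally have "norm (trunc K \<delta> f x) \<le> norm (trunc K \<delta> (loc Q) x) + norm (LINT y:G|lebesgue. K x y * f y)"
      by (simp add: norm_triangle_ineq)
    also have "\<dots> \<le> v + A / \<eta> ^ DIM('a) * m"
    proof (rule add_mono)
      show "norm (trunc K \<delta> (loc Q) x) \<le> v" using v(1) \<delta> unfolding trunc_le_def by auto
      show "norm (LINT y:G|lebesgue. K x y * f y) \<le> A / \<eta> ^ DIM('a) * m"
      proof (rule norm_off[OF f Gs \<eta>])
        show "mass f G \<le> ennreal m" using mass_mono[of G UNIV f] m by (meson order_trans subset_UNIV)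
      qed (use away m in \<open>auto simp: G_def\<close>)
    qed
    finally show "norm (trunc K \<delta> f x) \<le> v + (A + 1) * m / \<eta> ^ DIM('a)" using Am by simp
  qed
  moreover have "max_le f x (v + (A + 1) * m / \<eta> ^ DIM('a))"
    unfolding max_le_def
  proof (intro allI impI)
    fix r :: real assume r: "r > 0"
    have split: "mass f (ball x r) \<le> mass (loc Q) (ball x r) + mass f (ball x r \<inter> (ball 0 l - star Q))"
    proof -
      have [measurable]: "f \<in> borel_measurable lebesgue" by (rule fm)
      have [measurable]: "star Q \<inter> ball x r \<in> sets lebesgue" by auto
      have [measurable]: "ball x r \<inter> (ball 0 l - star Q) \<in> sets lebesgue"
        by (intro sets.Int sets.Diff) auto
      have "mass f (ball x r) \<le> (\<integral>\<^sup>+y. ennreal (norm (f y)) * indicator (star Q \<inter> ball x r) y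
          + ennreal (norm (f y)) * indicator (ball x r \<inter> (ball 0 l - star Q)) y \<partial>lebesgue)"
        unfolding mass_def
      proof (rule nn_integral_mono_AE)
        show "AE y in lebesgue. ennreal (norm (f y)) * indicator (ball x r) y \<le> ennreal (norm (f y)) * indicator (star Q \<inter> ball x r) y
          + ennreal (norm (f y)) * indicator (ball x r \<inter> (ball 0 l - star Q)) y"
          using zero by eventually_elim (auto simp: indicator_def)
      qed
      also have "\<dots> = mass (loc Q) (ball x r) + mass f (ball x r \<inter> (ball 0 l - star Q))"
        unfolding loc_def mass_res unfolding mass_def by (rule nn_integral_add) measurable
      finally show ?thesis .
    qed
    have "mass f (ball x r \<inter> (ball 0 l - star Q)) \<le> ennreal (m / \<eta> ^ DIM('a) * r ^ DIM('a))"
    proof (cases "ball x r \<inter> (ball 0 l - star Q) = {}")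
      case True
      then have "mass f (ball x r \<inter> (ball 0 l - star Q)) = 0" by (simp add: mass_def)
      then show ?thesis by simp
    next
      case False
      then obtain y where "y \<in> ball x r" "y \<in> ball 0 l" "y \<notin> star Q" by auto
      then have "\<eta> \<le> r" using away[of y] by simp
      then have "\<eta> ^ DIM('a) \<le> r ^ DIM('a)" using \<eta> by (intro power_mono) auto
      then have "1 \<le> r ^ DIM('a) / \<eta> ^ DIM('a)" using \<eta> by (simp add: pos_le_divide_eq)
      then have "m * 1 \<le> m * (r ^ DIM('a) / \<eta> ^ DIM('a))" using m by (intro mult_left_mono) auto
      then have "ennreal m \<le> ennreal (m / \<eta> ^ DIM('a) * r ^ DIM('a))" by (intro ennreal_leI) simp
      moreover have "mass f (ball x r \<inter> (ball 0 l - star Q)) \<le> ennreal m"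
        using mass_mono[of _ UNIV f] m by (meson order_trans subset_UNIV)
      ultimately show ?thesis by (rule order_trans[rotated])
    qed
    then have "mass f (ball x r) \<le> ennreal (v * r ^ DIM('a)) + ennreal (m / \<eta> ^ DIM('a) * r ^ DIM('a))"
      using split v(2) r unfolding max_le_def by (meson add_mono order_trans)
    also have "\<dots> = ennreal ((v + m / \<eta> ^ DIM('a)) * r ^ DIM('a))"
      using real m \<eta> r by (simp add: ennreal_plus[symmetric] distrib_right del: ennreal_plus)
    also have "\<dots> \<le> ennreal ((v + (A + 1) * m / \<eta> ^ DIM('a)) * r ^ DIM('a))"
      using Am r by (intro ennreal_leI mult_right_mono) auto
    finally show "mass f (ball x r) \<le> ennreal ((v + (A + 1) * m / \<eta> ^ DIM('a)) * r ^ DIM('a))" .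
  qed
  moreover have "0 \<le> (A + 1) * m / \<eta> ^ DIM('a)" using \<eta> m A by simp
  ultimately have "joint_max K f x \<le> ennreal (v + (A + 1) * m / \<eta> ^ DIM('a))"
    using joint_max_le_iff[of "v + (A + 1) * m / \<eta> ^ DIM('a)" K f x] real by auto
  then show ?thesis unfolding c using real \<open>0 \<le> (A + 1) * m / \<eta> ^ DIM('a)\<close> by (simp add: ennreal_plus)
qed simp

text \<open>The dilate of Q lies in a cube \<open>p Q\<close> of a shifted grid; 24 d = 6 * 4 d is
  what the one-third trick asks of the ratio 2^n of the sides. Distinct Q may share the same
  \<open>p Q\<close>. For the Carleson bound one Q per cube is enough, represented by its disjoint
  major part. For the pointwise sum only the Q through x count, and those with equal
  \<open>p Q\<close> have equal level and so coincide.\<close>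

lemma adjacent_families:
  assumes F: "sparse_family D F" "\<And>Q. Q \<in> F \<Longrightarrow> k0 \<le> lev Q" and n: "24 * real DIM('a) \<le> 2 ^ n"
  obtains S where "\<And>A. S A \<subseteq> sgrid A" "\<And>A P. P \<in> S A \<Longrightarrow> k0 - int n \<le> grid.lev (sgrid A) P"
    "\<And>A G R. finite G \<Longrightarrow> G \<subseteq> S A \<Longrightarrow> R \<in> sgrid A \<Longrightarrow> \<forall>P\<in>G. P \<subseteq> R \<Longrightarrow>
       (\<Sum>P\<in>G. emeasure lebesgue P) \<le> ennreal (2 * (2 ^ n) ^ DIM('a)) * emeasure lebesgue R"
    "\<And>x. (\<Sum>\<^sub>\<infinity>Q\<in>F. ennreal (sparse_const * av Q) * indicator Q x) \<le> ennreal (sparse_const * (2 ^ n) ^ DIM('a)) *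
       (\<Sum>A\<in>Pow Basis. \<Sum>\<^sub>\<infinity>P\<in>S A. avg (\<lambda>y. ennreal (norm (f y))) P * indicator P x)"
proof -
  have FD: "F \<subseteq> D" using F(1) by (simp add: sparse_family_def)
  have "\<exists>A. A \<subseteq> Basis \<and> star Q \<subseteq> scell A (lev Q - int n) (SOME x. x \<in> Q)" for Q
  proof -
    have "6 * (4 * real DIM('a) * side (lev Q)) \<le> 2 ^ n * side (lev Q)"
      using mult_right_mono[OF n, of "side (lev Q)"] by simp
    then show ?thesis unfolding star_def by (intro ball_in_scell) (simp add: side_diff)
  qed
  then obtain a where a: "\<And>Q. a Q \<subseteq> Basis" "\<And>Q. star Q \<subseteq> scell (a Q) (lev Q - int n) (SOME x. x \<in> Q)" by metis
  define p where "p Q = scell (a Q) (lev Q - int n) (SOME x. x \<in> Q)" for Q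
  have Qp: "Q \<subseteq> p Q" if "Q \<in> F" for Q
  proof
    fix x assume x: "x \<in> Q"
    have QD: "Q \<in> D" using that FD by auto
    have "dist (SOME x. x \<in> Q) x \<le> real DIM('a) * side (lev Q)" using dist_in[OF QD some_mem[OF QD] x] .
    also have "\<dots> < 4 * real DIM('a) * side (lev Q)" using d1 by simp
    finally have "x \<in> star Q" by (simp add: star_def)
    then show "x \<in> p Q" using a(2) by (auto simp: p_def)
  qed
  have lev_p: "grid.lev (sgrid (a Q)) (p Q) = lev Q - int n" for Q by (simp add: p_def)
  have em_p: "emeasure lebesgue (p Q) = ennreal ((2 ^ n) ^ DIM('a)) * emeasure lebesgue Q" if "Q \<in> F" for Q
  proof -
    have "emeasure lebesgue (p Q) = ennreal ((2 ^ n * side (lev Q)) ^ DIM('a))"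
      unfolding p_def emeasure_scell side_diff ..
    also have "\<dots> = ennreal ((2 ^ n) ^ DIM('a)) * ennreal (side (lev Q) ^ DIM('a))"
      unfolding power_mult_distrib by (rule ennreal_mult') simp
    also have "ennreal (side (lev Q) ^ DIM('a)) = emeasure lebesgue Q"
      using that FD by (simp add: emeasure_lev subset_iff)
    finally show ?thesis .
  qed
  define S where "S A = p ` {Q\<in>F. a Q = A}" for A
  obtain E where E: "\<And>Q. Q \<in> F \<Longrightarrow> E Q \<in> sets lebesgue" "\<And>Q. Q \<in> F \<Longrightarrow> E Q \<subseteq> Q"
    "\<And>Q. Q \<in> F \<Longrightarrow> emeasure lebesgue Q \<le> 2 * emeasure lebesgue (E Q)" "disjoint_family_on E F"
    using sparse_disjoint_parts[OF F] by metis
  show ?thesis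
  proof (rule that[of S])
    show SA: "S A \<subseteq> sgrid A" for A by (auto simp: S_def p_def)
    show "k0 - int n \<le> grid.lev (sgrid A) P" if P: "P \<in> S A" for A P
    proof -
      obtain Q where Q: "Q \<in> F" "a Q = A" "P = p Q" using P by (auto simp: S_def)
      then show ?thesis using lev_p[of Q] F(2)[of Q] by simp
    qed
    show "(\<Sum>P\<in>G. emeasure lebesgue P) \<le> ennreal (2 * (2 ^ n) ^ DIM('a)) * emeasure lebesgue R"
      if G: "finite G" "G \<subseteq> S A" and R: "R \<in> sgrid A" and sub: "\<forall>P\<in>G. P \<subseteq> R" for A G R
    proof -
      have "\<exists>Q. Q \<in> F \<and> p Q = P" if "P \<in> G" for P using that G by (auto simp: S_def)
      then obtain q where q: "\<And>P. P \<in> G \<Longrightarrow> q P \<in> F" "\<And>P. P \<in> G \<Longrightarrow> p (q P) = P" by metis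
      have inj: "inj_on q G" using q(2) by (metis inj_onI)
      have Rs: "R \<in> sets lebesgue" using grid.D_sets[OF grid_sgrid R] .
      have "(\<Sum>P\<in>G. emeasure lebesgue P) \<le> (\<Sum>P\<in>G. ennreal (2 * (2 ^ n) ^ DIM('a)) * emeasure lebesgue (E (q P)))"
      proof (rule sum_mono)
        fix P assume P: "P \<in> G"
        have "emeasure lebesgue P = ennreal ((2 ^ n) ^ DIM('a)) * emeasure lebesgue (q P)"
          using em_p[OF q(1)[OF P]] q(2)[OF P] by simp
        also have "\<dots> \<le> ennreal ((2 ^ n) ^ DIM('a)) * (2 * emeasure lebesgue (E (q P)))"
          by (intro mult_left_mono E q P) simp
        also have "\<dots> = ennreal (2 * (2 ^ n) ^ DIM('a)) * emeasure lebesgue (E (q P))"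
        proof -
          have "ennreal (2 * (2 ^ n) ^ DIM('a)) = ennreal 2 * ennreal ((2 ^ n) ^ DIM('a))" by (rule ennreal_mult') simp
          then show ?thesis by (simp add: mult.assoc mult.left_commute)
        qed
        finally show "emeasure lebesgue P \<le> ennreal (2 * (2 ^ n) ^ DIM('a)) * emeasure lebesgue (E (q P))" .
      qed
      also have "\<dots> = ennreal (2 * (2 ^ n) ^ DIM('a)) * (\<Sum>P\<in>G. emeasure lebesgue (E (q P)))"
        by (simp add: sum_distrib_left)
      also have "\<dots> \<le> ennreal (2 * (2 ^ n) ^ DIM('a)) * emeasure lebesgue R"
      proof (intro mult_left_mono sum_emeasure_disjoint_le[OF G(1)] Rs)
        show "disjoint_family_on (\<lambda>P. E (q P)) G"
          unfolding disjoint_family_on_def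
        proof (intro ballI impI)
          fix P P' assume "P \<in> G" "P' \<in> G" "P \<noteq> P'"
          then have "q P \<in> F" "q P' \<in> F" "q P \<noteq> q P'" using q inj by (auto simp: inj_on_def)
          then show "E (q P) \<inter> E (q P') = {}" using E(4) by (auto simp: disjoint_family_on_def)
        qed
        fix P assume P: "P \<in> G"
        show "E (q P) \<in> sets lebesgue" by (rule E(1)[OF q(1)[OF P]])
        have "E (q P) \<subseteq> q P" by (rule E(2)[OF q(1)[OF P]])
        also have "q P \<subseteq> p (q P)" by (rule Qp[OF q(1)[OF P]])
        also have "p (q P) \<subseteq> R" using q(2)[OF P] bspec[OF sub P] by simp
        finally show "E (q P) \<subseteq> R" .
      qed simp
      finally show ?thesis .
    qed
    fix x
    define h where "h = (\<lambda>y. ennreal (norm (f y)))"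
    define c where "c = ennreal (sparse_const * (2 ^ n) ^ DIM('a))"
    show "(\<Sum>\<^sub>\<infinity>Q\<in>F. ennreal (sparse_const * av Q) * indicator Q x) \<le> ennreal (sparse_const * (2 ^ n) ^ DIM('a)) *
       (\<Sum>A\<in>Pow Basis. \<Sum>\<^sub>\<infinity>P\<in>S A. avg (\<lambda>y. ennreal (norm (f y))) P * indicator P x)"
      unfolding h_def[symmetric] c_def[symmetric]
    proof (rule infsum_ennreal_le)
      fix G assume G: "finite G" "G \<subseteq> F"
      define H where "H = {Q\<in>G. x \<in> Q}"
      have H: "finite H" "H \<subseteq> F" using G by (auto simp: H_def)
      have av_p: "ennreal (sparse_const * av Q) \<le> c * avg h (p Q)" if Q: "Q \<in> F" for Q
      proof -
        have QD: "Q \<in> D" using Q FD by auto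
        define s where "s = side (lev Q) ^ DIM('a)"
        have s: "0 < s" by (simp add: s_def)
        have avp: "avg h (p Q) = mass f (p Q) / ennreal ((2 ^ n) ^ DIM('a) * s)"
          unfolding p_def h_def avg_scell side_diff s_def power_mult_distrib ..
        obtain M where M: "mass f (p Q) = ennreal M" "0 \<le> M"
          using mass_real[OF f] by (metis enn2real_nonneg)
        have "ennreal (av Q * s) \<le> ennreal M"
          using mass_mono[OF a(2)[of Q], of f] M unfolding mass_star p_def[symmetric] s_def by simp
        then have "av Q * s \<le> M" using M by simp
        then have "av Q \<le> M / s" using s by (simp add: pos_le_divide_eq)
        then have "sparse_const * av Q \<le> sparse_const * (M / s)" using const_pos by (intro mult_left_mono) auto
        then have "ennreal (sparse_const * av Q) \<le> ennreal (sparse_const * (M / s))" by (rule ennreal_leI)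
        also have "sparse_const * (M / s) = (sparse_const * (2 ^ n) ^ DIM('a)) * (M / ((2 ^ n) ^ DIM('a) * s))" by simp
        also have "ennreal \<dots> = c * ennreal (M / ((2 ^ n) ^ DIM('a) * s))"
          unfolding c_def using const_pos by (intro ennreal_mult') simp
        also have "ennreal (M / ((2 ^ n) ^ DIM('a) * s)) = avg h (p Q)"
          unfolding avp M(1) using M s by (intro divide_ennreal[symmetric]) auto
        finally show ?thesis .
      qed
      have "(\<Sum>Q\<in>G. ennreal (sparse_const * av Q) * indicator Q x) = (\<Sum>Q\<in>H. ennreal (sparse_const * av Q))"
        unfolding H_def using G(1) by (intro sum.mono_neutral_cong_right) auto
      also have "\<dots> \<le> (\<Sum>Q\<in>H. c * avg h (p Q))" using H av_p by (intro sum_mono) auto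
      also have "\<dots> = c * (\<Sum>Q\<in>H. avg h (p Q))" by (simp add: sum_distrib_left)
      also have "(\<Sum>Q\<in>H. avg h (p Q)) = (\<Sum>A\<in>Pow Basis. \<Sum>Q\<in>{Q\<in>H. a Q = A}. avg h (p Q))"
        using a(1) by (intro sum.group[symmetric] H) auto
      also have "c * \<dots> \<le> c * (\<Sum>A\<in>Pow Basis. \<Sum>\<^sub>\<infinity>P\<in>S A. avg h P * indicator P x)"
      proof (intro mult_left_mono sum_mono)
        fix A :: "'a set" assume "A \<in> Pow Basis"
        define HA where "HA = {Q\<in>H. a Q = A}"
        have inj: "inj_on p HA"
        proof (rule inj_onI)
          fix Q Q' assume QQ: "Q \<in> HA" "Q' \<in> HA" "p Q = p Q'"
          then have "lev Q = lev Q'" using lev_p[of Q] lev_p[of Q'] by (auto simp: HA_def)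
          moreover have "Q \<in> D" "Q' \<in> D" "x \<in> Q" "x \<in> Q'" using QQ H FD by (auto simp: HA_def H_def)
          moreover have "Q = cell (lev Q) x" "Q' = cell (lev Q') x"
            using cell_lev[of Q x] cell_lev[of Q' x] calculation(2-) by auto
          ultimately show "Q = Q'" by metis
        qed
        have "(\<Sum>Q\<in>HA. avg h (p Q)) = (\<Sum>P\<in>p ` HA. avg h P)"
          by (simp add: sum.reindex[OF inj])
        also have "\<dots> = (\<Sum>P\<in>p ` HA. avg h P * indicator P x)"
        proof (rule sum.cong)
          fix P assume "P \<in> p ` HA"
          then obtain Q where Q: "Q \<in> HA" "P = p Q" by auto
          then have "x \<in> P" using Qp[of Q] H by (auto simp: HA_def H_def)
          then show "avg h P = avg h P * indicator P x" by simp
        qed simp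
        also have "\<dots> \<le> (\<Sum>\<^sub>\<infinity>P\<in>S A. avg h P * indicator P x)"
          by (rule sum_le_infsum_ennreal) (use H in \<open>auto simp: S_def HA_def\<close>)
        finally show "(\<Sum>Q\<in>{Q\<in>H. a Q = A}. avg h (p Q)) \<le> (\<Sum>\<^sub>\<infinity>P\<in>S A. avg h P * indicator P x)"
          by (simp add: HA_def)
      qed simp
      finally show "(\<Sum>Q\<in>G. ennreal (sparse_const * av Q) * indicator Q x) \<le> c *
        (\<Sum>A\<in>Pow Basis. \<Sum>\<^sub>\<infinity>P\<in>S A. avg h P * indicator P x)" .
    qed
  qed
qed

end

text \<open>The increasing chain of cubes around the origin accounts for the points far from the support.\<close>

lemma chain_sparse:
  "sparse_family (sgrid Basis) {scell (Basis :: 'a::euclidean_space set) k 0 | k. k \<le> k0}"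
  unfolding sparse_family_def
proof (intro conjI ballI)
  define S where "S = {scell (Basis :: 'a set) k 0 | k. k \<le> k0}"
  interpret grid "sgrid (Basis :: 'a set)" by (rule grid_sgrid)
  show "{scell (Basis :: 'a set) k 0 | k. k \<le> k0} \<subseteq> sgrid Basis" by auto
  have psub: "scell (Basis :: 'a set) j 0 \<subset> scell Basis k 0 \<longleftrightarrow> k < j" for j k
    using cell_psubset_iff[of j 0 k] by (simp add: sgrid_cell)
  fix P :: "'a set" assume "P \<in> {scell Basis k 0 | k. k \<le> k0}"
  then obtain k where k: "P = scell Basis k 0" "k \<le> k0" by auto
  \<comment> \<open>The chain has a cube at every level up to \<open>k0\<close>, so the only
    possible child of P is the next cube, whose volume is 2^-d times that of P.\<close>
  have ch: "children S P \<subseteq> {scell Basis (k + 1) 0}"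
  proof
    fix Q assume Q: "Q \<in> children S P"
    then obtain j where j: "Q = scell Basis j 0" "j \<le> k0" by (auto simp: children_def S_def)
    have "k < j" using Q psub[of j k] by (simp add: children_def k j)
    have "\<not> k + 1 < j"
    proof
      assume "k + 1 < j"
      then have "scell (Basis :: 'a set) (k + 1) 0 \<in> S" "scell (Basis :: 'a set) (k + 1) 0 \<subset> P"
          "Q \<subset> scell Basis (k + 1) 0"
        using j psub by (auto simp: S_def k simp del: psubsetI)
      then show False using Q by (auto simp: children_def)
    qed
    then have "j = k + 1" using \<open>k < j\<close> by simp
    then show "Q \<in> {scell Basis (k + 1) 0}" by (simp add: j)
  qed
  have "(\<Sum>\<^sub>\<infinity>Q\<in>children S P. emeasure lebesgue Q) \<le> emeasure lebesgue (scell (Basis :: 'a set) (k + 1) 0)"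
  proof (rule infsum_ennreal_le)
    fix G assume "finite G" "G \<subseteq> children S P"
    then have "G \<subseteq> {scell Basis (k + 1) 0}" using ch by auto
    then have "sum (emeasure lebesgue) G \<le> sum (emeasure lebesgue) {scell (Basis :: 'a set) (k + 1) 0}"
      by (intro sum_mono2) auto
    then show "sum (emeasure lebesgue) G \<le> emeasure lebesgue (scell (Basis :: 'a set) (k + 1) 0)" by simp
  qed
  also have "\<dots> = ennreal ((side k / 2) ^ DIM('a))" by (simp add: emeasure_scell side_Suc)
  also have "\<dots> \<le> ennreal (side k ^ DIM('a) / 2)"
  proof (rule ennreal_leI)
    have "(2::real) ^ 1 \<le> 2 ^ DIM('a)" by (intro power_increasing) (auto simp: DIM_positive Suc_leI)
    then have "side k ^ DIM('a) / 2 ^ DIM('a) \<le> side k ^ DIM('a) / 2" by (intro divide_left_mono) auto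
    then show "(side k / 2) ^ DIM('a) \<le> side k ^ DIM('a) / 2" by (simp add: power_divide)
  qed
  also have "\<dots> = ennreal (side k ^ DIM('a)) / ennreal 2" by (intro divide_ennreal[symmetric]) auto
  also have "\<dots> = emeasure lebesgue P / 2" by (simp add: k emeasure_scell)
  finally show "(\<Sum>\<^sub>\<infinity>Q\<in>children {scell Basis k 0 | k. k \<le> k0} P. emeasure lebesgue Q) \<le> emeasure lebesgue P / 2"
    by (simp add: S_def)
qed

text \<open>Both x and, up to a null set, the support of f lie in the ball of radius u = |x| +
  \<open>side k0\<close>. Some cube of the chain with side between 3 u and 6 u contains that ball,
  and the average over it is at least m / (6 u)^d.\<close>

lemma chain_bound:
  fixes f :: "'a::euclidean_space \<Rightarrow> complex"
  assumes supp: "mass f (- ball 0 (side k0)) = 0" and f: "integrable lebesgue f"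
    and m: "mass f UNIV = ennreal m" "0 \<le> m" and c: "0 \<le> c"
  shows "ennreal (c * m / (norm x + side k0) ^ DIM('a)) \<le> ennreal (c * 6 ^ DIM('a)) *
    (\<Sum>\<^sub>\<infinity>P\<in>{scell Basis k 0 | k. k \<le> k0}. avg (\<lambda>y. ennreal (norm (f y))) P * indicator P x)"
proof -
  define u where "u = norm x + side k0"
  have u: "0 < u" "side k0 \<le> u" "norm x < u" using side_pos[of k0] norm_ge_zero[of x] unfolding u_def by linarith+
  obtain j where j: "side j \<le> 3 * u" "3 * u < 2 * side j" by (rule ex_side[of "3 * u"]) (use u in auto)
  define k where "k = j - 1"
  have szk: "side k = 2 * side j" using side_Suc[of k] by (simp add: k_def)
  have k: "3 * u \<le> side k" "side k \<le> 6 * u" using j szk by auto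
  have "side k0 < side k" using k u side_pos[of k0] by linarith
  then have kk: "k \<le> k0" by simp
  define P where "P = scell (Basis :: 'a set) k 0"
  have ball: "ball 0 u \<subseteq> P" unfolding P_def by (rule ball_in_chain[OF k(1)])
  then have xP: "x \<in> P" using u by (auto simp: subset_iff)
  have "mass f UNIV \<le> mass f (ball 0 (side k0)) + mass f (- ball 0 (side k0))"
  proof -
    have [measurable]: "f \<in> borel_measurable lebesgue" "ball (0::'a) (side k0) \<in> sets lebesgue"
      using f by auto
    have [measurable]: "- ball (0::'a) (side k0) \<in> sets lebesgue" by (subst Compl_in_sets_lebesgue) simp
    have "mass f UNIV = (\<integral>\<^sup>+y. ennreal (norm (f y)) * indicator (ball 0 (side k0)) y + ennreal (norm (f y)) * indicator (- ball 0 (side k0)) y \<partial>lebesgue)"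
      unfolding mass_def by (rule nn_integral_cong) (auto simp: indicator_def)
    also have "\<dots> = mass f (ball 0 (side k0)) + mass f (- ball 0 (side k0))"
      unfolding mass_def by (rule nn_integral_add) measurable
    finally show ?thesis by simp
  qed
  also have "\<dots> = mass f (ball 0 (side k0))" by (simp add: supp)
  also have "\<dots> \<le> mass f P"
  proof (rule mass_mono)
    have "ball (0::'a) (side k0) \<subseteq> ball 0 u" using u(2) by (rule subset_ball)
    then show "ball 0 (side k0) \<subseteq> P" using ball by auto
  qed
  finally have mP: "ennreal m \<le> mass f P" using m by simp
  define h where "h = (\<lambda>y. ennreal (norm (f y)))"
  have "ennreal (m / side k ^ DIM('a)) = ennreal m / ennreal (side k ^ DIM('a))"
    using m by (intro divide_ennreal[symmetric]) auto
  also have "\<dots> \<le> mass f P / ennreal (side k ^ DIM('a))" by (rule divide_right_mono_ennreal[OF mP])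
  also have "\<dots> = avg h P" by (simp add: P_def h_def avg_scell)
  finally have av: "ennreal (m / side k ^ DIM('a)) \<le> avg h P" .
  have "ennreal (c * m / u ^ DIM('a)) \<le> ennreal ((c * 6 ^ DIM('a)) * (m / side k ^ DIM('a)))"
  proof (rule ennreal_leI)
    have "side k ^ DIM('a) \<le> (6 * u) ^ DIM('a)" using k by (intro power_mono) auto
    then have "m / (6 * u) ^ DIM('a) \<le> m / side k ^ DIM('a)" using m u by (intro divide_left_mono mult_pos_pos) auto
    then have "(c * 6 ^ DIM('a)) * (m / (6 * u) ^ DIM('a)) \<le> (c * 6 ^ DIM('a)) * (m / side k ^ DIM('a))"
      using c by (intro mult_left_mono) auto
    then show "c * m / u ^ DIM('a) \<le> (c * 6 ^ DIM('a)) * (m / side k ^ DIM('a))" by (simp add: power_mult_distrib)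
  qed
  also have "\<dots> = ennreal (c * 6 ^ DIM('a)) * ennreal (m / side k ^ DIM('a))"
    using c by (intro ennreal_mult') simp
  also have "\<dots> \<le> ennreal (c * 6 ^ DIM('a)) * avg h P" by (intro mult_left_mono av) simp
  also have "avg h P = (\<Sum>Q\<in>{P}. avg h Q * indicator Q x)" using xP by simp
  also have "ennreal (c * 6 ^ DIM('a)) * \<dots> \<le> ennreal (c * 6 ^ DIM('a)) *
      (\<Sum>\<^sub>\<infinity>P\<in>{scell Basis k 0 | k. k \<le> k0}. avg h P * indicator P x)"
    by (intro mult_left_mono sum_le_infsum_ennreal) (use kk in \<open>auto simp: P_def\<close>)
  finally show ?thesis by (simp add: u_def h_def)
qed

lemma compactly_supported_mass:
  fixes f :: "'a::euclidean_space \<Rightarrow> complex"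
  assumes "compactly_supported f"
  obtains k0 where "mass f (- ball 0 (side k0)) = 0"
proof -
  obtain C where C: "compact C" "AE x in lebesgue. x \<notin> C \<longrightarrow> f x = 0"
    using assms by (auto simp: compactly_supported_def)
  obtain r where r: "0 < r" "C \<subseteq> ball 0 r"
    using bounded_subset_ballD[OF compact_imp_bounded[OF C(1)], of 0] by auto
  obtain j where j: "r < 2 * side j" by (rule ex_side[OF r(1)])
  have "side (j - 1) = 2 * side j" using side_Suc[of "j - 1"] by simp
  then have "C \<subseteq> ball 0 (side (j - 1))" using r j by (auto simp: subset_iff)
  then have "AE y in lebesgue. ennreal (norm (f y)) * indicator (- ball 0 (side (j - 1))) y = 0"
    using C(2) by (auto elim!: eventually_mono)
  then have "mass f (- ball 0 (side (j - 1))) = (\<integral>\<^sup>+(y::'a). 0 \<partial>lebesgue)"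
    unfolding mass_def by (rule nn_integral_cong_AE)
  then show ?thesis by (intro that[of "j - 1"]) simp
qed

lemma (in cz_weak) joint_sparse_bound:
  "\<exists>C>0. \<forall>f. integrable lebesgue f \<and> compactly_supported f \<longrightarrow>
     (\<exists>S. sum_of_sparse_operators (2 ^ DIM('a) + 1) S \<and>
       (AE x in lebesgue. joint_max K f x \<le> ennreal C * S (\<lambda>y. ennreal (norm (f y))) x))"
proof -
  \<comment> \<open>The value of \<open>sparse_const\<close>, written out because that constant
    belongs to a locale in which f is fixed, whereas C is chosen before f.\<close>
  define c1 where "c1 = A + 1 + 2 * B * (1 + A * (4 * real DIM('a)) ^ DIM('a) + W + A * 6 ^ DIM('a) + (1 + real DIM('a)) ^ DIM('a))"
  obtain n :: nat where n: "24 * real DIM('a) \<le> 2 ^ n"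
    using real_arch_pow[of 2 "24 * real DIM('a)"] by (auto intro: less_imp_le)
  define c2 where "c2 = c1 * (2 ^ n) ^ DIM('a)"
  define L :: real where "L = 2 * (2 ^ n) ^ DIM('a)"
  define c3 where "c3 = (A + 1) * 2 ^ DIM('a) * 6 ^ DIM('a)"
  have c1: "0 < c1"
  proof -
    have "0 \<le> 2 * B * (1 + A * (4 * real DIM('a)) ^ DIM('a) + W + A * 6 ^ DIM('a) + (1 + real DIM('a)) ^ DIM('a))"
      using A B W_nonneg by (intro mult_nonneg_nonneg add_nonneg_nonneg) auto
    then show ?thesis using A unfolding c1_def by linarith
  qed
  have c2: "0 < c2" using c1 by (simp add: c2_def)
  have L: "1 \<le> L"
  proof -
    have "(1::real) \<le> (2 ^ n) ^ DIM('a)" by (intro one_le_power) simp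
    then show ?thesis unfolding L_def by linarith
  qed
  have c3: "0 \<le> c3" using A by (simp add: c3_def)
  define C where "C = c2 * (64 * L) + c3"
  have C: "0 < C" using c2 L c3 by (simp add: C_def add_pos_nonneg)
  show ?thesis
  proof (intro exI[of _ C] conjI C allI impI)
    fix f :: "'a \<Rightarrow> complex" assume ff: "integrable lebesgue f \<and> compactly_supported f"
    then have f: "integrable lebesgue f" by simp
    obtain k0 where supp: "mass f (- ball 0 (side k0)) = 0"
      using ff compactly_supported_mass by blast
    interpret cz_principal "sgrid ({} :: 'a set)" \<omega> K A B f
      by unfold_locales (use dyadic_sgrid f in auto)
    have sparse_const: "sparse_const = c1" by (simp add: sparse_const_def c1_def)
    define h where "h = (\<lambda>y. ennreal (norm (f y)))"
    have hm: "h \<in> borel_measurable lebesgue" using f by (auto simp: h_def)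
    have hi: "(\<integral>\<^sup>+y. h y \<partial>lebesgue) < \<infinity>" using mass_finite[OF f, of UNIV] by (simp add: mass_UNIV h_def)
    define m where "m = enn2real (mass f UNIV)"
    have m: "mass f UNIV = ennreal m" "0 \<le> m" using mass_real[OF f, of UNIV] by (auto simp: m_def)
    obtain F where F: "sparse_family (sgrid {}) F" "\<And>Q. Q \<in> F \<Longrightarrow> k0 \<le> lev Q"
      "AE x in lebesgue. joint_max K (loc (cell k0 x)) x \<le> (\<Sum>\<^sub>\<infinity>P\<in>F. ennreal (sparse_const * av P) * indicator P x)"
      by (rule local_domination[of k0]) (rule that)
    obtain S where S0: "\<And>A. S A \<subseteq> sgrid A" "\<And>A P. P \<in> S A \<Longrightarrow> k0 - int n \<le> grid.lev (sgrid A) P"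
      "\<And>A G R. finite G \<Longrightarrow> G \<subseteq> S A \<Longrightarrow> R \<in> sgrid A \<Longrightarrow> \<forall>P\<in>G. P \<subseteq> R \<Longrightarrow>
         (\<Sum>P\<in>G. emeasure lebesgue P) \<le> ennreal (2 * (2 ^ n) ^ DIM('a)) * emeasure lebesgue R"
      "\<And>x. (\<Sum>\<^sub>\<infinity>Q\<in>F. ennreal (sparse_const * av Q) * indicator Q x) \<le> ennreal (sparse_const * (2 ^ n) ^ DIM('a)) *
         (\<Sum>A\<in>Pow Basis. \<Sum>\<^sub>\<infinity>P\<in>S A. avg (\<lambda>y. ennreal (norm (f y))) P * indicator P x)"
      by (rule adjacent_families[OF F(1,2) n], assumption) (rule that)
    note S = S0(1,2) S0(3)[folded L_def] S0(4)[folded h_def, unfolded sparse_const, folded c2_def]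
    have S3: "(\<Sum>P\<in>G. emeasure lebesgue P) \<le> ennreal L * emeasure lebesgue R"
      if "finite G" "G \<subseteq> S A" "R \<in> sgrid A" "\<And>P. P \<in> G \<Longrightarrow> P \<subseteq> R" for A G R
      using S(3)[OF that(1,2,3)] that(4) by blast
    have ex1: "\<exists>F'. sparse_family (sgrid A) F' \<and> (AE x in lebesgue. (\<Sum>\<^sub>\<infinity>P\<in>S A. avg h P * indicator P x)
        \<le> ennreal (64 * L) * (\<Sum>\<^sub>\<infinity>P\<in>F'. avg h P * indicator P x))" for A
    proof (rule grid.carleson_sparse[OF grid_sgrid S(1)[of A] S(2)[of _ A] L hm hi S3[of _ A]], assumption, assumption, assumption, assumption, assumption)
      fix F' assume "sparse_family (sgrid A) F'" "AE x in lebesgue. (\<Sum>\<^sub>\<infinity>P\<in>S A. avg h P * indicator P x)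
        \<le> ennreal (64 * L) * (\<Sum>\<^sub>\<infinity>P\<in>F'. avg h P * indicator P x)"
      then show ?thesis by blast
    qed
    from choice[OF allI[OF ex1]] obtain F' where F'0: "\<forall>A. sparse_family (sgrid A) (F' A) \<and>
        (AE x in lebesgue. (\<Sum>\<^sub>\<infinity>P\<in>S A. avg h P * indicator P x)
        \<le> ennreal (64 * L) * (\<Sum>\<^sub>\<infinity>P\<in>F' A. avg h P * indicator P x))" ..
    have F': "sparse_family (sgrid A) (F' A)"
      "AE x in lebesgue. (\<Sum>\<^sub>\<infinity>P\<in>S A. avg h P * indicator P x)
        \<le> ennreal (64 * L) * (\<Sum>\<^sub>\<infinity>P\<in>F' A. avg h P * indicator P x)" for A
      by (rule F'0[rule_format, THEN conjunct1], rule F'0[rule_format, THEN conjunct2])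
    have "finite (Pow (Basis :: 'a set))" by simp
    then have "\<exists>e. bij_betw e {0..<card (Pow (Basis :: 'a set))} (Pow (Basis :: 'a set))"
      by (rule ex_bij_betw_nat_finite)
    then obtain e where e: "bij_betw e {0..<card (Pow (Basis :: 'a set))} (Pow (Basis :: 'a set))" ..
    define N where "N = (2::nat) ^ DIM('a)"
    have eN: "bij_betw e {..<N} (Pow Basis)" using e by (simp add: N_def card_Pow lessThan_atLeast0)
    define Ch where "Ch = {scell (Basis :: 'a set) k 0 | k. k \<le> k0}"
    \<comment> \<open>Indices below N enumerate the shifted grids through \<open>e\<close>; the
      index N carries the chain, which lives in the fully shifted grid.\<close>
    define Gr where "Gr i = (if i < N then sgrid (e i) else sgrid Basis)" for i
    define Fam where "Fam i = (if i < N then F' (e i) else Ch)" for i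
    define Op where "Op i = (\<lambda>h x. \<Sum>\<^sub>\<infinity>P\<in>Fam i. avg h P * indicator P x)" for i
    define SS where "SS = (\<lambda>h x. \<Sum>i<N + 1. Op i h x)"
    have "sum_of_sparse_operators (2 ^ DIM('a) + 1) SS"
      unfolding sum_of_sparse_operators_def N_def[symmetric]
    proof (intro exI[of _ Gr] exI[of _ Op] conjI allI impI)
      show "dyadic_grid (Gr i)" for i by (simp add: Gr_def dyadic_sgrid)
      show "sparse_operator (Gr i) (Op i)" for i
        unfolding sparse_operator_def
      proof (intro exI[of _ "Fam i"] conjI)
        show "sparse_family (Gr i) (Fam i)"
          using F'(1) chain_sparse[where 'a='a, of k0] by (simp add: Gr_def Fam_def Ch_def)
        show "Op i = (\<lambda>h x. \<Sum>\<^sub>\<infinity>P\<in>Fam i. avg h P * indicator P x)" by (simp add: Op_def)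
      qed
      show "SS = (\<lambda>h x. \<Sum>i<N + 1. Op i h x)" by (simp add: SS_def)
    qed
    moreover have "AE x in lebesgue. joint_max K f x \<le> ennreal C * SS h x"
    proof -
      have "AE x in lebesgue. \<forall>A\<in>Pow Basis. (\<Sum>\<^sub>\<infinity>P\<in>S A. avg h P * indicator P x)
        \<le> ennreal (64 * L) * (\<Sum>\<^sub>\<infinity>P\<in>F' A. avg h P * indicator P x)"
        using F'(2) by (intro AE_finite_allI) auto
      with F(3) show ?thesis
      proof eventually_elim
        case (elim x)
        define X where "X = (\<Sum>A\<in>Pow Basis. \<Sum>\<^sub>\<infinity>P\<in>F' A. avg h P * indicator P x)"
        define Y where "Y = (\<Sum>\<^sub>\<infinity>P\<in>Ch. avg h P * indicator P x)"
        have SSx: "SS h x = X + Y"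
        proof -
          have "(\<Sum>i<N. Op i h x) = (\<Sum>i<N. \<Sum>\<^sub>\<infinity>P\<in>F' (e i). avg h P * indicator P x)"
            by (intro sum.cong) (auto simp: Op_def Fam_def)
          also have "\<dots> = X" unfolding X_def using eN by (rule sum.reindex_bij_betw)
          finally show ?thesis by (simp add: SS_def Y_def Op_def Fam_def)
        qed
        have "joint_max K f x \<le> joint_max K (loc (cell k0 x)) x + ennreal ((A + 1) * 2 ^ DIM('a) * m / (norm x + side k0) ^ DIM('a))"
          using m by (intro far_part[OF supp]) auto
        also have "\<dots> \<le> ennreal c2 * (ennreal (64 * L) * X) + ennreal c3 * Y"
        proof (rule add_mono)
          have "joint_max K (loc (cell k0 x)) x \<le> (\<Sum>\<^sub>\<infinity>P\<in>F. ennreal (c1 * av P) * indicator P x)"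
            using elim(1) by (simp only: sparse_const)
          also have "\<dots> \<le> ennreal c2 * (\<Sum>A\<in>Pow Basis. \<Sum>\<^sub>\<infinity>P\<in>S A. avg h P * indicator P x)" by (rule S(4))
          also have "\<dots> \<le> ennreal c2 * (\<Sum>A\<in>Pow Basis. ennreal (64 * L) * (\<Sum>\<^sub>\<infinity>P\<in>F' A. avg h P * indicator P x))"
            using elim(2) by (intro mult_left_mono sum_mono) auto
          also have "\<dots> = ennreal c2 * (ennreal (64 * L) * X)" by (simp add: X_def sum_distrib_left)
          finally show "joint_max K (loc (cell k0 x)) x \<le> ennreal c2 * (ennreal (64 * L) * X)" .
          show "ennreal ((A + 1) * 2 ^ DIM('a) * m / (norm x + side k0) ^ DIM('a)) \<le> ennreal c3 * Y"
            unfolding c3_def Y_def Ch_def h_def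
            by (rule chain_bound[OF supp f m]) (use A in simp)
        qed
        also have "\<dots> = ennreal (c2 * (64 * L)) * X + ennreal c3 * Y"
          using c2 by (simp add: ennreal_mult' mult.assoc)
        also have "\<dots> \<le> ennreal C * X + ennreal C * Y"
          using c2 c3 L by (intro add_mono mult_right_mono ennreal_leI) (auto simp: C_def)
        also have "\<dots> = ennreal C * SS h x" by (simp add: SSx distrib_left)
        finally show ?case .
      qed
    qed
    ultimately show "\<exists>S. sum_of_sparse_operators (2 ^ DIM('a) + 1) S \<and>
       (AE x in lebesgue. joint_max K f x \<le> ennreal C * S (\<lambda>y. ennreal (norm (f y))) x)"
      unfolding h_def by blast
  qed
qed

subsection \<open>Cotlar's inequality\<close>

text \<open>By \<open>extension_axioms\<close> these facts hold for every weak extension. The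
  extension of the theorem is an arbitrary choice, so only facts common to all of them are
  available.\<close>

locale cz_extension = cz_kernel \<omega> K A for \<omega> and K :: "'a::euclidean_space \<Rightarrow> 'a \<Rightarrow> complex" and A +
  fixes U :: "('a \<Rightarrow> complex) \<Rightarrow> 'a \<Rightarrow> complex" and A1 :: real
  assumes A1: "0 < A1"
    and U_measurable: "integrable lebesgue f \<Longrightarrow> U f \<in> borel_measurable lebesgue"
    and U_weak: "integrable lebesgue f \<Longrightarrow> mass f UNIV \<le> ennreal n \<Longrightarrow> 0 \<le> n \<Longrightarrow> 0 < t \<Longrightarrow>
      emeasure lebesgue {x. t < norm (U f x)} \<le> ennreal (A1 * n / t)"
    and U_add: "integrable lebesgue f \<Longrightarrow> integrable lebesgue g \<Longrightarrow>
      AE x in lebesgue. U (\<lambda>y. f y + g y) x = U f x + U g x"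
    and U_kernel: "integrable lebesgue f \<Longrightarrow> closed H \<Longrightarrow> (\<And>y. y \<notin> H \<Longrightarrow> f y = 0) \<Longrightarrow>
      AE x in lebesgue. x \<notin> H \<longrightarrow> U f x = (LINT y:H|lebesgue. K x y * f y)"
begin

lemma level_sets: "integrable lebesgue f \<Longrightarrow> {x. t < norm (U f x)} \<in> sets lebesgue"
proof -
  assume "integrable lebesgue f"
  from measurable_compose[OF U_measurable[OF this] borel_measurable_norm]
  have "(\<lambda>x. norm (U f x)) \<in> borel_measurable lebesgue" .
  from borel_measurable_less[OF borel_measurable_const this]
  show ?thesis by simp
qed

text \<open>The part of f outside the open set B vanishes on B, so on B its image is given by the
  kernel.\<close>

lemma U_split:
  assumes f: "integrable lebesgue f" and B: "open B"
  shows "AE x in lebesgue. x \<in> B \<longrightarrow> U f x = U (res B f) x + (LINT y:- B|lebesgue. K x y * f y)"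
proof -
  have Bs: "B \<in> sets lebesgue" using B by auto
  then have Cs: "- B \<in> sets lebesgue" by (subst Compl_in_sets_lebesgue)
  have i: "integrable lebesgue (res B f)" "integrable lebesgue (res (- B) f)"
    using res_integrable[OF f] Bs Cs by auto
  have "(\<lambda>y. res B f y + res (- B) f y) = f" by (auto simp: res_def)
  with U_add[OF i] have 1: "AE x in lebesgue. U f x = U (res B f) x + U (res (- B) f) x" by simp
  have 2: "AE x in lebesgue. x \<notin> - B \<longrightarrow> U (res (- B) f) x = (LINT y:- B|lebesgue. K x y * res (- B) f y)"
    by (rule U_kernel[OF i(2)]) (use B in \<open>auto simp: res_def\<close>)
  have 3: "(LINT y:- B|lebesgue. K x y * res (- B) f y) = (LINT y:- B|lebesgue. K x y * f y)" for x
    unfolding set_lebesgue_integral_def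
    by (rule Bochner_Integration.integral_cong) (auto simp: res_def indicator_def)
  from 1 2 show ?thesis unfolding 3 by eventually_elim auto
qed

text \<open>Unlike in \<open>compare\<close>, the region stays centred at x and only the kernel is
  moved to z, so the tail estimate alone suffices.\<close>

lemma trunc_move:
  assumes f: "integrable lebesgue f" and r: "0 < r" and xz: "dist x z \<le> r / 2" and M: "max_le f x t" "0 \<le> t"
  shows "norm (trunc K r f x) \<le> norm (LINT y:{y. r < dist x y}|lebesgue. K z y * f y) + W * t"
proof -
  have fm: "f \<in> borel_measurable lebesgue" using f by auto
  define H where "H = {y. r < dist x y}"
  have Hs: "H \<in> sets lebesgue" by (simp add: H_def)
  have ix: "integrable lebesgue (\<lambda>y. indicator H y *\<^sub>R (K x y * f y))"
    by (rule integrable_off[OF f Hs r]) (auto simp: H_def)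
  have r2: "0 < r / 2" using r by simp
  have iz: "integrable lebesgue (\<lambda>y. indicator H y *\<^sub>R (K z y * f y))"
  proof (rule integrable_off[OF f Hs r2])
    fix y assume "y \<in> H"
    moreover have "dist x y \<le> dist x z + dist z y" by (rule dist_triangle)
    ultimately show "r / 2 \<le> dist z y" using xz by (simp add: H_def)
  qed
  have "norm (integral\<^sup>L lebesgue (\<lambda>y. indicator H y *\<^sub>R (K x y * f y) - indicator H y *\<^sub>R (K z y * f y))) \<le> W * t"
  proof (rule dominated_Ints_norm_bound)
    show "integrable lebesgue (\<lambda>y. indicator H y *\<^sub>R (K x y * f y) - indicator H y *\<^sub>R (K z y * f y))"
      using ix iz by (rule Bochner_Integration.integrable_diff)
    have "(\<integral>\<^sup>+y. ennreal (norm (indicator H y *\<^sub>R (K x y * f y) - indicator H y *\<^sub>R (K z y * f y))) \<partial>lebesgue)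
      \<le> (\<integral>\<^sup>+y\<in>{y. 2 * (r / 2) \<le> dist x y}. ennreal (norm (K x y - K z y)) * ennreal (norm (f y)) \<partial>lebesgue)"
    proof (rule nn_integral_mono)
      fix y
      show "ennreal (norm (indicator H y *\<^sub>R (K x y * f y) - indicator H y *\<^sub>R (K z y * f y)))
        \<le> ennreal (norm (K x y - K z y)) * ennreal (norm (f y)) * indicator {y. 2 * (r / 2) \<le> dist x y} y"
      proof (cases "y \<in> H")
        case True
        then have "2 * (r / 2) \<le> dist x y" by (simp add: H_def)
        moreover have "K x y * f y - K z y * f y = (K x y - K z y) * f y" by (simp add: algebra_simps)
        ultimately show ?thesis using True by (simp add: norm_mult ennreal_mult)
      qed simp
    qed
    also have "\<dots> \<le> ennreal (W * t)" by (rule tail[OF fm xz r2 M])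
    finally show "(\<integral>\<^sup>+y. ennreal (norm (indicator H y *\<^sub>R (K x y * f y) - indicator H y *\<^sub>R (K z y * f y))) \<partial>lebesgue) \<le> ennreal (W * t)" .
    show "0 \<le> W * t" using W_nonneg M by simp
  qed
  then have 2: "norm (trunc K r f x - (LINT y:H|lebesgue. K z y * f y)) \<le> W * t"
    unfolding trunc_def set_lebesgue_integral_def H_def[symmetric] using ix iz by simp
  have "norm (trunc K r f x) \<le> norm (LINT y:H|lebesgue. K z y * f y) + norm (trunc K r f x - (LINT y:H|lebesgue. K z y * f y))"
    by (rule norm_triangle_sub)
  then show ?thesis using 2 by (simp add: H_def)
qed

definition vol :: real where "vol = unit_ball_vol (real DIM('a))"

lemma vol_pos: "0 < vol" by (simp add: vol_def)

text \<open>W for moving the kernel, 1 for the value of U f, and the last term for U of the part of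
  f near x; it is the level s in \<open>cotlar\<close> divided by t.\<close>

definition cotlar_const :: real where "cotlar_const = W + 1 + 4 * A1 * 4 ^ DIM('a) / vol"

lemma cotlar_const_ge_1: "1 \<le> cotlar_const"
proof -
  have "0 \<le> 4 * A1 * 4 ^ DIM('a) / vol" using A1 vol_pos by simp
  then show ?thesis using W_nonneg unfolding cotlar_const_def by linarith
qed

text \<open>Up to W t, the truncation at x is the value, at any z near x, of U applied to the far
  part of f, that is U f minus U of the near part. A point z at which both are controlled exists,
  because each fails on at most a quarter of the ball of radius r / 2. The premise \<open>G\<close>
  bounds the maximal function of the indicator of a level set of U f, where the classical proof has
  the maximal function of a power of U f.\<close>

lemma cotlar:
  assumes f: "integrable lebesgue f" and t: "0 < t" and M: "max_le f x t"
    and G: "\<And>r. 0 < r \<Longrightarrow> emeasure lebesgue ({z. t < norm (U f z)} \<inter> ball x r) \<le> ennreal (vol / 4 * r ^ DIM('a))"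
  shows "trunc_le K f x (cotlar_const * t)"
  unfolding trunc_le_def
proof (intro allI impI)
  fix r :: real assume r: "r > 0"
  define B where "B = cball x r"
  define b where "b = ball x (r / 2)"
  define H where "H = {y. r < dist x y}"
  \<comment> \<open>Chosen so that the weak type bound for the near part, of mass at most t (2 r)^d,
    is a quarter of the volume of a ball of radius r / 2. The two ratios 2^d give 4^d.\<close>
  define s where "s = 4 * A1 * 4 ^ DIM('a) / vol * t"
  have s: "0 < s" using A1 vol_pos t by (simp add: s_def)
  have Hs: "H \<in> sets lebesgue" by (simp add: H_def)
  have Bs: "B \<in> sets lebesgue" by (simp add: B_def)
  have i: "integrable lebesgue (res B f)" "integrable lebesgue (res H f)"
    using res_integrable[OF f] Bs Hs by auto
  have "(\<lambda>y. res B f y + res H f y) = f" by (auto simp: res_def B_def H_def)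
  with U_add[OF i] have 1: "AE z in lebesgue. U f z = U (res B f) z + U (res H f) z" by simp
  \<comment> \<open>\<open>U_kernel\<close> asks for a closed set. The sphere may be added to it,
    since the restricted function vanishes there.\<close>
  have "closed {y. r \<le> dist x y}" by (intro closed_Collect_le continuous_intros)
  then have 2: "AE z in lebesgue. z \<notin> {y. r \<le> dist x y} \<longrightarrow>
      U (res H f) z = (LINT y:{y. r \<le> dist x y}|lebesgue. K z y * res H f y)"
    by (rule U_kernel[OF i(2)]) (auto simp: res_def H_def)
  have 3: "(LINT y:{y. r \<le> dist x y}|lebesgue. K z y * res H f y) = (LINT y:H|lebesgue. K z y * f y)" for z
    unfolding set_lebesgue_integral_def
    by (rule Bochner_Integration.integral_cong) (auto simp: res_def H_def indicator_def)
  have ae: "AE z in lebesgue. z \<in> b \<longrightarrow> norm (trunc K r f x) \<le> norm (U f z) + norm (U (res B f) z) + W * t"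
    using 1 2
  proof eventually_elim
    case (elim z)
    show ?case
    proof
      assume z: "z \<in> b"
      then have "U (res H f) z = (LINT y:H|lebesgue. K z y * f y)" using elim(2) r by (simp add: b_def 3)
      then have "(LINT y:H|lebesgue. K z y * f y) = U f z - U (res B f) z" using elim(1) by simp
      then have "norm (LINT y:H|lebesgue. K z y * f y) \<le> norm (U f z) + norm (U (res B f) z)"
        by (simp add: norm_triangle_ineq4)
      moreover have "norm (trunc K r f x) \<le> norm (LINT y:H|lebesgue. K z y * f y) + W * t"
        unfolding H_def by (rule trunc_move[OF f r _ M]) (use z t in \<open>auto simp: b_def\<close>)
      ultimately show "norm (trunc K r f x) \<le> norm (U f z) + norm (U (res B f) z) + W * t" by linarith
    qed
  qed
  define E1 where "E1 = {z. s < norm (U (res B f) z)}"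
  define E2 where "E2 = {z. t < norm (U f z)} \<inter> b"
  have sets: "E1 \<in> sets lebesgue" "E2 \<in> sets lebesgue" "b \<in> sets lebesgue"
    unfolding E1_def E2_def b_def using level_sets[OF i(1)] level_sets[OF f] by (auto intro: sets.Int)
  have "\<exists>z\<in>b. norm (trunc K r f x) \<le> norm (U f z) + norm (U (res B f) z) + W * t \<and> z \<notin> E1 \<and> z \<notin> E2"
  proof (rule ccontr)
    assume no: "\<not> ?thesis"
    define \<beta> where "\<beta> = vol * (r / 2) ^ DIM('a)"
    have \<beta>: "0 < \<beta>" using vol_pos r by (simp add: \<beta>_def)
    have eb: "emeasure lebesgue b = ennreal \<beta>"
      unfolding b_def \<beta>_def vol_def using r by (intro emeasure_lebesgue_ball) simp
    have "AE z in lebesgue. z \<in> b \<longrightarrow> z \<in> E1 \<union> E2"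
      using ae by eventually_elim (use no in blast)
    then have "emeasure lebesgue b \<le> emeasure lebesgue (E1 \<union> E2)" using sets by (intro emeasure_mono_AE) auto
    also have "\<dots> \<le> emeasure lebesgue E1 + emeasure lebesgue E2" using sets by (intro emeasure_subadditive) auto
    also have "\<dots> \<le> ennreal (\<beta> / 4) + ennreal (\<beta> / 4)"
    proof (rule add_mono)
      have "mass (res B f) UNIV = mass f B" by (simp add: mass_res)
      also have "\<dots> \<le> ennreal (t * (2 * r) ^ DIM('a))"
        using r by (intro mass_bounded_ball[OF M]) (auto simp: B_def)
      finally have "emeasure lebesgue E1 \<le> ennreal (A1 * (t * (2 * r) ^ DIM('a)) / s)"
        unfolding E1_def using t r by (intro U_weak[OF i(1) _ _ s]) auto
      also have "A1 * (t * (2 * r) ^ DIM('a)) / s = \<beta> / 4"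
      proof -
        have "(4::real) ^ DIM('a) = 2 ^ DIM('a) * 2 ^ DIM('a)" by (simp add: power_mult_distrib[symmetric])
        then show ?thesis using A1 t vol_pos by (simp add: s_def \<beta>_def power_mult_distrib power_divide field_simps)
      qed
      finally show "emeasure lebesgue E1 \<le> ennreal (\<beta> / 4)" .
      show "emeasure lebesgue E2 \<le> ennreal (\<beta> / 4)"
        using G[of "r / 2"] r by (simp add: E2_def b_def \<beta>_def)
    qed
    also have "\<dots> = ennreal (\<beta> / 2)" using \<beta> by (simp add: ennreal_plus[symmetric] del: ennreal_plus)
    finally show False using \<beta> by (simp add: eb)
  qed
  then obtain z where z: "z \<in> b" "norm (trunc K r f x) \<le> norm (U f z) + norm (U (res B f) z) + W * t" "z \<notin> E1" "z \<notin> E2"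
    by blast
  then have "norm (U f z) \<le> t" "norm (U (res B f) z) \<le> s" by (auto simp: E1_def E2_def)
  then have "norm (trunc K r f x) \<le> t + s + W * t" using z(2) by linarith
  also have "\<dots> = cotlar_const * t" by (simp add: cotlar_const_def s_def algebra_simps)
  finally show "norm (trunc K r f x) \<le> cotlar_const * t" .
qed

text \<open>Cotlar's inequality holds off two exceptional sets, both given by
  \<open>weak_max\<close>: one for f at level t, and one, at level vol / 4, for the indicator of the
  set where |U f| > t, whose measure is at most A1 n / t. Dividing t' by \<open>cotlar_const\<close>
  absorbs the loss in the inequality.\<close>

lemma weak_joint:
  assumes f: "integrable lebesgue f" and n: "mass f UNIV \<le> ennreal n" "0 \<le> n" and t': "0 < t'"
  shows "\<exists>E\<in>sets lebesgue. emeasure lebesgue E \<le> ennreal (24 ^ DIM('a) * (1 + 4 * A1 / vol) * cotlar_const * n / t') \<and>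
        (\<forall>x. x \<notin> E \<longrightarrow> trunc_le K f x t' \<and> max_le f x t')"
proof -
  define t where "t = t' / cotlar_const"
  have t: "0 < t" "cotlar_const * t = t'" "t \<le> t'" using t' cotlar_const_ge_1 by (auto simp: t_def pos_divide_le_eq)
  have fm: "f \<in> borel_measurable lebesgue" using f by auto
  obtain E1 where E1: "E1 \<in> sets lebesgue" "emeasure lebesgue E1 \<le> ennreal (24 ^ DIM('a) * n / t)"
    "\<And>x. x \<notin> E1 \<Longrightarrow> max_le f x t"
    using weak_max[OF fm n t(1)] by blast
  define G where "G = {z. t < norm (U f z)}"
  define g where "g = (\<lambda>z. indicator G z :: complex)"
  have Gs: "G \<in> sets lebesgue" unfolding G_def by (rule level_sets[OF f])
  have gm: "g \<in> borel_measurable lebesgue" unfolding g_def using Gs by (rule borel_measurable_indicator)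
  have mg: "mass g X = emeasure lebesgue (G \<inter> X)" if "X \<in> sets lebesgue" for X
  proof -
    have "mass g X = (\<integral>\<^sup>+z. indicator (G \<inter> X) z \<partial>lebesgue)"
      unfolding mass_def g_def by (rule nn_integral_cong) (auto simp: indicator_def)
    also have "\<dots> = emeasure lebesgue (G \<inter> X)" using Gs that by (intro nn_integral_indicator) auto
    finally show ?thesis .
  qed
  have "mass g UNIV \<le> ennreal (A1 * n / t)"
    using U_weak[OF f n t(1)] mg[of UNIV] by (simp add: G_def)
  moreover have "0 \<le> A1 * n / t" using A1 n t by simp
  moreover have "0 < vol / 4" using vol_pos by simp
  ultimately obtain E2 where E2: "E2 \<in> sets lebesgue" "emeasure lebesgue E2 \<le> ennreal (24 ^ DIM('a) * (A1 * n / t) / (vol / 4))"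
    "\<And>x. x \<notin> E2 \<Longrightarrow> max_le g x (vol / 4)"
    using weak_max[OF gm] by blast
  show ?thesis
  proof (intro bexI[of _ "E1 \<union> E2"] conjI allI impI)
    show "E1 \<union> E2 \<in> sets lebesgue" using E1 E2 by auto
    have "emeasure lebesgue (E1 \<union> E2) \<le> emeasure lebesgue E1 + emeasure lebesgue E2"
      using E1 E2 by (intro emeasure_subadditive) auto
    also have "\<dots> \<le> ennreal (24 ^ DIM('a) * n / t) + ennreal (24 ^ DIM('a) * (A1 * n / t) / (vol / 4))"
      using E1 E2 by (intro add_mono) auto
    also have "\<dots> = ennreal (24 ^ DIM('a) * n / t + 24 ^ DIM('a) * (A1 * n / t) / (vol / 4))"
      using n A1 t vol_pos by (intro ennreal_plus[symmetric]) auto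
    also have "24 ^ DIM('a) * n / t + 24 ^ DIM('a) * (A1 * n / t) / (vol / 4) = 24 ^ DIM('a) * (1 + 4 * A1 / vol) * cotlar_const * n / t'"
      using cotlar_const_ge_1 t' vol_pos by (simp add: t_def field_simps)
    finally show "emeasure lebesgue (E1 \<union> E2) \<le> ennreal (24 ^ DIM('a) * (1 + 4 * A1 / vol) * cotlar_const * n / t')" .
    fix x assume x: "x \<notin> E1 \<union> E2"
    have M: "max_le f x t" using E1(3) x by auto
    have "trunc_le K f x (cotlar_const * t)"
    proof (rule cotlar[OF f t(1) M])
      fix r :: real assume "r > 0"
      then have "mass g (ball x r) \<le> ennreal (vol / 4 * r ^ DIM('a))"
        using E2(3)[of x] x unfolding max_le_def by auto
      then show "emeasure lebesgue ({z. t < norm (U f z)} \<inter> ball x r) \<le> ennreal (vol / 4 * r ^ DIM('a))"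
        using mg[of "ball x r"] by (simp add: G_def)
    qed
    then show "trunc_le K f x t'" using t by simp
    show "max_le f x t'" unfolding max_le_def
    proof (intro allI impI)
      fix r :: real assume "r > 0"
      then have "mass f (ball x r) \<le> ennreal (t * r ^ DIM('a))" using M unfolding max_le_def by auto
      also have "\<dots> \<le> ennreal (t' * r ^ DIM('a))" using t \<open>r > 0\<close> by (intro ennreal_leI mult_right_mono) auto
      finally show "mass f (ball x r) \<le> ennreal (t' * r ^ DIM('a))" .
    qed
  qed
qed

subsection \<open>The operator is dominated by its maximal truncations\<close>

text \<open>The terms 1 + A 3^d + W come from \<open>compare\<close> with C = 3 and \<eta> = 2. The
  last term is the level at which the weak type bound for the local part is half a cube.\<close>

definition dom_const :: real where
  "dom_const = 1 + A * 3 ^ DIM('a) + W + 2 * A1 * (3 * real DIM('a)) ^ DIM('a)"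

lemma dom_const_pos: "0 < dom_const"
proof -
  have "0 \<le> A * 3 ^ DIM('a)" "0 \<le> 2 * A1 * (3 * real DIM('a)) ^ DIM('a)" using A A1 by auto
  then show ?thesis using W_nonneg unfolding dom_const_def by linarith
qed

text \<open>The union of the cubes on which \<open>joint_max\<close> exceeds q throughout is
  measurable and takes the place of the set where it exceeds q. A cube that meets the remaining set
  contains a point z with \<open>joint_max\<close> at most q. On this cube U f differs from U of the
  part of f near z by at most a multiple of q, so by weak type the remaining set fills at most half
  the cube, and it is null by density.\<close>

lemma U_le_joint_level:
  assumes f: "integrable lebesgue f" and q: "0 < q"
  shows "{x. dom_const * q < norm (U f x)} - \<Union>{Q \<in> sgrid {}. \<forall>z\<in>Q. ennreal q < joint_max K f z} \<in> null_sets lebesgue"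
proof -
  interpret grid "sgrid ({} :: 'a set)" by (rule grid_sgrid)
  define N where "N = {Q \<in> sgrid ({} :: 'a set). \<forall>z\<in>Q. ennreal q < joint_max K f z}"
  define E where "E = {x. dom_const * q < norm (U f x)} - \<Union>N"
  have "countable N" by (rule countable_subset[OF _ countable_D]) (auto simp: N_def)
  then have Ns: "\<Union>N \<in> sets lebesgue" using D_sets by (intro sets.countable_Union) (auto simp: N_def)
  have Es: "E \<in> sets lebesgue" unfolding E_def using level_sets[OF f] Ns by (intro sets.Diff) auto
  have "E \<in> null_sets lebesgue"
  proof (rule null_by_density[OF Es, of "1/2"])
    fix Q assume Q: "Q \<in> sgrid ({} :: 'a set)" "Q \<inter> E \<noteq> {}"
    then have "Q \<notin> N" by (auto simp: E_def)
    then obtain z where z: "z \<in> Q" "joint_max K f z \<le> ennreal q" using Q by (auto simp: N_def not_less)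
    then have zz: "trunc_le K f z q" "max_le f z q" using joint_max_le_iff[of q K f z] q by auto
    define s where "s = side (lev Q)"
    define \<rho> where "\<rho> = real DIM('a) * s"
    have s: "0 < s" by (simp add: s_def)
    have \<rho>: "0 < \<rho>" using s by (simp add: \<rho>_def)
    define B where "B = ball z (3 * \<rho>)"
    have Qz: "dist z x \<le> \<rho>" if "x \<in> Q" for x
      using dist_cell[of z "lev Q" z x] cell_lev[OF Q(1) z(1)] that z(1) by (simp add: \<rho>_def s_def)
    have opB: "open B" by (simp add: B_def)
    have iB: "integrable lebesgue (res B f)" by (rule res_integrable[OF f]) (simp add: B_def)
    define lam where "lam = 2 * A1 * (3 * real DIM('a)) ^ DIM('a) * q"
    have lam: "0 < lam" using A1 q by (simp add: lam_def)
    have bound: "norm (LINT y:- B|lebesgue. K x y * f y) \<le> (1 + A * 3 ^ DIM('a) + W) * q" if x: "x \<in> Q" for x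
    proof -
      have "norm (LINT y:- B|lebesgue. K x y * f y) \<le> norm (trunc K (3 * \<rho>) f z) + (A * (2 * 3 / 2) ^ DIM('a) + W) * q"
      proof (rule compare[OF f _ Qz[OF x] \<rho>])
        show "- B \<in> sets lebesgue" unfolding B_def by (subst Compl_in_sets_lebesgue) simp
        show "2 * \<rho> \<le> dist x y" if "y \<in> - B" for y
        proof -
          have "dist z y \<le> dist z x + dist x y" by (rule dist_triangle)
          moreover have "3 * \<rho> \<le> dist z y" using that by (simp add: B_def)
          ultimately show ?thesis using Qz[OF x] by linarith
        qed
      qed (use zz q in \<open>auto simp: B_def\<close>)
      moreover have "norm (trunc K (3 * \<rho>) f z) \<le> q" using zz(1) \<rho> unfolding trunc_le_def by auto
      ultimately show ?thesis by (simp add: algebra_simps)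
    qed
    have "AE x in lebesgue. x \<in> E \<inter> Q \<longrightarrow> x \<in> {x. lam < norm (U (res B f) x)}"
      using U_split[OF f opB]
    proof (rule eventually_mono, intro impI)
      fix x assume *: "x \<in> B \<longrightarrow> U f x = U (res B f) x + (LINT y:- B|lebesgue. K x y * f y)" and x: "x \<in> E \<inter> Q"
      have "x \<in> B" using Qz[of x] x \<rho> by (simp add: B_def)
      with * have "U f x = U (res B f) x + (LINT y:- B|lebesgue. K x y * f y)" by simp
      then have "norm (U f x) \<le> norm (U (res B f) x) + norm (LINT y:- B|lebesgue. K x y * f y)"
        by (simp add: norm_triangle_ineq)
      also have "\<dots> \<le> norm (U (res B f) x) + (1 + A * 3 ^ DIM('a) + W) * q" using bound x by auto
      finally have "norm (U f x) \<le> norm (U (res B f) x) + (1 + A * 3 ^ DIM('a) + W) * q" .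
      moreover have "dom_const * q < norm (U f x)" using x by (auto simp: E_def)
      moreover have "dom_const * q = (1 + A * 3 ^ DIM('a) + W) * q + lam" by (simp add: dom_const_def lam_def algebra_simps)
      ultimately show "x \<in> {x. lam < norm (U (res B f) x)}" by simp
    qed
    then have "emeasure lebesgue (E \<inter> Q) \<le> emeasure lebesgue {x. lam < norm (U (res B f) x)}"
      by (rule emeasure_mono_AE) (rule level_sets[OF iB])
    also have "\<dots> \<le> ennreal (A1 * (q * (3 * \<rho>) ^ DIM('a)) / lam)"
    proof (rule U_weak[OF iB _ _ lam])
      show "mass (res B f) UNIV \<le> ennreal (q * (3 * \<rho>) ^ DIM('a))"
        unfolding mass_res using \<rho> by (intro mass_bounded_ball[OF zz(2)]) (auto simp: B_def)
      show "0 \<le> q * (3 * \<rho>) ^ DIM('a)" using q \<rho> by simp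
    qed
    also have "A1 * (q * (3 * \<rho>) ^ DIM('a)) / lam = 1 / 2 * s ^ DIM('a)"
    proof -
      have "(3 * \<rho>) ^ DIM('a) = (3 * real DIM('a)) ^ DIM('a) * s ^ DIM('a)"
        by (simp add: \<rho>_def power_mult_distrib)
      then show ?thesis using A1 q by (simp add: lam_def)
    qed
    also have "ennreal (1 / 2 * s ^ DIM('a)) = ennreal (1 / 2) * ennreal (s ^ DIM('a))"
      by (rule ennreal_mult') simp
    also have "ennreal (s ^ DIM('a)) = emeasure lebesgue Q" by (simp add: emeasure_lev[OF Q(1)] s_def)
    finally show "emeasure lebesgue (E \<inter> Q) \<le> ennreal (1 / 2) * emeasure lebesgue Q" .
  qed auto
  then show ?thesis by (simp add: E_def N_def)
qed

text \<open>If the inequality fails at x, a rational q separates the two sides, and x belongs to the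
  null set for q.\<close>

lemma U_le_joint:
  assumes f: "integrable lebesgue f"
  shows "AE x in lebesgue. ennreal (norm (U f x)) \<le> ennreal dom_const * joint_max K f x"
proof -
  define E where "E q = {x. dom_const * q < norm (U f x)} - \<Union>{Q \<in> sgrid {}. \<forall>z\<in>Q. ennreal q < joint_max K f z}" for q
  have null: "(\<Union>q\<in>{q\<in>\<rat>. 0 < q}. E q) \<in> null_sets lebesgue"
  proof (rule null_sets_UN')
    show "countable {q::real \<in> \<rat>. 0 < q}" by (rule countable_subset[OF _ countable_rat]) auto
    show "E q \<in> null_sets lebesgue" if "q \<in> {q\<in>\<rat>. 0 < q}" for q
      unfolding E_def using that by (intro U_le_joint_level[OF f]) auto
  qed
  show ?thesis
  proof (rule AE_I'[OF null], safe)
    fix x assume no: "\<not> ennreal (norm (U f x)) \<le> ennreal dom_const * joint_max K f x"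
    then have "joint_max K f x \<noteq> top" using dom_const_pos by (auto simp: ennreal_mult_top)
    then obtain v where v: "joint_max K f x = ennreal v" "0 \<le> v" by (cases "joint_max K f x") auto
    have "dom_const * v < norm (U f x)"
      using no v dom_const_pos by (simp add: ennreal_mult'[symmetric] not_le)
    then have "v < norm (U f x) / dom_const" using dom_const_pos by (simp add: pos_less_divide_eq mult.commute)
    then obtain q where q: "q \<in> \<rat>" "v < q" "q < norm (U f x) / dom_const" using Rats_dense_in_real by blast
    have "dom_const * q < norm (U f x)" using q dom_const_pos by (simp add: pos_less_divide_eq mult.commute)
    moreover have "x \<notin> \<Union>{Q \<in> sgrid {}. \<forall>z\<in>Q. ennreal q < joint_max K f z}"
    proof
      assume "x \<in> \<Union>{Q \<in> sgrid {}. \<forall>z\<in>Q. ennreal q < joint_max K f z}"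
      then have "ennreal q < ennreal v" using v by auto
      then show False using q v by (simp add: ennreal_less_iff)
    qed
    ultimately have "x \<in> E q" by (simp add: E_def)
    then show "x \<in> (\<Union>q\<in>{q\<in>\<rat>. 0 < q}. E q)" using q v by auto
  qed
qed

end

subsection \<open>Density of the continuous functions with compact support\<close>

definition energy :: "('a::euclidean_space \<Rightarrow> complex) \<Rightarrow> ennreal" where
  "energy f = (\<integral>\<^sup>+x. ennreal ((norm (f x))\<^sup>2) \<partial>lebesgue)"

text \<open>The L1 norm plus the square of the L2 norm, so that a single approximation serves both.
  It is not a norm: sums cost a factor 2.\<close>

definition mixed :: "('a::euclidean_space \<Rightarrow> complex) \<Rightarrow> ennreal" where
  "mixed f = (\<integral>\<^sup>+x. ennreal (norm (f x) + (norm (f x))\<^sup>2) \<partial>lebesgue)"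

lemma mass_le_mixed: "mass f UNIV \<le> mixed f"
  unfolding mass_UNIV mixed_def by (intro nn_integral_mono ennreal_leI) simp

lemma energy_le_mixed: "energy f \<le> mixed f"
  unfolding energy_def mixed_def by (intro nn_integral_mono ennreal_leI) simp

lemma mixed_eq: "f \<in> borel_measurable lebesgue \<Longrightarrow> mixed f = mass f UNIV + energy f"
proof -
  assume [measurable]: "f \<in> borel_measurable lebesgue"
  have "mixed f = (\<integral>\<^sup>+x. ennreal (norm (f x)) + ennreal ((norm (f x))\<^sup>2) \<partial>lebesgue)"
    unfolding mixed_def by (intro nn_integral_cong) (simp add: ennreal_plus)
  also have "\<dots> = mass f UNIV + energy f"
    unfolding mass_UNIV energy_def by (rule nn_integral_add) measurable
  finally show ?thesis .
qed

lemma square_add_le: "(a + b)\<^sup>2 \<le> 2 * a\<^sup>2 + 2 * (b::real)\<^sup>2"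
  using sum_squares_bound[of a b] by (simp add: power2_sum)

lemma mixed_add_le:
  assumes [measurable]: "(f :: 'a::euclidean_space \<Rightarrow> complex) \<in> borel_measurable lebesgue" "g \<in> borel_measurable lebesgue"
  shows "mixed (\<lambda>x. f x + g x) \<le> 2 * mixed f + 2 * mixed g"
proof -
  have "mixed (\<lambda>x. f x + g x) \<le> (\<integral>\<^sup>+x. 2 * ennreal (norm (f x) + (norm (f x))\<^sup>2) + 2 * ennreal (norm (g x) + (norm (g x))\<^sup>2) \<partial>lebesgue)"
    unfolding mixed_def
  proof (rule nn_integral_mono)
    fix x
    have n: "norm (f x + g x) \<le> norm (f x) + norm (g x)" by (rule norm_triangle_ineq)
    then have "(norm (f x + g x))\<^sup>2 \<le> (norm (f x) + norm (g x))\<^sup>2" by (rule power_mono) simp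
    also have "\<dots> \<le> 2 * (norm (f x))\<^sup>2 + 2 * (norm (g x))\<^sup>2" by (rule square_add_le)
    finally have "norm (f x + g x) + (norm (f x + g x))\<^sup>2 \<le> 2 * (norm (f x) + (norm (f x))\<^sup>2) + 2 * (norm (g x) + (norm (g x))\<^sup>2)"
      using n norm_ge_zero[of "f x"] norm_ge_zero[of "g x"] unfolding distrib_left by linarith
    then have "ennreal (norm (f x + g x) + (norm (f x + g x))\<^sup>2) \<le> ennreal (2 * (norm (f x) + (norm (f x))\<^sup>2) + 2 * (norm (g x) + (norm (g x))\<^sup>2))"
      by (rule ennreal_leI)
    also have "\<dots> = 2 * ennreal (norm (f x) + (norm (f x))\<^sup>2) + 2 * ennreal (norm (g x) + (norm (g x))\<^sup>2)"
      by (simp add: ennreal_plus ennreal_mult del: distrib_left distrib_right)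
    finally show "ennreal (norm (f x + g x) + (norm (f x + g x))\<^sup>2) \<le> 2 * ennreal (norm (f x) + (norm (f x))\<^sup>2) + 2 * ennreal (norm (g x) + (norm (g x))\<^sup>2)" .
  qed
  also have "\<dots> = 2 * mixed f + 2 * mixed g"
  proof -
    have c: "(\<integral>\<^sup>+x. 2 * ennreal (norm (h x) + (norm (h x))\<^sup>2) \<partial>lebesgue) = 2 * mixed h"
      if [measurable]: "h \<in> borel_measurable lebesgue" for h :: "'a \<Rightarrow> complex"
      unfolding mixed_def by (rule nn_integral_cmult) measurable
    show ?thesis unfolding c[OF assms(1), symmetric] c[OF assms(2), symmetric]
      by (rule nn_integral_add) measurable
  qed
  finally show ?thesis .
qed

lemma C0_measurable: "\<phi> \<in> C0_fun \<Longrightarrow> \<phi> \<in> borel_measurable lebesgue"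
proof -
  assume "\<phi> \<in> C0_fun"
  then have "\<phi> \<in> borel_measurable borel" by (auto simp: C0_fun_def intro: borel_measurable_continuous_onI)
  then have "\<phi> \<in> borel_measurable lborel" by simp
  then show ?thesis by (rule measurable_completion)
qed

lemma C0_borel: "\<phi> \<in> C0_fun \<Longrightarrow> \<phi> \<in> borel_measurable borel"
  by (auto simp: C0_fun_def intro: borel_measurable_continuous_onI)

lemma support_subset: "{x. \<phi> x \<noteq> 0} \<subseteq> closed_support \<phi>"
  unfolding closed_support_def by (rule closure_subset)

lemma support_mem: "\<phi> x \<noteq> 0 \<Longrightarrow> x \<in> closed_support \<phi>"
  using support_subset[of \<phi>] by auto

lemma C0I: "continuous_on UNIV \<phi> \<Longrightarrow> {x. \<phi> x \<noteq> 0} \<subseteq> S \<Longrightarrow> bounded S \<Longrightarrow> \<phi> \<in> C0_fun"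
  by (auto simp: C0_fun_def closed_support_def compact_closure intro: bounded_subset)

lemma C0_bounded:
  assumes "\<phi> \<in> C0_fun"
  obtains M where "0 \<le> M" "\<And>x. norm (\<phi> x) \<le> M"
proof -
  have "compact (\<phi> ` closed_support \<phi>)"
    using assms by (intro compact_continuous_image) (auto simp: C0_fun_def intro: continuous_on_subset)
  then obtain M where M: "\<forall>x\<in>closed_support \<phi>. norm (\<phi> x) \<le> M"
    by (auto dest!: compact_imp_bounded simp: bounded_iff)
  have "norm (\<phi> x) \<le> max M 0" for x
    using M support_mem[of \<phi> x] by (cases "\<phi> x = 0") auto
  then show ?thesis by (intro that[of "max M 0"]) auto
qed

lemma C0_mixed_finite:
  assumes "\<phi> \<in> C0_fun"
  shows "mixed \<phi> < \<infinity>"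
proof -
  obtain M where M: "0 \<le> M" "\<And>x. norm (\<phi> x) \<le> M" using C0_bounded[OF assms] by metis
  have c: "compact (closed_support \<phi>)" using assms by (simp add: C0_fun_def)
  have "mixed \<phi> \<le> (\<integral>\<^sup>+x. ennreal (M + M\<^sup>2) * indicator (closed_support \<phi>) x \<partial>lebesgue)"
    unfolding mixed_def
  proof (rule nn_integral_mono)
    fix x
    show "ennreal (norm (\<phi> x) + (norm (\<phi> x))\<^sup>2) \<le> ennreal (M + M\<^sup>2) * indicator (closed_support \<phi>) x"
    proof (cases "\<phi> x = 0")
      case False
      then have "x \<in> closed_support \<phi>" using support_subset by auto
      then show ?thesis using M by (auto intro!: ennreal_leI add_mono power_mono)
    qed simp
  qed
  also have "\<dots> = ennreal (M + M\<^sup>2) * emeasure lebesgue (closed_support \<phi>)"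
    using lmeasurable_compact[OF c] by (intro nn_integral_cmult_indicator) auto
  also have "\<dots> < \<infinity>" using lmeasurable_compact[OF c] by (auto simp: ennreal_mult_less_top fmeasurable_def)
  finally show ?thesis .
qed

lemma mixed_finite_integrable:
  assumes f: "f \<in> borel_measurable lebesgue" and "mixed f < \<infinity>"
  shows "integrable lebesgue f" "f \<in> L2_fun" "energy f < \<infinity>"
proof -
  have "mass f UNIV < \<infinity>" "energy f < \<infinity>"
    using mass_le_mixed[of f] energy_le_mixed[of f] assms(2) by (meson le_less_trans)+
  then show "integrable lebesgue f" "energy f < \<infinity>"
    using f by (auto simp: integrable_iff_bounded mass_UNIV)
  have [measurable]: "f \<in> borel_measurable lebesgue" by (rule f)
  have "(\<integral>\<^sup>+x. ennreal (norm ((norm (f x))\<^sup>2)) \<partial>lebesgue) < \<infinity>"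
    using \<open>energy f < \<infinity>\<close> by (simp add: energy_def)
  moreover have "(\<lambda>x. (norm (f x))\<^sup>2) \<in> borel_measurable lebesgue" by measurable
  ultimately have "integrable lebesgue (\<lambda>x. (norm (f x))\<^sup>2)" by (intro integrableI_bounded)
  then show "f \<in> L2_fun" using f by (simp add: L2_fun_def)
qed

lemma L2_fun_energy: "f \<in> L2_fun \<longleftrightarrow> f \<in> borel_measurable lebesgue \<and> energy f < \<infinity>"
proof
  assume "f \<in> L2_fun"
  then have f: "f \<in> borel_measurable lebesgue" and i: "integrable lebesgue (\<lambda>x. (norm (f x))\<^sup>2)"
    by (auto simp: L2_fun_def)
  show "f \<in> borel_measurable lebesgue \<and> energy f < \<infinity>"
    using f i by (simp add: energy_def integrable_iff_bounded)
next
  assume *: "f \<in> borel_measurable lebesgue \<and> energy f < \<infinity>"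
  then have [measurable]: "f \<in> borel_measurable lebesgue" by simp
  have "integrable lebesgue (\<lambda>x. (norm (f x))\<^sup>2)"
    using * by (intro integrableI_bounded) (simp_all add: energy_def)
  then show "f \<in> L2_fun" by (simp add: L2_fun_def)
qed

lemma L2_mixed: "integrable lebesgue f \<Longrightarrow> f \<in> L2_fun \<Longrightarrow> mixed f < \<infinity>"
  using mass_finite[of f UNIV] by (simp add: mixed_eq L2_fun_energy)

text \<open>Keeping the approximants inside V preserves the separation of supports that
  \<open>has_kernel\<close> asks for.\<close>

definition approximable :: "'a::euclidean_space set \<Rightarrow> ('a \<Rightarrow> complex) \<Rightarrow> bool" where
  "approximable V f \<longleftrightarrow> (\<forall>e>0. \<exists>\<phi>\<in>C0_fun. {x. \<phi> x \<noteq> 0} \<subseteq> V \<and> mixed (\<lambda>x. f x - \<phi> x) \<le> ennreal e)"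

text \<open>A Urysohn function that is 1 on a compact part of S and 0 off a bounded open subset of
  V; it differs from the indicator only on three small sets.\<close>

lemma approximable_indicator:
  fixes V :: "'a::euclidean_space set"
  assumes V: "open V" and S: "S \<in> sets lebesgue" "S \<subseteq> V" "emeasure lebesgue S < \<infinity>"
  shows "approximable V (\<lambda>x. indicator S x *\<^sub>R c)"
  unfolding approximable_def
proof (intro allI impI)
  fix e :: real assume e: "e > 0"
  define k where "k = norm c + (norm c)\<^sup>2"
  have k: "0 \<le> k" by (simp add: k_def)
  \<comment> \<open>One third for each of the three sets. The denominator k + 1 instead of k avoids
    a division by zero when c = 0.\<close>
  define \<delta> where "\<delta> = e / (k + 1) / 3"
  have \<delta>: "0 < \<delta>" using e k by (simp add: \<delta>_def)
  obtain O' where O: "open O'" "S \<subseteq> O'" "emeasure lebesgue (O' - S) < ennreal \<delta>"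
    using sets_lebesgue_outer_open[OF S(1) \<delta>] by metis
  obtain T where T: "closed T" "T \<subseteq> S" "emeasure lebesgue (S - T) < ennreal \<delta>"
    using sets_lebesgue_inner_closed[OF S(1) \<delta>] by metis
  have Tm: "T \<in> sets lebesgue" using T by auto
  have Om: "O' \<in> sets lebesgue" using O by auto
  \<comment> \<open>The parts of T outside large balls have finite measure and decrease to the empty
    set, so a bounded part of T is enough.\<close>
  have "(\<lambda>n. emeasure lebesgue (T - ball 0 (real n))) \<longlonglongrightarrow> emeasure lebesgue (\<Inter>n. T - ball 0 (real n))"
  proof (rule Lim_emeasure_decseq)
    show "range (\<lambda>n. T - ball 0 (real n)) \<subseteq> sets lebesgue" using Tm by auto
    show "decseq (\<lambda>n. T - ball 0 (real n))" by (auto simp: decseq_def)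
    show "emeasure lebesgue (T - ball 0 (real i)) \<noteq> \<infinity>" for i
    proof -
      have "emeasure lebesgue (T - ball 0 (real i)) \<le> emeasure lebesgue S" using T S by (intro emeasure_mono) auto
      then show ?thesis using S(3) by (auto simp: top_unique)
    qed
  qed
  also have "(\<Inter>n. T - ball 0 (real n)) = {}"
  proof -
    have "\<exists>n. x \<in> ball 0 (real n)" for x :: 'a using reals_Archimedean2[of "norm x"] by auto
    then show ?thesis by blast
  qed
  finally have "(\<lambda>n. emeasure lebesgue (T - ball 0 (real n))) \<longlonglongrightarrow> 0" by simp
  moreover have "0 < ennreal \<delta>" using \<delta> by simp
  ultimately have "\<forall>\<^sub>F n in sequentially. emeasure lebesgue (T - ball 0 (real n)) < ennreal \<delta>"
    by (rule order_tendstoD(2))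
  then obtain n where n: "emeasure lebesgue (T - ball 0 (real n)) < ennreal \<delta>" by (auto simp: eventually_sequentially)
  define R where "R = real n + 1"
  define Q where "Q = O' \<inter> V \<inter> ball 0 R"
  define C where "C = T \<inter> cball 0 (real n)"
  have "closed C" "closed (- Q)" "C \<inter> - Q = {}"
    using T O V S by (auto simp: C_def Q_def R_def)
  then obtain h :: "'a \<Rightarrow> real" where h: "continuous_on UNIV h" "\<And>x. h x \<in> closed_segment 1 0"
    "\<And>x. x \<in> C \<Longrightarrow> h x = 1" "\<And>x. x \<in> - Q \<Longrightarrow> h x = 0"
    using Urysohn[of C "- Q" 1 0] by metis
  have h01: "0 \<le> h x" "h x \<le> 1" for x using h(2)[of x] by (auto simp: closed_segment_eq_real_ivl)
  define \<phi> where "\<phi> = (\<lambda>x. h x *\<^sub>R c)"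
  have supp: "{x. \<phi> x \<noteq> 0} \<subseteq> Q" using h(4) by (auto simp: \<phi>_def)
  have "continuous_on UNIV \<phi>" unfolding \<phi>_def using h(1) by (intro continuous_intros)
  then have \<phi>C: "\<phi> \<in> C0_fun" by (rule C0I[OF _ supp]) (auto simp: Q_def intro: bounded_subset[OF bounded_ball])
  define X where "X = (S - T) \<union> (T - ball 0 (real n)) \<union> (O' - S)"
  have Xm: "X \<in> sets lebesgue" using S(1) Tm Om by (auto simp: X_def)
  have eX: "emeasure lebesgue X \<le> ennreal (3 * \<delta>)"
  proof -
    have "emeasure lebesgue X \<le> emeasure lebesgue ((S - T) \<union> (T - ball 0 (real n))) + emeasure lebesgue (O' - S)"
      unfolding X_def using S(1) Tm Om by (intro emeasure_subadditive) auto
    also have "\<dots> \<le> emeasure lebesgue (S - T) + emeasure lebesgue (T - ball 0 (real n)) + emeasure lebesgue (O' - S)"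
      using S(1) Tm by (intro add_right_mono emeasure_subadditive) auto
    also have "\<dots> \<le> ennreal \<delta> + ennreal \<delta> + ennreal \<delta>" using T O n by (intro add_mono less_imp_le)
    also have "\<dots> = ennreal (3 * \<delta>)" using \<delta> by (simp add: ennreal_plus[symmetric] del: ennreal_plus)
    finally show ?thesis .
  qed
  have "mixed (\<lambda>x. indicator S x *\<^sub>R c - \<phi> x) \<le> (\<integral>\<^sup>+x. ennreal k * indicator X x \<partial>lebesgue)"
    unfolding mixed_def
  proof (rule nn_integral_mono)
    fix x
    have eq: "indicator S x *\<^sub>R c - \<phi> x = (indicator S x - h x) *\<^sub>R c" by (simp add: \<phi>_def scaleR_diff_left)
    show "ennreal (norm (indicator S x *\<^sub>R c - \<phi> x) + (norm (indicator S x *\<^sub>R c - \<phi> x))\<^sup>2) \<le> ennreal k * indicator X x"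
    proof (cases "x \<in> X")
      case True
      have "\<bar>indicator S x - h x\<bar> \<le> 1" using h01[of x] by (auto simp: indicator_def)
      then have "norm (indicator S x *\<^sub>R c - \<phi> x) \<le> 1 * norm c"
        unfolding eq norm_scaleR by (rule mult_right_mono) simp
      then have "norm (indicator S x *\<^sub>R c - \<phi> x) + (norm (indicator S x *\<^sub>R c - \<phi> x))\<^sup>2 \<le> k"
        unfolding k_def by (intro add_mono power_mono) auto
      then show ?thesis using True by (simp add: ennreal_leI del: ennreal_plus)
    next
      case False
      have "indicator S x = h x"
      proof (cases "x \<in> S")
        case True
        then have "x \<in> C" using False by (auto simp: X_def C_def)
        then show ?thesis using h(3) True by simp
      next
        case nS: False
        then have "x \<notin> O'" using False by (auto simp: X_def)
        then show ?thesis using h(4)[of x] nS by (simp add: Q_def)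
      qed
      then have "indicator S x *\<^sub>R c - \<phi> x = 0" unfolding eq by simp
      then show ?thesis by (simp only: norm_zero) simp
    qed
  qed
  also have "\<dots> = ennreal k * emeasure lebesgue X" using Xm by (intro nn_integral_cmult_indicator)
  also have "\<dots> \<le> ennreal k * ennreal (3 * \<delta>)" by (intro mult_left_mono eX) simp
  also have "\<dots> = ennreal (k * (3 * \<delta>))" using k by (intro ennreal_mult'[symmetric])
  also have "\<dots> \<le> ennreal e"
  proof (rule ennreal_leI)
    have third: "3 * (u / 3) = u" for u :: real by simp
    have "k * (3 * \<delta>) = e * (k / (k + 1))" unfolding \<delta>_def third by simp
    also have "\<dots> \<le> e * 1" using e k by (intro mult_left_mono) auto
    finally show "k * (3 * \<delta>) \<le> e" by simp
  qed
  finally have "mixed (\<lambda>x. indicator S x *\<^sub>R c - \<phi> x) \<le> ennreal e" .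
  then show "\<exists>\<phi>\<in>C0_fun. {x. \<phi> x \<noteq> 0} \<subseteq> V \<and> mixed (\<lambda>x. indicator S x *\<^sub>R c - \<phi> x) \<le> ennreal e"
    using \<phi>C supp by (intro bexI[of _ \<phi>]) (auto simp: Q_def)
qed

lemma C0_add: "\<phi> \<in> C0_fun \<Longrightarrow> \<psi> \<in> C0_fun \<Longrightarrow> (\<lambda>x. \<phi> x + \<psi> x) \<in> C0_fun"
proof (rule C0I[of _ "closed_support \<phi> \<union> closed_support \<psi>"])
  assume *: "\<phi> \<in> C0_fun" "\<psi> \<in> C0_fun"
  show "continuous_on UNIV (\<lambda>x. \<phi> x + \<psi> x)"
    using * by (intro continuous_on_add) (auto simp: C0_fun_def)
  have "{x. \<phi> x + \<psi> x \<noteq> 0} \<subseteq> {x. \<phi> x \<noteq> 0} \<union> {x. \<psi> x \<noteq> 0}" by auto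
  then show "{x. \<phi> x + \<psi> x \<noteq> 0} \<subseteq> closed_support \<phi> \<union> closed_support \<psi>"
    using support_subset[of \<phi>] support_subset[of \<psi>] by blast
  show "bounded (closed_support \<phi> \<union> closed_support \<psi>)"
    using * by (simp add: C0_fun_def compact_imp_bounded)
qed

lemma approximable_add:
  assumes [measurable]: "f \<in> borel_measurable lebesgue" "g \<in> borel_measurable lebesgue"
    and "approximable V f" "approximable V g"
  shows "approximable V (\<lambda>x. f x + g x)"
  unfolding approximable_def
proof (intro allI impI)
  fix e :: real assume "e > 0"
  then have e: "e / 4 > 0" by simp
  obtain \<phi> where \<phi>: "\<phi> \<in> C0_fun" "{x. \<phi> x \<noteq> 0} \<subseteq> V" "mixed (\<lambda>x. f x - \<phi> x) \<le> ennreal (e / 4)"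
    using assms(3) e unfolding approximable_def by meson
  obtain \<psi> where \<psi>: "\<psi> \<in> C0_fun" "{x. \<psi> x \<noteq> 0} \<subseteq> V" "mixed (\<lambda>x. g x - \<psi> x) \<le> ennreal (e / 4)"
    using assms(4) e unfolding approximable_def by meson
  have [measurable]: "\<phi> \<in> borel_measurable lebesgue" "\<psi> \<in> borel_measurable lebesgue"
    using C0_measurable \<phi> \<psi> by auto
  have "(\<lambda>x. f x + g x - (\<phi> x + \<psi> x)) = (\<lambda>x. (f x - \<phi> x) + (g x - \<psi> x))" by (simp add: fun_eq_iff)
  then have "mixed (\<lambda>x. f x + g x - (\<phi> x + \<psi> x)) \<le> 2 * mixed (\<lambda>x. f x - \<phi> x) + 2 * mixed (\<lambda>x. g x - \<psi> x)"
    using mixed_add_le[of "\<lambda>x. f x - \<phi> x" "\<lambda>x. g x - \<psi> x"] by simp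
  also have "\<dots> \<le> 2 * ennreal (e / 4) + 2 * ennreal (e / 4)"
    using \<phi>(3) \<psi>(3) by (intro add_mono mult_left_mono) auto
  also have "\<dots> = ennreal e"
  proof -
    have "2 * ennreal (e / 4) = ennreal (2 * (e / 4))" by (subst ennreal_mult') auto
    then show ?thesis using \<open>e > 0\<close> by (simp add: ennreal_plus[symmetric] del: ennreal_plus)
  qed
  finally have b: "mixed (\<lambda>x. f x + g x - (\<phi> x + \<psi> x)) \<le> ennreal e" .
  have "{x. \<phi> x + \<psi> x \<noteq> 0} \<subseteq> {x. \<phi> x \<noteq> 0} \<union> {x. \<psi> x \<noteq> 0}" by auto
  then have s: "{x. \<phi> x + \<psi> x \<noteq> 0} \<subseteq> V" using \<phi>(2) \<psi>(2) by blast
  show "\<exists>\<phi>\<in>C0_fun. {x. \<phi> x \<noteq> 0} \<subseteq> V \<and> mixed (\<lambda>x. f x + g x - \<phi> x) \<le> ennreal e"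
    by (rule bexI[OF _ C0_add[OF \<phi>(1) \<psi>(1)]]) (use b s in simp)
qed

lemma approximable_zero: "approximable V (\<lambda>x :: 'a::euclidean_space. 0)"
proof -
  have z: "(\<lambda>x :: 'a. 0) \<in> C0_fun" by (simp add: C0_fun_def closed_support_def)
  have "mixed (\<lambda>x :: 'a. 0) = 0" by (simp add: mixed_def)
  then show ?thesis unfolding approximable_def
    by (intro allI impI bexI[OF _ z]) simp
qed

text \<open>Simple functions bounded by 2 |f| converge to f. The bound keeps their nonzero values
  inside V and on sets of finite measure, and it provides the dominating function, as |f - s i|
  \<le> 3 |f|.\<close>

lemma approximable_L1_L2:
  assumes V: "open V" and f: "integrable lebesgue f" "f \<in> L2_fun" and supp: "\<And>x. x \<notin> V \<Longrightarrow> f x = 0"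
  shows "approximable V f"
  unfolding approximable_def
proof (intro allI impI)
  fix e :: real assume "e > 0"
  then have e: "e / 4 > 0" by simp
  have fm [measurable]: "f \<in> borel_measurable lebesgue" using f by auto
  obtain s where s: "\<And>i. simple_function lebesgue (s i)" "\<And>x. (\<lambda>i. s i x) \<longlonglongrightarrow> f x"
    "\<And>i x. norm (s i x) \<le> 2 * norm (f x)"
    using borel_measurable_implies_sequence_metric[OF fm, of 0] by auto
  have sm [measurable]: "s i \<in> borel_measurable lebesgue" for i using s(1) by (rule borel_measurable_simple_function)
  have s_app: "approximable V (s i)" for i
  proof -
    have fin: "finite (range (s i))" using simple_functionD(1)[OF s(1)] by simp
    have lev: "s i -` {y} \<in> sets lebesgue" for y using simple_functionD(2)[OF s(1), of i "{y}"] by simp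
    have one: "approximable V (\<lambda>x. indicator (s i -` {y}) x *\<^sub>R y) \<and> (\<lambda>x. indicator (s i -` {y}) x *\<^sub>R y) \<in> borel_measurable lebesgue" for y
    proof (cases "y = 0")
      case True then show ?thesis using approximable_zero by simp
    next
      case False
      have sub: "s i -` {y} \<subseteq> V"
      proof
        fix x assume "x \<in> s i -` {y}"
        then have "s i x \<noteq> 0" using False by simp
        then have "f x \<noteq> 0" using s(3)[of i x] by auto
        then show "x \<in> V" using supp by blast
      qed
      have "ennreal (norm y) * emeasure lebesgue (s i -` {y}) = (\<integral>\<^sup>+x. ennreal (norm y) * indicator (s i -` {y}) x \<partial>lebesgue)"
        using lev by (intro nn_integral_cmult_indicator[symmetric])
      also have "\<dots> \<le> (\<integral>\<^sup>+x. 2 * ennreal (norm (f x)) \<partial>lebesgue)"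
      proof (rule nn_integral_mono)
        fix x
        show "ennreal (norm y) * indicator (s i -` {y}) x \<le> 2 * ennreal (norm (f x))"
        proof (cases "s i x = y")
          case True
          then have "ennreal (norm y) \<le> ennreal (2 * norm (f x))" using s(3)[of i x] by (intro ennreal_leI) simp
          then show ?thesis using True by (simp add: ennreal_mult)
        qed simp
      qed
      also have "\<dots> = 2 * mass f UNIV" unfolding mass_UNIV by (rule nn_integral_cmult) measurable
      also have "\<dots> < \<infinity>" using mass_finite[OF f(1), of UNIV] by (simp add: ennreal_mult_less_top)
      finally have "emeasure lebesgue (s i -` {y}) < \<infinity>" using False by (auto simp: ennreal_mult_less_top)
      then have "approximable V (\<lambda>x. indicator (s i -` {y}) x *\<^sub>R y)"
        by (rule approximable_indicator[OF V lev sub])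
      moreover have "(\<lambda>x. indicator (s i -` {y}) x *\<^sub>R y) \<in> borel_measurable lebesgue"
        using lev by (intro borel_measurable_scaleR borel_measurable_indicator) auto
      ultimately show ?thesis by simp
    qed
    have "approximable V (\<lambda>x. \<Sum>y\<in>Y. indicator (s i -` {y}) x *\<^sub>R y) \<and>
        (\<lambda>x. \<Sum>y\<in>Y. indicator (s i -` {y}) x *\<^sub>R y) \<in> borel_measurable lebesgue" if "finite Y" for Y
      using that
    proof induction
      case empty then show ?case using approximable_zero by simp
    next
      case (insert y Y)
      have "approximable V (\<lambda>x. indicator (s i -` {y}) x *\<^sub>R y + (\<Sum>y\<in>Y. indicator (s i -` {y}) x *\<^sub>R y))"
        using one[of y] insert.IH by (intro approximable_add) auto
      moreover have "(\<lambda>x. indicator (s i -` {y}) x *\<^sub>R y + (\<Sum>y\<in>Y. indicator (s i -` {y}) x *\<^sub>R y)) \<in> borel_measurable lebesgue"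
        using one[of y] insert.IH by (intro borel_measurable_add) auto
      ultimately show ?case by (simp only: sum.insert[OF insert.hyps(1,2)] simp_thms)
    qed
    from conjunct1[OF this[OF fin]]
    have fin_app: "approximable V (\<lambda>x. \<Sum>y\<in>range (s i). indicator (s i -` {y}) x *\<^sub>R y)" .
    have eq: "s i = (\<lambda>x. \<Sum>y\<in>range (s i). indicator (s i -` {y}) x *\<^sub>R y)"
    proof (rule ext)
      fix x
      have "s i x = (\<Sum>y\<in>s i ` space lebesgue. indicator (s i -` {y} \<inter> space lebesgue) x *\<^sub>R y)"
        by (rule simple_function_indicator_representation_banach[OF s(1)]) simp
      then show "s i x = (\<Sum>y\<in>range (s i). indicator (s i -` {y}) x *\<^sub>R y)"
        by (simp only: space_completion space_lborel space_borel Int_UNIV_right)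
    qed
    show ?thesis using fin_app unfolding eq[symmetric] .
  qed
  have "(\<lambda>i. mixed (\<lambda>x. f x - s i x)) \<longlonglongrightarrow> (\<integral>\<^sup>+x. 0 \<partial>(lebesgue :: 'a measure))"
    unfolding mixed_def
  proof (rule nn_integral_dominated_convergence[where w = "\<lambda>x. 9 * ennreal (norm (f x) + (norm (f x))\<^sup>2)"])
    show "AE x in lebesgue. ennreal (norm (f x - s i x) + (norm (f x - s i x))\<^sup>2) \<le> 9 * ennreal (norm (f x) + (norm (f x))\<^sup>2)" for i
    proof (rule AE_I2)
      fix x
      have nine: "(3 * u)\<^sup>2 = 9 * u\<^sup>2" for u :: real by (simp add: power_mult_distrib)
      have 3: "norm (f x - s i x) \<le> 3 * norm (f x)"
        using norm_triangle_ineq4[of "f x" "s i x"] s(3)[of i x] by linarith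
      then have "(norm (f x - s i x))\<^sup>2 \<le> (3 * norm (f x))\<^sup>2" by (rule power_mono) simp
      then have "norm (f x - s i x) + (norm (f x - s i x))\<^sup>2 \<le> 9 * (norm (f x) + (norm (f x))\<^sup>2)"
        using 3 norm_ge_zero[of "f x"] unfolding nine distrib_left by linarith
      then have "ennreal (norm (f x - s i x) + (norm (f x - s i x))\<^sup>2) \<le> ennreal (9 * (norm (f x) + (norm (f x))\<^sup>2))"
        by (rule ennreal_leI)
      also have "\<dots> = 9 * ennreal (norm (f x) + (norm (f x))\<^sup>2)" by (subst ennreal_mult') auto
      finally show "ennreal (norm (f x - s i x) + (norm (f x - s i x))\<^sup>2) \<le> 9 * ennreal (norm (f x) + (norm (f x))\<^sup>2)" .
    qed
    have "(\<integral>\<^sup>+x. 9 * ennreal (norm (f x) + (norm (f x))\<^sup>2) \<partial>lebesgue) = 9 * mixed f"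
      unfolding mixed_def by (rule nn_integral_cmult) measurable
    also have "\<dots> < \<infinity>" using L2_mixed[OF f] by (simp add: ennreal_mult_less_top)
    finally show "(\<integral>\<^sup>+x. 9 * ennreal (norm (f x) + (norm (f x))\<^sup>2) \<partial>lebesgue) < \<infinity>" .
    show "AE x in lebesgue. (\<lambda>i. ennreal (norm (f x - s i x) + (norm (f x - s i x))\<^sup>2)) \<longlonglongrightarrow> 0"
    proof (rule AE_I2)
      fix x
      have "(\<lambda>i. ennreal (norm (f x - s i x) + (norm (f x - s i x))\<^sup>2)) \<longlonglongrightarrow> ennreal (norm (f x - f x) + (norm (f x - f x))\<^sup>2)"
        using s(2)[of x] by (intro tendsto_intros)
      then show "(\<lambda>i. ennreal (norm (f x - s i x) + (norm (f x - s i x))\<^sup>2)) \<longlonglongrightarrow> 0" by simp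
    qed
  qed measurable
  then have "(\<lambda>i. mixed (\<lambda>x. f x - s i x)) \<longlonglongrightarrow> 0" by simp
  moreover have "0 < ennreal (e / 4)" using e by simp
  ultimately have "\<forall>\<^sub>F i in sequentially. mixed (\<lambda>x. f x - s i x) < ennreal (e / 4)" by (rule order_tendstoD(2))
  then obtain i where i: "mixed (\<lambda>x. f x - s i x) < ennreal (e / 4)" by (auto simp: eventually_sequentially)
  obtain \<phi> where \<phi>: "\<phi> \<in> C0_fun" "{x. \<phi> x \<noteq> 0} \<subseteq> V" "mixed (\<lambda>x. s i x - \<phi> x) \<le> ennreal (e / 4)"
    using s_app[of i] e unfolding approximable_def by meson
  have [measurable]: "\<phi> \<in> borel_measurable lebesgue" by (rule C0_measurable[OF \<phi>(1)])
  have "mixed (\<lambda>x. f x - \<phi> x) = mixed (\<lambda>x. (f x - s i x) + (s i x - \<phi> x))" by simp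
  also have "\<dots> \<le> 2 * mixed (\<lambda>x. f x - s i x) + 2 * mixed (\<lambda>x. s i x - \<phi> x)"
    by (rule mixed_add_le) measurable
  also have "\<dots> \<le> 2 * ennreal (e / 4) + 2 * ennreal (e / 4)"
    using i \<phi>(3) by (intro add_mono mult_left_mono) auto
  also have "\<dots> = ennreal e"
  proof -
    have "2 * ennreal (e / 4) = ennreal (2 * (e / 4))" by (subst ennreal_mult') auto
    then show ?thesis using \<open>e > 0\<close> by (simp add: ennreal_plus[symmetric] del: ennreal_plus)
  qed
  finally show "\<exists>\<phi>\<in>C0_fun. {x. \<phi> x \<noteq> 0} \<subseteq> V \<and> mixed (\<lambda>x. f x - \<phi> x) \<le> ennreal e"
    using \<phi> by (intro bexI[of _ \<phi>]) auto
qed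

subsection \<open>The kernel representation of the operator\<close>

lemma L2_measurable: "f \<in> L2_fun \<Longrightarrow> f \<in> borel_measurable lebesgue"
  by (simp add: L2_fun_def)

text \<open>Cauchy-Schwarz in the form 2 |u v| \<le> s |u|^2 + |v|^2 / s; the free parameter s
  replaces square roots.\<close>

lemma pair_bound:
  assumes u: "u \<in> borel_measurable lebesgue" "energy u \<le> ennreal a" "0 \<le> a"
    and v: "v \<in> borel_measurable lebesgue" "energy v \<le> ennreal b" "0 \<le> b" and s: "0 < s"
  shows "integrable lebesgue (\<lambda>x. u x * v x)" "norm (\<integral>x. u x * v x \<partial>lebesgue) \<le> (s * a + b / s) / 2"
proof -
  have [measurable]: "u \<in> borel_measurable lebesgue" "v \<in> borel_measurable lebesgue" using u v by auto
  have "(\<integral>\<^sup>+x. ennreal (norm (u x * v x)) \<partial>lebesgue) \<le> (\<integral>\<^sup>+x. ennreal (s / 2) * ennreal ((norm (u x))\<^sup>2) + ennreal (1 / (2 * s)) * ennreal ((norm (v x))\<^sup>2) \<partial>lebesgue)"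
  proof (rule nn_integral_mono)
    fix x
    have "0 \<le> (s * norm (u x) - norm (v x))\<^sup>2" by simp
    then have "2 * s * (norm (u x) * norm (v x)) \<le> s\<^sup>2 * (norm (u x))\<^sup>2 + (norm (v x))\<^sup>2"
      by (simp add: power2_diff power_mult_distrib algebra_simps)
    then have "norm (u x) * norm (v x) \<le> (s\<^sup>2 * (norm (u x))\<^sup>2 + (norm (v x))\<^sup>2) / (2 * s)"
      using s by (simp add: pos_le_divide_eq algebra_simps)
    also have "\<dots> = s / 2 * (norm (u x))\<^sup>2 + 1 / (2 * s) * (norm (v x))\<^sup>2"
      using s by (simp add: add_divide_distrib power2_eq_square)
    finally have "ennreal (norm (u x * v x)) \<le> ennreal (s / 2 * (norm (u x))\<^sup>2 + 1 / (2 * s) * (norm (v x))\<^sup>2)"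
      by (simp only: norm_mult ennreal_leI)
    also have "\<dots> = ennreal (s / 2 * (norm (u x))\<^sup>2) + ennreal (1 / (2 * s) * (norm (v x))\<^sup>2)"
      using s by (intro ennreal_plus) auto
    also have "\<dots> = ennreal (s / 2) * ennreal ((norm (u x))\<^sup>2) + ennreal (1 / (2 * s)) * ennreal ((norm (v x))\<^sup>2)"
      using s by (intro arg_cong2[where f = "(+)"] ennreal_mult') auto
    finally show "ennreal (norm (u x * v x)) \<le> ennreal (s / 2) * ennreal ((norm (u x))\<^sup>2) + ennreal (1 / (2 * s)) * ennreal ((norm (v x))\<^sup>2)" .
  qed
  also have "\<dots> = ennreal (s / 2) * energy u + ennreal (1 / (2 * s)) * energy v"
  proof -
    have "(\<integral>\<^sup>+x. ennreal (s / 2) * ennreal ((norm (u x))\<^sup>2) \<partial>lebesgue) = ennreal (s / 2) * energy u"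
      unfolding energy_def by (rule nn_integral_cmult) measurable
    moreover have "(\<integral>\<^sup>+x. ennreal (1 / (2 * s)) * ennreal ((norm (v x))\<^sup>2) \<partial>lebesgue) = ennreal (1 / (2 * s)) * energy v"
      unfolding energy_def by (rule nn_integral_cmult) measurable
    moreover have "(\<integral>\<^sup>+x. ennreal (s / 2) * ennreal ((norm (u x))\<^sup>2) + ennreal (1 / (2 * s)) * ennreal ((norm (v x))\<^sup>2) \<partial>lebesgue)
      = (\<integral>\<^sup>+x. ennreal (s / 2) * ennreal ((norm (u x))\<^sup>2) \<partial>lebesgue) + (\<integral>\<^sup>+x. ennreal (1 / (2 * s)) * ennreal ((norm (v x))\<^sup>2) \<partial>lebesgue)"
      by (rule nn_integral_add) measurable
    ultimately show ?thesis by simp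
  qed
  also have "\<dots> \<le> ennreal (s / 2) * ennreal a + ennreal (1 / (2 * s)) * ennreal b"
    using u v by (intro add_mono mult_left_mono) auto
  also have "\<dots> = ennreal ((s * a + b / s) / 2)"
    using s u v by (simp add: ennreal_mult'[symmetric] ennreal_plus[symmetric] add_divide_distrib del: ennreal_plus)
  finally have *: "(\<integral>\<^sup>+x. ennreal (norm (u x * v x)) \<partial>lebesgue) \<le> ennreal ((s * a + b / s) / 2)" .
  show i: "integrable lebesgue (\<lambda>x. u x * v x)"
    by (rule integrableI_bounded) (measurable, use * in \<open>auto intro: le_less_trans\<close>)
  show "norm (\<integral>x. u x * v x \<partial>lebesgue) \<le> (s * a + b / s) / 2"
    by (rule dominated_Ints_norm_bound[OF i *]) (use s u v in auto)
qed

lemma energy_real: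
  assumes "f \<in> L2_fun"
  obtains a where "energy f = ennreal a" "0 \<le> a"
  using assms by (cases "energy f") (auto simp: L2_fun_energy)

text \<open>The integrals are summable, so the series of the functions is finite almost everywhere
  and its terms tend to 0.\<close>

lemma AE_summable_to_zero:
  fixes g :: "nat \<Rightarrow> 'b \<Rightarrow> ennreal"
  assumes m: "\<And>n. g n \<in> borel_measurable M" and le: "\<And>n. (\<integral>\<^sup>+x. g n x \<partial>M) \<le> ennreal (c * (1/4) ^ n)" and c: "0 \<le> c"
  shows "AE x in M. (\<lambda>n. g n x) \<longlonglongrightarrow> 0"
proof -
  have "(\<integral>\<^sup>+x. (\<Sum>n. g n x) \<partial>M) = (\<Sum>n. \<integral>\<^sup>+x. g n x \<partial>M)" by (rule nn_integral_suminf[OF m])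
  also have "\<dots> \<le> (\<Sum>n. ennreal (c * (1/4) ^ n))" by (intro suminf_le le) auto
  also have "\<dots> = ennreal (\<Sum>n. c * (1/4) ^ n)"
    using c by (intro suminf_ennreal2) (auto intro!: summable_mult summable_geometric)
  also have "\<dots> < \<infinity>" by simp
  finally have "(\<integral>\<^sup>+x. (\<Sum>n. g n x) \<partial>M) \<noteq> \<infinity>" by simp
  moreover have "(\<lambda>x. \<Sum>n. g n x) \<in> borel_measurable M"
    using m by (intro borel_measurable_suminf_order)
  ultimately have "AE x in M. (\<Sum>n. g n x) \<noteq> \<infinity>" by (intro nn_integral_PInf_AE)
  then show ?thesis
  proof eventually_elim
    case (elim x)
    then have fin: "(\<Sum>n. g n x) \<noteq> top" by simp
    have each: "g n x = ennreal (enn2real (g n x))" for n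
    proof -
      have "g n x = (\<Sum>k\<in>{n}. g k x)" by simp
      also have "\<dots> \<le> (\<Sum>n. g n x)" by (rule sum_le_suminf) auto
      finally have "g n x \<noteq> top" using fin by (auto simp: top_unique)
      then show ?thesis by (simp add: less_top)
    qed
    have "summable (\<lambda>n. enn2real (g n x))"
      using fin by (intro summable_suminf_not_top) (auto simp: each[symmetric])
    then have "(\<lambda>n. enn2real (g n x)) \<longlonglongrightarrow> 0" by (rule summable_LIMSEQ_zero)
    then have "(\<lambda>n. ennreal (enn2real (g n x))) \<longlonglongrightarrow> ennreal 0" by (rule tendsto_ennrealI)
    then show "(\<lambda>n. g n x) \<longlonglongrightarrow> 0" by (simp add: each[symmetric])
  qed
qed

lemma tendsto_zero_of_square:
  fixes z :: "nat \<Rightarrow> complex"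
  assumes "(\<lambda>n. ennreal ((norm (z n))\<^sup>2)) \<longlonglongrightarrow> 0"
  shows "z \<longlonglongrightarrow> 0"
proof -
  have "(\<lambda>n. (norm (z n))\<^sup>2) \<longlonglongrightarrow> 0"
    using assms by (subst tendsto_ennreal_iff[symmetric]) auto
  then have "(\<lambda>n. sqrt ((norm (z n))\<^sup>2)) \<longlonglongrightarrow> sqrt 0" by (rule tendsto_real_sqrt)
  then have "(\<lambda>n. norm (z n)) \<longlonglongrightarrow> 0" by simp
  then show ?thesis by (rule tendsto_norm_zero_cancel)
qed

lemma norm_lebesgue_integral_le:
  fixes f :: "'b \<Rightarrow> complex"
  assumes "integrable M f" "integrable M g" "\<And>x. norm (f x) \<le> g x"
  shows "norm (integral\<^sup>L M f) \<le> integral\<^sup>L M g"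
proof -
  have "norm (integral\<^sup>L M f) \<le> (\<integral>x. norm (f x) \<partial>M)" by (rule Bochner_Integration.integral_norm_bound)
  also have "\<dots> \<le> integral\<^sup>L M g"
    by (rule integral_mono) (use assms in auto)
  finally show ?thesis .
qed

lemma bump:
  fixes c :: "'a::euclidean_space"
  assumes "0 < \<eta>"
  obtains p :: "'a \<Rightarrow> real" where "continuous_on UNIV p" "\<And>u. 0 \<le> p u" "\<And>u. p u \<le> 1"
    "\<And>u. u \<notin> cball c \<eta> \<Longrightarrow> p u = 0" "\<And>u. u \<in> ball c (\<eta> / 2) \<Longrightarrow> 1 / 2 \<le> p u"
proof (rule that[of "\<lambda>u. max 0 (1 - dist c u / \<eta>)"])
  show "continuous_on UNIV (\<lambda>u. max 0 (1 - dist c u / \<eta>))"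
    using assms by (intro continuous_intros) auto
  show "max 0 (1 - dist c u / \<eta>) \<le> 1" for u using assms by simp
  show "max 0 (1 - dist c u / \<eta>) = 0" if "u \<notin> cball c \<eta>" for u
  proof -
    have "1 \<le> dist c u / \<eta>" using that assms by (simp add: pos_le_divide_eq)
    then show ?thesis by simp
  qed
  show "1 / 2 \<le> max 0 (1 - dist c u / \<eta>)" if "u \<in> ball c (\<eta> / 2)" for u
  proof -
    have "dist c u / \<eta> \<le> 1 / 2" using that assms by (simp add: pos_divide_le_eq)
    then show ?thesis by linarith
  qed
qed simp

section \<open>The operator on square integrable functions and the size of its kernel\<close>

locale cz_T = cz_regular \<omega> K for \<omega> and K :: "'a::euclidean_space \<Rightarrow> 'a \<Rightarrow> complex" +
  fixes T :: "('a \<Rightarrow> complex) \<Rightarrow> 'a \<Rightarrow> complex" and B :: real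
  assumes T_L2: "f \<in> L2_fun \<Longrightarrow> T f \<in> L2_fun"
    and T_add: "f \<in> L2_fun \<Longrightarrow> g \<in> L2_fun \<Longrightarrow> AE x in lebesgue. T (\<lambda>y. f y + g y) x = T f x + T g x"
    and T_scale: "f \<in> L2_fun \<Longrightarrow> AE x in lebesgue. T (\<lambda>y. c * f y) x = c * T f x"
    and T_bound: "f \<in> L2_fun \<Longrightarrow> energy (T f) \<le> ennreal B * energy f" and B: "0 \<le> B"
    and T_kernel: "has_kernel T K"
begin

text \<open>As the supports are disjoint, the integrand vanishes on the diagonal, where the kernel
  may be set to 0. The integrand becomes Borel, and Fubini applies to \<open>lborel\<close>.\<close>

lemma kernel_fubini:
  assumes \<phi>: "\<phi> \<in> C0_fun" and \<gamma>: "\<gamma> \<in> C0_fun" and disj: "closed_support \<phi> \<inter> closed_support \<gamma> = {}"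
  shows "integrable lborel (\<lambda>x. (\<integral>y. (if x = y then 0 else K x y) * \<phi> y \<partial>lborel) * \<gamma> x)"
    "(\<integral>x. T \<phi> x * \<gamma> x \<partial>lebesgue) = (\<integral>x. (\<integral>y. (if x = y then 0 else K x y) * \<phi> y \<partial>lborel) * \<gamma> x \<partial>lborel)"
proof -
  have [measurable]: "\<phi> \<in> borel_measurable borel" "\<gamma> \<in> borel_measurable borel"
    using C0_borel \<phi> \<gamma> by auto
  define F where "F = (\<lambda>(x, y). (if x = y then 0 else K x y) * \<phi> y * \<gamma> x)"
  have Fm: "F \<in> borel_measurable (borel \<Otimes>\<^sub>M borel)"
  proof -
    have "(\<lambda>p. (\<lambda>(x, y). if x = y then 0 else K x y) p * \<phi> (snd p) * \<gamma> (fst p)) \<in> borel_measurable (borel \<Otimes>\<^sub>M borel)"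
      by measurable
    then show ?thesis by (simp add: F_def case_prod_beta')
  qed
  then have Fb: "F \<in> borel_measurable lborel" by (simp add: borel_prod)
  have eq: "(\<lambda>(x, y). K x y * \<phi> y * \<gamma> x) = F"
  proof -
    have "\<phi> x = 0 \<or> \<gamma> x = 0" for x using disj support_mem[of \<phi> x] support_mem[of \<gamma> x] by blast
    then show ?thesis by (auto simp: F_def fun_eq_iff)
  qed
  have "has_bochner_integral lebesgue F (\<integral>x. T \<phi> x * \<gamma> x \<partial>lebesgue)"
    using T_kernel \<phi> \<gamma> disj unfolding has_kernel_def eq[symmetric] by blast
  then have "integrable lebesgue F" "integral\<^sup>L lebesgue F = (\<integral>x. T \<phi> x * \<gamma> x \<partial>lebesgue)"
    by (auto simp: has_bochner_integral_iff)
  then have F: "integrable lborel F" "integral\<^sup>L lborel F = (\<integral>x. T \<phi> x * \<gamma> x \<partial>lebesgue)"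
    using integrable_completion[OF Fb] integral_completion[OF Fb] by auto
  then have F': "integrable (lborel \<Otimes>\<^sub>M lborel) F" "integral\<^sup>L (lborel \<Otimes>\<^sub>M lborel) F = (\<integral>x. T \<phi> x * \<gamma> x \<partial>lebesgue)"
    by (simp_all add: lborel_prod)
  have in_eq: "(\<integral>y. F (x, y) \<partial>lborel) = (\<integral>y. (if x = y then 0 else K x y) * \<phi> y \<partial>lborel) * \<gamma> x" for x
    unfolding F_def by simp
  show "integrable lborel (\<lambda>x. (\<integral>y. (if x = y then 0 else K x y) * \<phi> y \<partial>lborel) * \<gamma> x)"
    using lborel_pair.integrable_fst'[OF F'(1)] unfolding in_eq .
  show "(\<integral>x. T \<phi> x * \<gamma> x \<partial>lebesgue) = (\<integral>x. (\<integral>y. (if x = y then 0 else K x y) * \<phi> y \<partial>lborel) * \<gamma> x \<partial>lborel)"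
    using lborel_pair.integral_fst'[OF F'(1)] F'(2) unfolding in_eq by simp
qed

text \<open>The operator norm controls the kernel itself: test it against two bumps whose supports are
  small compared with their distance, where the kernel is nearly constant.\<close>

lemma kernel_size:
  assumes "x0 \<noteq> y0"
  shows "norm (K x0 y0) \<le> ((B + 1) * 16 ^ DIM('a) / unit_ball_vol (real DIM('a)) + 2 * 2 ^ DIM('a)) / dist x0 y0 ^ DIM('a)"
proof -
  define r where "r = dist x0 y0"
  have r: "0 < r" using assms by (simp add: r_def)
  \<comment> \<open>With an eighth of the distance the two balls are disjoint, and the regularity
    condition allows one variable to move by \<eta> even after the other has moved.\<close>
  define \<eta> where "\<eta> = r / 8"
  have \<eta>: "0 < \<eta>" using r by (simp add: \<eta>_def)
  obtain p :: "'a \<Rightarrow> real" where p: "continuous_on UNIV p" "\<And>u. 0 \<le> p u" "\<And>u. p u \<le> 1"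
    "\<And>u. u \<notin> cball y0 \<eta> \<Longrightarrow> p u = 0" "\<And>u. u \<in> ball y0 (\<eta> / 2) \<Longrightarrow> 1 / 2 \<le> p u"
    using bump[OF \<eta>] by metis
  obtain q :: "'a \<Rightarrow> real" where q: "continuous_on UNIV q" "\<And>u. 0 \<le> q u" "\<And>u. q u \<le> 1"
    "\<And>u. u \<notin> cball x0 \<eta> \<Longrightarrow> q u = 0" "\<And>u. u \<in> ball x0 (\<eta> / 2) \<Longrightarrow> 1 / 2 \<le> q u"
    using bump[OF \<eta>] by metis
  define v where "v = unit_ball_vol (real DIM('a))"
  have v: "0 < v" by (simp add: v_def)
  \<comment> \<open>A lower bound for the integral of a bump, which is at least 1/2 on a ball of
    radius \<eta> / 2.\<close>
  define low where "low = v * (\<eta> / 2) ^ DIM('a) / 2"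
  have low: "0 < low" using v \<eta> by (simp add: low_def)
  have gen: "(\<lambda>u. complex_of_real (h u)) \<in> C0_fun \<and> closed_support (\<lambda>u. complex_of_real (h u)) \<subseteq> cball c \<eta> \<and>
      integrable lborel h \<and> energy (\<lambda>u. complex_of_real (h u)) \<le> ennreal (integral\<^sup>L lborel h) \<and> low \<le> integral\<^sup>L lborel h"
    if h: "continuous_on UNIV h" "\<And>u. 0 \<le> h u" "\<And>u. h u \<le> 1"
      "\<And>u. u \<notin> cball c \<eta> \<Longrightarrow> h u = 0" "\<And>u. u \<in> ball c (\<eta> / 2) \<Longrightarrow> 1 / 2 \<le> h u" for h and c :: 'a
  proof -
    have sub: "{u. complex_of_real (h u) \<noteq> 0} \<subseteq> cball c \<eta>"
    proof safe
      fix u assume "complex_of_real (h u) \<noteq> 0"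
      then show "u \<in> cball c \<eta>" using h(4)[of u] by fastforce
    qed
    have 1: "(\<lambda>u. complex_of_real (h u)) \<in> C0_fun"
      using h(1) by (intro C0I[OF _ sub] continuous_intros bounded_cball)
    have 2: "closed_support (\<lambda>u. complex_of_real (h u)) \<subseteq> cball c \<eta>"
      unfolding closed_support_def using sub by (intro closure_minimal) auto
    have hm [measurable]: "h \<in> borel_measurable borel" using h(1) by (rule borel_measurable_continuous_onI)
    have 3: "integrable lborel h"
    proof (rule integrableI_bounded_set[where A = "cball c \<eta>" and B = 1])
      show "emeasure lborel (cball c \<eta>) < \<infinity>" by (rule emeasure_compact_finite) simp
    qed (use h in \<open>auto simp: abs_of_nonneg\<close>)
    have nn: "(\<integral>\<^sup>+u. ennreal (h u) \<partial>lborel) = ennreal (integral\<^sup>L lborel h)"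
      using 3 h(2) by (intro nn_integral_eq_integral) auto
    have "energy (\<lambda>u. complex_of_real (h u)) = (\<integral>\<^sup>+u. ennreal ((h u)\<^sup>2) \<partial>lborel)"
      unfolding energy_def nn_integral_completion using h(2) by simp
    also have "\<dots> \<le> (\<integral>\<^sup>+u. ennreal (h u) \<partial>lborel)"
    proof (intro nn_integral_mono ennreal_leI)
      fix u show "(h u)\<^sup>2 \<le> h u"
        unfolding power2_eq_square using h(2,3)[of u] mult_left_mono[of "h u" 1 "h u"] by simp
    qed
    finally have 4: "energy (\<lambda>u. complex_of_real (h u)) \<le> ennreal (integral\<^sup>L lborel h)" by (simp add: nn)
    have "ennreal low = ennreal (1 / 2) * ennreal (v * (\<eta> / 2) ^ DIM('a))"
      using v \<eta> by (subst ennreal_mult'[symmetric]) (auto simp: low_def)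
    also have "\<dots> = ennreal (1 / 2) * emeasure lborel (ball c (\<eta> / 2))"
      using \<eta> by (simp add: emeasure_ball v_def)
    also have "\<dots> = (\<integral>\<^sup>+u. ennreal (1 / 2) * indicator (ball c (\<eta> / 2)) u \<partial>lborel)"
      by (intro nn_integral_cmult_indicator[symmetric]) auto
    also have "\<dots> \<le> (\<integral>\<^sup>+u. ennreal (h u) \<partial>lborel)"
    proof (rule nn_integral_mono)
      fix u show "ennreal (1 / 2) * indicator (ball c (\<eta> / 2)) u \<le> ennreal (h u)"
      proof (cases "u \<in> ball c (\<eta> / 2)")
        case True
        then show ?thesis using ennreal_leI[OF h(5)[OF True]] by (simp only: indicator_simps mult_1_right)
      qed simp
    qed
    finally have "ennreal low \<le> ennreal (integral\<^sup>L lborel h)" by (simp add: nn)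
    moreover have "0 \<le> integral\<^sup>L lborel h" using h(2) by (intro integral_nonneg_AE) auto
    ultimately have "low \<le> integral\<^sup>L lborel h" by simp
    with 1 2 3 4 show ?thesis by simp
  qed
  define \<phi> where "\<phi> = (\<lambda>u. complex_of_real (p u))"
  define \<gamma> where "\<gamma> = (\<lambda>u. complex_of_real (q u))"
  define P where "P = integral\<^sup>L lborel p"
  define G where "G = integral\<^sup>L lborel q"
  have \<phi>: "\<phi> \<in> C0_fun" "closed_support \<phi> \<subseteq> cball y0 \<eta>" "integrable lborel p" "energy \<phi> \<le> ennreal P" "low \<le> P"
    using gen[OF p] by (auto simp: \<phi>_def P_def)
  have \<gamma>: "\<gamma> \<in> C0_fun" "closed_support \<gamma> \<subseteq> cball x0 \<eta>" "integrable lborel q" "energy \<gamma> \<le> ennreal G" "low \<le> G"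
    using gen[OF q] by (auto simp: \<gamma>_def G_def)
  have PG: "0 < P" "0 < G" using low \<phi> \<gamma> by auto
  \<comment> \<open>Moving one variable changes the kernel by at most (2 / r)^d, since \<omega> is
    below 1 and the distance stays at least r / 2. Two such moves are made.\<close>
  define c where "c = 2 * (2 / r) ^ DIM('a)"
  have c: "0 \<le> c" using r by (simp add: c_def)
  have near: "norm (K x y - K x0 y0) \<le> c \<and> x \<noteq> y" if x: "x \<in> cball x0 \<eta>" and y: "y \<in> cball y0 \<eta>" for x y
  proof -
    have dx: "dist x0 x \<le> \<eta>" "dist y0 y \<le> \<eta>" using x y by auto
    have "r \<le> dist x0 y + dist y y0" unfolding r_def by (rule dist_triangle)
    then have xy: "7 * \<eta> \<le> dist x0 y" using dx by (simp add: \<eta>_def dist_commute)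
    have half: "r / 2 \<le> dist x0 y" using xy \<eta> by (simp add: \<eta>_def)
    have small: "w / s ^ DIM('a) \<le> (2 / r) ^ DIM('a)" if "w \<le> 1" "r / 2 \<le> s" for w s :: real
    proof -
      have "(r / 2) ^ DIM('a) \<le> s ^ DIM('a)" using that r by (intro power_mono) auto
      then have "w / s ^ DIM('a) \<le> 1 / (r / 2) ^ DIM('a)" using that r by (intro frac_le) auto
      then show ?thesis by (simp add: power_divide)
    qed
    have "norm (K x0 y - K x y) \<le> \<omega> (dist x0 x / dist x0 y) / dist x0 y ^ DIM('a)"
      using dx xy \<eta> by (intro regD) auto
    also have "\<dots> \<le> (2 / r) ^ DIM('a)"
      by (intro small half less_imp_le[OF om_less]) simp
    finally have 1: "norm (K x0 y - K x y) \<le> (2 / r) ^ DIM('a)" .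
    have "dist y0 x0 = 8 * \<eta>" by (simp add: r_def \<eta>_def dist_commute)
    then have "2 * dist y0 y \<le> dist y0 x0" using dx(2) \<eta> by linarith
    with assms have "norm (K x0 y0 - K x0 y) \<le> \<omega> (dist y0 y / dist y0 x0) / dist y0 x0 ^ DIM('a)"
      by (rule regTD)
    also have "\<dots> \<le> (2 / r) ^ DIM('a)"
      using r by (intro small less_imp_le[OF om_less]) (auto simp: r_def dist_commute)
    finally have 2: "norm (K x0 y0 - K x0 y) \<le> (2 / r) ^ DIM('a)" .
    have "K x y - K x0 y0 = - (K x0 y - K x y) - (K x0 y0 - K x0 y)" by simp
    then have "norm (K x y - K x0 y0) \<le> norm (- (K x0 y - K x y)) + norm (K x0 y0 - K x0 y)"
      by (metis norm_triangle_ineq4)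
    then have "norm (K x y - K x0 y0) \<le> c" using 1 2 unfolding norm_minus_cancel c_def by linarith
    moreover have "x \<noteq> y"
    proof
      assume "x = y"
      then have "dist x0 y \<le> \<eta>" using dx by simp
      then show False using xy \<eta> by linarith
    qed
    ultimately show ?thesis by simp
  qed
  have disj: "closed_support \<phi> \<inter> closed_support \<gamma> = {}"
    using near \<phi>(2) \<gamma>(2) by blast
  define J where "J x = (\<integral>y. (if x = y then 0 else K x y) * \<phi> y \<partial>lborel)" for x
  note fub = kernel_fubini[OF \<phi>(1) \<gamma>(1) disj, folded J_def]
  have [measurable]: "\<phi> \<in> borel_measurable borel" "\<gamma> \<in> borel_measurable borel"
    using C0_borel \<phi> \<gamma> by auto
  have i\<phi>: "integrable lborel \<phi>" "integral\<^sup>L lborel \<phi> = of_real P"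
    unfolding \<phi>_def P_def using \<phi>(3) by auto
  have i\<gamma>: "integrable lborel \<gamma>" "integral\<^sup>L lborel \<gamma> = of_real G"
    unfolding \<gamma>_def G_def using \<gamma>(3) by auto
  have J: "norm (J x - K x0 y0 * of_real P) \<le> c * P" if x: "x \<in> cball x0 \<eta>" for x
  proof -
    have le: "norm ((if x = y then 0 else K x y) * \<phi> y - K x0 y0 * \<phi> y) \<le> c * p y" for y
    proof (cases "y \<in> cball y0 \<eta>")
      case True
      then have "(if x = y then 0 else K x y) * \<phi> y - K x0 y0 * \<phi> y = (K x y - K x0 y0) * \<phi> y"
        using near[OF x] by (auto simp: algebra_simps)
      then have "norm ((if x = y then 0 else K x y) * \<phi> y - K x0 y0 * \<phi> y) = norm (K x y - K x0 y0) * p y"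
        using p(2) by (simp add: norm_mult \<phi>_def)
      also have "\<dots> \<le> c * p y" using near[OF x True] p(2) by (intro mult_right_mono) auto
      finally show ?thesis .
    next
      case False
      then show ?thesis using p(4)[of y] by (simp add: \<phi>_def)
    qed
    have "integrable lborel (\<lambda>y. (if x = y then 0 else K x y) * \<phi> y - K x0 y0 * \<phi> y)"
    proof (rule Bochner_Integration.integrable_bound)
      show "integrable lborel (\<lambda>y. c * p y)" using \<phi>(3) by simp
      have "(\<lambda>y. (\<lambda>(x, y). if x = y then 0 else K x y) (x, y) * \<phi> y - K x0 y0 * \<phi> y) \<in> borel_measurable borel"
        by measurable
      then show "(\<lambda>y. (if x = y then 0 else K x y) * \<phi> y - K x0 y0 * \<phi> y) \<in> borel_measurable lborel" by simp
      show "AE y in lborel. norm ((if x = y then 0 else K x y) * \<phi> y - K x0 y0 * \<phi> y) \<le> norm (c * p y)"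
      proof (rule AE_I2)
        fix y show "norm ((if x = y then 0 else K x y) * \<phi> y - K x0 y0 * \<phi> y) \<le> norm (c * p y)"
          using le[of y] by (rule order_trans) simp
      qed
    qed
    note i = this
    have "norm (\<integral>y. (if x = y then 0 else K x y) * \<phi> y - K x0 y0 * \<phi> y \<partial>lborel) \<le> (\<integral>y. c * p y \<partial>lborel)"
      using \<phi>(3) by (intro norm_lebesgue_integral_le i le) simp
    also have "\<dots> = c * P" by (simp add: P_def)
    also have "(\<integral>y. (if x = y then 0 else K x y) * \<phi> y - K x0 y0 * \<phi> y \<partial>lborel) = J x - K x0 y0 * of_real P"
    proof -
      have i1: "integrable lborel (\<lambda>y. K x0 y0 * \<phi> y)" using i\<phi>(1) by simp
      have i2: "integrable lborel (\<lambda>y. (if x = y then 0 else K x y) * \<phi> y)"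
        using Bochner_Integration.integrable_add[OF i i1] by simp
      show ?thesis unfolding J_def using i1 i2 i\<phi>(2) by simp
    qed
    finally show ?thesis .
  qed
  have "norm (\<integral>x. J x * \<gamma> x - K x0 y0 * of_real P * \<gamma> x \<partial>lborel) \<le> (\<integral>x. c * P * q x \<partial>lborel)"
  proof (rule norm_lebesgue_integral_le)
    show "integrable lborel (\<lambda>x. J x * \<gamma> x - K x0 y0 * of_real P * \<gamma> x)"
      using fub(1) i\<gamma>(1) by simp
    show "integrable lborel (\<lambda>x. c * P * q x)" using \<gamma>(3) by simp
    fix x
    show "norm (J x * \<gamma> x - K x0 y0 * of_real P * \<gamma> x) \<le> c * P * q x"
    proof (cases "x \<in> cball x0 \<eta>")
      case True
      have "J x * \<gamma> x - K x0 y0 * of_real P * \<gamma> x = (J x - K x0 y0 * of_real P) * \<gamma> x" by (simp add: algebra_simps)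
      then have "norm (J x * \<gamma> x - K x0 y0 * of_real P * \<gamma> x) = norm (J x - K x0 y0 * of_real P) * q x"
        using q(2) by (simp add: norm_mult \<gamma>_def)
      also have "\<dots> \<le> c * P * q x" using J[OF True] q(2) by (intro mult_right_mono) auto
      finally show ?thesis .
    next
      case False
      then show ?thesis using q(4)[of x] by (simp add: \<gamma>_def)
    qed
  qed
  also have "\<dots> = c * P * G" by (simp add: G_def)
  also have "(\<integral>x. J x * \<gamma> x - K x0 y0 * of_real P * \<gamma> x \<partial>lborel) = (\<integral>x. T \<phi> x * \<gamma> x \<partial>lebesgue) - K x0 y0 * of_real P * of_real G"
    using fub i\<gamma> by simp
  finally have main: "norm ((\<integral>x. T \<phi> x * \<gamma> x \<partial>lebesgue) - K x0 y0 * of_real P * of_real G) \<le> c * P * G" .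
  have L2: "\<phi> \<in> L2_fun" "\<gamma> \<in> L2_fun"
    using mixed_finite_integrable(2)[OF C0_measurable C0_mixed_finite] \<phi> \<gamma> by auto
  have "energy (T \<phi>) \<le> ennreal B * ennreal P"
    using T_bound[OF L2(1)] \<phi>(4) by (meson mult_left_mono order_trans zero_le)
  also have "\<dots> = ennreal (B * P)" using B by (simp add: ennreal_mult')
  finally have eT: "energy (T \<phi>) \<le> ennreal (B * P)" .
  have "norm (\<integral>x. T \<phi> x * \<gamma> x \<partial>lebesgue) \<le> (1 * (B * P) + G / 1) / 2"
    by (rule pair_bound(2)[OF L2_measurable[OF T_L2[OF L2(1)]] eT _ C0_measurable[OF \<gamma>(1)] \<gamma>(4)]) (use B PG in auto)
  then have I: "norm (\<integral>x. T \<phi> x * \<gamma> x \<partial>lebesgue) \<le> (B * P + G) / 2" by simp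
  have "norm (K x0 y0 * of_real P * of_real G) \<le> norm (\<integral>x. T \<phi> x * \<gamma> x \<partial>lebesgue) + norm ((\<integral>x. T \<phi> x * \<gamma> x \<partial>lebesgue) - K x0 y0 * of_real P * of_real G)"
    by (metis norm_minus_commute norm_triangle_sub)
  then have "norm (K x0 y0 * of_real P * of_real G) \<le> (B * P + G) / 2 + c * P * G"
    using main I by linarith
  moreover have "norm (K x0 y0 * of_real P * of_real G) = norm (K x0 y0) * (P * G)"
    using PG by (simp add: norm_mult)
  ultimately have "norm (K x0 y0) * (P * G) \<le> (B * P + G) / 2 + c * P * G" by simp
  also have "(B * P + G) / 2 + c * P * G = ((B / G + 1 / P) / 2 + c) * (P * G)"
    using PG by (simp add: field_simps)
  finally have "norm (K x0 y0) \<le> (B / G + 1 / P) / 2 + c"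
    using PG by (simp add: mult_le_cancel_right)
  also have "(B / G + 1 / P) / 2 + c \<le> (B / low + 1 / low) / 2 + c"
    using B low \<phi>(5) \<gamma>(5) by (intro add_right_mono divide_right_mono add_mono divide_left_mono) auto
  also have "(B / low + 1 / low) / 2 + c = ((B + 1) * 16 ^ DIM('a) / v + 2 * 2 ^ DIM('a)) / r ^ DIM('a)"
  proof -
    have "low = v * r ^ DIM('a) / 16 ^ DIM('a) / 2"
      by (simp add: low_def \<eta>_def power_divide)
    moreover have "c = 2 * (2 ^ DIM('a) / r ^ DIM('a))" by (simp add: c_def power_divide)
    moreover have "(B / (w * R / S / 2) + 1 / (w * R / S / 2)) / 2 + 2 * (E / R) = ((B + 1) * S / w + 2 * E) / R"
      if "0 < w" "0 < R" "0 < S" for w R S E :: real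
      using that by (simp add: field_simps)
    ultimately show ?thesis using v r by simp
  qed
  finally show ?thesis by (simp add: r_def v_def)
qed

end

section \<open>Linear operations on square integrable functions, and integration against the
  kernel\<close>

lemma energy_add_le:
  assumes [measurable]: "(f :: 'a::euclidean_space \<Rightarrow> complex) \<in> borel_measurable lebesgue" "g \<in> borel_measurable lebesgue"
  shows "energy (\<lambda>x. f x + g x) \<le> 2 * energy f + 2 * energy g"
proof -
  have c: "(\<integral>\<^sup>+x. 2 * ennreal ((norm (h x))\<^sup>2) \<partial>lebesgue) = 2 * energy h"
    if [measurable]: "h \<in> borel_measurable lebesgue" for h :: "'a \<Rightarrow> complex"
    unfolding energy_def by (rule nn_integral_cmult) measurable
  have "energy (\<lambda>x. f x + g x) \<le> (\<integral>\<^sup>+x. 2 * ennreal ((norm (f x))\<^sup>2) + 2 * ennreal ((norm (g x))\<^sup>2) \<partial>lebesgue)"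
    unfolding energy_def
  proof (rule nn_integral_mono)
    fix x
    have "(norm (f x + g x))\<^sup>2 \<le> (norm (f x) + norm (g x))\<^sup>2" by (rule power_mono) (auto intro: norm_triangle_ineq)
    also have "\<dots> \<le> 2 * (norm (f x))\<^sup>2 + 2 * (norm (g x))\<^sup>2" by (rule square_add_le)
    finally have "ennreal ((norm (f x + g x))\<^sup>2) \<le> ennreal (2 * (norm (f x))\<^sup>2 + 2 * (norm (g x))\<^sup>2)" by (rule ennreal_leI)
    also have "\<dots> = 2 * ennreal ((norm (f x))\<^sup>2) + 2 * ennreal ((norm (g x))\<^sup>2)"
      by (simp add: ennreal_plus ennreal_mult)
    finally show "ennreal ((norm (f x + g x))\<^sup>2) \<le> 2 * ennreal ((norm (f x))\<^sup>2) + 2 * ennreal ((norm (g x))\<^sup>2)" .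
  qed
  also have "\<dots> = 2 * energy f + 2 * energy g"
    unfolding c[OF assms(1), symmetric] c[OF assms(2), symmetric] by (rule nn_integral_add) measurable
  finally show ?thesis .
qed

lemma L2_add: "f \<in> L2_fun \<Longrightarrow> g \<in> L2_fun \<Longrightarrow> (\<lambda>x. f x + g x) \<in> L2_fun"
  unfolding L2_fun_energy
  by (auto intro!: le_less_trans[OF energy_add_le] simp: ennreal_mult_less_top)

lemma L2_mono:
  assumes "f \<in> L2_fun" "g \<in> borel_measurable lebesgue" "\<And>x. norm (g x) \<le> norm (f x)"
  shows "g \<in> L2_fun"
proof -
  have "energy g \<le> energy f"
    unfolding energy_def using assms(3) by (intro nn_integral_mono ennreal_leI power_mono) auto
  then show ?thesis using assms by (auto simp: L2_fun_energy)
qed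

lemma L2_scale: "f \<in> L2_fun \<Longrightarrow> (\<lambda>x. c * f x) \<in> L2_fun"
proof -
  assume f: "f \<in> L2_fun"
  have [measurable]: "f \<in> borel_measurable lebesgue" using f by (rule L2_measurable)
  have "energy (\<lambda>x. c * f x) = (\<integral>\<^sup>+x. ennreal ((norm c)\<^sup>2) * ennreal ((norm (f x))\<^sup>2) \<partial>lebesgue)"
    unfolding energy_def by (intro nn_integral_cong) (simp add: norm_mult power_mult_distrib ennreal_mult)
  also have "\<dots> = ennreal ((norm c)\<^sup>2) * energy f" unfolding energy_def by (rule nn_integral_cmult) measurable
  also have "\<dots> < \<infinity>" using f by (simp add: L2_fun_energy ennreal_mult_less_top)
  finally show ?thesis by (simp add: L2_fun_energy)
qed

lemma L2_diff: "f \<in> L2_fun \<Longrightarrow> g \<in> L2_fun \<Longrightarrow> (\<lambda>x. f x - g x) \<in> L2_fun"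
  using L2_add[of f "\<lambda>x. (-1) * g x"] L2_scale[of g "-1"] by simp

lemma (in cz_T) T_diff:
  assumes "f \<in> L2_fun" "g \<in> L2_fun"
  shows "AE x in lebesgue. T (\<lambda>y. f y - g y) x = T f x - T g x"
proof -
  have "AE x in lebesgue. T (\<lambda>y. f y + (-1) * g y) x = T f x + T (\<lambda>y. (-1) * g y) x"
    by (rule T_add[OF assms(1) L2_scale[OF assms(2)]])
  moreover have "AE x in lebesgue. T (\<lambda>y. (-1) * g y) x = (-1) * T g x" by (rule T_scale[OF assms(2)])
  ultimately show ?thesis by eventually_elim simp
qed

locale cz_op = cz_kernel \<omega> K A + cz_T \<omega> K T B
  for \<omega> and K :: "'a::euclidean_space \<Rightarrow> 'a \<Rightarrow> complex" and A T B
begin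

text \<open>On the ball, the difference u of T \<phi> and the kernel integral annihilates all test
  functions supported there, by the defining property of the kernel. Testing with approximants of
  the conjugate sign of u shows that |u| has integral 0. The gap between s and 2 s separates the
  closed supports.\<close>

lemma kernel_rep_C0:
  assumes s: "0 < s" and \<phi>: "\<phi> \<in> C0_fun" "{y. \<phi> y \<noteq> 0} \<subseteq> {y. 2 * s < dist x0 y}"
  shows "AE x in lebesgue. x \<in> ball x0 s \<longrightarrow> T \<phi> x = (LINT y:{y. 2 * s \<le> dist x0 y}|lebesgue. K x y * \<phi> y)"
proof -
  define b where "b = ball x0 s"
  define H where "H = {y. 2 * s \<le> dist x0 y}"
  have clH: "closed H" unfolding H_def by (intro closed_Collect_le continuous_intros)
  have Hs: "H \<in> sets lebesgue" using clH by auto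
  have bs: "b \<in> sets lebesgue" by (simp add: b_def)
  have \<phi>m [measurable]: "\<phi> \<in> borel_measurable borel" by (rule C0_borel[OF \<phi>(1)])
  have \<phi>l: "\<phi> \<in> borel_measurable lebesgue" by (rule C0_measurable[OF \<phi>(1)])
  have \<phi>i: "integrable lebesgue \<phi>" "\<phi> \<in> L2_fun"
    using mixed_finite_integrable[OF \<phi>l C0_mixed_finite[OF \<phi>(1)]] by auto
  define J where "J x = (\<integral>y. (if x = y then 0 else K x y) * \<phi> y \<partial>lborel)" for x
  have Jm: "J \<in> borel_measurable borel"
  proof -
    have "(\<lambda>p. (\<lambda>(x, y). if x = y then 0 else K x y) p * \<phi> (snd p)) \<in> borel_measurable (borel \<Otimes>\<^sub>M borel)"
      by measurable
    also have "(\<lambda>p. (\<lambda>(x, y). if x = y then 0 else K x y) p * \<phi> (snd p)) = (\<lambda>(x, y). (if x = y then 0 else K x y) * \<phi> y)"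
      by (simp add: case_prod_beta' fun_eq_iff)
    finally have "(\<lambda>(x, y). (if x = y then 0 else K x y) * \<phi> y) \<in> borel_measurable (borel \<Otimes>\<^sub>M lborel)"
      by (simp cong: measurable_cong_sets)
    then show ?thesis unfolding J_def by (rule lborel.borel_measurable_lebesgue_integral)
  qed
  then have Jl: "J \<in> borel_measurable lebesgue" by (intro measurable_completion) simp
  have sep: "s \<le> dist x y" if "x \<in> b" "y \<in> H" for x y
  proof -
    have "dist x0 y \<le> dist x0 x + dist x y" by (rule dist_triangle)
    then show ?thesis using that by (simp add: b_def H_def)
  qed
  have J_eq: "J x = (LINT y:H|lebesgue. K x y * \<phi> y)" if x: "x \<in> b" for x
  proof -
    have "(\<lambda>y. (\<lambda>(x, y). if x = y then 0 else K x y) (x, y) * \<phi> y) \<in> borel_measurable borel" by measurable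
    then have m: "(\<lambda>y. (if x = y then 0 else K x y) * \<phi> y) \<in> borel_measurable lborel" by simp
    have "(LINT y:H|lebesgue. K x y * \<phi> y) = (\<integral>y. (if x = y then 0 else K x y) * \<phi> y \<partial>lebesgue)"
      unfolding set_lebesgue_integral_def
    proof (rule Bochner_Integration.integral_cong)
      fix y
      show "indicator H y *\<^sub>R (K x y * \<phi> y) = (if x = y then 0 else K x y) * \<phi> y"
      proof (cases "y \<in> H")
        case True
        then have "x \<noteq> y" using sep[OF x True] s by auto
        then show ?thesis using True by simp
      next
        case False
        then have "\<phi> y = 0" using \<phi>(2) by (auto simp: H_def)
        then show ?thesis by simp
      qed
    qed simp
    then show ?thesis unfolding J_def integral_completion[OF m] by simp
  qed
  obtain m where m: "mass \<phi> H = ennreal m" "0 \<le> m" using mass_real[OF \<phi>i(1)] by (metis enn2real_nonneg)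
  define C where "C = A / s ^ DIM('a) * m"
  have C0: "0 \<le> C" using A s m by (simp add: C_def)
  have J_le: "norm (J x) \<le> C" if x: "x \<in> b" for x
    unfolding J_eq[OF x] C_def using m by (intro norm_off[OF \<phi>i(1) Hs s sep[OF x]]) auto
  \<comment> \<open>Cutting to the ball makes u square integrable: the bound \<open>J_le\<close> for
    the kernel integral holds there.\<close>
  define u where "u x = indicator b x *\<^sub>R (T \<phi> x - J x)" for x
  have Tm: "T \<phi> \<in> borel_measurable lebesgue" by (rule L2_measurable[OF T_L2[OF \<phi>i(2)]])
  have um: "u \<in> borel_measurable lebesgue"
    unfolding u_def using bs Tm Jl by (intro borel_measurable_scaleR borel_measurable_diff borel_measurable_indicator)
  have Jb: "(\<lambda>x. indicator b x *\<^sub>R J x) \<in> L2_fun"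
  proof -
    have "energy (\<lambda>x. indicator b x *\<^sub>R J x) \<le> (\<integral>\<^sup>+x. ennreal (C\<^sup>2) * indicator b x \<partial>lebesgue)"
      unfolding energy_def
    proof (rule nn_integral_mono)
      fix x show "ennreal ((norm (indicator b x *\<^sub>R J x))\<^sup>2) \<le> ennreal (C\<^sup>2) * indicator b x"
        using J_le[of x] by (cases "x \<in> b") (auto intro!: ennreal_leI power_mono)
    qed
    also have "\<dots> = ennreal (C\<^sup>2) * emeasure lebesgue b" using bs by (rule nn_integral_cmult_indicator)
    also have "\<dots> < \<infinity>" using s by (simp add: b_def emeasure_lebesgue_ball ennreal_mult_less_top)
    finally have "energy (\<lambda>x. indicator b x *\<^sub>R J x) < \<infinity>" .
    moreover have "(\<lambda>x. indicator b x *\<^sub>R J x) \<in> borel_measurable lebesgue"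
      using bs Jl by (intro borel_measurable_scaleR borel_measurable_indicator)
    ultimately show ?thesis by (simp add: L2_fun_energy)
  qed
  have Tb: "(\<lambda>x. indicator b x *\<^sub>R T \<phi> x) \<in> L2_fun"
  proof (rule L2_mono[OF T_L2[OF \<phi>i(2)]])
    show "(\<lambda>x. indicator b x *\<^sub>R T \<phi> x) \<in> borel_measurable lebesgue"
      using bs Tm by (intro borel_measurable_scaleR borel_measurable_indicator)
  qed (auto simp: indicator_def)
  have uL: "u \<in> L2_fun"
    using L2_diff[OF Tb Jb] unfolding u_def by (simp add: scaleR_diff_right)
  obtain X where X: "energy u = ennreal X" "0 \<le> X" using energy_real[OF uL] by metis
  have orth: "(\<integral>x. u x * \<gamma> x \<partial>lebesgue) = 0" if \<gamma>: "\<gamma> \<in> C0_fun" "{x. \<gamma> x \<noteq> 0} \<subseteq> b" for \<gamma>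
  proof -
    have \<gamma>m: "\<gamma> \<in> borel_measurable borel" by (rule C0_borel[OF \<gamma>(1)])
    have \<gamma>L: "\<gamma> \<in> L2_fun" using mixed_finite_integrable(2)[OF C0_measurable C0_mixed_finite] \<gamma>(1) by auto
    have "closed_support \<phi> \<subseteq> H"
      unfolding closed_support_def using \<phi>(2) by (intro closure_minimal clH) (auto simp: H_def)
    moreover have "closed_support \<gamma> \<subseteq> cball x0 s"
      unfolding closed_support_def using \<gamma>(2) by (intro closure_minimal) (auto simp: b_def)
    moreover have "H \<inter> cball x0 s = {}" using s by (auto simp: H_def)
    ultimately have disj: "closed_support \<phi> \<inter> closed_support \<gamma> = {}" by blast
    note fub = kernel_fubini[OF \<phi>(1) \<gamma>(1) disj, folded J_def]
    have Jg: "(\<lambda>x. J x * \<gamma> x) \<in> borel_measurable lborel" using Jm \<gamma>m by simp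
    have i1: "integrable lebesgue (\<lambda>x. J x * \<gamma> x)" using fub(1) integrable_completion[OF Jg] by simp
    obtain a c where "energy (T \<phi>) = ennreal a" "0 \<le> a" "energy \<gamma> = ennreal c" "0 \<le> c"
      using energy_real[OF T_L2[OF \<phi>i(2)]] energy_real[OF \<gamma>L] by metis
    then have i2: "integrable lebesgue (\<lambda>x. T \<phi> x * \<gamma> x)"
      by (intro pair_bound(1)[OF Tm _ _ L2_measurable[OF \<gamma>L], of a c 1]) auto
    have "(\<lambda>x. u x * \<gamma> x) = (\<lambda>x. T \<phi> x * \<gamma> x - J x * \<gamma> x)"
    proof
      fix x show "u x * \<gamma> x = T \<phi> x * \<gamma> x - J x * \<gamma> x"
        using \<gamma>(2) by (cases "x \<in> b") (auto simp: u_def algebra_simps)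
    qed
    then have "(\<integral>x. u x * \<gamma> x \<partial>lebesgue) = (\<integral>x. T \<phi> x * \<gamma> x \<partial>lebesgue) - (\<integral>x. J x * \<gamma> x \<partial>lebesgue)"
      using i1 i2 by simp
    also have "\<dots> = 0" using fub(2) integral_completion[OF Jg] by simp
    finally show ?thesis .
  qed
  \<comment> \<open>The pairing is bilinear, so the conjugate is what turns u v into |u|.\<close>
  define v where "v x = cnj (sgn (u x))" for x
  have vm: "v \<in> borel_measurable lebesgue"
  proof -
    have "cnj \<in> borel_measurable borel" by (intro borel_measurable_continuous_onI continuous_intros)
    moreover have "(\<lambda>x. sgn (u x)) \<in> borel_measurable lebesgue"
      unfolding sgn_div_norm using um by measurable
    ultimately show ?thesis unfolding v_def by (rule measurable_compose[rotated])
  qed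
  have vn: "norm (v x) \<le> 1" for x by (simp add: v_def norm_sgn)
  have v0: "v x = 0" if "x \<notin> b" for x using that by (simp add: v_def u_def)
  have uv: "u x * v x = of_real (norm (u x))" for x
  proof (cases "u x = 0")
    case False
    have "u x * v x = u x * cnj (u x) / of_real (norm (u x))" by (simp add: v_def sgn_eq)
    also have "\<dots> = of_real ((norm (u x))\<^sup>2) / of_real (norm (u x))" by (simp only: complex_norm_square)
    also have "\<dots> = of_real (norm (u x))" using False by (simp add: power2_eq_square)
    finally show ?thesis .
  qed (simp add: v_def)
  have bv: "mixed v < \<infinity>"
  proof -
    have "mixed v \<le> (\<integral>\<^sup>+x. ennreal 2 * indicator b x \<partial>lebesgue)"
      unfolding mixed_def
    proof (rule nn_integral_mono)
      fix x show "ennreal (norm (v x) + (norm (v x))\<^sup>2) \<le> ennreal 2 * indicator b x"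
      proof (cases "x \<in> b")
        case True
        have "norm (v x) + (norm (v x))\<^sup>2 \<le> 1 + 1" using vn[of x] by (intro add_mono power_le_one) auto
        then have "ennreal (norm (v x) + (norm (v x))\<^sup>2) \<le> ennreal 2" by (intro ennreal_leI) simp
        then show ?thesis using True by simp
      next
        case False then show ?thesis using v0[OF False] by simp
      qed
    qed
    also have "\<dots> = ennreal 2 * emeasure lebesgue b" using bs by (rule nn_integral_cmult_indicator)
    also have "\<dots> < \<infinity>" using s by (simp add: b_def emeasure_lebesgue_ball ennreal_mult_less_top)
    finally show ?thesis .
  qed
  have vi: "integrable lebesgue v" "v \<in> L2_fun" using mixed_finite_integrable[OF vm bv] by auto
  have app: "approximable b v" using vi v0 by (intro approximable_L1_L2) (auto simp: b_def)
  obtain Y where Y: "energy v = ennreal Y" "0 \<le> Y" using energy_real[OF vi(2)] by metis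
  have "integrable lebesgue (\<lambda>x. u x * v x)"
    by (rule pair_bound(1)[OF um _ X(2) vm _ Y(2), of 1]) (use X Y in auto)
  then have iu: "integrable lebesgue (\<lambda>x. norm (u x))"
    using integrable_norm uv by (smt (verit, best) Bochner_Integration.integrable_cong norm_of_real abs_norm_cancel)
  \<comment> \<open>An approximation error of \<epsilon>^2 in energy and the parameter s =
    \<epsilon> in \<open>pair_bound\<close> give the bound \<epsilon> (X + 1) / 2.\<close>
  have small: "(\<integral>x. norm (u x) \<partial>lebesgue) \<le> \<epsilon> * (X + 1) / 2" if \<epsilon>: "0 < \<epsilon>" for \<epsilon> :: real
  proof -
    have "0 < \<epsilon>\<^sup>2" using \<epsilon> by simp
    then obtain \<gamma> where \<gamma>: "\<gamma> \<in> C0_fun" "{x. \<gamma> x \<noteq> 0} \<subseteq> b" "mixed (\<lambda>x. v x - \<gamma> x) \<le> ennreal (\<epsilon>\<^sup>2)"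
      using app unfolding approximable_def by meson
    have \<gamma>L: "\<gamma> \<in> L2_fun" using mixed_finite_integrable(2)[OF C0_measurable C0_mixed_finite] \<gamma>(1) by auto
    obtain c where c: "energy \<gamma> = ennreal c" "0 \<le> c" using energy_real[OF \<gamma>L] by metis
    have ig: "integrable lebesgue (\<lambda>x. u x * \<gamma> x)"
      by (rule pair_bound(1)[OF um _ X(2) L2_measurable[OF \<gamma>L] _ c(2), of 1]) (use X c in auto)
    have dm: "(\<lambda>x. v x - \<gamma> x) \<in> borel_measurable lebesgue"
      using vm L2_measurable[OF \<gamma>L] by (rule borel_measurable_diff)
    have de: "energy (\<lambda>x. v x - \<gamma> x) \<le> ennreal (\<epsilon>\<^sup>2)" using energy_le_mixed \<gamma>(3) by (rule order_trans)
    have "norm (\<integral>x. u x * (v x - \<gamma> x) \<partial>lebesgue) \<le> (\<epsilon> * X + \<epsilon>\<^sup>2 / \<epsilon>) / 2"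
      by (rule pair_bound(2)[OF um _ X(2) dm de]) (use X \<epsilon> in auto)
    also have "\<dots> = \<epsilon> * (X + 1) / 2" using \<epsilon> by (simp add: power2_eq_square algebra_simps)
    also have "(\<integral>x. u x * (v x - \<gamma> x) \<partial>lebesgue) = (\<integral>x. u x * v x \<partial>lebesgue) - (\<integral>x. u x * \<gamma> x \<partial>lebesgue)"
      using \<open>integrable lebesgue (\<lambda>x. u x * v x)\<close> ig by (simp add: right_diff_distrib)
    also have "\<dots> = (\<integral>x. complex_of_real (norm (u x)) \<partial>lebesgue)" using orth[OF \<gamma>(1,2)] uv by simp
    also have "\<dots> = complex_of_real (\<integral>x. norm (u x) \<partial>lebesgue)" by (rule integral_complex_of_real)
    finally show ?thesis by (simp only: norm_of_real)
  qed
  have "(\<integral>x. norm (u x) \<partial>lebesgue) \<le> 0 + e" if "0 < e" for e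
    using small[of "2 * e / (X + 1)"] that X by simp
  then have "(\<integral>x. norm (u x) \<partial>lebesgue) \<le> 0" by (rule field_le_epsilon)
  moreover have "0 \<le> (\<integral>x. norm (u x) \<partial>lebesgue)" by (rule integral_nonneg_AE) simp
  ultimately have "(\<integral>x. norm (u x) \<partial>lebesgue) = 0" by simp
  then have "AE x in lebesgue. norm (u x) = 0"
    using integral_nonneg_eq_0_iff_AE[OF iu] by simp
  then show ?thesis
  proof eventually_elim
    case (elim x)
    show ?case using elim J_eq[of x] by (auto simp: u_def b_def H_def)
  qed
qed

text \<open>Both sides are limits of their values at continuous approximants supported away from the
  ball: T h almost everywhere by geometric decay of the energies, and the kernel integral by the
  size bound and convergence in L1.\<close>

lemma kernel_rep_ball:
  assumes s: "0 < s" and h: "integrable lebesgue h" "h \<in> L2_fun" and supp: "\<And>y. dist x0 y \<le> 2 * s \<Longrightarrow> h y = 0"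
  shows "AE x in lebesgue. x \<in> ball x0 s \<longrightarrow> T h x = (LINT y:{y. 2 * s \<le> dist x0 y}|lebesgue. K x y * h y)"
proof -
  define V where "V = {y. 2 * s < dist x0 y}"
  define H where "H = {y. 2 * s \<le> dist x0 y}"
  have clH: "closed H" unfolding H_def by (intro closed_Collect_le continuous_intros)
  have Hs: "H \<in> sets lebesgue" using clH by auto
  have "open V" unfolding V_def by (intro open_Collect_less continuous_intros)
  then have app: "approximable V h" using h supp by (intro approximable_L1_L2) (auto simp: V_def)
  have "\<exists>\<phi>. \<phi> \<in> C0_fun \<and> {x. \<phi> x \<noteq> 0} \<subseteq> V \<and> mixed (\<lambda>x. h x - \<phi> x) \<le> ennreal ((1/4) ^ n)" for n :: nat
  proof -
    have "0 < (1/4 :: real) ^ n" by simp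
    then show ?thesis using app unfolding approximable_def by blast
  qed
  from choice[OF allI[OF this]] obtain \<phi> where
    \<phi>0: "\<forall>n. \<phi> n \<in> C0_fun \<and> {x. \<phi> n x \<noteq> 0} \<subseteq> V \<and> mixed (\<lambda>x. h x - \<phi> n x) \<le> ennreal ((1/4) ^ n)" ..
  have \<phi>: "\<phi> n \<in> C0_fun" "{x. \<phi> n x \<noteq> 0} \<subseteq> V" "mixed (\<lambda>x. h x - \<phi> n x) \<le> ennreal ((1/4) ^ n)" for n
    using \<phi>0 by auto
  have \<phi>i: "integrable lebesgue (\<phi> n)" "\<phi> n \<in> L2_fun" for n
    using mixed_finite_integrable[OF C0_measurable C0_mixed_finite] \<phi>(1) by auto
  have dL: "(\<lambda>x. h x - \<phi> n x) \<in> L2_fun" for n by (rule L2_diff[OF h(2) \<phi>i(2)])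
  have di: "integrable lebesgue (\<lambda>x. h x - \<phi> n x)" for n using h(1) \<phi>i(1) by simp
  have "AE x in lebesgue. (\<lambda>n. ennreal ((norm (T (\<lambda>y. h y - \<phi> n y) x))\<^sup>2)) \<longlonglongrightarrow> 0"
  proof (rule AE_summable_to_zero[where c = B])
    fix n
    show "(\<lambda>x. ennreal ((norm (T (\<lambda>y. h y - \<phi> n y) x))\<^sup>2)) \<in> borel_measurable lebesgue"
      using L2_measurable[OF T_L2[OF dL[of n]]] by measurable
    have "energy (T (\<lambda>y. h y - \<phi> n y)) \<le> ennreal B * energy (\<lambda>y. h y - \<phi> n y)" by (rule T_bound[OF dL])
    also have "\<dots> \<le> ennreal B * ennreal ((1/4) ^ n)"
      by (intro mult_left_mono order_trans[OF energy_le_mixed \<phi>(3)]) simp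
    also have "\<dots> = ennreal (B * (1/4) ^ n)" using B by (simp add: ennreal_mult')
    finally show "(\<integral>\<^sup>+x. ennreal ((norm (T (\<lambda>y. h y - \<phi> n y) x))\<^sup>2) \<partial>lebesgue) \<le> ennreal (B * (1/4) ^ n)"
      by (simp add: energy_def)
  qed (rule B)
  moreover have "AE x in lebesgue. \<forall>n. T (\<lambda>y. h y - \<phi> n y) x = T h x - T (\<phi> n) x"
    using T_diff[OF h(2) \<phi>i(2)] by (simp add: AE_all_countable)
  moreover have "AE x in lebesgue. x \<in> ball x0 s \<longrightarrow> T (\<phi> n) x = (LINT y:H|lebesgue. K x y * \<phi> n y)" for n
    unfolding H_def by (rule kernel_rep_C0[OF s \<phi>(1) \<phi>(2)[unfolded V_def]])
  then have "AE x in lebesgue. \<forall>n. x \<in> ball x0 s \<longrightarrow> T (\<phi> n) x = (LINT y:H|lebesgue. K x y * \<phi> n y)"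
    unfolding AE_all_countable by blast
  ultimately show ?thesis
  proof eventually_elim
    case (elim x)
    show ?case
    proof
      assume x: "x \<in> ball x0 s"
      have sep: "s \<le> dist x y" if "y \<in> H" for y
      proof -
        have "dist x0 y \<le> dist x0 x + dist x y" by (rule dist_triangle)
        then show ?thesis using that x by (simp add: H_def)
      qed
      have "(\<lambda>n. T (\<lambda>y. h y - \<phi> n y) x) \<longlonglongrightarrow> 0" by (rule tendsto_zero_of_square[OF elim(1)])
      then have 1: "(\<lambda>n. T h x - (LINT y:H|lebesgue. K x y * \<phi> n y)) \<longlonglongrightarrow> 0"
        using elim(2,3) x by simp
      have cmp: "norm ((LINT y:H|lebesgue. K x y * h y) - (LINT y:H|lebesgue. K x y * \<phi> n y)) \<le> A / s ^ DIM('a) * (1/4) ^ n" for n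
      proof -
        have ih: "integrable lebesgue (\<lambda>y. indicator H y *\<^sub>R (K x y * h y))" by (rule integrable_off[OF h(1) Hs s sep])
        have ip: "integrable lebesgue (\<lambda>y. indicator H y *\<^sub>R (K x y * \<phi> n y))" by (rule integrable_off[OF \<phi>i(1) Hs s sep])
        have "(LINT y:H|lebesgue. K x y * h y) - (LINT y:H|lebesgue. K x y * \<phi> n y) = (LINT y:H|lebesgue. K x y * (h y - \<phi> n y))"
          unfolding set_lebesgue_integral_def Bochner_Integration.integral_diff[OF ih ip, symmetric]
          by (simp add: right_diff_distrib scaleR_diff_right)
        also have "norm \<dots> \<le> A / s ^ DIM('a) * (1/4) ^ n"
        proof (rule norm_off[OF di Hs s sep])
          have "mass (\<lambda>y. h y - \<phi> n y) H \<le> mass (\<lambda>y. h y - \<phi> n y) UNIV" by (rule mass_mono) simp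
          also have "\<dots> \<le> ennreal ((1/4) ^ n)" by (rule order_trans[OF mass_le_mixed \<phi>(3)])
          finally show "mass (\<lambda>y. h y - \<phi> n y) H \<le> ennreal ((1/4) ^ n)" .
        qed simp_all
        finally show ?thesis .
      qed
      have "(\<lambda>n. A / s ^ DIM('a) * (1/4) ^ n) \<longlonglongrightarrow> A / s ^ DIM('a) * 0"
        by (intro tendsto_mult tendsto_const LIMSEQ_realpow_zero) auto
      then have lim: "(\<lambda>n. A / s ^ DIM('a) * (1/4) ^ n) \<longlonglongrightarrow> 0" by simp
      have 2: "(\<lambda>n. (LINT y:H|lebesgue. K x y * h y) - (LINT y:H|lebesgue. K x y * \<phi> n y)) \<longlonglongrightarrow> 0"
        by (rule Lim_null_comparison[OF always_eventually lim]) (use cmp in blast)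
      have eqd: "(a - b) - (c - b) = a - c" for a b c :: complex by simp
      have "(\<lambda>n. T h x - (LINT y:H|lebesgue. K x y * h y)) \<longlonglongrightarrow> 0 - 0"
        using tendsto_diff[OF 1 2] unfolding eqd .
      from LIMSEQ_unique[OF tendsto_const this]
      have "T h x - (LINT y:H|lebesgue. K x y * h y) = 0" by simp
      then show "T h x = (LINT y:{y. 2 * s \<le> dist x0 y}|lebesgue. K x y * h y)" by (simp add: H_def)
    qed
  qed
qed

lemma set_integral_support:
  assumes "\<And>y. y \<notin> H \<Longrightarrow> h y = 0"
  shows "(LINT y:H|lebesgue. K x y * h y) = (\<integral>y. K x y * h y \<partial>lebesgue)"
  unfolding set_lebesgue_integral_def
  by (rule Bochner_Integration.integral_cong) (use assms in \<open>auto simp: indicator_def\<close>)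

text \<open>By Lindelof, countably many balls whose fourfold dilates miss H cover the complement of
  H, so the null sets of the local representations can be united.\<close>

lemma kernel_rep:
  assumes h: "integrable lebesgue h" "h \<in> L2_fun" and H: "closed H" "\<And>y. y \<notin> H \<Longrightarrow> h y = 0"
  shows "AE x in lebesgue. x \<notin> H \<longrightarrow> T h x = (LINT y:H|lebesgue. K x y * h y)"
proof -
  define \<F> where "\<F> = {b. \<exists>x0 s. 0 < s \<and> b = ball x0 s \<and> ball x0 (4 * s) \<inter> H = {}}"
  have op: "\<And>b. b \<in> \<F> \<Longrightarrow> open b" by (auto simp: \<F>_def)
  obtain \<G> where \<G>: "\<G> \<subseteq> \<F>" "countable \<G>" "\<Union>\<G> = \<Union>\<F>" using Lindelof[OF op] by metis
  have cover: "x \<in> \<Union>\<F>" if xH: "x \<notin> H" for x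
  proof -
    have "open (- H)" "x \<in> - H" using H(1) xH by auto
    then obtain r where r: "0 < r" "ball x r \<subseteq> - H" by (meson open_contains_ball_eq)
    then have "ball x (r / 4) \<in> \<F>" unfolding \<F>_def by (intro CollectI exI[of _ x] exI[of _ "r / 4"]) auto
    then show ?thesis using r by (intro UnionI[of "ball x (r / 4)"]) auto
  qed
  have "AE x in lebesgue. \<forall>b\<in>\<G>. x \<in> b \<longrightarrow> T h x = (LINT y:H|lebesgue. K x y * h y)"
  proof (subst AE_ball_countable[OF \<G>(2)], rule ballI)
    fix b assume "b \<in> \<G>"
    then obtain x0 s where b: "0 < s" "b = ball x0 s" "ball x0 (4 * s) \<inter> H = {}" using \<G>(1) by (auto simp: \<F>_def)
    have zero: "h y = 0" if "dist x0 y \<le> 2 * s" for y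
    proof -
      have "y \<in> ball x0 (4 * s)" using that b(1) by simp
      then show ?thesis using b(3) H(2) by blast
    qed
    have eq: "(LINT y:{y. 2 * s \<le> dist x0 y}|lebesgue. K x y * h y) = (LINT y:H|lebesgue. K x y * h y)" for x
    proof -
      have "(LINT y:{y. 2 * s \<le> dist x0 y}|lebesgue. K x y * h y) = (\<integral>y. K x y * h y \<partial>lebesgue)"
        by (rule set_integral_support) (use zero in auto)
      also have "\<dots> = (LINT y:H|lebesgue. K x y * h y)" by (rule set_integral_support[symmetric]) (rule H(2))
      finally show ?thesis .
    qed
    show "AE x in lebesgue. x \<in> b \<longrightarrow> T h x = (LINT y:H|lebesgue. K x y * h y)"
    proof -
      have "AE x in lebesgue. x \<in> ball x0 s \<longrightarrow> T h x = (LINT y:{y. 2 * s \<le> dist x0 y}|lebesgue. K x y * h y)"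
        by (rule kernel_rep_ball[OF b(1) h]) (rule zero)
      then show ?thesis unfolding b(2) eq .
    qed
  qed
  then show ?thesis
  proof eventually_elim
    case (elim x)
    then show ?case using cover[of x] \<G>(3) by blast
  qed
qed

end

subsection \<open>Weak type (1,1) on integrable square integrable functions\<close>

lemma markov:
  assumes "h \<in> borel_measurable M" "0 < (s::real)"
  shows "emeasure M {x\<in>space M. ennreal s \<le> h x} \<le> ennreal (1 / s) * (\<integral>\<^sup>+x. h x \<partial>M)"
proof -
  have iff: "1 \<le> ennreal (1 / s) * z \<longleftrightarrow> ennreal s \<le> z" for z
  proof (cases z)
    case (real r)
    then have "ennreal (1 / s) * z = ennreal (r / s)" using assms(2) by (simp add: ennreal_mult'[symmetric])
    then show ?thesis using real assms(2) by (simp add: pos_le_divide_eq)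
  next
    case top
    then show ?thesis using assms(2) by (simp add: ennreal_mult_top)
  qed
  have "emeasure M {x\<in>space M. 1 \<le> ennreal (1 / s) * h x} \<le> ennreal (1 / s) * (\<integral>\<^sup>+x. h x * indicator (space M) x \<partial>M)"
    by (rule nn_integral_Markov_inequality) (use assms(1) in measurable)
  also have "(\<integral>\<^sup>+x. h x * indicator (space M) x \<partial>M) = (\<integral>\<^sup>+x. h x \<partial>M)" by (rule nn_integral_cong) simp
  finally show ?thesis unfolding iff .
qed

text \<open>In \<open>atom_bound\<close> the function b is only Lebesgue measurable, so Fubini is
  applied to the product of two completed measures, for which sigma-finiteness is required.\<close>

lemma sigma_finite_lebesgue: "sigma_finite_measure (lebesgue :: 'a::euclidean_space measure)"
proof
  have "\<Union>(range (\<lambda>n::nat. ball (0::'a) (real n))) = UNIV"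
    by (auto simp: reals_Archimedean2)
  then show "\<exists>A. countable A \<and> A \<subseteq> sets lebesgue \<and> \<Union>A = space lebesgue \<and> (\<forall>a\<in>A. emeasure (lebesgue :: 'a measure) a \<noteq> \<infinity>)"
    by (intro exI[of _ "range (\<lambda>n::nat. ball (0::'a) (real n))"]) (auto simp: emeasure_lebesgue_ball)
qed

lemma disjoint_unique: "disjoint F \<Longrightarrow> Q \<in> F \<Longrightarrow> R \<in> F \<Longrightarrow> x \<in> Q \<Longrightarrow> x \<in> R \<Longrightarrow> Q = R"
  by (auto simp: disjoint_def)

context grid begin

text \<open>All but finitely many cubes carry at most the energy e. This keeps the decomposition
  below finite, and T is additive on finite sums.\<close>

lemma tail_energy_small:
  assumes J: "J \<subseteq> D" "disjoint J" and f: "f \<in> L2_fun" and e: "0 < (e::real)"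
  shows "\<exists>F. finite F \<and> F \<subseteq> J \<and> (\<integral>\<^sup>+x\<in>\<Union>(J - F). ennreal ((norm (f x))\<^sup>2) \<partial>lebesgue) < ennreal e"
proof -
  have cJ: "countable J" using J(1) countable_D by (rule countable_subset)
  have [measurable]: "f \<in> borel_measurable lebesgue" using f by (rule L2_measurable)
  define Fm where "Fm m = {Q \<in> J. to_nat_on J Q \<le> m}" for m
  have Fs [measurable]: "\<Union>(J - Fm m) \<in> sets lebesgue" for m
    using J(1) cJ D_sets by (intro sets.countable_Union countable_Diff) auto
  have fin: "finite (Fm m)" for m
  proof (rule inj_on_finite)
    show "inj_on (to_nat_on J) (Fm m)" by (rule inj_on_subset[OF inj_on_to_nat_on[OF cJ]]) (auto simp: Fm_def)
    show "to_nat_on J ` Fm m \<subseteq> {..m}" by (auto simp: Fm_def)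
  qed simp
  have "(\<lambda>m. \<integral>\<^sup>+x\<in>\<Union>(J - Fm m). ennreal ((norm (f x))\<^sup>2) \<partial>lebesgue) \<longlonglongrightarrow> (\<integral>\<^sup>+x. 0 \<partial>(lebesgue :: 'a measure))"
  proof (rule nn_integral_dominated_convergence[where w = "\<lambda>x. ennreal ((norm (f x))\<^sup>2)"])
    show "(\<integral>\<^sup>+x. ennreal ((norm (f x))\<^sup>2) \<partial>lebesgue) < \<infinity>" using f by (simp add: L2_fun_energy energy_def)
    show "AE x in lebesgue. ennreal ((norm (f x))\<^sup>2) * indicator (\<Union>(J - Fm m)) x \<le> ennreal ((norm (f x))\<^sup>2)" for m
      by (rule AE_I2) (simp add: indicator_def)
    show "AE x in lebesgue. (\<lambda>m. ennreal ((norm (f x))\<^sup>2) * indicator (\<Union>(J - Fm m)) x) \<longlonglongrightarrow> 0"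
    proof (rule AE_I2)
      fix x
      have "\<exists>m0. \<forall>m\<ge>m0. x \<notin> \<Union>(J - Fm m)"
      proof (cases "x \<in> \<Union>J")
        case True
        then obtain Q where Q: "Q \<in> J" "x \<in> Q" by auto
        have "x \<notin> \<Union>(J - Fm m)" if "to_nat_on J Q \<le> m" for m
        proof
          assume "x \<in> \<Union>(J - Fm m)"
          then obtain R where R: "R \<in> J" "R \<notin> Fm m" "x \<in> R" by auto
          then have "R = Q" using disjoint_unique[OF J(2)] Q by metis
          then show False using R Q that by (simp add: Fm_def)
        qed
        then show ?thesis by blast
      qed auto
      then obtain m0 where "\<And>m. m \<ge> m0 \<Longrightarrow> x \<notin> \<Union>(J - Fm m)" by blast
      then have "\<forall>\<^sub>F m in sequentially. ennreal ((norm (f x))\<^sup>2) * indicator (\<Union>(J - Fm m)) x = 0"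
        unfolding eventually_sequentially by (intro exI[of _ m0]) (simp add: indicator_def)
      then show "(\<lambda>m. ennreal ((norm (f x))\<^sup>2) * indicator (\<Union>(J - Fm m)) x) \<longlonglongrightarrow> 0"
        by (rule tendsto_eventually)
    qed
  qed measurable
  then have "(\<lambda>m. \<integral>\<^sup>+x\<in>\<Union>(J - Fm m). ennreal ((norm (f x))\<^sup>2) \<partial>lebesgue) \<longlonglongrightarrow> 0" by simp
  then have "\<forall>\<^sub>F m in sequentially. (\<integral>\<^sup>+x\<in>\<Union>(J - Fm m). ennreal ((norm (f x))\<^sup>2) \<partial>lebesgue) < ennreal e"
    by (rule order_tendstoD) (use e in simp)
  then obtain m where "(\<integral>\<^sup>+x\<in>\<Union>(J - Fm m). ennreal ((norm (f x))\<^sup>2) \<partial>lebesgue) < ennreal e"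
    by (auto simp: eventually_sequentially)
  then show ?thesis using fin[of m] by (intro exI[of _ "Fm m"]) (auto simp: Fm_def)
qed

text \<open>The Calderon-Zygmund selection at height l, with finitely many cubes kept. The other
  selected cubes are left to the good part, where they add at most e to the energy. Off all selected
  cubes |f| \<le> 2 l almost everywhere, whence the term 2 l n.\<close>

lemma stopping_cubes:
  assumes f: "integrable lebesgue f" "f \<in> L2_fun" and n: "mass f UNIV \<le> ennreal n" "0 \<le> n"
    and l: "0 < l" and e: "0 < e"
  shows "\<exists>F. finite F \<and> F \<subseteq> D \<and> disjoint F \<and>
    (\<forall>Q\<in>F. ennreal l * emeasure lebesgue Q \<le> mass f Q \<and> mass f Q \<le> ennreal (2 ^ DIM('a) * l) * emeasure lebesgue Q) \<and>
    energy (res (- \<Union>F) f) \<le> ennreal (2 * l * n + e)"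
proof -
  have fm [measurable]: "f \<in> borel_measurable lebesgue" using f by auto
  define G where "G = {Q \<in> D. ennreal l * emeasure lebesgue Q < mass f Q}"
  define J where "J = maxi G"
  have GD: "G \<subseteq> D" by (auto simp: G_def)
  obtain k0 where k0: "\<And>k. side k ^ DIM('a) \<le> n / l \<Longrightarrow> k0 \<le> k" using ex_level_bound by blast
  have lev0: "k0 \<le> lev Q" if "Q \<in> G" for Q
  proof -
    have QD: "Q \<in> D" using that GD by auto
    have "ennreal (l * side (lev Q) ^ DIM('a)) = ennreal l * emeasure lebesgue Q"
      using l by (simp add: emeasure_lev[OF QD] ennreal_mult)
    also have "\<dots> \<le> mass f Q" using that by (auto simp: G_def intro: less_imp_le)
    also have "\<dots> \<le> ennreal n" using mass_mono[of Q UNIV f] n by simp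
    finally have "l * side (lev Q) ^ DIM('a) \<le> n" using n by simp
    then show ?thesis using l by (intro k0) (simp add: pos_le_divide_eq mult.commute)
  qed
  have J: "J \<subseteq> D" "J \<subseteq> G" "disjoint J" "\<Union>J = \<Union>G"
    using maxi_subset GD maxi_disjoint[OF GD] Union_maxi[OF GD lev0] by (auto simp: J_def)
  obtain F where F: "finite F" "F \<subseteq> J" "(\<integral>\<^sup>+x\<in>\<Union>(J - F). ennreal ((norm (f x))\<^sup>2) \<partial>lebesgue) < ennreal e"
    using tail_energy_small[OF J(1,3) f(2) e] by blast
  have "countable G" "countable J" using GD J(1) countable_D countable_subset by blast+
  then have Gs [measurable]: "\<Union>G \<in> sets lebesgue" and JFs [measurable]: "\<Union>(J - F) \<in> sets lebesgue"
    using GD J(1) D_sets by (auto intro!: sets.countable_Union countable_Diff)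
  have up: "mass f Q \<le> ennreal (2 ^ DIM('a) * l) * emeasure lebesgue Q" if Q: "Q \<in> F" for Q
  proof -
    have QJ: "Q \<in> J" "Q \<in> D" using Q F J by auto
    obtain x where x: "x \<in> Q" using D_nonempty QJ(2) by blast
    have Qc: "cell (lev Q) x = Q" by (rule cell_lev[OF QJ(2) x])
    \<comment> \<open>By maximality of Q its parent is not selected; the parent has 2^d times the
      volume.\<close>
    define P where "P = cell (lev Q - 1) x"
    have "Q \<subset> P" using cell_psubset_iff[of "lev Q" x "lev Q - 1"] unfolding Qc P_def by simp
    then have "P \<notin> G" using QJ(1) by (auto simp: J_def maxi_def)
    then have less: "mass f P \<le> ennreal l * emeasure lebesgue P" by (auto simp: G_def P_def not_less)
    have "side (lev Q - 1) = 2 * side (lev Q)" using side_Suc[of "lev Q - 1"] by simp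
    then have "emeasure lebesgue P = ennreal (2 ^ DIM('a)) * emeasure lebesgue Q"
      unfolding P_def emeasure_cell emeasure_lev[OF QJ(2)] by (simp add: power_mult_distrib ennreal_mult)
    then have "mass f P \<le> ennreal (2 ^ DIM('a) * l) * emeasure lebesgue Q"
      using less l by (simp add: ennreal_mult ac_simps)
    moreover have "mass f Q \<le> mass f P" using \<open>Q \<subset> P\<close> by (intro mass_mono) auto
    ultimately show ?thesis by (rule order_trans[rotated])
  qed
  \<comment> \<open>The bound is 2 l rather than l: on a cube that is not selected, the set where
    |f| > 2 l fills at most half, a proportion below 1 as the density criterion demands.\<close>
  define E where "E = {x. 2 * l < norm (f x)} - \<Union>G"
  have "{x \<in> space lebesgue. 2 * l < norm (f x)} \<in> sets lebesgue" by measurable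
  then have Es [measurable]: "E \<in> sets lebesgue" unfolding E_def by (intro sets.Diff) auto
  have "E \<in> null_sets lebesgue"
  proof (rule null_by_density[OF Es, of "1/2"])
    fix Q assume Q: "Q \<in> D" "Q \<inter> E \<noteq> {}"
    have Qs: "Q \<in> sets lebesgue" using D_sets[OF Q(1)] .
    have "Q \<notin> G" using Q(2) by (auto simp: E_def)
    then have less: "mass f Q \<le> ennreal l * emeasure lebesgue Q" using Q(1) by (auto simp: G_def not_less)
    have "ennreal (2 * l) * emeasure lebesgue (E \<inter> Q) = (\<integral>\<^sup>+x. ennreal (2 * l) * indicator (E \<inter> Q) x \<partial>lebesgue)"
      using Es Qs by (intro nn_integral_cmult_indicator[symmetric]) auto
    also have "\<dots> \<le> mass f Q" unfolding mass_def
      by (rule nn_integral_mono) (auto simp: E_def indicator_def intro!: ennreal_leI)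
    also note less
    finally have "ennreal (1 / (2 * l)) * (ennreal (2 * l) * emeasure lebesgue (E \<inter> Q)) \<le> ennreal (1 / (2 * l)) * (ennreal l * emeasure lebesgue Q)"
      by (rule mult_left_mono) simp
    then show "emeasure lebesgue (E \<inter> Q) \<le> ennreal (1/2) * emeasure lebesgue Q"
      using l by (simp add: mult.assoc[symmetric] ennreal_mult'[symmetric])
  qed auto
  then have AE_E: "AE x in lebesgue. x \<notin> E" by (rule AE_not_in)
  have "energy (res (- \<Union>F) f) \<le> (\<integral>\<^sup>+x. ennreal (2 * l) * ennreal (norm (f x)) + ennreal ((norm (f x))\<^sup>2) * indicator (\<Union>(J - F)) x \<partial>lebesgue)"
    unfolding energy_def
  proof (rule nn_integral_mono_AE, use AE_E in eventually_elim)
    fix x assume xE: "x \<notin> E"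
    show "ennreal ((norm (res (- \<Union>F) f x))\<^sup>2) \<le> ennreal (2 * l) * ennreal (norm (f x)) + ennreal ((norm (f x))\<^sup>2) * indicator (\<Union>(J - F)) x"
    proof (cases "x \<in> \<Union>F")
      case False
      show ?thesis
      proof (cases "x \<in> \<Union>J")
        case True
        then have "x \<in> \<Union>(J - F)" using False by blast
        then show ?thesis using False by (simp add: res_def)
      next
        case xJ: False
        then have "norm (f x) \<le> 2 * l" using xE J(4) by (auto simp: E_def)
        then have "(norm (f x))\<^sup>2 \<le> 2 * l * norm (f x)" unfolding power2_eq_square by (rule mult_right_mono) simp
        then have "ennreal ((norm (f x))\<^sup>2) \<le> ennreal (2 * l) * ennreal (norm (f x))"
          using l by (subst ennreal_mult[symmetric]) (auto intro: ennreal_leI)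
        also have "\<dots> \<le> \<dots> + ennreal ((norm (f x))\<^sup>2) * indicator (\<Union>(J - F)) x" by simp
        finally show ?thesis using False by (simp add: res_def)
      qed
    next
      case True then show ?thesis by (auto simp: res_def)
    qed
  qed
  also have "\<dots> = (\<integral>\<^sup>+x. ennreal (2 * l) * ennreal (norm (f x)) \<partial>lebesgue) + (\<integral>\<^sup>+x\<in>\<Union>(J - F). ennreal ((norm (f x))\<^sup>2) \<partial>lebesgue)"
    by (rule nn_integral_add) measurable
  also have "(\<integral>\<^sup>+x. ennreal (2 * l) * ennreal (norm (f x)) \<partial>lebesgue) = ennreal (2 * l) * mass f UNIV"
    unfolding mass_UNIV by (rule nn_integral_cmult) measurable
  also have "ennreal (2 * l) * mass f UNIV + (\<integral>\<^sup>+x\<in>\<Union>(J - F). ennreal ((norm (f x))\<^sup>2) \<partial>lebesgue) \<le> ennreal (2 * l) * ennreal n + ennreal e"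
    using F(3) n(1) by (intro add_mono mult_left_mono) auto
  also have "\<dots> = ennreal (2 * l * n + e)" using l n e by (simp add: ennreal_mult ennreal_plus)
  finally have en: "energy (res (- \<Union>F) f) \<le> ennreal (2 * l * n + e)" .
  have "ennreal l * emeasure lebesgue Q \<le> mass f Q" if "Q \<in> F" for Q
    using that F(2) J(2) by (auto simp: G_def intro: less_imp_le)
  moreover have "disjoint F" using J(3) F(2) by (auto simp: disjoint_def)
  ultimately show ?thesis using F(1,2) J(1) up en by (intro exI[of _ F] conjI ballI) auto
qed

end

context cz_op begin

lemma T_sum:
  assumes "finite F" "\<And>Q. Q \<in> F \<Longrightarrow> h Q \<in> L2_fun"
  shows "(\<lambda>x. \<Sum>Q\<in>F. h Q x) \<in> L2_fun \<and> (AE x in lebesgue. T (\<lambda>y. \<Sum>Q\<in>F. h Q y) x = (\<Sum>Q\<in>F. T (h Q) x))"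
  using assms
proof (induction F rule: finite_induct)
  case empty
  have z: "(\<lambda>x. 0) \<in> L2_fun" by (simp add: L2_fun_def)
  then show ?case using T_scale[OF z, of 0] by simp
next
  case (insert Q F)
  then have IH: "(\<lambda>x. \<Sum>Q\<in>F. h Q x) \<in> L2_fun" "AE x in lebesgue. T (\<lambda>y. \<Sum>Q\<in>F. h Q y) x = (\<Sum>Q\<in>F. T (h Q) x)"
    and hQ: "h Q \<in> L2_fun" by auto
  have "AE x in lebesgue. T (\<lambda>y. h Q y + (\<Sum>Q\<in>F. h Q y)) x = T (h Q) x + T (\<lambda>y. \<Sum>Q\<in>F. h Q y) x"
    by (rule T_add[OF hQ IH(1)])
  with IH(2) have "AE x in lebesgue. T (\<lambda>y. h Q y + (\<Sum>Q\<in>F. h Q y)) x = T (h Q) x + (\<Sum>Q\<in>F. T (h Q) x)"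
    by eventually_elim simp
  then show ?case using L2_add[OF hQ IH(1)] insert.hyps by simp
qed

text \<open>As b has mean zero, the kernel at the centre z can be subtracted. Fubini and Hormander's
  condition then bound the integral away from the support.\<close>

lemma atom_bound:
  assumes \<rho>: "0 < \<rho>" and b: "integrable lebesgue b" "b \<in> L2_fun" and supp: "\<And>y. \<rho> < dist z y \<Longrightarrow> b y = 0"
    and mean: "(\<integral>y. b y \<partial>lebesgue) = 0"
  shows "(\<integral>\<^sup>+x\<in>{x. 2 * \<rho> \<le> dist z x}. ennreal (norm (T b x)) \<partial>lebesgue)
      \<le> ennreal (W * unit_ball_vol (real DIM('a))) * mass b UNIV"
proof -
  interpret L: sigma_finite_measure "lebesgue :: 'a measure" by (rule sigma_finite_lebesgue)
  interpret LL: pair_sigma_finite "lebesgue :: 'a measure" "lebesgue :: 'a measure" ..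
  have bm [measurable]: "b \<in> borel_measurable lebesgue" using b by auto
  define H where "H = cball z \<rho>"
  define R where "R = {x. 2 * \<rho> \<le> dist z x}"
  have "closed R" unfolding R_def by (intro closed_Collect_le continuous_intros)
  then have Rs [measurable]: "R \<in> sets lebesgue" by auto
  have Hs [measurable]: "H \<in> sets lebesgue" by (simp add: H_def)
  have b0: "b y = 0" if "y \<notin> H" for y using supp that by (simp add: H_def)
  define k where "k x y = (if x = y then 0 else K x y)" for x y
  have km [measurable]: "(\<lambda>(x, y). k x y) \<in> borel_measurable (lebesgue \<Otimes>\<^sub>M lebesgue)"
  proof -
    have idm: "(\<lambda>x. x) \<in> lebesgue \<rightarrow>\<^sub>M (borel :: 'a measure)" by (rule measurable_completion) simp
    have "(\<lambda>p. (fst p, snd p)) \<in> (lebesgue \<Otimes>\<^sub>M lebesgue) \<rightarrow>\<^sub>M ((borel :: 'a measure) \<Otimes>\<^sub>M (borel :: 'a measure))"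
      by (intro measurable_Pair measurable_compose[OF measurable_fst idm] measurable_compose[OF measurable_snd idm])
    from measurable_compose[OF this K_off_pair] show ?thesis by (simp add: k_def case_prod_beta')
  qed
  have kz [measurable]: "(\<lambda>x. k x z) \<in> borel_measurable lebesgue" unfolding k_def by (rule K_off_1)
  define g where "g x y = ennreal (norm (k x z - k x y)) * ennreal (norm (b y)) * indicator R x * indicator H y" for x y
  have gm: "(\<lambda>(x, y). g x y) \<in> borel_measurable (lebesgue \<Otimes>\<^sub>M lebesgue)"
    unfolding g_def case_prod_beta' using km[unfolded case_prod_beta'] by measurable
  have point: "ennreal (norm (LINT y:H|lebesgue. K x y * b y)) \<le> (\<integral>\<^sup>+y. g x y \<partial>lebesgue)" if x: "x \<in> R" for x
  proof -
    have sep: "\<rho> \<le> dist x y" if "y \<in> H" for y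
    proof -
      have "dist z x \<le> dist z y + dist y x" by (rule dist_triangle)
      then show ?thesis using that x by (simp add: H_def R_def dist_commute)
    qed
    have i1: "integrable lebesgue (\<lambda>y. indicator H y *\<^sub>R (K x y * b y))" by (rule integrable_off[OF b(1) Hs \<rho> sep])
    have i2: "integrable lebesgue (\<lambda>y. K x z * b y)" using b(1) by simp
    have "(LINT y:H|lebesgue. K x y * b y) = (\<integral>y. indicator H y *\<^sub>R (K x y * b y) \<partial>lebesgue) - K x z * (\<integral>y. b y \<partial>lebesgue)"
      by (simp add: set_lebesgue_integral_def mean)
    also have "\<dots> = (\<integral>y. indicator H y *\<^sub>R (K x y * b y) - K x z * b y \<partial>lebesgue)"
      using i1 i2 b(1) by (simp add: Bochner_Integration.integral_diff)
    finally have "ennreal (norm (LINT y:H|lebesgue. K x y * b y)) \<le> (\<integral>\<^sup>+y. ennreal (norm (indicator H y *\<^sub>R (K x y * b y) - K x z * b y)) \<partial>lebesgue)"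
      using integral_norm_bound_ennreal[OF Bochner_Integration.integrable_diff[OF i1 i2]] by simp
    also have "\<dots> \<le> (\<integral>\<^sup>+y. g x y \<partial>lebesgue)"
    proof (rule nn_integral_mono)
      fix y
      show "ennreal (norm (indicator H y *\<^sub>R (K x y * b y) - K x z * b y)) \<le> g x y"
      proof (cases "y \<in> H")
        case True
        have "x \<noteq> y" using sep[OF True] \<rho> by auto
        moreover have "x \<noteq> z" using x \<rho> by (auto simp: R_def)
        moreover have "norm (K x y * b y - K x z * b y) = norm (K x z - K x y) * norm (b y)"
          by (simp add: left_diff_distrib[symmetric] norm_mult norm_minus_commute)
        ultimately show ?thesis using True x by (simp add: g_def k_def ennreal_mult)
      qed (simp add: b0)
    qed
    finally show ?thesis .
  qed
  have rep: "AE x in lebesgue. x \<notin> H \<longrightarrow> T b x = (LINT y:H|lebesgue. K x y * b y)"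
    by (rule kernel_rep[OF b _ b0]) (auto simp: H_def)
  have "(\<integral>\<^sup>+x\<in>R. ennreal (norm (T b x)) \<partial>lebesgue) \<le> (\<integral>\<^sup>+x. \<integral>\<^sup>+y. g x y \<partial>lebesgue \<partial>lebesgue)"
  proof (rule nn_integral_mono_AE, use rep in eventually_elim)
    fix x assume x: "x \<notin> H \<longrightarrow> T b x = (LINT y:H|lebesgue. K x y * b y)"
    show "ennreal (norm (T b x)) * indicator R x \<le> (\<integral>\<^sup>+y. g x y \<partial>lebesgue)"
    proof (cases "x \<in> R")
      case True
      then have "x \<notin> H" using \<rho> by (simp add: R_def H_def)
      then show ?thesis using x point[OF True] True by simp
    qed simp
  qed
  also have "\<dots> = (\<integral>\<^sup>+y. \<integral>\<^sup>+x. g x y \<partial>lebesgue \<partial>lebesgue)"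
    by (rule LL.Fubini'[OF gm, symmetric])
  also have "\<dots> \<le> (\<integral>\<^sup>+y. ennreal (W * unit_ball_vol (real DIM('a))) * ennreal (norm (b y)) \<partial>lebesgue)"
  proof (rule nn_integral_mono)
    fix y
    show "(\<integral>\<^sup>+x. g x y \<partial>lebesgue) \<le> ennreal (W * unit_ball_vol (real DIM('a))) * ennreal (norm (b y))"
    proof (cases "y \<in> H")
      case True
      have ky [measurable]: "(\<lambda>x. k x y) \<in> borel_measurable lebesgue" unfolding k_def by (rule K_off_1)
      have "(\<integral>\<^sup>+x. g x y \<partial>lebesgue) = (\<integral>\<^sup>+x. ennreal (norm (k x z - k x y)) * indicator R x * ennreal (norm (b y)) \<partial>lebesgue)"
        using True by (intro nn_integral_cong) (simp add: g_def ac_simps)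
      also have "\<dots> = (\<integral>\<^sup>+x\<in>R. ennreal (norm (k x z - k x y)) \<partial>lebesgue) * ennreal (norm (b y))"
        by (rule nn_integral_multc) measurable
      also have "(\<integral>\<^sup>+x\<in>R. ennreal (norm (k x z - k x y)) \<partial>lebesgue) = (\<integral>\<^sup>+x\<in>R. ennreal (norm (K x z - K x y)) \<partial>lebesgue)"
      proof (rule nn_integral_cong)
        fix x
        have "x \<noteq> z \<and> x \<noteq> y" if "x \<in> R" using that \<rho> True by (auto simp: R_def H_def)
        then show "ennreal (norm (k x z - k x y)) * indicator R x = ennreal (norm (K x z - K x y)) * indicator R x"
          by (cases "x \<in> R") (auto simp: k_def)
      qed
      also have "\<dots> * ennreal (norm (b y)) \<le> ennreal (W * unit_ball_vol (real DIM('a))) * ennreal (norm (b y))"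
        unfolding R_def by (rule mult_right_mono[OF tail_dual]) (use True \<rho> in \<open>auto simp: H_def\<close>)
      finally show ?thesis .
    next
      case False
      then show ?thesis by (simp add: g_def)
    qed
  qed
  also have "\<dots> = ennreal (W * unit_ball_vol (real DIM('a))) * mass b UNIV"
    unfolding mass_UNIV by (rule nn_integral_cmult) measurable
  finally show ?thesis by (simp add: R_def)
qed

end

text \<open>Here c is the mean of f on Q. Its modulus times the volume is at most the mass of f on
  Q, so the mean zero part has at most twice that mass.\<close>

lemma (in grid) average_split:
  fixes f :: "'a \<Rightarrow> complex"
  assumes f: "integrable lebesgue f" "f \<in> L2_fun" and Q: "Q \<in> D"
  obtains c where "integrable lebesgue (res Q (\<lambda>y. f y - c))" "res Q (\<lambda>y. f y - c) \<in> L2_fun"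
    "(\<integral>y. res Q (\<lambda>y. f y - c) y \<partial>lebesgue) = 0" "ennreal (norm c) * emeasure lebesgue Q \<le> mass f Q"
    "mass (res Q (\<lambda>y. f y - c)) UNIV \<le> 2 * mass f Q"
proof -
  have fm [measurable]: "f \<in> borel_measurable lebesgue" using f by auto
  have Qs [measurable]: "Q \<in> sets lebesgue" using D_sets[OF Q] .
  define m where "m = side (lev Q) ^ DIM('a)"
  have m: "0 < m" "emeasure lebesgue Q = ennreal m" by (simp_all add: m_def emeasure_lev[OF Q])
  define I where "I = (\<integral>y. res Q f y \<partial>lebesgue)"
  define c where "c = I / of_real m"
  define b where "b = res Q (\<lambda>y. f y - c)"
  have iR: "integrable lebesgue (res Q f)" by (rule res_integrable[OF f(1) Qs])
  have iQ: "integrable lebesgue (\<lambda>y. indicator Q y *\<^sub>R c)"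
    by (rule integrable_scaleR_left) (use Qs m in \<open>auto intro!: integrable_real_indicator\<close>)
  have b_eq: "b = (\<lambda>y. res Q f y - indicator Q y *\<^sub>R c)" by (auto simp: b_def res_def fun_eq_iff)
  have bi: "integrable lebesgue b" unfolding b_eq by (rule Bochner_Integration.integrable_diff[OF iR iQ])
  have bm [measurable]: "b \<in> borel_measurable lebesgue" using bi by auto
  have mQ: "measure lebesgue Q = m" using m by (simp add: measure_def)
  have "(\<integral>y. indicator Q y *\<^sub>R c \<partial>lebesgue) = m *\<^sub>R c"
    using Qs m mQ by (subst integral_scaleR_left) (auto intro!: integrable_real_indicator)
  then have b0: "(\<integral>y. b y \<partial>lebesgue) = 0"
    unfolding b_eq Bochner_Integration.integral_diff[OF iR iQ] using m by (simp add: I_def[symmetric] c_def scaleR_conv_of_real)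
  have nI: "ennreal (norm I) \<le> mass f Q"
  proof -
    have "ennreal (norm I) \<le> mass (res Q f) UNIV" unfolding I_def mass_UNIV by (rule integral_norm_bound_ennreal[OF iR])
    then show ?thesis by (simp add: mass_res)
  qed
  have nc: "ennreal (norm c) * emeasure lebesgue Q = ennreal (norm I)"
    using m by (simp add: c_def norm_divide ennreal_mult'[symmetric])
  have "mass b UNIV \<le> (\<integral>\<^sup>+y. ennreal (norm (f y)) * indicator Q y + ennreal (norm c) * indicator Q y \<partial>lebesgue)"
    unfolding mass_UNIV
  proof (rule nn_integral_mono)
    fix y
    have "ennreal (norm (f y - c)) \<le> ennreal (norm (f y) + norm c)" by (rule ennreal_leI) (rule norm_triangle_ineq4)
    then show "ennreal (norm (b y)) \<le> ennreal (norm (f y)) * indicator Q y + ennreal (norm c) * indicator Q y"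
      by (cases "y \<in> Q") (auto simp: b_def res_def ennreal_plus)
  qed
  also have "\<dots> = mass f Q + ennreal (norm c) * emeasure lebesgue Q"
    unfolding mass_def nn_integral_cmult_indicator[OF Qs, symmetric] by (rule nn_integral_add) measurable
  also have "\<dots> \<le> mass f Q + mass f Q" unfolding nc by (rule add_left_mono[OF nI])
  finally have bmass: "mass b UNIV \<le> 2 * mass f Q" by (simp add: mult_2)
  have iL: "res Q f \<in> L2_fun" by (rule L2_mono[OF f(2)]) (auto simp: res_def[abs_def] intro: res_measurable[OF fm Qs, unfolded res_def])
  have QL: "(\<lambda>y. indicator Q y *\<^sub>R c) \<in> L2_fun"
  proof -
    have "energy (\<lambda>y. indicator Q y *\<^sub>R c) \<le> (\<integral>\<^sup>+y. ennreal ((norm c)\<^sup>2) * indicator Q y \<partial>lebesgue)"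
      unfolding energy_def by (intro nn_integral_mono) (auto simp: indicator_def)
    also have "\<dots> = ennreal ((norm c)\<^sup>2) * emeasure lebesgue Q" by (rule nn_integral_cmult_indicator[OF Qs])
    also have "\<dots> < \<infinity>" using m by (simp add: ennreal_mult_less_top)
    finally show ?thesis using iQ by (auto simp: L2_fun_energy)
  qed
  have bL: "b \<in> L2_fun" unfolding b_eq by (rule L2_diff[OF iL QL])
  show ?thesis using that[of c] bi bL b0 nI nc bmass unfolding b_def by simp
qed

lemma cheb_energy:
  assumes h: "h \<in> L2_fun" and e: "energy h \<le> ennreal a" "0 \<le> a" and s: "0 < s"
  shows "emeasure lebesgue {x. s \<le> norm (h x)} \<le> ennreal (a / s\<^sup>2)"
proof -
  have [measurable]: "h \<in> borel_measurable lebesgue" by (rule L2_measurable[OF h])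
  have s2: "0 < s\<^sup>2" using s by simp
  have "{x. s \<le> norm (h x)} = {x \<in> space lebesgue. ennreal (s\<^sup>2) \<le> ennreal ((norm (h x))\<^sup>2)}"
    using s by (auto simp: power2_le_iff_abs_le intro: power_mono)
  also have "emeasure lebesgue \<dots> \<le> ennreal (1 / s\<^sup>2) * energy h"
    unfolding energy_def by (rule markov[OF _ s2]) measurable
  also have "\<dots> \<le> ennreal (1 / s\<^sup>2) * ennreal a" by (rule mult_left_mono[OF e(1)]) simp
  also have "\<dots> = ennreal (a / s\<^sup>2)" using s2 by (simp add: ennreal_mult'[symmetric])
  finally show ?thesis .
qed

context cz_op begin

text \<open>Three contributions: Chebyshev's inequality for the good part, the doubled balls around
  the cubes, and the integral of T of the mean zero parts off these balls.\<close>

definition weak_const :: real where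
  "weak_const = 4 * B * (3 + 2 ^ DIM('a)) + unit_ball_vol (real DIM('a)) * (2 * real DIM('a)) ^ DIM('a)
     + 4 * (W * unit_ball_vol (real DIM('a)))"

lemma weak_const_nonneg: "0 \<le> weak_const"
  using B W_nonneg unit_ball_vol_nonneg[of "real DIM('a)"] by (simp add: weak_const_def)

text \<open>The good part g equals the mean on each of the finitely many cubes and f elsewhere; the
  parts b Q have mean zero. The energy tolerance t n is of the order of the main term, and it is
  positive because n is.\<close>

lemma weak_type_pos:
  assumes f: "integrable lebesgue f" "f \<in> L2_fun" and n: "mass f UNIV \<le> ennreal n" "0 < n" and t: "0 < t"
  shows "emeasure lebesgue {x. t < norm (T f x)} \<le> ennreal (weak_const * n / t)"
proof -
  interpret grid "sgrid ({} :: 'a set)" by unfold_locales (rule dyadic_sgrid)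
  define V where "V = unit_ball_vol (real DIM('a))"
  have V: "0 \<le> V" by (simp add: V_def)
  have fm [measurable]: "f \<in> borel_measurable lebesgue" using f by auto
  have e: "0 < t * n" using t n by simp
  obtain F where F: "finite F" "F \<subseteq> sgrid {}" "disjoint F"
    and low: "\<And>Q. Q \<in> F \<Longrightarrow> ennreal t * emeasure lebesgue Q \<le> mass f Q"
    and up: "\<And>Q. Q \<in> F \<Longrightarrow> mass f Q \<le> ennreal (2 ^ DIM('a) * t) * emeasure lebesgue Q"
    and en: "energy (res (- \<Union>F) f) \<le> ennreal (2 * t * n + t * n)"
    using stopping_cubes[OF f n(1) less_imp_le[OF n(2)] t e] by blast
  have FD: "Q \<in> sgrid {}" if "Q \<in> F" for Q using that F(2) by auto
  have Qs: "Q \<in> sets lebesgue" if "Q \<in> F" for Q using D_sets[OF FD[OF that]] .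
  have UFs [measurable]: "\<Union>F \<in> sets lebesgue" using F(1) Qs by (auto intro: sets.finite_Union)
  have summass: "(\<Sum>Q\<in>F. mass f Q) \<le> ennreal n"
  proof -
    have d: "disjoint_family_on (\<lambda>Q. Q) F" using F(3) by (auto simp: disjoint_family_on_def disjoint_def)
    have "(\<Sum>Q\<in>F. mass f Q) \<le> (\<integral>\<^sup>+y\<in>UNIV. ennreal (norm (f y)) \<partial>lebesgue)"
      unfolding mass_def by (rule sum_nn_integral_disjoint_le[OF F(1) Qs d]) auto
    then show ?thesis using n by (simp add: mass_UNIV)
  qed
  have "\<forall>Q\<in>F. \<exists>c. integrable lebesgue (res Q (\<lambda>y. f y - c)) \<and> res Q (\<lambda>y. f y - c) \<in> L2_fun \<and>
    (\<integral>y. res Q (\<lambda>y. f y - c) y \<partial>lebesgue) = 0 \<and> ennreal (norm c) * emeasure lebesgue Q \<le> mass f Q \<and>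
    mass (res Q (\<lambda>y. f y - c)) UNIV \<le> 2 * mass f Q"
  proof
    fix Q assume "Q \<in> F"
    show "\<exists>c. integrable lebesgue (res Q (\<lambda>y. f y - c)) \<and> res Q (\<lambda>y. f y - c) \<in> L2_fun \<and>
    (\<integral>y. res Q (\<lambda>y. f y - c) y \<partial>lebesgue) = 0 \<and> ennreal (norm c) * emeasure lebesgue Q \<le> mass f Q \<and>
    mass (res Q (\<lambda>y. f y - c)) UNIV \<le> 2 * mass f Q"
      by (rule average_split[OF f FD[OF \<open>Q \<in> F\<close>]]) blast
  qed
  from bchoice[OF this] obtain c where c0: "\<forall>Q\<in>F. integrable lebesgue (res Q (\<lambda>y. f y - c Q)) \<and> res Q (\<lambda>y. f y - c Q) \<in> L2_fun \<and>
    (\<integral>y. res Q (\<lambda>y. f y - c Q) y \<partial>lebesgue) = 0 \<and> ennreal (norm (c Q)) * emeasure lebesgue Q \<le> mass f Q \<and>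
    mass (res Q (\<lambda>y. f y - c Q)) UNIV \<le> 2 * mass f Q" ..
  define b where "b Q = res Q (\<lambda>y. f y - c Q)" for Q
  have b: "integrable lebesgue (b Q)" "b Q \<in> L2_fun" "(\<integral>y. b Q y \<partial>lebesgue) = 0"
      "ennreal (norm (c Q)) * emeasure lebesgue Q \<le> mass f Q" "mass (b Q) UNIV \<le> 2 * mass f Q" if "Q \<in> F" for Q
    using c0 that by (auto simp: b_def)
  define sb where "sb = (\<lambda>x. \<Sum>Q\<in>F. b Q x)"
  have sb: "sb \<in> L2_fun" "AE x in lebesgue. T sb x = (\<Sum>Q\<in>F. T (b Q) x)"
    using T_sum[OF F(1), of b] b(2) by (auto simp: sb_def)
  define g where "g = (\<lambda>x. f x - sb x)"
  have gL: "g \<in> L2_fun" unfolding g_def by (rule L2_diff[OF f(2) sb(1)])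
  have norm_c: "norm (c Q) \<le> 2 ^ DIM('a) * t" if Q: "Q \<in> F" for Q
  proof -
    define m where "m = side (lev Q) ^ DIM('a)"
    have m: "0 < m" "emeasure lebesgue Q = ennreal m" by (simp_all add: m_def emeasure_lev[OF FD[OF Q]])
    have "ennreal (norm (c Q)) * emeasure lebesgue Q \<le> ennreal (2 ^ DIM('a) * t) * emeasure lebesgue Q"
      by (rule order_trans[OF b(4)[OF Q] up[OF Q]])
    then have "norm (c Q) * m \<le> 2 ^ DIM('a) * t * m"
      using m t by (simp add: ennreal_mult'[symmetric] ennreal_le_iff)
    then show ?thesis using m by simp
  qed
  have g_eq: "g x = c Q" if Q: "Q \<in> F" "x \<in> Q" for x Q
  proof -
    have "sb x = (\<Sum>R\<in>F. if R = Q then f x - c Q else 0)"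
      unfolding sb_def by (rule sum.cong) (use disjoint_unique[OF F(3)] Q in \<open>auto simp: b_def res_def\<close>)
    then show ?thesis using F(1) Q by (simp add: g_def)
  qed
  have g_off: "g x = f x" if "x \<notin> \<Union>F" for x
  proof -
    have "sb x = 0" unfolding sb_def by (rule sum.neutral) (use that in \<open>auto simp: b_def res_def\<close>)
    then show ?thesis by (simp add: g_def)
  qed
  have "energy g \<le> (\<integral>\<^sup>+x. ennreal ((norm (res (- \<Union>F) f x))\<^sup>2) + (\<Sum>Q\<in>F. ennreal ((norm (c Q))\<^sup>2) * indicator Q x) \<partial>lebesgue)"
    unfolding energy_def
  proof (rule nn_integral_mono)
    fix x
    show "ennreal ((norm (g x))\<^sup>2) \<le> ennreal ((norm (res (- \<Union>F) f x))\<^sup>2) + (\<Sum>Q\<in>F. ennreal ((norm (c Q))\<^sup>2) * indicator Q x)"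
    proof (cases "x \<in> \<Union>F")
      case True
      then obtain Q where Q: "Q \<in> F" "x \<in> Q" by auto
      have "ennreal ((norm (g x))\<^sup>2) = ennreal ((norm (c Q))\<^sup>2) * indicator Q x" using Q g_eq[OF Q] by simp
      also have "\<dots> \<le> (\<Sum>Q\<in>F. ennreal ((norm (c Q))\<^sup>2) * indicator Q x)"
        by (rule member_le_sum[OF Q(1)]) (use F in auto)
      also have "\<dots> \<le> ennreal ((norm (res (- \<Union>F) f x))\<^sup>2) + \<dots>" by simp
      finally show ?thesis .
    next
      case False
      then show ?thesis using g_off[OF False] by (simp add: res_def)
    qed
  qed
  also have "\<dots> = energy (res (- \<Union>F) f) + (\<integral>\<^sup>+x. (\<Sum>Q\<in>F. ennreal ((norm (c Q))\<^sup>2) * indicator Q x) \<partial>lebesgue)"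
    unfolding energy_def
  proof (rule nn_integral_add)
    show "(\<lambda>x. ennreal ((norm (res (- \<Union>F) f x))\<^sup>2)) \<in> borel_measurable lebesgue"
    proof -
      have [measurable]: "- \<Union>F \<in> sets lebesgue" using UFs by (subst Compl_in_sets_lebesgue)
      show ?thesis by measurable
    qed
    show "(\<lambda>x. \<Sum>Q\<in>F. ennreal ((norm (c Q))\<^sup>2) * indicator Q x) \<in> borel_measurable lebesgue"
      using Qs by (intro borel_measurable_sum) auto
  qed
  also have "(\<integral>\<^sup>+x. (\<Sum>Q\<in>F. ennreal ((norm (c Q))\<^sup>2) * indicator Q x) \<partial>lebesgue) = (\<Sum>Q\<in>F. ennreal ((norm (c Q))\<^sup>2) * emeasure lebesgue Q)"
    using Qs by (subst nn_integral_sum) (auto simp: nn_integral_cmult_indicator)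
  also have "(\<Sum>Q\<in>F. ennreal ((norm (c Q))\<^sup>2) * emeasure lebesgue Q) \<le> (\<Sum>Q\<in>F. ennreal (2 ^ DIM('a) * t) * mass f Q)"
  proof (rule sum_mono)
    fix Q assume Q: "Q \<in> F"
    have "ennreal ((norm (c Q))\<^sup>2) * emeasure lebesgue Q = ennreal (norm (c Q)) * (ennreal (norm (c Q)) * emeasure lebesgue Q)"
      by (simp add: power2_eq_square ennreal_mult mult.assoc)
    also have "\<dots> \<le> ennreal (2 ^ DIM('a) * t) * mass f Q"
      using norm_c[OF Q] b(4)[OF Q] by (intro mult_mono ennreal_leI) auto
    finally show "ennreal ((norm (c Q))\<^sup>2) * emeasure lebesgue Q \<le> ennreal (2 ^ DIM('a) * t) * mass f Q" .
  qed
  also have "(\<Sum>Q\<in>F. ennreal (2 ^ DIM('a) * t) * mass f Q) \<le> ennreal (2 ^ DIM('a) * t) * ennreal n"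
    unfolding sum_distrib_left[symmetric] by (rule mult_left_mono[OF summass]) simp
  also have "energy (res (- \<Union>F) f) + ennreal (2 ^ DIM('a) * t) * ennreal n \<le> ennreal (2 * t * n + t * n) + ennreal (2 ^ DIM('a) * t) * ennreal n"
    by (rule add_right_mono[OF en])
  also have "\<dots> = ennreal ((3 + 2 ^ DIM('a)) * t * n)"
    using t n by (simp add: ennreal_mult[symmetric] ennreal_plus[symmetric] algebra_simps del: ennreal_plus)
  finally have eg: "energy g \<le> ennreal ((3 + 2 ^ DIM('a)) * t * n)" by (simp add: add_left_mono)
  have "energy (T g) \<le> ennreal B * energy g" by (rule T_bound[OF gL])
  also have "\<dots> \<le> ennreal B * ennreal ((3 + 2 ^ DIM('a)) * t * n)" by (rule mult_left_mono[OF eg]) simp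
  also have "\<dots> = ennreal (B * ((3 + 2 ^ DIM('a)) * t * n))" using B by (simp add: ennreal_mult')
  finally have eTg: "energy (T g) \<le> ennreal (B * ((3 + 2 ^ DIM('a)) * t * n))" .
  have "emeasure lebesgue {x. t / 2 \<le> norm (T g x)} \<le> ennreal (B * ((3 + 2 ^ DIM('a)) * t * n) / (t / 2)\<^sup>2)"
    by (rule cheb_energy[OF T_L2[OF gL] eTg]) (use B t n in auto)
  also have "B * ((3 + 2 ^ DIM('a)) * t * n) / (t / 2)\<^sup>2 = 4 * B * (3 + 2 ^ DIM('a)) * n / t"
    using t by (simp add: power2_eq_square)
  finally have P1: "emeasure lebesgue {x. t / 2 \<le> norm (T g x)} \<le> ennreal (4 * B * (3 + 2 ^ DIM('a)) * n / t)" .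
  define z where "z Q = (SOME x. x \<in> Q)" for Q :: "'a set"
  have z: "z Q \<in> Q" if "Q \<in> F" for Q
    using D_nonempty[OF FD[OF that]] by (auto simp: z_def some_in_eq)
  \<comment> \<open>Q lies within \<rho> Q of its chosen point z Q, so doubling the radius leaves
    the separation that \<open>atom_bound\<close> uses.\<close>
  define \<rho> where "\<rho> Q = real DIM('a) * side (lev Q)" for Q :: "'a set"
  have \<rho>: "0 < \<rho> Q" for Q by (simp add: \<rho>_def)
  define \<Omega> where "\<Omega> = (\<Union>Q\<in>F. ball (z Q) (2 * \<rho> Q))"
  have \<Omega>s [measurable]: "\<Omega> \<in> sets lebesgue" using F(1) by (auto simp: \<Omega>_def)
  have "emeasure lebesgue \<Omega> \<le> (\<Sum>Q\<in>F. emeasure lebesgue (ball (z Q) (2 * \<rho> Q)))"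
    unfolding \<Omega>_def by (rule emeasure_subadditive_finite[OF F(1)]) auto
  also have "\<dots> \<le> (\<Sum>Q\<in>F. ennreal (V * (2 * real DIM('a)) ^ DIM('a) / t) * mass f Q)"
  proof (rule sum_mono)
    fix Q assume Q: "Q \<in> F"
    have "emeasure lebesgue (ball (z Q) (2 * \<rho> Q)) = ennreal (V * (2 * \<rho> Q) ^ DIM('a))"
      using \<rho>[of Q] by (simp add: emeasure_lebesgue_ball V_def less_imp_le)
    also have "V * (2 * \<rho> Q) ^ DIM('a) = (V * (2 * real DIM('a)) ^ DIM('a) / t) * (t * side (lev Q) ^ DIM('a))"
      using t by (simp add: \<rho>_def power_mult_distrib)
    also have "ennreal \<dots> = ennreal (V * (2 * real DIM('a)) ^ DIM('a) / t) * (ennreal t * emeasure lebesgue Q)"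
      unfolding emeasure_lev[OF FD[OF Q]] using V t by (simp add: ennreal_mult[symmetric])
    also have "\<dots> \<le> ennreal (V * (2 * real DIM('a)) ^ DIM('a) / t) * mass f Q"
      by (rule mult_left_mono[OF low[OF Q]]) simp
    finally show "emeasure lebesgue (ball (z Q) (2 * \<rho> Q)) \<le> ennreal (V * (2 * real DIM('a)) ^ DIM('a) / t) * mass f Q" .
  qed
  also have "\<dots> \<le> ennreal (V * (2 * real DIM('a)) ^ DIM('a) / t) * ennreal n"
    unfolding sum_distrib_left[symmetric] by (rule mult_left_mono[OF summass]) simp
  also have "\<dots> = ennreal (V * (2 * real DIM('a)) ^ DIM('a) * n / t)"
    using V t n by (simp add: ennreal_mult[symmetric])
  finally have P2: "emeasure lebesgue \<Omega> \<le> ennreal (V * (2 * real DIM('a)) ^ DIM('a) * n / t)" .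
  define h where "h x = (\<Sum>Q\<in>F. ennreal (norm (T (b Q) x)) * indicator {x. 2 * \<rho> Q \<le> dist (z Q) x} x)" for x
  have Tbm: "(\<lambda>x. ennreal (norm (T (b Q) x)) * indicator {x. 2 * \<rho> Q \<le> dist (z Q) x} x) \<in> borel_measurable lebesgue" if "Q \<in> F" for Q
  proof -
    have [measurable]: "T (b Q) \<in> borel_measurable lebesgue" by (rule L2_measurable[OF T_L2[OF b(2)[OF that]]])
    have "closed {x. 2 * \<rho> Q \<le> dist (z Q) x}" by (intro closed_Collect_le continuous_intros)
    then have [measurable]: "{x. 2 * \<rho> Q \<le> dist (z Q) x} \<in> sets lebesgue" by auto
    show ?thesis by measurable
  qed
  have hm: "h \<in> borel_measurable lebesgue" unfolding h_def[abs_def] by (rule borel_measurable_sum) (rule Tbm)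
  have "(\<integral>\<^sup>+x. h x \<partial>lebesgue) = (\<Sum>Q\<in>F. \<integral>\<^sup>+x\<in>{x. 2 * \<rho> Q \<le> dist (z Q) x}. ennreal (norm (T (b Q) x)) \<partial>lebesgue)"
    unfolding h_def by (rule nn_integral_sum) (rule Tbm)
  also have "\<dots> \<le> (\<Sum>Q\<in>F. ennreal (2 * (W * V)) * mass f Q)"
  proof (rule sum_mono)
    fix Q assume Q: "Q \<in> F"
    have supp: "b Q y = 0" if y: "\<rho> Q < dist (z Q) y" for y
    proof -
      have "y \<notin> Q"
      proof
        assume "y \<in> Q"
        then have "y \<in> cell (lev Q) (z Q)" "z Q \<in> cell (lev Q) (z Q)" using cell_lev[OF FD[OF Q] z[OF Q]] z[OF Q] by auto
        then have "dist (z Q) y \<le> real DIM('a) * side (lev Q)" by (intro dist_cell)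
        then show False using y by (simp add: \<rho>_def)
      qed
      then show ?thesis by (simp add: b_def res_def)
    qed
    have "(\<integral>\<^sup>+x\<in>{x. 2 * \<rho> Q \<le> dist (z Q) x}. ennreal (norm (T (b Q) x)) \<partial>lebesgue) \<le> ennreal (W * V) * mass (b Q) UNIV"
      unfolding V_def by (rule atom_bound[OF \<rho> b(1,2)[OF Q] supp b(3)[OF Q]])
    also have "\<dots> \<le> ennreal (W * V) * (2 * mass f Q)" by (rule mult_left_mono[OF b(5)[OF Q]]) simp
    also have "\<dots> = ennreal (2 * (W * V)) * mass f Q" using W_nonneg V by (simp add: ennreal_mult ac_simps)
    finally show "(\<integral>\<^sup>+x\<in>{x. 2 * \<rho> Q \<le> dist (z Q) x}. ennreal (norm (T (b Q) x)) \<partial>lebesgue) \<le> ennreal (2 * (W * V)) * mass f Q" .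
  qed
  also have "\<dots> \<le> ennreal (2 * (W * V)) * ennreal n"
    unfolding sum_distrib_left[symmetric] by (rule mult_left_mono[OF summass]) simp
  finally have hI: "(\<integral>\<^sup>+x. h x \<partial>lebesgue) \<le> ennreal (2 * (W * V)) * ennreal n" .
  have "emeasure lebesgue {x\<in>space lebesgue. ennreal (t / 2) \<le> h x} \<le> ennreal (1 / (t / 2)) * (\<integral>\<^sup>+x. h x \<partial>lebesgue)"
    by (rule markov[OF hm]) (use t in simp)
  also have "\<dots> \<le> ennreal (1 / (t / 2)) * (ennreal (2 * (W * V)) * ennreal n)" by (rule mult_left_mono[OF hI]) simp
  also have "\<dots> = ennreal (4 * (W * V) * n / t)"
    using W_nonneg V t n by (simp add: ennreal_mult[symmetric] ac_simps)
  finally have P3: "emeasure lebesgue {x\<in>space lebesgue. ennreal (t / 2) \<le> h x} \<le> ennreal (4 * (W * V) * n / t)" .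
  have gs: "{x. t / 2 \<le> norm (T g x)} \<in> sets lebesgue"
  proof -
    have [measurable]: "T g \<in> borel_measurable lebesgue" by (rule L2_measurable[OF T_L2[OF gL]])
    have "{x\<in>space lebesgue. t / 2 \<le> norm (T g x)} \<in> sets lebesgue" by measurable
    then show ?thesis by simp
  qed
  have hs: "{x\<in>space lebesgue. ennreal (t / 2) \<le> h x} \<in> sets lebesgue" using hm by measurable
  have "AE x in lebesgue. T (\<lambda>y. g y + sb y) x = T g x + T sb x" by (rule T_add[OF gL sb(1)])
  then have Tsplit: "AE x in lebesgue. T f x = T g x + (\<Sum>Q\<in>F. T (b Q) x)"
    using sb(2) by eventually_elim (simp add: g_def)
  have "emeasure lebesgue {x. t < norm (T f x)} \<le> emeasure lebesgue ({x. t / 2 \<le> norm (T g x)} \<union> \<Omega> \<union> {x\<in>space lebesgue. ennreal (t / 2) \<le> h x})"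
  proof (rule emeasure_mono_AE)
    show "AE x in lebesgue. x \<in> {x. t < norm (T f x)} \<longrightarrow> x \<in> {x. t / 2 \<le> norm (T g x)} \<union> \<Omega> \<union> {x\<in>space lebesgue. ennreal (t / 2) \<le> h x}"
      using Tsplit
    proof eventually_elim
      case (elim x)
      show ?case
      proof (rule impI, rule ccontr)
        assume x: "x \<in> {x. t < norm (T f x)}" and no: "x \<notin> {x. t / 2 \<le> norm (T g x)} \<union> \<Omega> \<union> {x\<in>space lebesgue. ennreal (t / 2) \<le> h x}"
        have far: "2 * \<rho> Q \<le> dist (z Q) x" if "Q \<in> F" for Q using no that by (auto simp: \<Omega>_def)
        have "h x = (\<Sum>Q\<in>F. ennreal (norm (T (b Q) x)))" unfolding h_def by (rule sum.cong) (use far in auto)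
        also have "\<dots> = ennreal (\<Sum>Q\<in>F. norm (T (b Q) x))" by (rule sum_ennreal) simp
        finally have "ennreal (\<Sum>Q\<in>F. norm (T (b Q) x)) < ennreal (t / 2)" using no by (simp add: not_le)
        then have 1: "(\<Sum>Q\<in>F. norm (T (b Q) x)) < t / 2" using t by (simp add: ennreal_less_iff sum_nonneg)
        have "norm (T f x) \<le> norm (T g x) + norm (\<Sum>Q\<in>F. T (b Q) x)" unfolding elim by (rule norm_triangle_ineq)
        also have "norm (\<Sum>Q\<in>F. T (b Q) x) \<le> (\<Sum>Q\<in>F. norm (T (b Q) x))" by (rule norm_sum)
        finally show False using 1 x no by auto
      qed
    qed
    show "{x. t / 2 \<le> norm (T g x)} \<union> \<Omega> \<union> {x\<in>space lebesgue. ennreal (t / 2) \<le> h x} \<in> sets lebesgue"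
      using gs hs \<Omega>s by (intro sets.Un)
  qed
  also have "\<dots> \<le> emeasure lebesgue {x. t / 2 \<le> norm (T g x)} + emeasure lebesgue \<Omega> + emeasure lebesgue {x\<in>space lebesgue. ennreal (t / 2) \<le> h x}"
    using gs hs \<Omega>s by (intro order_trans[OF emeasure_subadditive] add_right_mono emeasure_subadditive) auto
  also have "\<dots> \<le> ennreal (4 * B * (3 + 2 ^ DIM('a)) * n / t) + ennreal (V * (2 * real DIM('a)) ^ DIM('a) * n / t) + ennreal (4 * (W * V) * n / t)"
    by (intro add_mono P1 P2 P3)
  also have "\<dots> = ennreal (4 * B * (3 + 2 ^ DIM('a)) * n / t + V * (2 * real DIM('a)) ^ DIM('a) * n / t + 4 * (W * V) * n / t)"
    using B V W_nonneg t n by (subst ennreal_plus[symmetric] | simp)+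
  also have "4 * B * (3 + 2 ^ DIM('a)) * n / t + V * (2 * real DIM('a)) ^ DIM('a) * n / t + 4 * (W * V) * n / t = weak_const * n / t"
    unfolding weak_const_def V_def[symmetric] by (simp only: add_divide_distrib distrib_right)
  finally show ?thesis .
qed

text \<open>Apply \<open>weak_type_pos\<close> with n + d for small positive d; the surplus is at
  most e.\<close>

lemma weak_type:
  assumes f: "integrable lebesgue f" "f \<in> L2_fun" and n: "mass f UNIV \<le> ennreal n" "0 \<le> n" and t: "0 < t"
  shows "emeasure lebesgue {x. t < norm (T f x)} \<le> ennreal (weak_const * n / t)"
proof (rule ennreal_le_epsilon)
  fix e :: real assume e: "0 < e"
  define d where "d = e * t / (weak_const + 1)"
  have d: "0 < d" using e t weak_const_nonneg by (simp add: d_def)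
  have "weak_const * d \<le> e * t"
    using weak_const_nonneg e t by (simp add: d_def pos_divide_le_eq mult.commute mult_left_mono)
  then have de: "weak_const * d / t \<le> e" using t by (simp add: pos_divide_le_eq)
  have "emeasure lebesgue {x. t < norm (T f x)} \<le> ennreal (weak_const * (n + d) / t)"
    by (rule weak_type_pos[OF f _ _ t]) (use n d in \<open>auto intro: order_trans[OF n(1)] ennreal_leI\<close>)
  also have "\<dots> \<le> ennreal (weak_const * n / t + e)"
    using de by (intro ennreal_leI) (simp add: distrib_left add_divide_distrib)
  also have "\<dots> = ennreal (weak_const * n / t) + ennreal e" using weak_const_nonneg n t e by (intro ennreal_plus) auto
  finally show "emeasure lebesgue {x. t < norm (T f x)} \<le> ennreal (weak_const * n / t) + ennreal e" .
qed

end

subsection \<open>The extension to integrable functions\<close>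

lemma mass_add_le:
  assumes [measurable]: "(a :: 'a::euclidean_space \<Rightarrow> complex) \<in> borel_measurable lebesgue" "b \<in> borel_measurable lebesgue"
  shows "mass (\<lambda>x. a x + b x) UNIV \<le> mass a UNIV + mass b UNIV"
proof -
  have "mass (\<lambda>x. a x + b x) UNIV \<le> (\<integral>\<^sup>+x. ennreal (norm (a x)) + ennreal (norm (b x)) \<partial>lebesgue)"
    unfolding mass_UNIV
    by (intro nn_integral_mono) (auto simp: ennreal_plus[symmetric] norm_triangle_ineq simp del: ennreal_plus intro!: ennreal_leI)
  also have "\<dots> = mass a UNIV + mass b UNIV" unfolding mass_UNIV by (rule nn_integral_add) measurable
  finally show ?thesis .
qed

lemma mass_minus: "mass (\<lambda>x. g x - f x) A = mass (\<lambda>x. f x - g x) A"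
  unfolding mass_def by (simp add: norm_minus_commute)

text \<open>Borel-Cantelli at the levels 2^-k: errors of order 4^-k leave sets of measure A 2^-k,
  which are summable.\<close>

lemma weak_eventually_small:
  fixes v :: "nat \<Rightarrow> 'a::euclidean_space \<Rightarrow> complex"
  assumes m: "\<And>k. v k \<in> borel_measurable lebesgue" and A: "0 \<le> A"
    and w: "\<And>k s. 0 < s \<Longrightarrow> emeasure lebesgue {x. s < norm (v k x)} \<le> ennreal (A * (1/4) ^ k / s)"
  shows "AE x in lebesgue. \<forall>\<^sub>F k in sequentially. norm (v k x) \<le> (1/2) ^ k"
proof -
  define S where "S k = {x. (1/2) ^ k < norm (v k x)}" for k
  have Ss: "S k \<in> sets lebesgue" for k
  proof -
    have [measurable]: "v k \<in> borel_measurable lebesgue" by (rule m)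
    have "{x\<in>space lebesgue. (1/2) ^ k < norm (v k x)} \<in> sets lebesgue" by measurable
    then show ?thesis by (simp add: S_def)
  qed
  have eS: "emeasure lebesgue (S k) \<le> ennreal (A * (1/2) ^ k)" for k
  proof -
    have "emeasure lebesgue (S k) \<le> ennreal (A * (1/4) ^ k / (1/2) ^ k)" unfolding S_def by (rule w) simp
    also have "A * (1/4) ^ k / (1/2) ^ k = A * ((1/4) / (1/2)) ^ k" by (simp only: power_divide times_divide_eq_right)
    finally show ?thesis by simp
  qed
  have "AE x in lebesgue. \<forall>\<^sub>F k in sequentially. x \<in> space lebesgue - S k"
  proof (rule borel_cantelli_AE1[OF Ss])
    show "emeasure lebesgue (S k) < \<infinity>" for k using eS[of k] by (rule le_less_trans) simp
    have meas: "norm (measure lebesgue (S k)) \<le> A * (1/2) ^ k" for k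
      using eS[of k] A by (simp add: measure_def enn2real_leI)
    have "summable (\<lambda>k. A * (1/2) ^ k)" by (rule summable_mult) (simp add: summable_geometric)
    then show "summable (\<lambda>k. measure lebesgue (S k))"
      by (rule summable_comparison_test'[where N = 0]) (rule meas)
  qed
  then show ?thesis
  proof eventually_elim
    case (elim x)
    then show ?case by (rule eventually_mono) (simp add: S_def not_less)
  qed
qed

lemma convergent_geometric_steps:
  fixes u :: "nat \<Rightarrow> complex"
  assumes "\<forall>\<^sub>F k in sequentially. norm (u (Suc k) - u k) \<le> (1/2) ^ k"
  shows "convergent u"
proof -
  have "summable (\<lambda>k. u (Suc k) - u k)"
    by (rule summable_comparison_test_ev[OF assms]) (simp add: summable_geometric)
  then have "convergent (\<lambda>n. \<Sum>k<n. u (Suc k) - u k)" by (simp add: summable_iff_convergent)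
  then have "convergent (\<lambda>n. (u n - u 0) + u 0)"
    unfolding sum_lessThan_telescope by (rule convergent_add[OF _ convergent_const])
  then show ?thesis by simp
qed

lemma small_to_zero:
  fixes u :: "nat \<Rightarrow> complex"
  assumes "\<forall>\<^sub>F k in sequentially. norm (u k) \<le> (1/2) ^ k"
  shows "u \<longlonglongrightarrow> 0"
  by (rule Lim_null_comparison[OF assms]) (simp add: LIMSEQ_realpow_zero)

lemma ex_L2_approx:
  fixes f :: "'a::euclidean_space \<Rightarrow> complex"
  assumes f: "integrable lebesgue f" and e: "0 < e"
  shows "\<exists>g. integrable lebesgue g \<and> g \<in> L2_fun \<and> mass (\<lambda>x. f x - g x) UNIV \<le> ennreal e"
proof -
  have fm [measurable]: "f \<in> borel_measurable lebesgue" using f by auto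
  define S where "S m = {x. norm (f x) \<le> real m}" for m :: nat
  have Ss [measurable]: "S m \<in> sets lebesgue" for m
  proof -
    have "{x\<in>space lebesgue. norm (f x) \<le> real m} \<in> sets lebesgue" by measurable
    then show ?thesis by (simp add: S_def)
  qed
  have "(\<lambda>m. mass (\<lambda>x. f x - res (S m) f x) UNIV) \<longlonglongrightarrow> (\<integral>\<^sup>+x. 0 \<partial>(lebesgue :: 'a measure))"
    unfolding mass_UNIV
  proof (rule nn_integral_dominated_convergence[where w = "\<lambda>x. ennreal (norm (f x))"])
    show "(\<lambda>x. ennreal (norm (f x - res (S m) f x))) \<in> borel_measurable lebesgue" for m by measurable
    show "(\<integral>\<^sup>+x. ennreal (norm (f x)) \<partial>lebesgue) < \<infinity>" using mass_finite[OF f, of UNIV] by (simp add: mass_UNIV)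
    show "AE x in lebesgue. ennreal (norm (f x - res (S m) f x)) \<le> ennreal (norm (f x))" for m
      by (rule AE_I2) (simp add: res_def)
    show "AE x in lebesgue. (\<lambda>m. ennreal (norm (f x - res (S m) f x))) \<longlonglongrightarrow> 0"
    proof (rule AE_I2)
      fix x
      obtain m0 :: nat where m0: "norm (f x) \<le> real m0" using real_arch_simple by blast
      have "ennreal (norm (f x - res (S m) f x)) = 0" if "m \<ge> m0" for m
        using m0 that by (simp add: res_def S_def)
      then have "\<forall>\<^sub>F m in sequentially. ennreal (norm (f x - res (S m) f x)) = 0"
        unfolding eventually_sequentially by blast
      then show "(\<lambda>m. ennreal (norm (f x - res (S m) f x))) \<longlonglongrightarrow> 0" by (rule tendsto_eventually)
    qed
  qed measurable
  then have "(\<lambda>m. mass (\<lambda>x. f x - res (S m) f x) UNIV) \<longlonglongrightarrow> 0" by simp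
  then have "\<forall>\<^sub>F m in sequentially. mass (\<lambda>x. f x - res (S m) f x) UNIV < ennreal e"
    by (rule order_tendstoD) (use e in simp)
  then obtain m where m: "mass (\<lambda>x. f x - res (S m) f x) UNIV < ennreal e"
    by (auto simp: eventually_sequentially)
  have "energy (res (S m) f) \<le> (\<integral>\<^sup>+x. ennreal (real m) * ennreal (norm (f x)) \<partial>lebesgue)"
    unfolding energy_def
  proof (rule nn_integral_mono)
    fix x
    have "(norm (f x))\<^sup>2 \<le> real m * norm (f x)" if "x \<in> S m"
      using that unfolding power2_eq_square by (intro mult_right_mono) (auto simp: S_def)
    then show "ennreal ((norm (res (S m) f x))\<^sup>2) \<le> ennreal (real m) * ennreal (norm (f x))"
      by (cases "x \<in> S m") (auto simp: res_def ennreal_mult[symmetric] intro!: ennreal_leI)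
  qed
  also have "\<dots> = ennreal (real m) * mass f UNIV" unfolding mass_UNIV by (rule nn_integral_cmult) measurable
  also have "\<dots> < \<infinity>" using mass_finite[OF f, of UNIV] by (simp add: ennreal_mult_less_top)
  finally have "res (S m) f \<in> L2_fun" using fm by (simp add: L2_fun_energy)
  then show ?thesis using m res_integrable[OF f Ss] by (intro exI[of _ "res (S m) f"]) auto
qed

text \<open>The rate 4^-k is the one that \<open>weak_eventually_small\<close> turns into pointwise
  errors 2^-k.\<close>

definition apx :: "('a::euclidean_space \<Rightarrow> complex) \<Rightarrow> nat \<Rightarrow> 'a \<Rightarrow> complex" where
  "apx f k = (SOME g. integrable lebesgue g \<and> g \<in> L2_fun \<and> mass (\<lambda>x. f x - g x) UNIV \<le> ennreal ((1/4) ^ k))"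

lemma apx:
  assumes "integrable lebesgue f"
  shows "integrable lebesgue (apx f k)" "apx f k \<in> L2_fun" "mass (\<lambda>x. f x - apx f k x) UNIV \<le> ennreal ((1/4) ^ k)"
proof -
  have "\<exists>g. integrable lebesgue g \<and> g \<in> L2_fun \<and> mass (\<lambda>x. f x - g x) UNIV \<le> ennreal ((1/4) ^ k)"
    by (rule ex_L2_approx[OF assms]) simp
  from someI_ex[OF this]
  show "integrable lebesgue (apx f k)" "apx f k \<in> L2_fun" "mass (\<lambda>x. f x - apx f k x) UNIV \<le> ennreal ((1/4) ^ k)"
    unfolding apx_def by auto
qed

lemma energy_L2_norm:
  assumes "f \<in> L2_fun"
  shows "energy f = ennreal ((L2_norm f)\<^sup>2)"
proof -
  have i: "integrable lebesgue (\<lambda>x. (norm (f x))\<^sup>2)" using assms by (simp add: L2_fun_def)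
  have "energy f = ennreal (\<integral>x. (norm (f x))\<^sup>2 \<partial>lebesgue)" unfolding energy_def by (rule nn_integral_eq_integral[OF i]) simp
  also have "(\<integral>x. (norm (f x))\<^sup>2 \<partial>lebesgue) = (L2_norm f)\<^sup>2" by (simp add: L2_norm_def integral_nonneg_AE)
  finally show ?thesis .
qed

definition extends_weakly where
  "extends_weakly T U \<longleftrightarrow> weak_type_1_1 U \<and> ae_linear_on {f. integrable lebesgue f} U \<and>
     (\<forall>f\<in>L2_fun. integrable lebesgue f \<longrightarrow> (AE x in lebesgue. U f x = T f x))"

context cz_op begin

lemma T_close:
  assumes g: "\<And>k. integrable lebesgue (g k)" "\<And>k. g k \<in> L2_fun"
    and h: "\<And>k. integrable lebesgue (h k)" "\<And>k. h k \<in> L2_fun"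
    and c: "\<And>k. mass (\<lambda>x. g k x - h k x) UNIV \<le> ennreal (c * (1/4) ^ k)" "0 \<le> c"
  shows "AE x in lebesgue. \<forall>\<^sub>F k in sequentially. norm (T (g k) x - T (h k) x) \<le> (1/2) ^ k"
proof -
  have L: "(\<lambda>x. g k x - h k x) \<in> L2_fun" for k by (rule L2_diff[OF g(2) h(2)])
  have "AE x in lebesgue. \<forall>\<^sub>F k in sequentially. norm (T (\<lambda>x. g k x - h k x) x) \<le> (1/2) ^ k"
  proof (rule weak_eventually_small[where A = "weak_const * c"])
    show "T (\<lambda>x. g k x - h k x) \<in> borel_measurable lebesgue" for k by (rule L2_measurable[OF T_L2[OF L]])
    show "0 \<le> weak_const * c" using weak_const_nonneg c by simp
    fix k and s :: real assume s: "0 < s"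
    have "emeasure lebesgue {x. s < norm (T (\<lambda>x. g k x - h k x) x)} \<le> ennreal (weak_const * (c * (1/4) ^ k) / s)"
      by (rule weak_type[OF _ L c(1) _ s]) (use g h c in auto)
    then show "emeasure lebesgue {x. s < norm (T (\<lambda>x. g k x - h k x) x)} \<le> ennreal (weak_const * c * (1/4) ^ k / s)"
      by (simp only: mult.assoc)
  qed
  moreover have "AE x in lebesgue. T (\<lambda>x. g k x - h k x) x = T (g k) x - T (h k) x" for k
    by (rule T_diff[OF g(2) h(2)])
  then have "AE x in lebesgue. \<forall>k. T (\<lambda>x. g k x - h k x) x = T (g k) x - T (h k) x"
    unfolding AE_all_countable by blast
  ultimately show ?thesis by eventually_elim simp
qed

text \<open>For integrable f the sequence converges almost everywhere, by \<open>ext_lim\<close>;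
  divergence is confined to a null set.\<close>

definition ext :: "('a \<Rightarrow> complex) \<Rightarrow> 'a \<Rightarrow> complex" where
  "ext f x = lim (\<lambda>k. T (apx f k) x)"

text \<open>The limit is the same along every approximating sequence with errors c 4^-k. Linearity
  and agreement with T follow by a suitable choice of the sequence.\<close>

lemma ext_lim:
  assumes f: "integrable lebesgue f" and h: "\<And>k. integrable lebesgue (h k)" "\<And>k. h k \<in> L2_fun"
    and c: "\<And>k. mass (\<lambda>x. f x - h k x) UNIV \<le> ennreal (c * (1/4) ^ k)" "0 \<le> c"
  shows "AE x in lebesgue. (\<lambda>k. T (h k) x) \<longlonglongrightarrow> ext f x"
proof -
  have fm: "f \<in> borel_measurable lebesgue" using f by auto
  have tri: "mass (\<lambda>x. a x - b x) UNIV \<le> mass (\<lambda>x. f x - a x) UNIV + mass (\<lambda>x. f x - b x) UNIV"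
    if "integrable lebesgue a" "integrable lebesgue b" for a b :: "'a \<Rightarrow> complex"
  proof -
    have "mass (\<lambda>x. (a x - f x) + (f x - b x)) UNIV \<le> mass (\<lambda>x. a x - f x) UNIV + mass (\<lambda>x. f x - b x) UNIV"
      by (rule mass_add_le) (use that fm in auto)
    then show ?thesis by (simp add: mass_minus[of a f])
  qed
  have "AE x in lebesgue. \<forall>\<^sub>F k in sequentially. norm (T (apx f (Suc k)) x - T (apx f k) x) \<le> (1/2) ^ k"
  proof (rule T_close[where c = 2])
    fix k
    have "mass (\<lambda>x. apx f (Suc k) x - apx f k x) UNIV \<le> ennreal ((1/4) ^ Suc k) + ennreal ((1/4) ^ k)"
      by (rule order_trans[OF tri[OF apx(1) apx(1)] add_mono[OF apx(3) apx(3)]]) (rule f)+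
    also have "\<dots> = ennreal ((1/4) ^ Suc k + (1/4) ^ k)" by (rule ennreal_plus[symmetric]) auto
    also have "\<dots> \<le> ennreal (2 * (1/4) ^ k)" by (rule ennreal_leI) simp
    finally show "mass (\<lambda>x. apx f (Suc k) x - apx f k x) UNIV \<le> ennreal (2 * (1/4) ^ k)" .
  qed (use apx[OF f] in auto)
  moreover have "AE x in lebesgue. \<forall>\<^sub>F k in sequentially. norm (T (h k) x - T (apx f k) x) \<le> (1/2) ^ k"
  proof (rule T_close[where c = "c + 1"])
    fix k
    have "mass (\<lambda>x. h k x - apx f k x) UNIV \<le> ennreal (c * (1/4) ^ k) + ennreal ((1/4) ^ k)"
      by (rule order_trans[OF tri[OF h(1) apx(1)[OF f]] add_mono[OF c(1) apx(3)[OF f]]])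
    also have "\<dots> = ennreal (c * (1/4) ^ k + (1/4) ^ k)" by (rule ennreal_plus[symmetric]) (use c in auto)
    also have "c * (1/4) ^ k + (1/4) ^ k = (c + 1) * (1/4) ^ k" by (simp only: distrib_right mult_1_left)
    finally show "mass (\<lambda>x. h k x - apx f k x) UNIV \<le> ennreal ((c + 1) * (1/4) ^ k)" .
  qed (use apx[OF f] h c in auto)
  ultimately show ?thesis
  proof eventually_elim
    case (elim x)
    have "convergent (\<lambda>k. T (apx f k) x)" using elim(1) by (rule convergent_geometric_steps)
    then have 1: "(\<lambda>k. T (apx f k) x) \<longlonglongrightarrow> ext f x" unfolding ext_def by (simp add: convergent_LIMSEQ_iff)
    from tendsto_add[OF small_to_zero[OF elim(2)] 1] show ?case by simp
  qed
qed

lemma ext_measurable: "integrable lebesgue f \<Longrightarrow> ext f \<in> borel_measurable lebesgue"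
  unfolding ext_def[abs_def] by (rule borel_measurable_lim_metric) (rule L2_measurable[OF T_L2[OF apx(2)]])

text \<open>A strict inequality in the limit holds for all late terms. Up to a null set the level
  set thus lies in an increasing union of sets, each contained in all late level sets of the
  approximants, whose bounds tend to the one claimed.\<close>

lemma ext_weak:
  assumes f: "integrable lebesgue f" and n: "mass f UNIV \<le> ennreal n" "0 \<le> n" and t: "0 < t"
  shows "emeasure lebesgue {x. t < norm (ext f x)} \<le> ennreal (weak_const * n / t)"
proof -
  have fm: "f \<in> borel_measurable lebesgue" using f by auto
  define S where "S k = {x. t < norm (T (apx f k) x)}" for k
  have Ss: "S k \<in> sets lebesgue" for k
  proof -
    have [measurable]: "T (apx f k) \<in> borel_measurable lebesgue" by (rule L2_measurable[OF T_L2[OF apx(2)[OF f]]])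
    have "{x\<in>space lebesgue. t < norm (T (apx f k) x)} \<in> sets lebesgue" by measurable
    then show ?thesis by (simp add: S_def)
  qed
  have eS: "emeasure lebesgue (S k) \<le> ennreal (weak_const * (n + (1/4) ^ k) / t)" for k
    unfolding S_def
  proof (rule weak_type[OF apx(1)[OF f] apx(2)[OF f] _ _ t])
    have "mass (\<lambda>x. (apx f k x - f x) + f x) UNIV \<le> mass (\<lambda>x. apx f k x - f x) UNIV + mass f UNIV"
      by (rule mass_add_le) (use apx(1)[OF f, of k] fm in auto)
    also have "\<dots> \<le> ennreal ((1/4) ^ k) + ennreal n"
      by (rule add_mono) (use apx(3)[OF f, of k] mass_minus[of f "apx f k" UNIV] n in auto)
    also have "\<dots> = ennreal (n + (1/4) ^ k)" using n by (simp add: ennreal_plus add.commute)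
    finally show "mass (apx f k) UNIV \<le> ennreal (n + (1/4) ^ k)" by simp
  qed (use n in simp)
  define R where "R N = (\<Inter>k\<in>{N..}. S k)" for N :: nat
  have Rs: "R N \<in> sets lebesgue" for N unfolding R_def using Ss by (intro sets.countable_INT) auto
  have eR: "emeasure lebesgue (R N) \<le> ennreal (weak_const * n / t)" for N
  proof (rule LIMSEQ_le_const)
    have "(\<lambda>k. weak_const * (n + (1/4) ^ k) / t) \<longlonglongrightarrow> weak_const * (n + 0) / t"
      by (intro tendsto_intros LIMSEQ_realpow_zero) (use t in auto)
    then show "(\<lambda>k. ennreal (weak_const * (n + (1/4) ^ k) / t)) \<longlonglongrightarrow> ennreal (weak_const * n / t)"
      by (intro tendsto_ennrealI) simp
    show "\<exists>M. \<forall>k\<ge>M. emeasure lebesgue (R N) \<le> ennreal (weak_const * (n + (1/4) ^ k) / t)"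
    proof (intro exI[of _ N] allI impI)
      fix k assume "N \<le> k"
      then have "emeasure lebesgue (R N) \<le> emeasure lebesgue (S k)" by (intro emeasure_mono Ss) (auto simp: R_def)
      then show "emeasure lebesgue (R N) \<le> ennreal (weak_const * (n + (1/4) ^ k) / t)" using eS by (rule order_trans)
    qed
  qed
  have inc: "incseq R" by (rule incseq_SucI) (auto simp: R_def)
  have "AE x in lebesgue. (\<lambda>k. T (apx f k) x) \<longlonglongrightarrow> ext f x"
    by (rule ext_lim[OF f apx(1)[OF f] apx(2)[OF f], where c = 1]) (use apx(3)[OF f] in auto)
  then have "emeasure lebesgue {x. t < norm (ext f x)} \<le> emeasure lebesgue (\<Union>N. R N)"
  proof (intro emeasure_mono_AE, eventually_elim)
    fix x assume lim: "(\<lambda>k. T (apx f k) x) \<longlonglongrightarrow> ext f x"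
    show "x \<in> {x. t < norm (ext f x)} \<longrightarrow> x \<in> (\<Union>N. R N)"
    proof
      assume "x \<in> {x. t < norm (ext f x)}"
      then have "\<forall>\<^sub>F k in sequentially. t < norm (T (apx f k) x)"
        by (intro order_tendstoD(1)[OF tendsto_norm[OF lim]]) simp
      then show "x \<in> (\<Union>N. R N)" by (auto simp: eventually_sequentially R_def S_def)
    qed
  qed (use Rs in auto)
  also have "\<dots> = (SUP N. emeasure lebesgue (R N))"
    by (rule SUP_emeasure_incseq[symmetric, OF _ inc]) (use Rs in auto)
  also have "\<dots> \<le> ennreal (weak_const * n / t)" using eR by (rule SUP_least)
  finally show ?thesis .
qed

lemma ext_extends: "extends_weakly T ext"
  unfolding extends_weakly_def weak_type_1_1_def ae_linear_on_def
proof (intro conjI allI impI ballI exI[of _ weak_const])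
  show "ext f \<in> borel_measurable lebesgue" if "integrable lebesgue f" for f by (rule ext_measurable[OF that])
  show "emeasure lebesgue {x. t < norm (ext f x)} \<le> ennreal (weak_const * (\<integral>x. norm (f x) \<partial>lebesgue) / t)"
    if "integrable lebesgue f" "0 < t" for f t
    by (rule ext_weak[OF that(1) _ _ that(2)]) (simp_all add: mass_integrable[OF that(1)] integral_nonneg_AE)
next
  fix f g :: "'a \<Rightarrow> complex" assume "f \<in> {f. integrable lebesgue f}" "g \<in> {f. integrable lebesgue f}"
  then have f: "integrable lebesgue f" and g: "integrable lebesgue g" by auto
  have fm: "f \<in> borel_measurable lebesgue" "g \<in> borel_measurable lebesgue" using f g by auto
  have 1: "AE x in lebesgue. (\<lambda>k. T (apx f k) x) \<longlonglongrightarrow> ext f x"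
    by (rule ext_lim[OF f apx(1)[OF f] apx(2)[OF f], where c = 1]) (use apx(3)[OF f] in auto)
  have 2: "AE x in lebesgue. (\<lambda>k. T (apx g k) x) \<longlonglongrightarrow> ext g x"
    by (rule ext_lim[OF g apx(1)[OF g] apx(2)[OF g], where c = 1]) (use apx(3)[OF g] in auto)
  have 3: "AE x in lebesgue. (\<lambda>k. T (\<lambda>y. apx f k y + apx g k y) x) \<longlonglongrightarrow> ext (\<lambda>y. f y + g y) x"
  proof (rule ext_lim[where c = 2])
    show "(\<lambda>y. apx f k y + apx g k y) \<in> L2_fun" for k by (rule L2_add[OF apx(2)[OF f] apx(2)[OF g]])
    fix k
    have "mass (\<lambda>x. (f x - apx f k x) + (g x - apx g k x)) UNIV \<le> mass (\<lambda>x. f x - apx f k x) UNIV + mass (\<lambda>x. g x - apx g k x) UNIV"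
      by (rule mass_add_le) (use fm apx(1)[OF f, of k] apx(1)[OF g, of k] in auto)
    also have "\<dots> \<le> ennreal ((1/4) ^ k) + ennreal ((1/4) ^ k)" by (rule add_mono[OF apx(3)[OF f] apx(3)[OF g]])
    also have "\<dots> = ennreal (2 * (1/4) ^ k)" by (simp add: ennreal_plus[symmetric] del: ennreal_plus)
    finally show "mass (\<lambda>x. f x + g x - (apx f k x + apx g k x)) UNIV \<le> ennreal (2 * (1/4) ^ k)"
      by (simp add: algebra_simps)
  qed (use f g apx(1)[OF f] apx(1)[OF g] in auto)
  have "AE x in lebesgue. T (\<lambda>y. apx f k y + apx g k y) x = T (apx f k) x + T (apx g k) x" for k
    by (rule T_add[OF apx(2)[OF f] apx(2)[OF g]])
  then have "AE x in lebesgue. \<forall>k. T (\<lambda>y. apx f k y + apx g k y) x = T (apx f k) x + T (apx g k) x"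
    unfolding AE_all_countable by blast
  with 1 2 3 show "AE x in lebesgue. ext (\<lambda>y. f y + g y) x = ext f x + ext g x"
  proof eventually_elim
    case (elim x)
    from tendsto_add[OF elim(1,2)] elim(3) show ?case unfolding elim(4)[rule_format] by (metis LIMSEQ_unique)
  qed
next
  fix c and f :: "'a \<Rightarrow> complex" assume "f \<in> {f. integrable lebesgue f}"
  then have f: "integrable lebesgue f" by auto
  have fm: "f \<in> borel_measurable lebesgue" using f by auto
  have 1: "AE x in lebesgue. (\<lambda>k. T (apx f k) x) \<longlonglongrightarrow> ext f x"
    by (rule ext_lim[OF f apx(1)[OF f] apx(2)[OF f], where c = 1]) (use apx(3)[OF f] in auto)
  have 3: "AE x in lebesgue. (\<lambda>k. T (\<lambda>y. c * apx f k y) x) \<longlonglongrightarrow> ext (\<lambda>y. c * f y) x"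
  proof (rule ext_lim[where c = "norm c"])
    show "(\<lambda>y. c * apx f k y) \<in> L2_fun" for k by (rule L2_scale[OF apx(2)[OF f]])
    fix k
    have [measurable]: "(\<lambda>x. f x - apx f k x) \<in> borel_measurable lebesgue" using fm apx(1)[OF f, of k] by auto
    have "mass (\<lambda>x. c * f x - c * apx f k x) UNIV = (\<integral>\<^sup>+x. ennreal (norm c) * ennreal (norm (f x - apx f k x)) \<partial>lebesgue)"
      unfolding mass_UNIV by (intro nn_integral_cong) (simp add: right_diff_distrib[symmetric] norm_mult ennreal_mult)
    also have "\<dots> = ennreal (norm c) * mass (\<lambda>x. f x - apx f k x) UNIV"
      unfolding mass_UNIV by (rule nn_integral_cmult) measurable
    also have "\<dots> \<le> ennreal (norm c) * ennreal ((1/4) ^ k)" by (rule mult_left_mono[OF apx(3)[OF f]]) simp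
    finally show "mass (\<lambda>x. c * f x - c * apx f k x) UNIV \<le> ennreal (norm c * (1/4) ^ k)" by (simp add: ennreal_mult)
  qed (use f apx(1)[OF f] in auto)
  have "AE x in lebesgue. T (\<lambda>y. c * apx f k y) x = c * T (apx f k) x" for k
    by (rule T_scale[OF apx(2)[OF f]])
  then have "AE x in lebesgue. \<forall>k. T (\<lambda>y. c * apx f k y) x = c * T (apx f k) x"
    unfolding AE_all_countable by blast
  with 1 3 show "AE x in lebesgue. ext (\<lambda>y. c * f y) x = c * ext f x"
  proof eventually_elim
    case (elim x)
    from tendsto_mult[OF tendsto_const elim(1), of c] elim(2) show ?case unfolding elim(3)[rule_format] by (metis LIMSEQ_unique)
  qed
next
  fix f :: "'a \<Rightarrow> complex" assume f: "f \<in> L2_fun" "integrable lebesgue f"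
  have "AE x in lebesgue. (\<lambda>k::nat. T f x) \<longlonglongrightarrow> ext f x"
    by (rule ext_lim[OF f(2) f(2) f(1), where c = 0]) (simp_all add: mass_def)
  then show "AE x in lebesgue. ext f x = T f x" by eventually_elim (metis LIMSEQ_unique tendsto_const)
qed

text \<open>For the kernel representation, split f into f - h k and a square integrable h k
  supported in H. Under U the first part tends to 0 by the weak type bound, and the second is
  covered by \<open>kernel_rep\<close>.\<close>

lemma extension_axioms:
  assumes U: "extends_weakly T U"
  obtains A1 where "cz_extension \<omega> K A U A1"
proof -
  have Um: "integrable lebesgue f \<Longrightarrow> U f \<in> borel_measurable lebesgue" for f
    using U by (simp add: extends_weakly_def weak_type_1_1_def)
  from U have "weak_type_1_1 U" by (simp add: extends_weakly_def)
  then have "\<exists>A. \<forall>f. integrable lebesgue f \<longrightarrow>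
      (\<forall>t>0. emeasure lebesgue {x. t < norm (U f x)} \<le> ennreal (A * (\<integral>x. norm (f x) \<partial>lebesgue) / t))"
    unfolding weak_type_1_1_def by (rule conjunct2)
  then obtain A0 where A0': "\<forall>f. integrable lebesgue f \<longrightarrow>
      (\<forall>t>0. emeasure lebesgue {x. t < norm (U f x)} \<le> ennreal (A0 * (\<integral>x. norm (f x) \<partial>lebesgue) / t))" ..
  have A0: "emeasure lebesgue {x. t < norm (U f x)} \<le> ennreal (A0 * (\<integral>x. norm (f x) \<partial>lebesgue) / t)"
    if "integrable lebesgue f" "0 < t" for f t
    using A0'[rule_format, OF that] .
  \<comment> \<open>\<open>weak_type_1_1\<close> puts no sign on its constant, while
    \<open>cz_extension\<close> asks for a positive one.\<close>
  define A1 where "A1 = max A0 1"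
  have A1: "0 < A1" "A0 \<le> A1" by (auto simp: A1_def)
  have weak: "emeasure lebesgue {x. t < norm (U f x)} \<le> ennreal (A1 * n / t)"
    if f: "integrable lebesgue f" and n: "mass f UNIV \<le> ennreal n" "0 \<le> n" and t: "0 < t" for f n t
  proof -
    have "ennreal (\<integral>x. norm (f x) \<partial>lebesgue) \<le> ennreal n" using n mass_integrable[OF f] by simp
    then have I: "(\<integral>x. norm (f x) \<partial>lebesgue) \<le> n" using n(2) by simp
    have "0 \<le> (\<integral>x. norm (f x) \<partial>lebesgue)" by (simp add: integral_nonneg_AE)
    then have "A0 * (\<integral>x. norm (f x) \<partial>lebesgue) \<le> A1 * n" using A1 I by (intro mult_mono) auto
    then have "ennreal (A0 * (\<integral>x. norm (f x) \<partial>lebesgue) / t) \<le> ennreal (A1 * n / t)"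
      using t by (intro ennreal_leI divide_right_mono) auto
    with A0[OF f t] show ?thesis by (rule order_trans)
  qed
  have add: "AE x in lebesgue. U (\<lambda>y. f y + g y) x = U f x + U g x" if "integrable lebesgue f" "integrable lebesgue g" for f g
    using U that by (simp add: extends_weakly_def ae_linear_on_def)
  have agree: "AE x in lebesgue. U f x = T f x" if "integrable lebesgue f" "f \<in> L2_fun" for f
    using U that by (simp add: extends_weakly_def)
  have kern: "AE x in lebesgue. x \<notin> H \<longrightarrow> U f x = (LINT y:H|lebesgue. K x y * f y)"
    if f: "integrable lebesgue f" and H: "closed H" and supp: "\<And>y. y \<notin> H \<Longrightarrow> f y = 0" for f H
  proof -
    have fm: "f \<in> borel_measurable lebesgue" using f by auto
    have Hs: "H \<in> sets lebesgue" using H by auto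
    \<comment> \<open>Restricting the approximants to H gives them the support of f and does not
      increase the error, as f vanishes off H.\<close>
    define h where "h k = res H (apx f k)" for k
    have hi: "integrable lebesgue (h k)" for k unfolding h_def by (rule res_integrable[OF apx(1)[OF f] Hs])
    have hL: "h k \<in> L2_fun" for k
    proof (rule L2_mono[OF apx(2)[OF f, of k]])
      show "h k \<in> borel_measurable lebesgue" using hi[of k] by auto
    qed (simp add: h_def res_def)
    have h0: "h k y = 0" if "y \<notin> H" for k y using that by (simp add: h_def res_def)
    have dm: "mass (\<lambda>x. f x - h k x) UNIV \<le> ennreal ((1/4) ^ k)" for k
    proof -
      have "mass (\<lambda>x. f x - h k x) UNIV \<le> mass (\<lambda>x. f x - apx f k x) UNIV"
        unfolding mass_UNIV
        by (rule nn_integral_mono) (use supp in \<open>auto simp: h_def res_def intro!: ennreal_leI\<close>)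
      then show ?thesis using apx(3)[OF f] by (rule order_trans)
    qed
    have di: "integrable lebesgue (\<lambda>x. f x - h k x)" for k using f hi by simp
    have "AE x in lebesgue. \<forall>\<^sub>F k in sequentially. norm (U (\<lambda>x. f x - h k x) x) \<le> (1/2) ^ k"
    proof (rule weak_eventually_small[where A = A1])
      show "emeasure lebesgue {x. s < norm (U (\<lambda>x. f x - h k x) x)} \<le> ennreal (A1 * (1/4) ^ k / s)" if "0 < s" for k s
        by (rule weak[OF di dm _ that]) simp
    qed (use Um[OF di] A1 in auto)
    moreover have "AE x in lebesgue. U f x = U (\<lambda>x. f x - h k x) x + U (h k) x" for k
      using add[OF di hi, of k k] by simp
    then have "AE x in lebesgue. \<forall>k. U f x = U (\<lambda>x. f x - h k x) x + U (h k) x"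
      unfolding AE_all_countable by blast
    moreover have "AE x in lebesgue. \<forall>k. U (h k) x = T (h k) x"
      unfolding AE_all_countable using agree[OF hi hL] by blast
    moreover have "AE x in lebesgue. x \<notin> H \<longrightarrow> T (h k) x = (LINT y:H|lebesgue. K x y * h k y)" for k
      by (rule kernel_rep[OF hi hL H h0])
    then have "AE x in lebesgue. \<forall>k. x \<notin> H \<longrightarrow> T (h k) x = (LINT y:H|lebesgue. K x y * h k y)"
      unfolding AE_all_countable by blast
    ultimately show ?thesis
    proof eventually_elim
      case (elim x)
      show ?case
      proof
        assume x: "x \<notin> H"
        have "open (- H)" "x \<in> - H" using H x by auto
        then obtain r where r: "0 < r" "ball x r \<subseteq> - H" by (meson open_contains_ball_eq)
        have sep: "r \<le> dist x y" if "y \<in> H" for y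
        proof (rule ccontr)
          assume "\<not> r \<le> dist x y"
          then have "y \<in> ball x r" by simp
          then show False using r(2) that by blast
        qed
        have eqk: "U f x - (LINT y:H|lebesgue. K x y * f y) = U (\<lambda>x. f x - h k x) x - (LINT y:H|lebesgue. K x y * (f y - h k y))" for k
        proof -
          have i1: "integrable lebesgue (\<lambda>y. indicator H y *\<^sub>R (K x y * f y))" by (rule integrable_off[OF f Hs r(1) sep])
          have i2: "integrable lebesgue (\<lambda>y. indicator H y *\<^sub>R (K x y * h k y))" by (rule integrable_off[OF hi Hs r(1) sep])
          have "(LINT y:H|lebesgue. K x y * (f y - h k y)) = (LINT y:H|lebesgue. K x y * f y) - (LINT y:H|lebesgue. K x y * h k y)"
            unfolding set_lebesgue_integral_def Bochner_Integration.integral_diff[OF i1 i2, symmetric]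
            by (simp add: right_diff_distrib scaleR_diff_right)
          moreover have "U f x = U (\<lambda>x. f x - h k x) x + (LINT y:H|lebesgue. K x y * h k y)"
            using elim(2)[rule_format, of k] elim(3)[rule_format, of k] elim(4)[rule_format, OF x, of k] by simp
          ultimately show ?thesis by simp
        qed
        have small: "norm (LINT y:H|lebesgue. K x y * (f y - h k y)) \<le> A / r ^ DIM('a) * (1/4) ^ k" for k
        proof (rule norm_off[OF di Hs r(1) sep])
          show "mass (\<lambda>y. f y - h k y) H \<le> ennreal ((1/4) ^ k)"
            by (rule order_trans[OF mass_mono dm]) simp
        qed simp_all
        have "(\<lambda>k. A / r ^ DIM('a) * (1/4) ^ k) \<longlonglongrightarrow> A / r ^ DIM('a) * 0"
          by (intro tendsto_mult tendsto_const LIMSEQ_realpow_zero) auto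
        then have lim: "(\<lambda>k. A / r ^ DIM('a) * (1/4) ^ k) \<longlonglongrightarrow> 0" by simp
        have 2: "(\<lambda>k. LINT y:H|lebesgue. K x y * (f y - h k y)) \<longlonglongrightarrow> 0"
          by (rule Lim_null_comparison[OF always_eventually lim]) (use small in blast)
        have "(\<lambda>k::nat. U f x - (LINT y:H|lebesgue. K x y * f y)) \<longlonglongrightarrow> 0 - 0"
          using tendsto_diff[OF small_to_zero[OF elim(1)] 2] unfolding eqk[symmetric] .
        from LIMSEQ_unique[OF tendsto_const this]
        show "U f x = (LINT y:H|lebesgue. K x y * f y)" by simp
      qed
    qed
  qed
  have "cz_extension \<omega> K A U A1"
    by unfold_locales (use A1 Um weak add kern in auto)
  then show ?thesis by (rule that)
qed

end

section \<open>Assembly of the theorem\<close>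

lemma cz_op_exists:
  fixes T :: "('a::euclidean_space \<Rightarrow> complex) \<Rightarrow> 'a \<Rightarrow> complex"
  assumes cz: "calderon_zygmund \<omega> T K" and dini: "dini \<omega>"
  obtains A B where "cz_op \<omega> K A T B"
proof -
  have om: "modulus_of_continuity \<omega>" and bl: "bounded_linear_L2 T" and ker: "has_kernel T K"
    and reg: "kernel_regularity \<omega> K" "kernel_regularity \<omega> (\<lambda>x y. K y x)"
    using cz by (auto simp: calderon_zygmund_def)
  have sum: "summable (\<lambda>k. \<omega> ((1/2) ^ k))" by (rule dini_summable[OF om dini])
  obtain B0 where B0: "\<And>f. f \<in> L2_fun \<Longrightarrow> L2_norm (T f) \<le> B0 * L2_norm f"
    using bl unfolding bounded_linear_L2_def by blast
  have TL: "T f \<in> L2_fun" if "f \<in> L2_fun" for f using bl that by (auto simp: bounded_linear_L2_def)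
  \<comment> \<open>Squared, because \<open>energy\<close> is the square of the L2 norm.\<close>
  define B where "B = B0\<^sup>2"
  have nn: "0 \<le> L2_norm f" for f :: "'a \<Rightarrow> complex" by (simp add: L2_norm_def integral_nonneg_AE)
  have bound: "energy (T f) \<le> ennreal B * energy f" if f: "f \<in> L2_fun" for f
  proof -
    have "(L2_norm (T f))\<^sup>2 \<le> (B0 * L2_norm f)\<^sup>2" by (rule power_mono[OF B0[OF f] nn])
    then have "(L2_norm (T f))\<^sup>2 \<le> B * (L2_norm f)\<^sup>2" by (simp add: B_def power_mult_distrib)
    then show ?thesis
      unfolding energy_L2_norm[OF f] energy_L2_norm[OF TL[OF f]] by (simp add: ennreal_mult[symmetric] B_def ennreal_leI)
  qed
  interpret cz_T \<omega> K T B
    by unfold_locales (use om sum reg ker TL bound bl in \<open>auto simp: bounded_linear_L2_def ae_linear_on_def B_def\<close>)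
  have "cz_op \<omega> K ((B + 1) * 16 ^ DIM('a) / unit_ball_vol (real DIM('a)) + 2 * 2 ^ DIM('a)) T B"
  proof unfold_locales
    show "0 \<le> (B + 1) * 16 ^ DIM('a) / unit_ball_vol (real DIM('a)) + 2 * 2 ^ DIM('a)"
      using B by (simp add: unit_ball_vol_nonneg)
  qed (rule kernel_size)
  then show ?thesis by (rule that)
qed

theorem theorem4p2:
  fixes T :: "('a::euclidean_space \<Rightarrow> complex) \<Rightarrow> 'a \<Rightarrow> complex"
    and K :: "'a \<Rightarrow> 'a \<Rightarrow> complex"
    and \<omega> :: "real \<Rightarrow> real"
  assumes "calderon_zygmund \<omega> T K"
    and "dini \<omega>"
  shows "\<exists>C>0. \<forall>f. integrable lebesgue f \<and> compactly_supported f \<longrightarrow>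
           (\<exists>n S. n \<le> 3 ^ DIM('a) \<and> sum_of_sparse_operators n S \<and>
              (AE x in lebesgue. ennreal (norm (weak_L1_extension T f x))
                 \<le> ennreal C * S (\<lambda>y. ennreal (norm (f y))) x)) \<and>
           (\<exists>n S. n \<le> 3 ^ DIM('a) \<and> sum_of_sparse_operators n S \<and>
              (AE x in lebesgue. max_truncation K f x
                 \<le> ennreal C * S (\<lambda>y. ennreal (norm (f y))) x))"
proof -
  obtain A B where op: "cz_op \<omega> K A T B" using cz_op_exists[OF assms] .
  define U where "U = weak_L1_extension T"
  \<comment> \<open>\<open>ext_extends\<close> provides a witness, so the operator selected by
    \<open>weak_L1_extension\<close> has the properties of an extension.\<close>
  have "extends_weakly T U"
    using someI_ex[OF exI[of "extends_weakly T", OF cz_op.ext_extends[OF op]]]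
    unfolding U_def weak_L1_extension_def extends_weakly_def .
  then obtain A1 where "cz_extension \<omega> K A U A1" using cz_op.extension_axioms[OF op] by blast
  then interpret cz_extension \<omega> K A U A1 .
  interpret cz_weak \<omega> K A "24 ^ DIM('a) * (1 + 4 * A1 / vol) * cotlar_const"
  proof unfold_locales
    show "0 < 24 ^ DIM('a) * (1 + 4 * A1 / vol) * cotlar_const"
      using A1 vol_pos cotlar_const_ge_1 by (intro mult_pos_pos add_pos_nonneg) auto
  qed (rule weak_joint)
  obtain C where C: "0 < C" and sparse: "\<And>f. integrable lebesgue f \<and> compactly_supported f \<Longrightarrow>
      \<exists>S. sum_of_sparse_operators (2 ^ DIM('a) + 1) S \<and>
        (AE x in lebesgue. joint_max K f x \<le> ennreal C * S (\<lambda>y. ennreal (norm (f y))) x)"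
    using joint_sparse_bound by blast
  have count: "2 ^ DIM('a) + 1 \<le> (3::nat) ^ DIM('a)"
  proof -
    have "2 ^ Suc m + 1 \<le> (3::nat) ^ Suc m" for m by (induction m) auto
    then show ?thesis using DIM_positive[where ?'a = 'a] by (metis gr0_implies_Suc)
  qed
  \<comment> \<open>A common constant for both claims: dom_const * C for T and C for the
    truncations. One and the same S serves both.\<close>
  define C' where "C' = (1 + dom_const) * C"
  have "0 < dom_const * C" using C dom_const_pos by (rule mult_pos_pos[rotated])
  then have C': "0 < C'" "C \<le> C'" "dom_const * C \<le> C'" using C unfolding C'_def distrib_right by auto
  show ?thesis
  proof (intro exI[of _ C'] conjI allI impI)
    fix f :: "'a \<Rightarrow> complex" assume f: "integrable lebesgue f \<and> compactly_supported f"
    obtain S where S: "sum_of_sparse_operators (2 ^ DIM('a) + 1) S"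
      and le: "AE x in lebesgue. joint_max K f x \<le> ennreal C * S (\<lambda>y. ennreal (norm (f y))) x"
      using sparse[OF f] by blast
    have "AE x in lebesgue. ennreal (norm (U f x)) \<le> ennreal dom_const * joint_max K f x"
      by (rule U_le_joint) (use f in simp)
    then have "AE x in lebesgue. ennreal (norm (U f x)) \<le> ennreal C' * S (\<lambda>y. ennreal (norm (f y))) x"
      using le
    proof eventually_elim
      case (elim x)
      have "ennreal (norm (U f x)) \<le> ennreal dom_const * (ennreal C * S (\<lambda>y. ennreal (norm (f y))) x)"
        by (rule order_trans[OF elim(1) mult_left_mono[OF elim(2)]]) simp
      also have "\<dots> = ennreal (dom_const * C) * S (\<lambda>y. ennreal (norm (f y))) x"
        using C dom_const_pos by (simp add: ennreal_mult mult.assoc)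
      also have "\<dots> \<le> ennreal C' * S (\<lambda>y. ennreal (norm (f y))) x"
        by (rule mult_right_mono[OF ennreal_leI[OF C'(3)]]) simp
      finally show ?case .
    qed
    then show "\<exists>n S. n \<le> 3 ^ DIM('a) \<and> sum_of_sparse_operators n S \<and>
        (AE x in lebesgue. ennreal (norm (weak_L1_extension T f x)) \<le> ennreal C' * S (\<lambda>y. ennreal (norm (f y))) x)"
      using S count unfolding U_def by blast
    have "AE x in lebesgue. max_truncation K f x \<le> ennreal C' * S (\<lambda>y. ennreal (norm (f y))) x"
      using le
    proof eventually_elim
      case (elim x)
      have "max_truncation K f x \<le> joint_max K f x" by (simp add: joint_max_def)
      also note elim
      also have "ennreal C * S (\<lambda>y. ennreal (norm (f y))) x \<le> ennreal C' * S (\<lambda>y. ennreal (norm (f y))) x"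
        by (rule mult_right_mono[OF ennreal_leI[OF C'(2)]]) simp
      finally show ?case .
    qed
    then show "\<exists>n S. n \<le> 3 ^ DIM('a) \<and> sum_of_sparse_operators n S \<and>
        (AE x in lebesgue. max_truncation K f x \<le> ennreal C' * S (\<lambda>y. ennreal (norm (f y))) x)"
      using S count by blast
  qed (rule C'(1))
qed

end
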